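(* Let $p\ge11$, set $\Psi:=\Psi_{\frac{p+5}{2}}$, assume $\Psi\not\equiv0\pmod p$, and let $\Sigma:=z_6\Psi H$. Then there exists $\Lambda\in M^1_\Sigma$ that is quasi linear, tangential, of weak weight $1-p$, with $\Lambda\equiv H^{-1}\pmod p$, and there exists a Frobenius lift $\Phi$ on $\widehat{E^*_{\mathbb{S}}}$ extending the universal Frobenius lift on $\mathbb{S}:=\widehat{M^\infty_\Sigma}$ such that $\Phi$ is Lie invariant mod $p^2$ with eigenvalue $\Lambda$.
   Context: $p$ is a prime, $p\neq2,3$. Define $\alpha_n,\beta_n\in\mathbb{Z}_{(p)}[A,B,B^{-1}]$ ($A,B$ variables), $1\le n\le p-1$, by $\alpha_1=\frac{A}{2B}$, $\beta_1=0$, $\alpha_2=-\frac{A^2}{8B^2}$, $\beta_2=\frac{A}{4B}$, $\alpha_3=\frac{A^3}{16B^3}+\frac1{2B}$, $\beta_3=-\frac{A^2}{8B^2}$, $\alpha_4=-\frac{5A^4}{128B^4}-\frac{A}{4B^2}$, $\beta_4=\frac{5A^3}{64B^3}+\frac3{8B}$, and for $n\ge5$: $\alpha_n=-\frac{2n-3}{2n}\frac AB\alpha_{n-1}-\frac{2n-9}{2n}\frac1B\alpha_{n-3}$, same recurrence for $\beta_n$. Let $\psi_n=\alpha_n\beta_{n+1}-\alpha_{n+1}\beta_n$; $\Psi_m\in\mathbb{Z}_{(p)}[z_4,z_6]$ is the polynomial with $\psi_{2k}=\Psi_{2k}(A,B)/B^{2k}$, $\psi_{2k-1}=\Psi_{2k-1}(A,B)/B^{2k}$.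 $\mathbb{Z}_{(p)}[z_4,z_6]$ is graded with $z_4,z_6$ of weights $4,6$. $\Delta=4z_4^3+27z_6^2$; $H$ is the coefficient of $x^{p-1}$ in $(x^3+z_4x+z_6)^{(p-1)/2}$. $M_\Sigma=\mathbb{Z}_{(p)}[z_4,z_6,\Delta^{-1}\Sigma^{-1}]$, $M^r_\Sigma=M_\Sigma[z_4',z_6',\dots,z_4^{(r)},z_6^{(r)}]$, $M^\infty_\Sigma=\bigcup_rM^r_\Sigma$. Weak weight on $M^1_\Sigma$: $z_4,z_6,z_4',z_6'$ have weights $4,6,4p,6p$. Quasi linear: $M_\Sigma$-linear combination of $1,z_4',z_6'$; tangential: of $1,pz_4',pz_6'$. The universal Frobenius lift $\phi$ on $\widehat{M^\infty_\Sigma}$: $\phi(z_k^{(i)})=(z_k^{(i)})^p+pz_k^{(i+1)}$ ($k=4,6$). $E^*_{\mathbb{S}}=\mathrm{Spec}\,\mathbb{S}[x,y,y^{-1}]/(y^2-(x^3+z_4x+z_6))$; a Frobenius lift on its $p$-adic completion extending the universal one is an endomorphism of $\widehat{\mathcal{O}(E^*_{\mathbb{S}})}$ restricting to $\phi$ on $\mathbb{S}$ and reducing to Frobenius mod $p$; Lie invariant mod $p^2$ with eigenvalue $\Lambda$ means $\frac1p\Phi^*\omega\equiv\Lambda\omega\pmod{p^2}$ in the completed Kähler differentials $\varprojlim_n\Omega_{(E^*_{\mathbb{S}}\otimes\mathbb{S}/p^n)/(\mathbb{S}/p^n)}$, $\omega=dx/y$. *)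

theory Defs
  imports
    "HOL-Library.Poly_Mapping"
    "HOL-Computational_Algebra.Polynomial_Factorial"
    "HOL-Algebra.UnivPoly"
    "HOL-Algebra.QuotRing"
begin

section \<open>The jet rings \<open>M\<^sup>r\<close>\<close>

text \<open>
  All the rings \<open>M\<^sup>r\<close> are domains of characteristic 0, so they are realised as subrings of one
  field, the fraction field of the polynomial ring over the rationals in countably many variables.
  The variable number \<open>2 * i\<close> is the \<open>i\<close>-th jet coordinate of \<open>z\<^sub>4\<close>, the variable number
  \<open>2 * i + 1\<close> is the \<open>i\<close>-th jet coordinate of \<open>z\<^sub>6\<close>.
\<close>

type_synonym jet_poly = "(nat \<Rightarrow>\<^sub>0 nat) \<Rightarrow>\<^sub>0 rat"
type_synonym jet_frac = "jet_poly fract"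

definition jet_var :: "nat \<Rightarrow> jet_frac" where
  "jet_var v = to_fract (Poly_Mapping.single (Poly_Mapping.single v 1) 1)"

definition z4 :: "nat \<Rightarrow> jet_frac" where "z4 i = jet_var (2 * i)"
definition z6 :: "nat \<Rightarrow> jet_frac" where "z6 i = jet_var (2 * i + 1)"

definition Z_loc :: "nat \<Rightarrow> rat set" where
  "Z_loc p = {q. \<not> int p dvd snd (quotient_of q)}"

definition jet_polys :: "nat \<Rightarrow> nat \<Rightarrow> jet_poly set" where
  "jet_polys p r = {P. (\<forall>m. Poly_Mapping.lookup P m \<in> Z_loc p) \<and>
     (\<forall>m\<in>Poly_Mapping.keys P. \<forall>v\<in>Poly_Mapping.keys m. v div 2 \<le> r)}"

definition Delta :: jet_frac where
  "Delta = 4 * z4 0 ^ 3 + 27 * z6 0 ^ 2"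

definition Hasse :: "nat \<Rightarrow> jet_frac" where
  "Hasse p = Polynomial.coeff ([:z6 0, z4 0, 0, 1:] ^ ((p - 1) div 2)) (p - 1)"

text \<open>
  \<open>jet_M p Sig r\<close> is \<open>M\<^sup>r\<close> for \<open>\<Sigma> = Sig\<close>: the localisation of the polynomial ring over the local
  ring \<open>Z_loc p\<close> in the variables of order at most \<open>r\<close> at the powers of \<open>\<Delta>\<Sigma>\<close>.
  In particular \<open>jet_M p Sig 0\<close> is \<open>M\<close> itself.
\<close>

definition jet_M :: "nat \<Rightarrow> jet_frac \<Rightarrow> nat \<Rightarrow> jet_frac set" where
  "jet_M p Sig r = {to_fract P / (Delta * Sig) ^ k | P k. P \<in> jet_polys p r}"

definition jet_M_inf :: "nat \<Rightarrow> jet_frac \<Rightarrow> jet_frac ring" where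
  "jet_M_inf p Sig = \<lparr>carrier = (\<Union>r. jet_M p Sig r), mult = (*), one = 1, zero = 0, add = (+)\<rparr>"

definition weak_var_weight :: "nat \<Rightarrow> nat \<Rightarrow> nat" where
  "weak_var_weight p v = (if even v then 4 else 6) * p ^ (v div 2)"

definition isobaric :: "nat \<Rightarrow> nat \<Rightarrow> jet_poly \<Rightarrow> bool" where
  "isobaric p w P \<longleftrightarrow>
     (\<forall>m\<in>Poly_Mapping.keys P. (\<Sum>v\<in>Poly_Mapping.keys m. Poly_Mapping.lookup m v * weak_var_weight p v) = w)"

text \<open>The grading of a localisation: quotients of isobaric polynomials.\<close>

definition weak_weight :: "nat \<Rightarrow> int \<Rightarrow> jet_frac \<Rightarrow> bool" where
  "weak_weight p w f \<longleftrightarrow>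
     (\<exists>P Q a b. Q \<noteq> 0 \<and> isobaric p a P \<and> isobaric p b Q \<and>
        f = to_fract P / to_fract Q \<and> w = int a - int b)"

definition quasi_linear :: "nat \<Rightarrow> jet_frac \<Rightarrow> jet_frac \<Rightarrow> bool" where
  "quasi_linear p Sig f \<longleftrightarrow>
     (\<exists>a\<in>jet_M p Sig 0. \<exists>b\<in>jet_M p Sig 0. \<exists>c\<in>jet_M p Sig 0.
        f = a + b * z4 1 + c * z6 1)"

definition tangential :: "nat \<Rightarrow> jet_frac \<Rightarrow> jet_frac \<Rightarrow> bool" where
  "tangential p Sig f \<longleftrightarrow>
     (\<exists>a\<in>jet_M p Sig 0. \<exists>b\<in>jet_M p Sig 0. \<exists>c\<in>jet_M p Sig 0.
        f = a + b * (of_nat p * z4 1) + c * (of_nat p * z6 1))"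


section \<open>The polynomials \<open>\<Psi>\<^sub>m\<close>\<close>

fun alpha :: "'a::field \<Rightarrow> 'a \<Rightarrow> nat \<Rightarrow> 'a" where
  "alpha A B n =
     (if n = 0 then 0
      else if n = 1 then A / (2 * B)
      else if n = 2 then - (A ^ 2 / (8 * B ^ 2))
      else if n = 3 then A ^ 3 / (16 * B ^ 3) + 1 / (2 * B)
      else if n = 4 then - (5 * A ^ 4 / (128 * B ^ 4)) - A / (4 * B ^ 2)
      else - (of_nat (2 * n - 3) / of_nat (2 * n) * (A / B) * alpha A B (n - 1))
           - of_nat (2 * n - 9) / of_nat (2 * n) * (1 / B) * alpha A B (n - 3))"

fun beta :: "'a::field \<Rightarrow> 'a \<Rightarrow> nat \<Rightarrow> 'a" where
  "beta A B n =
     (if n = 0 then 0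
      else if n = 1 then 0
      else if n = 2 then A / (4 * B)
      else if n = 3 then - (A ^ 2 / (8 * B ^ 2))
      else if n = 4 then 5 * A ^ 3 / (64 * B ^ 3) + 3 / (8 * B)
      else - (of_nat (2 * n - 3) / of_nat (2 * n) * (A / B) * beta A B (n - 1))
           - of_nat (2 * n - 9) / of_nat (2 * n) * (1 / B) * beta A B (n - 3))"

declare alpha.simps [simp del] beta.simps [simp del]

definition psi :: "'a::field \<Rightarrow> 'a \<Rightarrow> nat \<Rightarrow> 'a" where
  "psi A B n = alpha A B n * beta A B (n + 1) - alpha A B (n + 1) * beta A B n"

text \<open>
  \<open>\<psi>\<^sub>2\<^sub>k = \<Psi>\<^sub>2\<^sub>k / B\<^sup>2\<^sup>k\<close> and \<open>\<psi>\<^sub>2\<^sub>k\<^sub>-\<^sub>1 = \<Psi>\<^sub>2\<^sub>k\<^sub>-\<^sub>1 / B\<^sup>2\<^sup>k\<close>, solved for \<open>\<Psi>\<close> with \<open>A = z\<^sub>4\<close>, \<open>B = z\<^sub>6\<close>.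
\<close>

definition Psi :: "nat \<Rightarrow> jet_frac" where
  "Psi m = z6 0 ^ (2 * ((m + 1) div 2)) * psi (z4 0) (z6 0) m"


section \<open>\<open>p\<close>-adic completion\<close>

definition padic_ideal :: "nat \<Rightarrow> ('a, 'm) ring_scheme \<Rightarrow> nat \<Rightarrow> 'a set" where
  "padic_ideal p R n = PIdl\<^bsub>R\<^esub> ([(p ^ n)] \<cdot>\<^bsub>R\<^esub> \<one>\<^bsub>R\<^esub>)"

definition padic_quot :: "nat \<Rightarrow> ('a, 'm) ring_scheme \<Rightarrow> nat \<Rightarrow> 'a set ring" where
  "padic_quot p R n = R Quot padic_ideal p R n"

definition padic_proj :: "nat \<Rightarrow> ('a, 'm) ring_scheme \<Rightarrow> nat \<Rightarrow> 'a \<Rightarrow> 'a set" where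
  "padic_proj p R n r = padic_ideal p R n +>\<^bsub>R\<^esub> r"

text \<open>
  The map into \<open>R / p\<^sup>n R\<close> induced by a homomorphism \<open>h\<close> into \<open>R\<close>, on cosets modulo any ideal that
  \<open>h\<close> sends into \<open>p\<^sup>n R\<close>: the union ranges over a constant family.
  For \<open>h = id\<close> it is the transition map \<open>R / p\<^sup>n\<^sup>+\<^sup>1 R \<rightarrow> R / p\<^sup>n R\<close>.
\<close>

definition padic_quot_map ::
  "nat \<Rightarrow> ('a, 'm) ring_scheme \<Rightarrow> nat \<Rightarrow> ('b \<Rightarrow> 'a) \<Rightarrow> 'b set \<Rightarrow> 'a set" where
  "padic_quot_map p R n h X = (\<Union>b\<in>X. padic_proj p R n (h b))"

definition padic_completion :: "nat \<Rightarrow> ('a, 'm) ring_scheme \<Rightarrow> (nat \<Rightarrow> 'a set) ring" where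
  "padic_completion p R =
     \<lparr>carrier = {s. (\<forall>n. s n \<in> carrier (padic_quot p R n)) \<and>
                    (\<forall>n. padic_quot_map p R n id (s (Suc n)) = s n)},
      mult = (\<lambda>s t n. s n \<otimes>\<^bsub>padic_quot p R n\<^esub> t n),
      one = (\<lambda>n. \<one>\<^bsub>padic_quot p R n\<^esub>),
      zero = (\<lambda>n. \<zero>\<^bsub>padic_quot p R n\<^esub>),
      add = (\<lambda>s t n. s n \<oplus>\<^bsub>padic_quot p R n\<^esub> t n)\<rparr>"

definition padic_embed :: "nat \<Rightarrow> ('a, 'm) ring_scheme \<Rightarrow> 'a \<Rightarrow> nat \<Rightarrow> 'a set" where
  "padic_embed p R r = (\<lambda>n. padic_proj p R n r)"

text \<open>
  The endomorphism of \<open>R / p\<^sup>n R\<close>, which is the completion modulo \<open>p\<^sup>n\<close>, induced by an endomorphism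
  of the completion.
\<close>

definition padic_reduce ::
  "nat \<Rightarrow> ('a, 'm) ring_scheme \<Rightarrow> ((nat \<Rightarrow> 'a set) \<Rightarrow> nat \<Rightarrow> 'a set) \<Rightarrow> nat \<Rightarrow> 'a set \<Rightarrow> 'a set" where
  "padic_reduce p R \<Phi> n X = (\<Union>r\<in>X. \<Phi> (padic_embed p R r) n)"

definition frobenius_lift :: "nat \<Rightarrow> ('a, 'm) ring_scheme \<Rightarrow> ('a \<Rightarrow> 'a) \<Rightarrow> bool" where
  "frobenius_lift p R \<Phi> \<longleftrightarrow> \<Phi> \<in> ring_hom R R \<and>
     (\<forall>r\<in>carrier R. \<Phi> r \<ominus>\<^bsub>R\<^esub> r [^]\<^bsub>R\<^esub> p \<in> padic_ideal p R 1)"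

definition jet_S :: "nat \<Rightarrow> jet_frac \<Rightarrow> (nat \<Rightarrow> jet_frac set) ring" where
  "jet_S p Sig = padic_completion p (jet_M_inf p Sig)"

definition jet_embed :: "nat \<Rightarrow> jet_frac \<Rightarrow> jet_frac \<Rightarrow> nat \<Rightarrow> jet_frac set" where
  "jet_embed p Sig = padic_embed p (jet_M_inf p Sig)"

text \<open>Extensionality makes the function unique, which is otherwise arbitrary off the carrier.\<close>

definition universal_frobenius ::
  "nat \<Rightarrow> jet_frac \<Rightarrow> (nat \<Rightarrow> jet_frac set) \<Rightarrow> nat \<Rightarrow> jet_frac set" where
  "universal_frobenius p Sig = (THE \<phi>.
     \<phi> \<in> extensional (carrier (jet_S p Sig)) \<and>
     frobenius_lift p (jet_S p Sig) \<phi> \<and>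
     (\<forall>z\<in>{z4, z6}. \<forall>i.
        \<phi> (jet_embed p Sig (z i)) =
          jet_embed p Sig (z i) [^]\<^bsub>jet_S p Sig\<^esub> p \<oplus>\<^bsub>jet_S p Sig\<^esub>
          [p] \<cdot>\<^bsub>jet_S p Sig\<^esub> jet_embed p Sig (z (Suc i))))"


section \<open>Kaehler differentials\<close>

text \<open>
  For a ring homomorphism \<open>h : A \<rightarrow> B\<close> the module of differentials is the free \<open>B\<close>-module on the
  elements of \<open>B\<close> modulo additivity, the Leibniz rule, and the vanishing of \<open>d\<close> on the image of \<open>A\<close>.
  The multiplication and the unit of these records are not used.
\<close>

definition free_module :: "('b, 'm) ring_scheme \<Rightarrow> 'c set \<Rightarrow> ('b, 'c \<Rightarrow> 'b) module" where
  "free_module B C =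
     \<lparr>carrier = {u. finite {c. u c \<noteq> \<zero>\<^bsub>B\<^esub>} \<and> (\<forall>c\<in>C. u c \<in> carrier B) \<and> (\<forall>c. c \<notin> C \<longrightarrow> u c = \<zero>\<^bsub>B\<^esub>)},
      mult = undefined, one = undefined,
      zero = (\<lambda>c. \<zero>\<^bsub>B\<^esub>),
      add = (\<lambda>u v c. u c \<oplus>\<^bsub>B\<^esub> v c),
      smult = (\<lambda>b u c. b \<otimes>\<^bsub>B\<^esub> u c)\<rparr>"

definition free_gen :: "('b, 'm) ring_scheme \<Rightarrow> 'c \<Rightarrow> 'c \<Rightarrow> 'b" where
  "free_gen B c = (\<lambda>c'. if c' = c then \<one>\<^bsub>B\<^esub> else \<zero>\<^bsub>B\<^esub>)"

definition submodule_span ::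
  "('b, 'm) ring_scheme \<Rightarrow> ('b, 'c, 'n) module_scheme \<Rightarrow> 'c set \<Rightarrow> 'c set" where
  "submodule_span B M X = \<Inter>{N. submodule N B M \<and> X \<subseteq> N}"

definition quot_module :: "('b, 'c, 'n) module_scheme \<Rightarrow> 'c set \<Rightarrow> ('b, 'c set) module" where
  "quot_module M N =
     \<lparr>carrier = a_rcosets\<^bsub>M\<^esub> N,
      mult = undefined, one = undefined,
      zero = N,
      add = set_add M,
      smult = (\<lambda>b X. \<Union>u\<in>X. N +>\<^bsub>M\<^esub> (b \<odot>\<^bsub>M\<^esub> u))\<rparr>"

definition kaehler_free :: "('b, 'n) ring_scheme \<Rightarrow> ('b, 'b \<Rightarrow> 'b) module" where
  "kaehler_free B = free_module B (carrier B)"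

definition kaehler_relations ::
  "('a, 'm) ring_scheme \<Rightarrow> ('a \<Rightarrow> 'b) \<Rightarrow> ('b, 'n) ring_scheme \<Rightarrow> ('b \<Rightarrow> 'b) set" where
  "kaehler_relations A h B = submodule_span B (kaehler_free B)
     ({free_gen B (b \<oplus>\<^bsub>B\<^esub> c) \<ominus>\<^bsub>kaehler_free B\<^esub> (free_gen B b \<oplus>\<^bsub>kaehler_free B\<^esub> free_gen B c)
         | b c. b \<in> carrier B \<and> c \<in> carrier B} \<union>
      {free_gen B (b \<otimes>\<^bsub>B\<^esub> c) \<ominus>\<^bsub>kaehler_free B\<^esub>
         (b \<odot>\<^bsub>kaehler_free B\<^esub> free_gen B c \<oplus>\<^bsub>kaehler_free B\<^esub> c \<odot>\<^bsub>kaehler_free B\<^esub> free_gen B b)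
         | b c. b \<in> carrier B \<and> c \<in> carrier B} \<union>
      {free_gen B (h a) | a. a \<in> carrier A})"

definition kaehler ::
  "('a, 'm) ring_scheme \<Rightarrow> ('a \<Rightarrow> 'b) \<Rightarrow> ('b, 'n) ring_scheme \<Rightarrow> ('b, ('b \<Rightarrow> 'b) set) module" where
  "kaehler A h B = quot_module (kaehler_free B) (kaehler_relations A h B)"

definition kaehler_d ::
  "('a, 'm) ring_scheme \<Rightarrow> ('a \<Rightarrow> 'b) \<Rightarrow> ('b, 'n) ring_scheme \<Rightarrow> 'b \<Rightarrow> ('b \<Rightarrow> 'b) set" where
  "kaehler_d A h B b = kaehler_relations A h B +>\<^bsub>kaehler_free B\<^esub> free_gen B b"

text \<open>
  The map \<open>\<Sum> b\<^sub>i dc\<^sub>i \<mapsto> \<Sum> g(b\<^sub>i) dg(c\<^sub>i)\<close> into the differentials of \<open>h' : A' \<rightarrow> B'\<close> induced by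
  a ring homomorphism \<open>g : B \<rightarrow> B'\<close> compatible with the base rings.
\<close>

definition free_push ::
  "('b, 'm) ring_scheme \<Rightarrow> ('c, 'n) ring_scheme \<Rightarrow> ('b \<Rightarrow> 'c) \<Rightarrow> ('b \<Rightarrow> 'b) \<Rightarrow> 'c \<Rightarrow> 'c" where
  "free_push B B' g u =
     (\<lambda>c'. \<Oplus>\<^bsub>B'\<^esub>c\<in>{c\<in>carrier B. u c \<noteq> \<zero>\<^bsub>B\<^esub> \<and> g c = c'}. g (u c))"

definition kaehler_map ::
  "('b, 'm) ring_scheme \<Rightarrow> ('a, 'k) ring_scheme \<Rightarrow> ('a \<Rightarrow> 'c) \<Rightarrow> ('c, 'n) ring_scheme \<Rightarrow>
    ('b \<Rightarrow> 'c) \<Rightarrow> ('b \<Rightarrow> 'b) set \<Rightarrow> ('c \<Rightarrow> 'c) set" where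
  "kaehler_map B A' h' B' g X =
     (\<Union>u\<in>X. kaehler_relations A' h' B' +>\<^bsub>kaehler_free B'\<^esub> free_push B B' g u)"

text \<open>
  The completed differentials of \<open>h : A \<rightarrow> B\<close>: the inverse limit of the differentials of
  \<open>B / p\<^sup>n B = B \<otimes> A / p\<^sup>n A\<close> over \<open>A / p\<^sup>n A\<close>, a module over the completion of \<open>B\<close>.
\<close>

definition padic_kaehler ::
  "nat \<Rightarrow> ('a, 'm) ring_scheme \<Rightarrow> ('a \<Rightarrow> 'b) \<Rightarrow> ('b, 'n) ring_scheme \<Rightarrow> nat \<Rightarrow>
    ('b set, ('b set \<Rightarrow> 'b set) set) module" where
  "padic_kaehler p A h B n =
     kaehler (padic_quot p A n) (padic_quot_map p B n h) (padic_quot p B n)"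

definition completed_kaehler ::
  "nat \<Rightarrow> ('a, 'm) ring_scheme \<Rightarrow> ('a \<Rightarrow> 'b) \<Rightarrow> ('b, 'n) ring_scheme \<Rightarrow>
    (nat \<Rightarrow> 'b set, nat \<Rightarrow> ('b set \<Rightarrow> 'b set) set) module" where
  "completed_kaehler p A h B =
     \<lparr>carrier = {w. (\<forall>n. w n \<in> carrier (padic_kaehler p A h B n)) \<and>
        (\<forall>n. kaehler_map (padic_quot p B (Suc n))
                (padic_quot p A n) (padic_quot_map p B n h) (padic_quot p B n)
                (padic_quot_map p B n id) (w (Suc n)) = w n)},
      mult = undefined, one = undefined,
      zero = (\<lambda>n. \<zero>\<^bsub>padic_kaehler p A h B n\<^esub>),
      add = (\<lambda>v w n. v n \<oplus>\<^bsub>padic_kaehler p A h B n\<^esub> w n),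
      smult = (\<lambda>b w n. b n \<odot>\<^bsub>padic_kaehler p A h B n\<^esub> w n)\<rparr>"

definition completed_d ::
  "nat \<Rightarrow> ('a, 'm) ring_scheme \<Rightarrow> ('a \<Rightarrow> 'b) \<Rightarrow> ('b, 'n) ring_scheme \<Rightarrow>
    (nat \<Rightarrow> 'b set) \<Rightarrow> nat \<Rightarrow> ('b set \<Rightarrow> 'b set) set" where
  "completed_d p A h B b =
     (\<lambda>n. kaehler_d (padic_quot p A n) (padic_quot_map p B n h) (padic_quot p B n) (b n))"

definition completed_pullback ::
  "nat \<Rightarrow> ('a, 'm) ring_scheme \<Rightarrow> ('a \<Rightarrow> 'b) \<Rightarrow> ('b, 'n) ring_scheme \<Rightarrow>
    ((nat \<Rightarrow> 'b set) \<Rightarrow> nat \<Rightarrow> 'b set) \<Rightarrow>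
    (nat \<Rightarrow> ('b set \<Rightarrow> 'b set) set) \<Rightarrow> nat \<Rightarrow> ('b set \<Rightarrow> 'b set) set" where
  "completed_pullback p A h B \<Phi> w =
     (\<lambda>n. kaehler_map (padic_quot p B n)
            (padic_quot p A n) (padic_quot_map p B n h) (padic_quot p B n)
            (padic_reduce p B \<Phi> n) (w n))"


section \<open>The elliptic curve without its 2-torsion\<close>

text \<open>
  \<open>S[x, y, y\<^sup>-\<^sup>1] / (y\<^sup>2 - (x\<^sup>3 + a x + b))\<close> is presented as \<open>S[x][y][t]\<close> modulo the ideal generated by
  \<open>y\<^sup>2 - (x\<^sup>3 + a x + b)\<close> and \<open>y t - 1\<close>, so that \<open>t\<close> is the inverse of \<open>y\<close>.
\<close>

type_synonym 's pol3 = "nat \<Rightarrow> nat \<Rightarrow> nat \<Rightarrow> 's"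

definition pol3_ring :: "('s, 'm) ring_scheme \<Rightarrow> (nat \<Rightarrow> nat \<Rightarrow> 's, 's pol3) up_ring" where
  "pol3_ring S = UP (UP (UP S))"

definition pol3_const :: "('s, 'm) ring_scheme \<Rightarrow> 's \<Rightarrow> 's pol3" where
  "pol3_const S s =
     up_ring.monom (pol3_ring S) (up_ring.monom (UP (UP S)) (up_ring.monom (UP S) s 0) 0) 0"

definition pol3_x :: "('s, 'm) ring_scheme \<Rightarrow> 's pol3" where
  "pol3_x S =
     up_ring.monom (pol3_ring S) (up_ring.monom (UP (UP S)) (up_ring.monom (UP S) \<one>\<^bsub>S\<^esub> 1) 0) 0"

definition pol3_y :: "('s, 'm) ring_scheme \<Rightarrow> 's pol3" where
  "pol3_y S = up_ring.monom (pol3_ring S) (up_ring.monom (UP (UP S)) \<one>\<^bsub>UP S\<^esub> 1) 0"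

definition pol3_t :: "('s, 'm) ring_scheme \<Rightarrow> 's pol3" where
  "pol3_t S = up_ring.monom (pol3_ring S) \<one>\<^bsub>UP (UP S)\<^esub> 1"

definition ell_ideal :: "('s, 'm) ring_scheme \<Rightarrow> 's \<Rightarrow> 's \<Rightarrow> 's pol3 set" where
  "ell_ideal S a b =
     Idl\<^bsub>pol3_ring S\<^esub>
       {pol3_y S [^]\<^bsub>pol3_ring S\<^esub> (2::nat) \<ominus>\<^bsub>pol3_ring S\<^esub>
          (pol3_x S [^]\<^bsub>pol3_ring S\<^esub> (3::nat) \<oplus>\<^bsub>pol3_ring S\<^esub>
           pol3_const S a \<otimes>\<^bsub>pol3_ring S\<^esub> pol3_x S \<oplus>\<^bsub>pol3_ring S\<^esub> pol3_const S b),
        pol3_y S \<otimes>\<^bsub>pol3_ring S\<^esub> pol3_t S \<ominus>\<^bsub>pol3_ring S\<^esub> \<one>\<^bsub>pol3_ring S\<^esub>}"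

definition ell_ring :: "('s, 'm) ring_scheme \<Rightarrow> 's \<Rightarrow> 's \<Rightarrow> 's pol3 set ring" where
  "ell_ring S a b = pol3_ring S Quot ell_ideal S a b"

definition ell_const :: "('s, 'm) ring_scheme \<Rightarrow> 's \<Rightarrow> 's \<Rightarrow> 's \<Rightarrow> 's pol3 set" where
  "ell_const S a b s = ell_ideal S a b +>\<^bsub>pol3_ring S\<^esub> pol3_const S s"

definition ell_x :: "('s, 'm) ring_scheme \<Rightarrow> 's \<Rightarrow> 's \<Rightarrow> 's pol3 set" where
  "ell_x S a b = ell_ideal S a b +>\<^bsub>pol3_ring S\<^esub> pol3_x S"

definition ell_y_inv :: "('s, 'm) ring_scheme \<Rightarrow> 's \<Rightarrow> 's \<Rightarrow> 's pol3 set" where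
  "ell_y_inv S a b = ell_ideal S a b +>\<^bsub>pol3_ring S\<^esub> pol3_t S"

definition ell_completion ::
  "nat \<Rightarrow> ('s, 'm) ring_scheme \<Rightarrow> 's \<Rightarrow> 's \<Rightarrow> (nat \<Rightarrow> 's pol3 set set) ring" where
  "ell_completion p S a b = padic_completion p (ell_ring S a b)"

definition ell_base :: "nat \<Rightarrow> ('s, 'm) ring_scheme \<Rightarrow> 's \<Rightarrow> 's \<Rightarrow> 's \<Rightarrow> nat \<Rightarrow> 's pol3 set set" where
  "ell_base p S a b s = padic_embed p (ell_ring S a b) (ell_const S a b s)"

definition ell_differentials ::
  "nat \<Rightarrow> ('s, 'm) ring_scheme \<Rightarrow> 's \<Rightarrow> 's \<Rightarrow>
    (nat \<Rightarrow> 's pol3 set set, nat \<Rightarrow> ('s pol3 set set \<Rightarrow> 's pol3 set set) set) module" where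
  "ell_differentials p S a b = completed_kaehler p S (ell_const S a b) (ell_ring S a b)"

definition ell_omega ::
  "nat \<Rightarrow> ('s, 'm) ring_scheme \<Rightarrow> 's \<Rightarrow> 's \<Rightarrow> nat \<Rightarrow> ('s pol3 set set \<Rightarrow> 's pol3 set set) set" where
  "ell_omega p S a b =
     padic_embed p (ell_ring S a b) (ell_y_inv S a b) \<odot>\<^bsub>ell_differentials p S a b\<^esub>
     completed_d p S (ell_const S a b) (ell_ring S a b)
       (padic_embed p (ell_ring S a b) (ell_x S a b))"

text \<open>A Frobenius lift on the completed coordinate ring extending \<open>\<phi>\<close> on \<open>S\<close>.\<close>

definition ell_frobenius_lift ::
  "nat \<Rightarrow> ('s, 'm) ring_scheme \<Rightarrow> 's \<Rightarrow> 's \<Rightarrow> ('s \<Rightarrow> 's) \<Rightarrow>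
    ((nat \<Rightarrow> 's pol3 set set) \<Rightarrow> nat \<Rightarrow> 's pol3 set set) \<Rightarrow> bool" where
  "ell_frobenius_lift p S a b \<phi> \<Phi> \<longleftrightarrow>
     frobenius_lift p (ell_completion p S a b) \<Phi> \<and>
     (\<forall>s\<in>carrier S. \<Phi> (ell_base p S a b s) = ell_base p S a b (\<phi> s))"

text \<open>
  \<open>\<eta>\<close> is \<open>\<Phi>\<^sup>*\<omega> / p\<close>; it is unique because the completed differentials have no \<open>p\<close>-torsion.
\<close>

definition lie_invariant_mod ::
  "nat \<Rightarrow> ('s, 'm) ring_scheme \<Rightarrow> 's \<Rightarrow> 's \<Rightarrow> nat \<Rightarrow> 's \<Rightarrow>
    ((nat \<Rightarrow> 's pol3 set set) \<Rightarrow> nat \<Rightarrow> 's pol3 set set) \<Rightarrow> bool" where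
  "lie_invariant_mod p S a b k \<Lambda> \<Phi> \<longleftrightarrow>
     (\<exists>\<eta>\<in>carrier (ell_differentials p S a b).
        [p] \<cdot>\<^bsub>ell_differentials p S a b\<^esub> \<eta> =
          completed_pullback p S (ell_const S a b) (ell_ring S a b) \<Phi> (ell_omega p S a b) \<and>
        (\<exists>\<tau>\<in>carrier (ell_differentials p S a b).
           \<eta> = ell_base p S a b \<Lambda> \<odot>\<^bsub>ell_differentials p S a b\<^esub> ell_omega p S a b
                 \<oplus>\<^bsub>ell_differentials p S a b\<^esub> [(p ^ k)] \<cdot>\<^bsub>ell_differentials p S a b\<^esub> \<tau>))"

end

theory Submission
  imports Defs
begin

text \<open>
  Write \<open>f = x\<^sup>3 + z\<^sub>4 x + z\<^sub>6\<close> and look for \<open>\<Phi>(x) = x\<^sup>p + p u + p\<^sup>2 V / f\<^sup>p\<close> with polynomials \<open>u\<close> and \<open>V\<close>;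
  then \<open>\<Phi>(y)\<close> is a square root of \<open>\<Phi>(x)\<^sup>3 + \<phi>(z\<^sub>4) \<Phi>(x) + \<phi>(z\<^sub>6)\<close>, which exists because this element
  is \<open>y\<^sup>2\<^sup>p\<close> times a unit congruent to 1 modulo \<open>p\<close>. Modulo \<open>p\<close>, Lie invariance says \<open>u' + x\<^sup>p\<^sup>-\<^sup>1 = \<Lambda> f\<^sup>m\<close> with
  \<open>m = (p - 1) / 2\<close>, which forces \<open>\<Lambda> = 1 / H\<close> and determines \<open>u\<close> up to a polynomial \<open>c(x\<^sup>p)\<close>.
  Modulo \<open>p\<^sup>2\<close> the equation prescribes \<open>V'\<close>, so the only obstruction is the Cartier
  operator of the right-hand side. For \<open>\<Lambda> = (1 + p \<lambda>) / H\<close> its vanishing is the differential equation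
  \<open>c' F - c F' / 2 = \<lambda> F + \<rho>\<close> modulo \<open>p\<close>, where \<open>F = X\<^sup>3 + z\<^sub>4\<^sup>p X + z\<^sub>6\<^sup>p\<close> and \<open>\<rho>\<close> is affine linear in \<open>z\<^sub>4'\<close>, \<open>z\<^sub>6'\<close>.
  The coefficients of a power series solution \<open>c\<close> obey the recurrence of \<open>\<alpha>\<^sub>n\<close> and \<open>\<beta>\<^sub>n\<close>. One of its factors
  vanishes modulo \<open>p\<close>, so a polynomial solution exists as soon as two consecutive coefficients
  can be made to vanish by the choice of \<open>c\<^sub>0\<close> and \<open>\<lambda>\<close>: a linear system with determinant \<open>\<psi>\<^sub>N\<close>, \<open>N = (p + 5) / 2\<close>,
  evaluated at \<open>(z\<^sub>4\<^sup>p, z\<^sub>6\<^sup>p)\<close>, hence congruent to the \<open>p\<close>-th power of a unit.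
\<close>

subsection \<open>Completions at \<open>p\<close>\<close>

text \<open>The hard identities are identities of polynomials over a field of characteristic 0;
  quotients and completions only receive their images under ring homomorphisms, and the quotient by
  p of the pulled back form is written down as an explicit coefficient times dx. The power p in the
  denominator f^p of the ansatz matters: the derivative of f^-p is itself a multiple of p, so d
  Phi(x) / p is x^(p-1) + u' + p V' / f^p modulo p^2. As 1 / Phi(y) is y^-p times a unit,
  multiplication by 2 f^p turns the condition into one between polynomials. Two demands have to be
  met at once: u and V may have arbitrary coefficients in M^infinity, whereas Lambda must be affine
  in z4', z6' with homogeneous coefficients free of derivatives. Hence lambda is given by Cramer's
  rule, as a formula linear in the data; the inverse of the determinant is replaced by the p-th
  power of 1 / psi_N, which inverts it modulo p. The bound p >= 11 gives N + 1 < p, so the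
  recurrence divides only by numbers prime to p up to the index that is needed.\<close>

lemma ring_hom_add_pow:
  assumes "h \<in> ring_hom R S" "cring R" "cring S" "x \<in> carrier R"
  shows "h ([(k::nat)] \<cdot>\<^bsub>R\<^esub> x) = [k] \<cdot>\<^bsub>S\<^esub> h x"
proof -
  interpret ring_hom_cring R S h using assms by (intro ring_hom_cringI)
  show ?thesis using assms(4) by (induction k) auto
qed

context cring
begin

lemma padic_ideal_iff:
  "x \<in> padic_ideal p R n \<longleftrightarrow> (\<exists>r\<in>carrier R. x = [(p ^ n)] \<cdot> r)"
proof -
  have "x \<otimes> [(p ^ n)] \<cdot> \<one> = [(p ^ n)] \<cdot> x" if "x \<in> carrier R" for x
    using that by (simp add: add_pow_rdistr)
  then show ?thesis unfolding padic_ideal_def cgenideal_def by auto metis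
qed

lemma ideal_padic_ideal: "ideal (padic_ideal p R n) R"
  unfolding padic_ideal_def by (rule cgenideal_ideal) simp

lemma cring_padic_quot: "cring (padic_quot p R n)"
  unfolding padic_quot_def by (rule ideal.quotient_is_cring[OF ideal_padic_ideal]) (rule is_cring)

lemma padic_proj_hom: "padic_proj p R n \<in> ring_hom R (padic_quot p R n)"
proof -
  have "padic_proj p R n = (+>) (padic_ideal p R n)" by (auto simp: padic_proj_def)
  then show ?thesis unfolding padic_quot_def using ideal.rcos_ring_hom[OF ideal_padic_ideal] by metis
qed

lemma padic_quot_carrier: "carrier (padic_quot p R n) = padic_proj p R n ` carrier R"
  by (auto simp: padic_quot_def padic_proj_def FactRing_def A_RCOSETS_def')

lemma padic_proj_closed: "r \<in> carrier R \<Longrightarrow> padic_proj p R n r \<in> carrier (padic_quot p R n)"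
  by (simp add: padic_quot_carrier)

text \<open>Congruences carry an explicit quotient \<open>d\<close>: an equation x = y + p^n d is
  transported by every ring homomorphism, which is how congruences are moved between rings
  later.\<close>

lemma padic_proj_eq_iff:
  assumes "x \<in> carrier R" "y \<in> carrier R"
  shows "padic_proj p R n x = padic_proj p R n y \<longleftrightarrow> (\<exists>d\<in>carrier R. x = y \<oplus> [(p ^ n)] \<cdot> d)"
proof -
  interpret ideal "padic_ideal p R n" R by (rule ideal_padic_ideal)
  have "padic_proj p R n x = padic_proj p R n y \<longleftrightarrow> x \<ominus> y \<in> padic_ideal p R n"
    unfolding padic_proj_def using assms quotient_eq_iff_same_a_r_cos[OF ideal_padic_ideal] by auto
  also have "\<dots> \<longleftrightarrow> (\<exists>d\<in>carrier R. x \<ominus> y = [(p ^ n)] \<cdot> d)" by (rule padic_ideal_iff)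
  also have "\<dots> \<longleftrightarrow> (\<exists>d\<in>carrier R. x = y \<oplus> [(p ^ n)] \<cdot> d)"
  proof (intro bex_cong refl)
    fix d assume d: "d \<in> carrier R"
    let ?e = "[(p ^ n)] \<cdot> d"
    have e: "?e \<in> carrier R" using d by simp
    show "x \<ominus> y = ?e \<longleftrightarrow> x = y \<oplus> ?e"
    proof
      assume "x \<ominus> y = ?e"
      then have "y \<oplus> ?e = y \<oplus> (x \<ominus> y)" by simp
      also have "\<dots> = x" using assms by algebra
      finally show "x = y \<oplus> ?e" by simp
    next
      assume "x = y \<oplus> ?e"
      then have "x \<ominus> y = (y \<oplus> ?e) \<ominus> y" by simp
      also have "\<dots> = ?e" using assms e by algebra
      finally show "x \<ominus> y = ?e" .
    qed
  qed
  finally show ?thesis .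
qed

lemma padic_projE:
  assumes "r \<in> carrier R" "r' \<in> padic_proj p R n r"
  obtains d where "d \<in> carrier R" "r' = r \<oplus> [(p ^ n)] \<cdot> d" "r' \<in> carrier R"
proof -
  from assms(2) obtain h where h: "h \<in> padic_ideal p R n" "r' = h \<oplus> r"
    by (auto simp: padic_proj_def a_r_coset_def')
  then obtain d where d: "d \<in> carrier R" "h = [(p ^ n)] \<cdot> d" by (auto simp: padic_ideal_iff)
  then have "r' = r \<oplus> [(p ^ n)] \<cdot> d" using h assms by (simp add: a_comm)
  then show ?thesis using that d assms by auto
qed

lemma padic_proj_self: "r \<in> carrier R \<Longrightarrow> r \<in> padic_proj p R n r"
proof -
  assume r: "r \<in> carrier R"
  interpret ideal "padic_ideal p R n" R by (rule ideal_padic_ideal)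
  show ?thesis unfolding padic_proj_def using r by (rule a_rcos_self)
qed

text \<open>Since h (a + p^n d) = h a + p^n h d, all members of the union that defines
  \<open>padic_quot_map\<close> are the same coset.\<close>

lemma padic_quot_map_proj:
  assumes "cring A" "h \<in> ring_hom A R" "a \<in> carrier A"
  shows "padic_quot_map p R n h (padic_proj p A n a) = padic_proj p R n (h a)"
proof -
  interpret A: cring A by fact
  have "padic_proj p R n (h b) = padic_proj p R n (h a)" if "b \<in> padic_proj p A n a" for b
  proof -
    from A.padic_projE[OF assms(3) that] obtain d where
      d: "d \<in> carrier A" "b = a \<oplus>\<^bsub>A\<^esub> [(p ^ n)] \<cdot>\<^bsub>A\<^esub> d" "b \<in> carrier A" .
    have "h b = h a \<oplus> [(p ^ n)] \<cdot> h d"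
      using d assms by (simp add: ring_hom_add ring_hom_add_pow is_cring)
    then show ?thesis using d assms
      by (subst padic_proj_eq_iff) (auto intro!: ring_hom_closed[OF assms(2)])
  qed
  with A.padic_proj_self[OF assms(3)] show ?thesis unfolding padic_quot_map_def by blast
qed

lemma padic_quot_map_hom:
  assumes "cring A" "h \<in> ring_hom A R"
  shows "padic_quot_map p R n h \<in> ring_hom (padic_quot p A n) (padic_quot p R n)"
proof -
  interpret A: cring A by fact
  note hA = A.padic_proj_hom[of p n] and hR = padic_proj_hom[of p n]
  show ?thesis
  proof (rule ring_hom_memI)
    fix x assume "x \<in> carrier (padic_quot p A n)"
    then obtain a where a: "a \<in> carrier A" "x = padic_proj p A n a" by (auto simp: A.padic_quot_carrier)
    then show "padic_quot_map p R n h x \<in> carrier (padic_quot p R n)"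
      using assms ring_hom_closed[OF assms(2)] by (simp add: padic_quot_map_proj padic_proj_closed)
    fix y assume "y \<in> carrier (padic_quot p A n)"
    then obtain b where b: "b \<in> carrier A" "y = padic_proj p A n b" by (auto simp: A.padic_quot_carrier)
    have c: "h a \<in> carrier R" "h b \<in> carrier R" using a b ring_hom_closed[OF assms(2)] by auto
    have "x \<otimes>\<^bsub>padic_quot p A n\<^esub> y = padic_proj p A n (a \<otimes>\<^bsub>A\<^esub> b)"
      using a b ring_hom_mult[OF hA] by simp
    then show "padic_quot_map p R n h (x \<otimes>\<^bsub>padic_quot p A n\<^esub> y)
        = padic_quot_map p R n h x \<otimes>\<^bsub>padic_quot p R n\<^esub> padic_quot_map p R n h y"
      using a b assms c by (simp add: padic_quot_map_proj ring_hom_mult[OF assms(2)] ring_hom_mult[OF hR])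
    have "x \<oplus>\<^bsub>padic_quot p A n\<^esub> y = padic_proj p A n (a \<oplus>\<^bsub>A\<^esub> b)"
      using a b ring_hom_add[OF hA] by simp
    then show "padic_quot_map p R n h (x \<oplus>\<^bsub>padic_quot p A n\<^esub> y)
        = padic_quot_map p R n h x \<oplus>\<^bsub>padic_quot p R n\<^esub> padic_quot_map p R n h y"
      using a b assms c by (simp add: padic_quot_map_proj ring_hom_add[OF assms(2)] ring_hom_add[OF hR])
  next
    have "\<one>\<^bsub>padic_quot p A n\<^esub> = padic_proj p A n \<one>\<^bsub>A\<^esub>" using ring_hom_one[OF hA] by simp
    then show "padic_quot_map p R n h \<one>\<^bsub>padic_quot p A n\<^esub> = \<one>\<^bsub>padic_quot p R n\<^esub>"
      using assms ring_hom_one[OF hR] ring_hom_one[OF assms(2)] by (simp add: padic_quot_map_proj)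
  qed
qed

lemma padic_proj_antimono:
  assumes "x \<in> carrier R" "y \<in> carrier R" "padic_proj p R n x = padic_proj p R n y" "m \<le> n"
  shows "padic_proj p R m x = padic_proj p R m y"
proof -
  obtain d where d: "d \<in> carrier R" "x = y \<oplus> [(p ^ n)] \<cdot> d" using assms padic_proj_eq_iff by blast
  have "[(p ^ n)] \<cdot> d = [(p ^ m)] \<cdot> ([(p ^ (n - m))] \<cdot> d)"
    using d assms(4) by (simp add: add.nat_pow_pow flip: power_add)
  then show ?thesis using assms d by (subst padic_proj_eq_iff) auto
qed

text \<open>Not an instance of \<open>padic_quot_map_proj\<close>, because the source is taken
  modulo p^(n+1): the argument is a smaller coset, on which the projection modulo p^n is still
  constant.\<close>

lemma padic_transition_proj:
  "r \<in> carrier R \<Longrightarrow> padic_quot_map p R n id (padic_proj p R (Suc n) r) = padic_proj p R n r"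
proof -
  assume r: "r \<in> carrier R"
  have "padic_proj p R n (id b) = padic_proj p R n r" if "b \<in> padic_proj p R (Suc n) r" for b
  proof -
    from padic_projE[OF r that] obtain d where
      "d \<in> carrier R" "b = r \<oplus> [(p ^ Suc n)] \<cdot> d" "b \<in> carrier R" .
    then have "padic_proj p R (Suc n) b = padic_proj p R (Suc n) r" using r padic_proj_eq_iff by auto
    then show ?thesis using padic_proj_antimono[of b r p "Suc n" n] r \<open>b \<in> carrier R\<close> by simp
  qed
  with padic_proj_self[OF r, of p "Suc n"] show ?thesis unfolding padic_quot_map_def by blast
qed

lemma padic_transition_hom:
  "padic_quot_map p R n id \<in> ring_hom (padic_quot p R (Suc n)) (padic_quot p R n)"
proof -
  note h1 = padic_proj_hom[of p n] and h2 = padic_proj_hom[of p "Suc n"]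
  show ?thesis
  proof (rule ring_hom_memI)
    fix x assume "x \<in> carrier (padic_quot p R (Suc n))"
    then obtain a where a: "a \<in> carrier R" "x = padic_proj p R (Suc n) a" by (auto simp: padic_quot_carrier)
    then show "padic_quot_map p R n id x \<in> carrier (padic_quot p R n)"
      by (simp add: padic_transition_proj padic_proj_closed)
    fix y assume "y \<in> carrier (padic_quot p R (Suc n))"
    then obtain b where b: "b \<in> carrier R" "y = padic_proj p R (Suc n) b" by (auto simp: padic_quot_carrier)
    have "x \<otimes>\<^bsub>padic_quot p R (Suc n)\<^esub> y = padic_proj p R (Suc n) (a \<otimes> b)"
      using a b ring_hom_mult[OF h2] by simp
    then show "padic_quot_map p R n id (x \<otimes>\<^bsub>padic_quot p R (Suc n)\<^esub> y)
        = padic_quot_map p R n id x \<otimes>\<^bsub>padic_quot p R n\<^esub> padic_quot_map p R n id y"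
      using a b by (simp add: padic_transition_proj ring_hom_mult[OF h1])
    have "x \<oplus>\<^bsub>padic_quot p R (Suc n)\<^esub> y = padic_proj p R (Suc n) (a \<oplus> b)"
      using a b ring_hom_add[OF h2] by simp
    then show "padic_quot_map p R n id (x \<oplus>\<^bsub>padic_quot p R (Suc n)\<^esub> y)
        = padic_quot_map p R n id x \<oplus>\<^bsub>padic_quot p R n\<^esub> padic_quot_map p R n id y"
      using a b by (simp add: padic_transition_proj ring_hom_add[OF h1])
  next
    have "\<one>\<^bsub>padic_quot p R (Suc n)\<^esub> = padic_proj p R (Suc n) \<one>" using ring_hom_one[OF h2] by simp
    then show "padic_quot_map p R n id \<one>\<^bsub>padic_quot p R (Suc n)\<^esub> = \<one>\<^bsub>padic_quot p R n\<^esub>"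
      using ring_hom_one[OF h1] by (simp add: padic_transition_proj)
  qed
qed

lemma padic_completion_carrier:
  "s \<in> carrier (padic_completion p R) \<longleftrightarrow> (\<forall>n. s n \<in> carrier (padic_quot p R n)) \<and>
     (\<forall>n. padic_quot_map p R n id (s (Suc n)) = s n)"
  by (simp add: padic_completion_def)

lemma padic_completion_ops:
  "s \<otimes>\<^bsub>padic_completion p R\<^esub> t = (\<lambda>n. s n \<otimes>\<^bsub>padic_quot p R n\<^esub> t n)"
  "s \<oplus>\<^bsub>padic_completion p R\<^esub> t = (\<lambda>n. s n \<oplus>\<^bsub>padic_quot p R n\<^esub> t n)"
  "\<one>\<^bsub>padic_completion p R\<^esub> = (\<lambda>n. \<one>\<^bsub>padic_quot p R n\<^esub>)"
  "\<zero>\<^bsub>padic_completion p R\<^esub> = (\<lambda>n. \<zero>\<^bsub>padic_quot p R n\<^esub>)"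
  by (simp_all add: padic_completion_def)

lemma padic_completion_zero_component: "\<zero>\<^bsub>padic_completion p R\<^esub> n = \<zero>\<^bsub>padic_quot p R n\<^esub>"
  by (simp add: padic_completion_ops)

lemma padic_component_repr:
  assumes "s \<in> carrier (padic_completion p R)"
  obtains r where "r \<in> carrier R" "s n = padic_proj p R n r"
  using assms unfolding padic_completion_carrier padic_quot_carrier image_iff by blast

lemma cring_padic_completion: "cring (padic_completion p R)"
proof -
  let ?C = "padic_completion p R"
  have Q: "cring (padic_quot p R n)" for n by (rule cring_padic_quot)
  have T: "ring_hom_cring (padic_quot p R (Suc n)) (padic_quot p R n) (padic_quot_map p R n id)" for n
    by (intro ring_hom_cringI cring_padic_quot padic_transition_hom)
  note tr = ring_hom_closed[OF padic_transition_hom] ring_hom_mult[OF padic_transition_hom]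
    ring_hom_add[OF padic_transition_hom] ring_hom_one[OF padic_transition_hom]
    ring_hom_cring.hom_zero[OF T] ring_hom_cring.hom_a_inv[OF T]
  note ax = monoid.m_closed[OF ring.is_monoid[OF cring.axioms(1)[OF Q]]] 
     monoid.one_closed[OF ring.is_monoid[OF cring.axioms(1)[OF Q]]]
     abelian_monoid.a_closed[OF abelian_group.axioms(1)[OF ring.is_abelian_group[OF cring.axioms(1)[OF Q]]]]
     abelian_monoid.zero_closed[OF abelian_group.axioms(1)[OF ring.is_abelian_group[OF cring.axioms(1)[OF Q]]]]
     abelian_group.a_inv_closed[OF ring.is_abelian_group[OF cring.axioms(1)[OF Q]]]
  show ?thesis
  proof (intro cringI abelian_groupI comm_monoidI)
    fix x assume x: "x \<in> carrier ?C"
    show "\<exists>y\<in>carrier ?C. y \<oplus>\<^bsub>?C\<^esub> x = \<zero>\<^bsub>?C\<^esub>"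
    proof
      show "(\<lambda>n. \<ominus>\<^bsub>padic_quot p R n\<^esub> x n) \<in> carrier ?C"
        using x by (simp add: padic_completion_carrier tr ax)
      show "(\<lambda>n. \<ominus>\<^bsub>padic_quot p R n\<^esub> x n) \<oplus>\<^bsub>?C\<^esub> x = \<zero>\<^bsub>?C\<^esub>"
        using x abelian_group.l_neg[OF ring.is_abelian_group[OF cring.axioms(1)[OF Q]]]
        by (auto simp: padic_completion_carrier padic_completion_ops)
    qed
  qed (simp_all add: padic_completion_carrier padic_completion_ops tr ax fun_eq_iff,
       simp_all add: cring.cring_simprules[OF Q] monoid.r_one[OF ring.is_monoid[OF cring.axioms(1)[OF Q]]])
qed

lemma padic_component_hom:
  "(\<lambda>s. s n) \<in> ring_hom (padic_completion p R) (padic_quot p R n)"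
  by (rule ring_hom_memI) (simp_all add: padic_completion_carrier padic_completion_ops)

lemma padic_component_pow:
  "s \<in> carrier (padic_completion p R) \<Longrightarrow>
    (s [^]\<^bsub>padic_completion p R\<^esub> (k::nat)) n = s n [^]\<^bsub>padic_quot p R n\<^esub> k"
  using ring_hom_cring.hom_pow[OF ring_hom_cringI[OF cring_padic_completion cring_padic_quot padic_component_hom], of s p]
  by simp

lemma padic_component_add_pow:
  "s \<in> carrier (padic_completion p R) \<Longrightarrow>
    ([(k::nat)] \<cdot>\<^bsub>padic_completion p R\<^esub> s) n = [k] \<cdot>\<^bsub>padic_quot p R n\<^esub> s n"
  using ring_hom_add_pow[OF padic_component_hom cring_padic_completion cring_padic_quot] by metis

lemma padic_quot_p_power_zero:
  assumes "x \<in> carrier (padic_quot p R n)"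
  shows "[(p ^ n)] \<cdot>\<^bsub>padic_quot p R n\<^esub> x = \<zero>\<^bsub>padic_quot p R n\<^esub>"
proof -
  interpret h: ring_hom_cring R "padic_quot p R n" "padic_proj p R n"
    by (intro ring_hom_cringI is_cring cring_padic_quot padic_proj_hom)
  obtain r where r: "r \<in> carrier R" "x = padic_proj p R n r" using assms by (auto simp: padic_quot_carrier)
  then have "[(p ^ n)] \<cdot>\<^bsub>padic_quot p R n\<^esub> x = padic_proj p R n ([(p ^ n)] \<cdot> r)"
    by (simp add: ring_hom_add_pow[OF padic_proj_hom is_cring cring_padic_quot])
  also have "\<dots> = padic_proj p R n \<zero>" using r by (subst padic_proj_eq_iff) auto
  finally show ?thesis by simp
qed

lemma padic_embed_hom: "padic_embed p R \<in> ring_hom R (padic_completion p R)"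
  using ring_hom_mult[OF padic_proj_hom[of p]] ring_hom_add[OF padic_proj_hom[of p]]
    ring_hom_one[OF padic_proj_hom[of p]]
  by (intro ring_hom_memI)
    (auto simp: padic_embed_def padic_completion_carrier padic_completion_ops padic_proj_closed
      padic_transition_proj fun_eq_iff)

lemma padic_embed_closed: "r \<in> carrier R \<Longrightarrow> padic_embed p R r \<in> carrier (padic_completion p R)"
  by (rule ring_hom_closed[OF padic_embed_hom])

lemma padic_completion_repr:
  assumes "s \<in> carrier (padic_completion p R)"
  obtains r where "\<And>n. r n \<in> carrier R" "\<And>n. s n = padic_proj p R n (r n)"
    "\<And>m n. m \<le> n \<Longrightarrow> padic_proj p R m (r n) = s m"
proof -
  have "\<forall>n. \<exists>r\<in>carrier R. s n = padic_proj p R n r"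
    using assms unfolding padic_completion_carrier padic_quot_carrier image_iff by blast
  then obtain r where r: "\<And>n. r n \<in> carrier R" "\<And>n. s n = padic_proj p R n (r n)" by metis
  have "padic_proj p R m (r (m + k)) = s m" for m k
  proof (induction k)
    case (Suc k)
    have "padic_proj p R (m + k) (r (Suc (m + k))) = s (m + k)"
      using assms r padic_transition_proj[of "r (Suc (m + k))" p "m + k"] by (simp add: padic_completion_carrier)
    then show ?case
      using Suc padic_proj_antimono[of "r (Suc (m + k))" "r (m + k)" p "m + k" m] r by simp
  qed (simp add: r)
  then show ?thesis using that[of r] r by (metis le_add_diff_inverse)
qed

text \<open>Dividing the partial sums of a coherent sequence by \<open>p\<^sup>n\<close> term by term needs no
  torsion-freeness of the ring.\<close>

lemma padic_divisible:
  assumes s: "s \<in> carrier (padic_completion p R)" and "s n = \<zero>\<^bsub>padic_quot p R n\<^esub>"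
  shows "\<exists>t\<in>carrier (padic_completion p R). s = [(p ^ n)] \<cdot>\<^bsub>padic_completion p R\<^esub> t"
proof -
  interpret h: ring_hom_cring R "padic_quot p R k" "padic_proj p R k" for k
    by (intro ring_hom_cringI is_cring cring_padic_quot padic_proj_hom)
  obtain r where r: "\<And>n. r n \<in> carrier R" "\<And>n. s n = padic_proj p R n (r n)"
    "\<And>m n. m \<le> n \<Longrightarrow> padic_proj p R m (r n) = s m" using padic_completion_repr[OF s] by blast
  have "\<forall>k. \<exists>d\<in>carrier R. r (Suc k) = r k \<oplus> [(p ^ k)] \<cdot> d"
    using r padic_proj_eq_iff by (metis le_SucI le_refl)
  then obtain d where d: "\<And>k. d k \<in> carrier R" "\<And>k. r (Suc k) = r k \<oplus> [(p ^ k)] \<cdot> d k" by metis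
  have "padic_proj p R n (r n) = padic_proj p R n \<zero>" using assms r(2)[of n] by simp
  then obtain q0 where "q0 \<in> carrier R" "r n = \<zero> \<oplus> [(p ^ n)] \<cdot> q0"
    using padic_proj_eq_iff[OF r(1) zero_closed] by blast
  then have q0: "q0 \<in> carrier R" "r n = [(p ^ n)] \<cdot> q0" by auto
  \<comment> \<open>The increments of \<open>r\<close> beyond index n are p^(n+j) d (n+j). With p^n
    removed from each of them, \<open>q\<close> adds up what remains, starting from the quotient of
    \<open>r n\<close>.\<close>
  define q where "q = rec_nat q0 (\<lambda>j x. x \<oplus> [(p ^ j)] \<cdot> d (n + j))"
  have q: "q 0 = q0" "q (Suc j) = q j \<oplus> [(p ^ j)] \<cdot> d (n + j)" for j by (simp_all add: q_def)
  have qc: "q j \<in> carrier R" for j by (induction j) (auto simp: q q0 d)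
  have rq: "r (n + j) = [(p ^ n)] \<cdot> q j" for j
  proof (induction j)
    case (Suc j)
    then show ?case using d q qc by (simp add: add.nat_pow_distrib add.nat_pow_pow power_add mult.commute)
  qed (simp add: q q0)
  define t where "t = (\<lambda>j. padic_proj p R j (q j))"
  have "padic_proj p R j (q (Suc j)) = padic_proj p R j (q j)" for j
    using qc d q(2) by (subst padic_proj_eq_iff) auto
  then have t: "t \<in> carrier (padic_completion p R)"
    using qc by (simp add: padic_completion_carrier t_def padic_proj_closed padic_transition_proj)
  have "([(p ^ n)] \<cdot>\<^bsub>padic_completion p R\<^esub> t) j = s j" for j
  proof -
    have "([(p ^ n)] \<cdot>\<^bsub>padic_completion p R\<^esub> t) j = padic_proj p R j ([(p ^ n)] \<cdot> q j)"
      using t qc by (simp add: padic_component_add_pow t_def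
          ring_hom_add_pow[OF padic_proj_hom is_cring cring_padic_quot])
    also have "\<dots> = s j" using rq[of j] r(3)[of j "n + j"] by simp
    finally show ?thesis .
  qed
  then show ?thesis using t by (intro bexI[of _ t]) auto
qed

text \<open>By \<open>padic_divisible\<close> the kernel of the projection to R / p^n is exactly p^n
  times the completion. Equality of n-th components is therefore congruence modulo p^n inside the
  completion.\<close>

lemma padic_component_eq_iff:
  assumes "a \<in> carrier (padic_completion p R)" "b \<in> carrier (padic_completion p R)"
  shows "a n = b n \<longleftrightarrow> (\<exists>d\<in>carrier (padic_completion p R).
           a = b \<oplus>\<^bsub>padic_completion p R\<^esub> [(p ^ n)] \<cdot>\<^bsub>padic_completion p R\<^esub> d)"
proof -
  let ?C = "padic_completion p R"
  interpret C: cring ?C by (rule cring_padic_completion)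
  interpret Q: cring "padic_quot p R n" by (rule cring_padic_quot)
  interpret h: ring_hom_cring ?C "padic_quot p R n" "\<lambda>s. s n"
    by (intro ring_hom_cringI cring_padic_completion cring_padic_quot padic_component_hom)
  show ?thesis
  proof
    assume "a n = b n"
    then have "(a \<ominus>\<^bsub>?C\<^esub> b) n = \<zero>\<^bsub>padic_quot p R n\<^esub>"
      using assms by (simp add: a_minus_def Q.r_neg)
    then obtain d where d: "d \<in> carrier ?C" "a \<ominus>\<^bsub>?C\<^esub> b = [(p ^ n)] \<cdot>\<^bsub>?C\<^esub> d"
      using padic_divisible[of "a \<ominus>\<^bsub>?C\<^esub> b" p n] assms by auto
    have "a = b \<oplus>\<^bsub>?C\<^esub> (a \<ominus>\<^bsub>?C\<^esub> b)" using assms by algebra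
    then show "\<exists>d\<in>carrier ?C. a = b \<oplus>\<^bsub>?C\<^esub> [(p ^ n)] \<cdot>\<^bsub>?C\<^esub> d" using d by metis
  next
    assume "\<exists>d\<in>carrier ?C. a = b \<oplus>\<^bsub>?C\<^esub> [(p ^ n)] \<cdot>\<^bsub>?C\<^esub> d"
    then obtain d where d: "d \<in> carrier ?C" "a = b \<oplus>\<^bsub>?C\<^esub> [(p ^ n)] \<cdot>\<^bsub>?C\<^esub> d" by blast
    have "([(p ^ n)] \<cdot>\<^bsub>?C\<^esub> d) n = \<zero>\<^bsub>padic_quot p R n\<^esub>"
      using d by (simp add: padic_component_add_pow padic_quot_p_power_zero)
    then show "a n = b n" using d assms by (simp add: h.hom_closed)
  qed
qed

text \<open>Extension by continuity. The n-th component of h r depends only on r modulo p^n, so any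
  representative of the n-th component of s may be chosen.\<close>

definition padic_extend :: "nat \<Rightarrow> ('a \<Rightarrow> nat \<Rightarrow> 'c) \<Rightarrow> (nat \<Rightarrow> 'a set) \<Rightarrow> nat \<Rightarrow> 'c" where
  "padic_extend p h s n = h (SOME r. r \<in> carrier R \<and> s n = padic_proj p R n r) n"

lemma padic_hom_component_cong:
  assumes "cring T" "h \<in> ring_hom R (padic_completion p T)" "r \<in> carrier R" "r' \<in> carrier R"
    and "padic_proj p R n r = padic_proj p R n r'"
  shows "h r n = h r' n"
proof -
  interpret T: cring T by fact
  have C: "cring (padic_completion p T)" by (rule T.cring_padic_completion)
  obtain d where d: "d \<in> carrier R" "r = r' \<oplus> [(p ^ n)] \<cdot> d" using assms padic_proj_eq_iff by blast
  have "h r = h r' \<oplus>\<^bsub>padic_completion p T\<^esub> [(p ^ n)] \<cdot>\<^bsub>padic_completion p T\<^esub> h d"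
    using d assms by (simp add: ring_hom_add[OF assms(2)] ring_hom_add_pow[OF assms(2) is_cring C])
  moreover have "h d \<in> carrier (padic_completion p T)" "h r \<in> carrier (padic_completion p T)"
    "h r' \<in> carrier (padic_completion p T)"
    using assms d ring_hom_closed[OF assms(2)] by blast+
  ultimately show ?thesis using T.padic_component_eq_iff by blast
qed

lemma padic_extend_component:
  assumes "cring T" "h \<in> ring_hom R (padic_completion p T)" "r \<in> carrier R"
    and "s n = padic_proj p R n r"
  shows "padic_extend p h s n = h r n"
proof -
  let ?r = "SOME r. r \<in> carrier R \<and> s n = padic_proj p R n r"
  have "?r \<in> carrier R \<and> s n = padic_proj p R n ?r"
    using assms(3,4) by (intro someI[where P = "\<lambda>r. r \<in> carrier R \<and> s n = padic_proj p R n r" and x = r]) simp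
  then show ?thesis unfolding padic_extend_def
    using padic_hom_component_cong[OF assms(1,2), of ?r r n] assms(3,4) by metis
qed

lemma padic_extend_embed:
  assumes "cring T" "h \<in> ring_hom R (padic_completion p T)" "r \<in> carrier R"
  shows "padic_extend p h (padic_embed p R r) = h r"
  using padic_extend_component[OF assms] by (auto simp: padic_embed_def)

lemma padic_extend_hom:
  assumes "cring T" "h \<in> ring_hom R (padic_completion p T)"
  shows "padic_extend p h \<in> ring_hom (padic_completion p R) (padic_completion p T)"
proof -
  interpret T: cring T by fact
  note E = padic_extend_component[OF assms]
  note hh = ring_hom_mult[OF assms(2)] ring_hom_add[OF assms(2)] ring_hom_one[OF assms(2)]
  note ph = ring_hom_mult[OF padic_proj_hom] ring_hom_add[OF padic_proj_hom] ring_hom_one[OF padic_proj_hom]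
  show ?thesis
  proof (rule ring_hom_memI)
    fix x assume x: "x \<in> carrier (padic_completion p R)"
    obtain r where r: "\<And>n. r n \<in> carrier R" "\<And>n. x n = padic_proj p R n (r n)"
      "\<And>m n. m \<le> n \<Longrightarrow> padic_proj p R m (r n) = x m" using padic_completion_repr[OF x] by blast
    have Ex: "padic_extend p h x n = h (r n) n" for n using E r by blast
    have hc: "h (r n) \<in> carrier (padic_completion p T)" for n using r ring_hom_closed[OF assms(2)] by blast
    have "padic_quot_map p T n id (h (r (Suc n)) (Suc n)) = h (r n) n" for n
    proof -
      have "padic_quot_map p T n id (h (r (Suc n)) (Suc n)) = h (r (Suc n)) n"
        using hc T.padic_completion_carrier by blast
      also have "\<dots> = h (r n) n"
        using r by (intro padic_hom_component_cong[OF assms]) (simp_all)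
      finally show ?thesis .
    qed
    then show "padic_extend p h x \<in> carrier (padic_completion p T)"
      using hc by (simp add: T.padic_completion_carrier Ex)
    fix y assume y: "y \<in> carrier (padic_completion p R)"
    obtain q where q: "\<And>n. q n \<in> carrier R" "\<And>n. y n = padic_proj p R n (q n)"
      by (rule padic_completion_repr[OF y]) (rule that)
    have Ey: "padic_extend p h y n = h (q n) n" for n using E q by blast
    have "padic_extend p h (x \<otimes>\<^bsub>padic_completion p R\<^esub> y) n = h (r n \<otimes> q n) n" for n
      using r q by (intro E) (auto simp: padic_completion_ops ph)
    then show "padic_extend p h (x \<otimes>\<^bsub>padic_completion p R\<^esub> y) =
        padic_extend p h x \<otimes>\<^bsub>padic_completion p T\<^esub> padic_extend p h y"
      using r q by (auto simp: T.padic_completion_ops Ex Ey hh)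
    have "padic_extend p h (x \<oplus>\<^bsub>padic_completion p R\<^esub> y) n = h (r n \<oplus> q n) n" for n
      using r q by (intro E) (auto simp: padic_completion_ops ph)
    then show "padic_extend p h (x \<oplus>\<^bsub>padic_completion p R\<^esub> y) =
        padic_extend p h x \<oplus>\<^bsub>padic_completion p T\<^esub> padic_extend p h y"
      using r q by (auto simp: T.padic_completion_ops Ex Ey hh)
  next
    have "padic_extend p h \<one>\<^bsub>padic_completion p R\<^esub> n = h \<one> n" for n
      by (intro E) (auto simp: padic_completion_ops ph)
    then show "padic_extend p h \<one>\<^bsub>padic_completion p R\<^esub> = \<one>\<^bsub>padic_completion p T\<^esub>"
      by (auto simp: hh)
  qed
qed

text \<open>Every ring homomorphism between completions is continuous, since it maps multiples of
  p^n to multiples of p^n; it is thus determined by its values on R.\<close>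

lemma padic_hom_component:
  assumes "cring T" "\<Phi> \<in> ring_hom (padic_completion p R) (padic_completion p T)"
    and "s \<in> carrier (padic_completion p R)" "r \<in> carrier R" "s n = padic_proj p R n r"
  shows "\<Phi> s n = \<Phi> (padic_embed p R r) n"
proof -
  interpret T: cring T by fact
  interpret C: cring "padic_completion p R" by (rule cring_padic_completion)
  have e: "padic_embed p R r \<in> carrier (padic_completion p R)" using assms padic_embed_closed by blast
  obtain d where d: "d \<in> carrier (padic_completion p R)"
    "s = padic_embed p R r \<oplus>\<^bsub>padic_completion p R\<^esub> [(p ^ n)] \<cdot>\<^bsub>padic_completion p R\<^esub> d"
    using padic_component_eq_iff[OF assms(3) e, of n] assms(5) by (auto simp: padic_embed_def)
  have "\<Phi> s = \<Phi> (padic_embed p R r) \<oplus>\<^bsub>padic_completion p T\<^esub> [(p ^ n)] \<cdot>\<^bsub>padic_completion p T\<^esub> \<Phi> d"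
    using d e by (simp add: ring_hom_add[OF assms(2)]
        ring_hom_add_pow[OF assms(2) cring_padic_completion T.cring_padic_completion])
  then show ?thesis using d e assms(3) ring_hom_closed[OF assms(2)] T.padic_component_eq_iff by blast
qed

lemma padic_hom_unique:
  assumes "cring T" "\<Phi> \<in> ring_hom (padic_completion p R) (padic_completion p T)"
    "\<Psi> \<in> ring_hom (padic_completion p R) (padic_completion p T)"
    and "\<And>r. r \<in> carrier R \<Longrightarrow> \<Phi> (padic_embed p R r) = \<Psi> (padic_embed p R r)"
    and "s \<in> carrier (padic_completion p R)"
  shows "\<Phi> s = \<Psi> s"
proof
  fix n
  obtain r where "r \<in> carrier R" "s n = padic_proj p R n r"
    by (rule padic_component_repr[OF assms(5)])
  then show "\<Phi> s n = \<Psi> s n"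
    using padic_hom_component[OF assms(1,2,5)] padic_hom_component[OF assms(1,3,5)] assms(4) by metis
qed

lemma padic_reduce_proj:
  assumes "\<Phi> \<in> ring_hom (padic_completion p R) (padic_completion p R)" "r \<in> carrier R"
  shows "padic_reduce p R \<Phi> n (padic_proj p R n r) = \<Phi> (padic_embed p R r) n"
proof -
  have "\<Phi> (padic_embed p R b) n = \<Phi> (padic_embed p R r) n" if "b \<in> padic_proj p R n r" for b
  proof -
    from padic_projE[OF assms(2) that] obtain d where d: "d \<in> carrier R" "b = r \<oplus> [(p ^ n)] \<cdot> d" "b \<in> carrier R" .
    then have "padic_embed p R b n = padic_proj p R n r"
      using assms(2) padic_proj_eq_iff by (auto simp: padic_embed_def)
    then show ?thesis
      using padic_hom_component[OF is_cring assms(1) padic_embed_closed[OF d(3)] assms(2)] by simp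
  qed
  with padic_proj_self[OF assms(2)] show ?thesis unfolding padic_reduce_def by blast
qed

lemma padic_reduce_hom:
  assumes "\<Phi> \<in> ring_hom (padic_completion p R) (padic_completion p R)"
  shows "padic_reduce p R \<Phi> n \<in> ring_hom (padic_quot p R n) (padic_quot p R n)"
proof (rule ring_hom_memI)
  note P = padic_reduce_proj[OF assms]
  note ph = ring_hom_mult[OF padic_proj_hom, symmetric] ring_hom_add[OF padic_proj_hom, symmetric]
    ring_hom_one[OF padic_proj_hom, symmetric]
  note eh = ring_hom_mult[OF padic_embed_hom] ring_hom_add[OF padic_embed_hom] ring_hom_one[OF padic_embed_hom]
  note fh = ring_hom_mult[OF assms] ring_hom_add[OF assms] ring_hom_one[OF assms]
  fix x assume "x \<in> carrier (padic_quot p R n)"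
  then obtain a where a: "a \<in> carrier R" "x = padic_proj p R n a" by (auto simp: padic_quot_carrier)
  then show "padic_reduce p R \<Phi> n x \<in> carrier (padic_quot p R n)"
    using P ring_hom_closed[OF assms padic_embed_closed] by (simp add: padic_completion_carrier)
  fix y assume "y \<in> carrier (padic_quot p R n)"
  then obtain b where b: "b \<in> carrier R" "y = padic_proj p R n b" by (auto simp: padic_quot_carrier)
  show "padic_reduce p R \<Phi> n (x \<otimes>\<^bsub>padic_quot p R n\<^esub> y)
      = padic_reduce p R \<Phi> n x \<otimes>\<^bsub>padic_quot p R n\<^esub> padic_reduce p R \<Phi> n y"
    using a b by (simp add: ph P eh fh padic_embed_closed) (simp add: padic_completion_ops)
  show "padic_reduce p R \<Phi> n (x \<oplus>\<^bsub>padic_quot p R n\<^esub> y)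
      = padic_reduce p R \<Phi> n x \<oplus>\<^bsub>padic_quot p R n\<^esub> padic_reduce p R \<Phi> n y"
    using a b by (simp add: ph P eh fh padic_embed_closed) (simp add: padic_completion_ops)
next
  have "padic_reduce p R \<Phi> n (padic_proj p R n \<one>) = \<Phi> (padic_embed p R \<one>) n"
    by (rule padic_reduce_proj[OF assms]) simp
  then show "padic_reduce p R \<Phi> n \<one>\<^bsub>padic_quot p R n\<^esub> = \<one>\<^bsub>padic_quot p R n\<^esub>"
    using ring_hom_one[OF padic_proj_hom] ring_hom_one[OF padic_embed_hom] ring_hom_one[OF assms]
    by (simp add: padic_completion_ops)
qed

lemma padic_ideal_completion:
  assumes "s \<in> carrier (padic_completion p R)"
  shows "s \<in> padic_ideal p (padic_completion p R) n \<longleftrightarrow> s n = \<zero>\<^bsub>padic_quot p R n\<^esub>"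
proof -
  interpret C: cring "padic_completion p R" by (rule cring_padic_completion)
  show ?thesis
    using padic_component_eq_iff[OF assms C.zero_closed, of n] C.padic_ideal_iff[of s p n]
    by (simp add: padic_completion_zero_component)
qed

text \<open>Being a Frobenius lift concerns only the first component, and there every element of the
  completion agrees with an element of R.\<close>

lemma frobenius_lift_completionI:
  assumes \<Phi>: "\<Phi> \<in> ring_hom (padic_completion p R) (padic_completion p R)"
    and F: "\<And>r. r \<in> carrier R \<Longrightarrow> \<Phi> (padic_embed p R r) 1 = padic_proj p R 1 r [^]\<^bsub>padic_quot p R 1\<^esub> p"
  shows "frobenius_lift p (padic_completion p R) \<Phi>"
proof -
  interpret C: cring "padic_completion p R" by (rule cring_padic_completion)
  interpret Q: cring "padic_quot p R 1" by (rule cring_padic_quot)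
  interpret h: ring_hom_cring "padic_completion p R" "padic_quot p R 1" "\<lambda>s. s 1"
    by (intro ring_hom_cringI cring_padic_completion cring_padic_quot padic_component_hom)
  show ?thesis unfolding frobenius_lift_def
  proof (intro conjI ballI \<Phi>)
    fix s assume s: "s \<in> carrier (padic_completion p R)"
    obtain r where r: "r \<in> carrier R" "s 1 = padic_proj p R 1 r"
      by (rule padic_component_repr[OF s])
    have \<Phi>s: "\<Phi> s \<in> carrier (padic_completion p R)" using ring_hom_closed[OF \<Phi> s] .
    have "\<Phi> s 1 = (s [^]\<^bsub>padic_completion p R\<^esub> p) 1"
      using padic_hom_component[OF is_cring \<Phi> s r] F[OF r(1)] r s by (simp add: padic_component_pow)
    then have "(\<Phi> s \<ominus>\<^bsub>padic_completion p R\<^esub> s [^]\<^bsub>padic_completion p R\<^esub> p) 1 = \<zero>\<^bsub>padic_quot p R 1\<^esub>"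
      using \<Phi>s s h.hom_closed[of "s [^]\<^bsub>padic_completion p R\<^esub> p"]
        h.hom_a_inv[of "s [^]\<^bsub>padic_completion p R\<^esub> p"] unfolding a_minus_def
      by (subst h.hom_add) (auto simp: Q.r_neg simp del: h.hom_pow h.hom_a_inv One_nat_def)
    then show "\<Phi> s \<ominus>\<^bsub>padic_completion p R\<^esub> s [^]\<^bsub>padic_completion p R\<^esub> p
        \<in> padic_ideal p (padic_completion p R) 1"
      using \<Phi>s s by (subst padic_ideal_completion) auto
  qed
qed

text \<open>The contraction principle for the p-adic topology. The iterates of 0 stabilise: the
  steps k and k + 1 agree modulo p^k, and the diagonal sequence is the limit.\<close>

lemma padic_fixed_point:
  assumes T: "\<And>a. a \<in> carrier (padic_completion p R) \<Longrightarrow> T a \<in> carrier (padic_completion p R)"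
    and contr: "\<And>a b n. a \<in> carrier (padic_completion p R) \<Longrightarrow> b \<in> carrier (padic_completion p R) \<Longrightarrow>
      a n = b n \<Longrightarrow> T a (Suc n) = T b (Suc n)"
  shows "\<exists>s\<in>carrier (padic_completion p R). T s = s"
proof -
  let ?C = "padic_completion p R"
  interpret C: cring ?C by (rule cring_padic_completion)
  \<comment> \<open>As p^0 = 1, all elements agree at level 0; this anchors the iteration.\<close>
  have triv: "a 0 = b 0" if "a \<in> carrier ?C" "b \<in> carrier ?C" for a b :: "nat \<Rightarrow> 'a set"
  proof -
    have "a = b \<oplus>\<^bsub>?C\<^esub> (a \<ominus>\<^bsub>?C\<^esub> b)" using that by algebra
    then have "\<exists>d\<in>carrier ?C. a = b \<oplus>\<^bsub>?C\<^esub> [(p ^ 0)] \<cdot>\<^bsub>?C\<^esub> d"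
      using that by (intro bexI[of _ "a \<ominus>\<^bsub>?C\<^esub> b"]) auto
    then show ?thesis using padic_component_eq_iff that by blast
  qed
  define x where "x k = (T ^^ k) \<zero>\<^bsub>?C\<^esub>" for k
  have xc: "x k \<in> carrier ?C" for k by (induction k) (auto simp: x_def T)
  have x_Suc: "x (Suc k) = T (x k)" for k by (simp add: x_def)
  have step: "x (Suc k) k = x k k" for k
  proof (induction k)
    case (Suc k)
    then show ?case using contr[OF xc xc] x_Suc by metis
  qed (simp add: triv xc)
  define s where "s n = x n n" for n
  have s: "s \<in> carrier ?C" unfolding padic_completion_carrier
  proof (intro conjI allI)
    fix n
    show "s n \<in> carrier (padic_quot p R n)" using xc[of n] by (simp add: s_def padic_completion_carrier)
    have "padic_quot_map p R n id (x (Suc n) (Suc n)) = x (Suc n) n"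
      using xc[of "Suc n"] by (simp add: padic_completion_carrier)
    then show "padic_quot_map p R n id (s (Suc n)) = s n" using step by (simp add: s_def)
  qed
  have "T s n = s n" for n
  proof (cases n)
    case 0
    then show ?thesis using triv s T by blast
  next
    case (Suc k)
    have "T s (Suc k) = T (x k) (Suc k)" by (rule contr[OF s xc]) (simp add: s_def)
    then show ?thesis using Suc x_Suc by (simp add: s_def)
  qed
  then show ?thesis using s by blast
qed

text \<open>The inverse of 1 + p w is the fixed point of the contraction v -> 1 - p w v.\<close>

lemma padic_one_plus_unit:
  assumes w: "w \<in> carrier (padic_completion p R)"
  shows "\<exists>v\<in>carrier (padic_completion p R).
    (\<one>\<^bsub>padic_completion p R\<^esub> \<oplus>\<^bsub>padic_completion p R\<^esub> [p] \<cdot>\<^bsub>padic_completion p R\<^esub> w)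
      \<otimes>\<^bsub>padic_completion p R\<^esub> v = \<one>\<^bsub>padic_completion p R\<^esub>"
proof -
  let ?C = "padic_completion p R"
  interpret C: cring ?C by (rule cring_padic_completion)
  let ?T = "\<lambda>v. \<one>\<^bsub>?C\<^esub> \<ominus>\<^bsub>?C\<^esub> [p] \<cdot>\<^bsub>?C\<^esub> (w \<otimes>\<^bsub>?C\<^esub> v)"
  have "\<exists>v\<in>carrier ?C. ?T v = v"
  proof (rule padic_fixed_point)
    fix a b n assume a: "a \<in> carrier ?C" and b: "b \<in> carrier ?C" and "a n = b n"
    then obtain d where d: "d \<in> carrier ?C" "a = b \<oplus>\<^bsub>?C\<^esub> [(p ^ n)] \<cdot>\<^bsub>?C\<^esub> d"
      using padic_component_eq_iff[OF a b, of n] by auto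
    have e1: "[p] \<cdot>\<^bsub>?C\<^esub> (w \<otimes>\<^bsub>?C\<^esub> a) = [p] \<cdot>\<^bsub>?C\<^esub> (w \<otimes>\<^bsub>?C\<^esub> b) \<oplus>\<^bsub>?C\<^esub> [(p ^ Suc n)] \<cdot>\<^bsub>?C\<^esub> (w \<otimes>\<^bsub>?C\<^esub> d)"
      using b w d by (simp add: C.r_distr C.add.nat_pow_distrib C.add_pow_rdistr C.add.nat_pow_pow mult.commute)
    have "?T a = ?T b \<oplus>\<^bsub>?C\<^esub> [(p ^ Suc n)] \<cdot>\<^bsub>?C\<^esub> (\<ominus>\<^bsub>?C\<^esub> (w \<otimes>\<^bsub>?C\<^esub> d))"
    proof -
      have n: "[(p ^ Suc n)] \<cdot>\<^bsub>?C\<^esub> (\<ominus>\<^bsub>?C\<^esub> (w \<otimes>\<^bsub>?C\<^esub> d)) = \<ominus>\<^bsub>?C\<^esub> ([(p ^ Suc n)] \<cdot>\<^bsub>?C\<^esub> (w \<otimes>\<^bsub>?C\<^esub> d))"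
        using w d by (simp add: C.add.nat_pow_inv)
      have c: "[p] \<cdot>\<^bsub>?C\<^esub> (w \<otimes>\<^bsub>?C\<^esub> b) \<in> carrier ?C" "[(p ^ Suc n)] \<cdot>\<^bsub>?C\<^esub> (w \<otimes>\<^bsub>?C\<^esub> d) \<in> carrier ?C"
        using w b d by auto
      show ?thesis unfolding e1 n using c by algebra
    qed
    then show "?T a (Suc n) = ?T b (Suc n)"
      using a b w d by (subst padic_component_eq_iff) auto
  qed (use w in auto)
  then obtain v where v: "v \<in> carrier ?C" "?T v = v" by blast
  let ?u = "[p] \<cdot>\<^bsub>?C\<^esub> (w \<otimes>\<^bsub>?C\<^esub> v)"
  have u: "?u \<in> carrier ?C" using w v by auto
  have "(\<one>\<^bsub>?C\<^esub> \<oplus>\<^bsub>?C\<^esub> [p] \<cdot>\<^bsub>?C\<^esub> w) \<otimes>\<^bsub>?C\<^esub> v = v \<oplus>\<^bsub>?C\<^esub> ?u"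
    using w v by (simp add: C.l_distr C.add_pow_ldistr)
  also have "\<dots> = (\<one>\<^bsub>?C\<^esub> \<ominus>\<^bsub>?C\<^esub> ?u) \<oplus>\<^bsub>?C\<^esub> ?u" using v by simp
  also have "\<dots> = \<one>\<^bsub>?C\<^esub>" using u by algebra
  finally show ?thesis using v by blast
qed

text \<open>For i = 1/2 the equation reads 2 w + p w^2 = E, that is (1 + p w)^2 = 1 + p E. This is
  the square root from which the image of y is built.\<close>

lemma padic_half_fixed_point:
  assumes i: "i \<in> carrier (padic_completion p R)" and E: "E \<in> carrier (padic_completion p R)"
  shows "\<exists>w\<in>carrier (padic_completion p R).
    w = i \<otimes>\<^bsub>padic_completion p R\<^esub> (E \<ominus>\<^bsub>padic_completion p R\<^esub>
       [p] \<cdot>\<^bsub>padic_completion p R\<^esub> (w \<otimes>\<^bsub>padic_completion p R\<^esub> w))"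
proof -
  let ?C = "padic_completion p R"
  interpret C: cring ?C by (rule cring_padic_completion)
  let ?T = "\<lambda>w. i \<otimes>\<^bsub>?C\<^esub> (E \<ominus>\<^bsub>?C\<^esub> [p] \<cdot>\<^bsub>?C\<^esub> (w \<otimes>\<^bsub>?C\<^esub> w))"
  have "\<exists>v\<in>carrier ?C. ?T v = v"
  proof (rule padic_fixed_point)
    fix a b n assume a: "a \<in> carrier ?C" and b: "b \<in> carrier ?C" and "a n = b n"
    then obtain d where d: "d \<in> carrier ?C" "a = b \<oplus>\<^bsub>?C\<^esub> [(p ^ n)] \<cdot>\<^bsub>?C\<^esub> d"
      using padic_component_eq_iff[OF a b, of n] by auto
    let ?q = "[(p ^ n)] \<cdot>\<^bsub>?C\<^esub> d"
    have q: "?q \<in> carrier ?C" using d by auto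
    let ?r = "d \<otimes>\<^bsub>?C\<^esub> (a \<oplus>\<^bsub>?C\<^esub> b)"
    have r: "?r \<in> carrier ?C" using a b d by auto
    \<comment> \<open>a^2 - b^2 = (a - b)(a + b) keeps the factor p^n of a - b, and the p in front
      supplies one more.\<close>
    have "a \<otimes>\<^bsub>?C\<^esub> a = b \<otimes>\<^bsub>?C\<^esub> b \<oplus>\<^bsub>?C\<^esub> ?q \<otimes>\<^bsub>?C\<^esub> (a \<oplus>\<^bsub>?C\<^esub> b)"
      unfolding d(2) using b q by algebra
    also have "?q \<otimes>\<^bsub>?C\<^esub> (a \<oplus>\<^bsub>?C\<^esub> b) = [(p ^ n)] \<cdot>\<^bsub>?C\<^esub> ?r" using a b d by (simp add: C.add_pow_ldistr)
    finally have e1: "[p] \<cdot>\<^bsub>?C\<^esub> (a \<otimes>\<^bsub>?C\<^esub> a) = [p] \<cdot>\<^bsub>?C\<^esub> (b \<otimes>\<^bsub>?C\<^esub> b) \<oplus>\<^bsub>?C\<^esub> [(p ^ Suc n)] \<cdot>\<^bsub>?C\<^esub> ?r"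
      using b r by (simp add: C.add.nat_pow_distrib C.add.nat_pow_pow mult.commute)
    have n: "[(p ^ Suc n)] \<cdot>\<^bsub>?C\<^esub> (\<ominus>\<^bsub>?C\<^esub> (i \<otimes>\<^bsub>?C\<^esub> ?r)) = \<ominus>\<^bsub>?C\<^esub> (i \<otimes>\<^bsub>?C\<^esub> [(p ^ Suc n)] \<cdot>\<^bsub>?C\<^esub> ?r)"
      using i r by (simp add: C.add.nat_pow_inv C.add_pow_rdistr)
    have c: "[p] \<cdot>\<^bsub>?C\<^esub> (b \<otimes>\<^bsub>?C\<^esub> b) \<in> carrier ?C" "[(p ^ Suc n)] \<cdot>\<^bsub>?C\<^esub> ?r \<in> carrier ?C"
      using r b by auto
    have "?T a = ?T b \<oplus>\<^bsub>?C\<^esub> [(p ^ Suc n)] \<cdot>\<^bsub>?C\<^esub> (\<ominus>\<^bsub>?C\<^esub> (i \<otimes>\<^bsub>?C\<^esub> ?r))"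
      unfolding e1 n using c i E by algebra
    then show "?T a (Suc n) = ?T b (Suc n)"
      using a b i E r by (subst padic_component_eq_iff) auto
  qed (use i E in auto)
  then show ?thesis by metis
qed

end

subsection \<open>Modules of differentials\<close>

lemma free_module_carrier:
  "u \<in> carrier (free_module B C) \<longleftrightarrow>
    finite {c. u c \<noteq> \<zero>\<^bsub>B\<^esub>} \<and> (\<forall>c\<in>C. u c \<in> carrier B) \<and> (\<forall>c. c \<notin> C \<longrightarrow> u c = \<zero>\<^bsub>B\<^esub>)"
  by (simp add: free_module_def)

lemma free_module_ops:
  "u \<oplus>\<^bsub>free_module B C\<^esub> v = (\<lambda>c. u c \<oplus>\<^bsub>B\<^esub> v c)"
  "b \<odot>\<^bsub>free_module B C\<^esub> u = (\<lambda>c. b \<otimes>\<^bsub>B\<^esub> u c)"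
  "\<zero>\<^bsub>free_module B C\<^esub> = (\<lambda>c. \<zero>\<^bsub>B\<^esub>)"
  by (simp_all add: free_module_def)

context cring
begin

lemma free_module_component: "u \<in> carrier (free_module R C) \<Longrightarrow> u c \<in> carrier R"
  by (cases "c \<in> C") (simp_all add: free_module_carrier)

lemma module_free_module: "module R (free_module R C)"
proof (intro moduleI abelian_groupI is_cring)
  fix u assume u: "u \<in> carrier (free_module R C)"
  note uc = free_module_component[OF u]
  have finu: "finite {c. u c \<noteq> \<zero>}" using u by (simp add: free_module_carrier)
  show "\<zero>\<^bsub>free_module R C\<^esub> \<oplus>\<^bsub>free_module R C\<^esub> u = u" using uc by (simp add: free_module_ops)
  show "\<exists>v\<in>carrier (free_module R C). v \<oplus>\<^bsub>free_module R C\<^esub> u = \<zero>\<^bsub>free_module R C\<^esub>"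
  proof
    have "finite {c. \<ominus> u c \<noteq> \<zero>}" by (rule finite_subset[OF _ finu]) auto
    then show "(\<lambda>c. \<ominus> u c) \<in> carrier (free_module R C)" using u uc by (simp add: free_module_carrier)
    show "(\<lambda>c. \<ominus> u c) \<oplus>\<^bsub>free_module R C\<^esub> u = \<zero>\<^bsub>free_module R C\<^esub>"
      using uc by (simp add: free_module_ops l_neg)
  qed
  show "\<one> \<odot>\<^bsub>free_module R C\<^esub> u = u" using uc by (simp add: free_module_ops)
  { fix b assume b: "b \<in> carrier R"
    have "finite {c. b \<otimes> u c \<noteq> \<zero>}" by (rule finite_subset[OF _ finu]) (use b in auto)
    then show "b \<odot>\<^bsub>free_module R C\<^esub> u \<in> carrier (free_module R C)"
      using u uc b by (simp add: free_module_carrier free_module_ops)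
    fix c assume c: "c \<in> carrier R"
    show "(b \<oplus> c) \<odot>\<^bsub>free_module R C\<^esub> u =
      b \<odot>\<^bsub>free_module R C\<^esub> u \<oplus>\<^bsub>free_module R C\<^esub> c \<odot>\<^bsub>free_module R C\<^esub> u"
      using uc b c by (simp add: free_module_ops l_distr)
    show "(b \<otimes> c) \<odot>\<^bsub>free_module R C\<^esub> u = b \<odot>\<^bsub>free_module R C\<^esub> (c \<odot>\<^bsub>free_module R C\<^esub> u)"
      using uc b c by (simp add: free_module_ops m_assoc)
  }
  fix v assume v: "v \<in> carrier (free_module R C)"
  note vc = free_module_component[OF v]
  have finv: "finite {c. v c \<noteq> \<zero>}" using v by (simp add: free_module_carrier)
  have "finite {c. u c \<oplus> v c \<noteq> \<zero>}"
    by (rule finite_subset[OF _ finite_UnI[OF finu finv]]) auto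
  then show "u \<oplus>\<^bsub>free_module R C\<^esub> v \<in> carrier (free_module R C)"
    using u v by (simp add: free_module_carrier free_module_ops)
  show "u \<oplus>\<^bsub>free_module R C\<^esub> v = v \<oplus>\<^bsub>free_module R C\<^esub> u"
    using uc vc by (simp add: free_module_ops a_comm)
  { fix b assume b: "b \<in> carrier R"
    show "b \<odot>\<^bsub>free_module R C\<^esub> (u \<oplus>\<^bsub>free_module R C\<^esub> v) =
      b \<odot>\<^bsub>free_module R C\<^esub> u \<oplus>\<^bsub>free_module R C\<^esub> b \<odot>\<^bsub>free_module R C\<^esub> v"
      using uc vc b by (simp add: free_module_ops r_distr)
  }
  fix w assume w: "w \<in> carrier (free_module R C)"
  show "u \<oplus>\<^bsub>free_module R C\<^esub> v \<oplus>\<^bsub>free_module R C\<^esub> w = u \<oplus>\<^bsub>free_module R C\<^esub> (v \<oplus>\<^bsub>free_module R C\<^esub> w)"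
    using uc vc free_module_component[OF w] by (simp add: free_module_ops a_assoc)
qed (simp add: free_module_carrier free_module_ops)

lemma free_gen_closed: "c \<in> C \<Longrightarrow> free_gen R c \<in> carrier (free_module R C)"
  by (auto simp: free_module_carrier free_gen_def)

end

context module
begin

lemma submodule_span_submodule:
  assumes "X \<subseteq> carrier M"
  shows "submodule (submodule_span R M X) R M"
proof (rule submoduleI)
  show "submodule_span R M X \<subseteq> carrier M"
    unfolding submodule_span_def using carrier_is_submodule assms by blast
  show "\<zero>\<^bsub>M\<^esub> \<in> submodule_span R M X"
    unfolding submodule_span_def using subgroup.one_closed[OF submodule.axioms(1)] by fastforce
qed (auto simp: submodule_span_def dest: submoduleE)

lemma submodule_span_superset: "X \<subseteq> submodule_span R M X"
  by (auto simp: submodule_span_def)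

lemma submodule_span_least: "submodule N R M \<Longrightarrow> X \<subseteq> N \<Longrightarrow> submodule_span R M X \<subseteq> N"
  by (auto simp: submodule_span_def)

end

locale quotient_module = module R M for R (structure) and M (structure) and N +
  assumes sub: "submodule N R M"
begin

lemma N_abelian_subgroup: "abelian_subgroup N M"
  by (rule abelian_subgroupI3[OF additive_subgroupI[OF submodule.axioms(1)[OF sub]] M.abelian_group_axioms])

sublocale N: abelian_subgroup N M by (rule N_abelian_subgroup)

lemma coset_eqI:
  assumes "u \<in> carrier M" "v \<in> carrier M" "u \<ominus>\<^bsub>M\<^esub> v \<in> N"
  shows "N +>\<^bsub>M\<^esub> u = N +>\<^bsub>M\<^esub> v"
proof -
  have "u = (u \<ominus>\<^bsub>M\<^esub> v) \<oplus>\<^bsub>M\<^esub> v"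
    using assms(1,2) by (simp add: a_minus_def M.a_assoc M.l_neg)
  then have "u \<in> N +>\<^bsub>M\<^esub> v" using assms by (auto simp: a_r_coset_def' intro!: bexI[of _ "u \<ominus>\<^bsub>M\<^esub> v"])
  then show ?thesis using M.a_repr_independence[OF _ assms(2) N.a_subgroup] by simp
qed

lemma cosetE:
  assumes "u' \<in> N +>\<^bsub>M\<^esub> u"
  obtains n where "n \<in> N" "u' = n \<oplus>\<^bsub>M\<^esub> u"
  using assms by (auto simp: a_r_coset_def')

lemma coset_add_left:
  assumes "u \<in> carrier M" "n \<in> N"
  shows "N +>\<^bsub>M\<^esub> (n \<oplus>\<^bsub>M\<^esub> u) = N +>\<^bsub>M\<^esub> u"
  using M.a_repr_independence[of "n \<oplus>\<^bsub>M\<^esub> u", OF _ assms(1) N.a_subgroup] assms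
  by (auto simp: a_r_coset_def')

lemma quot_carrier: "carrier (quot_module M N) = (\<lambda>u. N +>\<^bsub>M\<^esub> u) ` carrier M"
  by (auto simp: quot_module_def A_RCOSETS_def')

lemma quot_zero: "\<zero>\<^bsub>quot_module M N\<^esub> = N +>\<^bsub>M\<^esub> \<zero>\<^bsub>M\<^esub>"
  by (simp add: quot_module_def N.a_subset)

lemma quot_zero_eq: "n \<in> N \<Longrightarrow> N +>\<^bsub>M\<^esub> n = \<zero>\<^bsub>quot_module M N\<^esub>"
  using N.a_subset coset_add_left[of "\<zero>\<^bsub>M\<^esub>" n] by (auto simp: quot_zero)

lemma quot_add:
  "u \<in> carrier M \<Longrightarrow> v \<in> carrier M \<Longrightarrow>
    (N +>\<^bsub>M\<^esub> u) \<oplus>\<^bsub>quot_module M N\<^esub> (N +>\<^bsub>M\<^esub> v) = N +>\<^bsub>M\<^esub> (u \<oplus>\<^bsub>M\<^esub> v)"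
  by (simp add: quot_module_def N.a_rcos_sum)

lemma quot_smult:
  assumes b: "b \<in> carrier R" and u: "u \<in> carrier M"
  shows "b \<odot>\<^bsub>quot_module M N\<^esub> (N +>\<^bsub>M\<^esub> u) = N +>\<^bsub>M\<^esub> (b \<odot>\<^bsub>M\<^esub> u)"
proof -
  have "N +>\<^bsub>M\<^esub> (b \<odot>\<^bsub>M\<^esub> u') = N +>\<^bsub>M\<^esub> (b \<odot>\<^bsub>M\<^esub> u)" if u': "u' \<in> N +>\<^bsub>M\<^esub> u" for u'
  proof -
    obtain n where n: "n \<in> N" "u' = n \<oplus>\<^bsub>M\<^esub> u" using u' by (rule cosetE)
    then have "b \<odot>\<^bsub>M\<^esub> u' = b \<odot>\<^bsub>M\<^esub> n \<oplus>\<^bsub>M\<^esub> b \<odot>\<^bsub>M\<^esub> u"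
      using u b N.a_subset by (auto simp: smult_r_distr)
    moreover have "b \<odot>\<^bsub>M\<^esub> n \<in> N" using submodule.smult_closed[OF sub b n(1)] .
    ultimately show ?thesis using coset_add_left u b by simp
  qed
  moreover have "u \<in> N +>\<^bsub>M\<^esub> u" using u by (rule N.a_rcos_self)
  ultimately have "(\<Union>u'\<in>N +>\<^bsub>M\<^esub> u. N +>\<^bsub>M\<^esub> (b \<odot>\<^bsub>M\<^esub> u')) = N +>\<^bsub>M\<^esub> (b \<odot>\<^bsub>M\<^esub> u)"
    by blast
  then show ?thesis by (simp add: quot_module_def)
qed

lemma module_quot: "module R (quot_module M N)"
proof (intro moduleI abelian_groupI R.is_cring)
  fix x assume "x \<in> carrier (quot_module M N)"
  then obtain u where u: "u \<in> carrier M" "x = N +>\<^bsub>M\<^esub> u" by (auto simp: quot_carrier)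
  show "\<exists>y\<in>carrier (quot_module M N). y \<oplus>\<^bsub>quot_module M N\<^esub> x = \<zero>\<^bsub>quot_module M N\<^esub>"
    using u by (intro bexI[of _ "N +>\<^bsub>M\<^esub> (\<ominus>\<^bsub>M\<^esub> u)"]) (auto simp: quot_add quot_zero quot_carrier M.l_neg)
  show "\<zero>\<^bsub>quot_module M N\<^esub> \<oplus>\<^bsub>quot_module M N\<^esub> x = x" using u by (simp add: quot_zero quot_add)
  show "\<one> \<odot>\<^bsub>quot_module M N\<^esub> x = x" using u by (simp add: quot_smult)
  { fix b assume b: "b \<in> carrier R"
    show "b \<odot>\<^bsub>quot_module M N\<^esub> x \<in> carrier (quot_module M N)" using u b by (auto simp: quot_smult quot_carrier)
    fix c assume c: "c \<in> carrier R"
    show "(b \<oplus> c) \<odot>\<^bsub>quot_module M N\<^esub> x =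
      b \<odot>\<^bsub>quot_module M N\<^esub> x \<oplus>\<^bsub>quot_module M N\<^esub> c \<odot>\<^bsub>quot_module M N\<^esub> x"
      using u b c by (simp add: quot_smult quot_add smult_l_distr)
    show "(b \<otimes> c) \<odot>\<^bsub>quot_module M N\<^esub> x = b \<odot>\<^bsub>quot_module M N\<^esub> (c \<odot>\<^bsub>quot_module M N\<^esub> x)"
      using u b c by (simp add: quot_smult smult_assoc1) }
  fix y assume "y \<in> carrier (quot_module M N)"
  then obtain v where v: "v \<in> carrier M" "y = N +>\<^bsub>M\<^esub> v" by (auto simp: quot_carrier)
  show "x \<oplus>\<^bsub>quot_module M N\<^esub> y \<in> carrier (quot_module M N)" using u v by (auto simp: quot_add quot_carrier)
  show "x \<oplus>\<^bsub>quot_module M N\<^esub> y = y \<oplus>\<^bsub>quot_module M N\<^esub> x" using u v by (simp add: quot_add M.a_comm)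
  { fix b assume b: "b \<in> carrier R"
    show "b \<odot>\<^bsub>quot_module M N\<^esub> (x \<oplus>\<^bsub>quot_module M N\<^esub> y) =
      b \<odot>\<^bsub>quot_module M N\<^esub> x \<oplus>\<^bsub>quot_module M N\<^esub> b \<odot>\<^bsub>quot_module M N\<^esub> y"
      using u v b by (simp add: quot_smult quot_add smult_r_distr) }
  fix z assume "z \<in> carrier (quot_module M N)"
  then obtain w where w: "w \<in> carrier M" "z = N +>\<^bsub>M\<^esub> w" by (auto simp: quot_carrier)
  show "x \<oplus>\<^bsub>quot_module M N\<^esub> y \<oplus>\<^bsub>quot_module M N\<^esub> z =
    x \<oplus>\<^bsub>quot_module M N\<^esub> (y \<oplus>\<^bsub>quot_module M N\<^esub> z)"
    using u v w by (simp add: quot_add M.a_assoc)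
qed (auto simp: quot_carrier quot_zero)

end

section \<open>Kaehler differentials and their functoriality\<close>

locale kaehler_differentials = cring B for B :: "('b, 'n) ring_scheme" (structure) +
  fixes A :: "('a, 'm) ring_scheme" and h :: "'a \<Rightarrow> 'b"
  assumes base_closed: "a \<in> carrier A \<Longrightarrow> h a \<in> carrier B"
begin

abbreviation "F \<equiv> kaehler_free B"
abbreviation "N \<equiv> kaehler_relations A h B"

sublocale F: module B F unfolding kaehler_free_def by (rule module_free_module)

lemma gen_closed: "b \<in> carrier B \<Longrightarrow> free_gen B b \<in> carrier F"
  unfolding kaehler_free_def by (rule free_gen_closed)

lemma relations_submodule: "submodule N B F"
  unfolding kaehler_relations_def
  by (rule F.submodule_span_submodule) (auto intro!: F.minus_closed F.a_closed F.smult_closed gen_closed base_closed)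

sublocale quotient_module B F N 
  by (intro quotient_module.intro F.module_axioms quotient_module_axioms.intro relations_submodule)

sublocale \<Omega>: module B "kaehler A h B" unfolding kaehler_def by (rule module_quot)

lemma relation_add:
  "b \<in> carrier B \<Longrightarrow> c \<in> carrier B \<Longrightarrow>
    free_gen B (b \<oplus> c) \<ominus>\<^bsub>F\<^esub> (free_gen B b \<oplus>\<^bsub>F\<^esub> free_gen B c) \<in> N"
  unfolding kaehler_relations_def by (rule subsetD[OF F.submodule_span_superset]) blast

lemma relation_mult:
  "b \<in> carrier B \<Longrightarrow> c \<in> carrier B \<Longrightarrow>
    free_gen B (b \<otimes> c) \<ominus>\<^bsub>F\<^esub> (b \<odot>\<^bsub>F\<^esub> free_gen B c \<oplus>\<^bsub>F\<^esub> c \<odot>\<^bsub>F\<^esub> free_gen B b) \<in> N"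
  unfolding kaehler_relations_def by (rule subsetD[OF F.submodule_span_superset]) blast

lemma relation_base: "a \<in> carrier A \<Longrightarrow> free_gen B (h a) \<in> N"
  unfolding kaehler_relations_def by (rule subsetD[OF F.submodule_span_superset]) blast

abbreviation "d \<equiv> kaehler_d A h B"

lemma d_closed: "b \<in> carrier B \<Longrightarrow> d b \<in> carrier (kaehler A h B)"
  by (auto simp: kaehler_d_def kaehler_def quot_carrier gen_closed)

lemma d_add: "b \<in> carrier B \<Longrightarrow> c \<in> carrier B \<Longrightarrow> d (b \<oplus> c) = d b \<oplus>\<^bsub>kaehler A h B\<^esub> d c"
  unfolding kaehler_d_def kaehler_def
  by (subst quot_add) (simp_all add: gen_closed coset_eqI relation_add)

lemma d_mult: "b \<in> carrier B \<Longrightarrow> c \<in> carrier B \<Longrightarrow>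
  d (b \<otimes> c) = b \<odot>\<^bsub>kaehler A h B\<^esub> d c \<oplus>\<^bsub>kaehler A h B\<^esub> c \<odot>\<^bsub>kaehler A h B\<^esub> d b"
  unfolding kaehler_d_def kaehler_def
  by (simp add: quot_smult quot_add gen_closed coset_eqI relation_mult)

lemma d_base: "a \<in> carrier A \<Longrightarrow> d (h a) = \<zero>\<^bsub>kaehler A h B\<^esub>"
  unfolding kaehler_d_def kaehler_def by (intro quot_zero_eq relation_base)

end

text \<open>Compatibility with the base is asked only for images: \<open>g (h a)\<close> is some
  \<open>h' a'\<close>. This covers the transition maps as well as lifts of Frobenius, which move
  the base ring by a Frobenius lift of its own.\<close>

locale kaehler_pushforward = B: kaehler_differentials B A h + B': kaehler_differentials B' A' h'
  for B :: "('b, 'm) ring_scheme" and A :: "('a, 'k) ring_scheme" and h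
  and B' :: "('c, 'n) ring_scheme" and A' :: "('d, 'l) ring_scheme" and h' +
  fixes g :: "'b \<Rightarrow> 'c"
  assumes g: "g \<in> ring_hom B B'"
    and g_base: "a \<in> carrier A \<Longrightarrow> \<exists>a'\<in>carrier A'. g (h a) = h' a'"
begin

sublocale g: ring_hom_cring B B' g
  by (intro ring_hom_cringI B.is_cring B'.is_cring g)

abbreviation "push \<equiv> free_push B B' g"

lemma F_supp: "u \<in> carrier B.F \<Longrightarrow> finite {c. u c \<noteq> \<zero>\<^bsub>B\<^esub>} \<and> {c. u c \<noteq> \<zero>\<^bsub>B\<^esub>} \<subseteq> carrier B"
  by (auto simp: kaehler_free_def free_module_carrier)

lemma F_component: "u \<in> carrier B.F \<Longrightarrow> u c \<in> carrier B"
  unfolding kaehler_free_def by (rule B.free_module_component)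

text \<open>Allows sums for different arguments to run over a common finite index set, which is what
  additivity of \<open>push\<close> needs.\<close>

lemma push_superset:
  assumes u: "u \<in> carrier B.F" and S: "finite S" "S \<subseteq> carrier B" "{c. u c \<noteq> \<zero>\<^bsub>B\<^esub>} \<subseteq> S"
  shows "push u c' = (\<Oplus>\<^bsub>B'\<^esub>c\<in>{c\<in>S. g c = c'}. g (u c))"
  unfolding free_push_def
  by (rule B'.add.finprod_mono_neutral_cong_left)
    (use S F_component[OF u] in auto)

lemma push_closed:
  assumes u: "u \<in> carrier B.F"
  shows "push u \<in> carrier B'.F"
proof -
  let ?S = "{c. u c \<noteq> \<zero>\<^bsub>B\<^esub>}"
  have S: "finite ?S" "?S \<subseteq> carrier B" using F_supp[OF u] by auto
  note P = push_superset[OF u S subset_refl]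
  have z: "push u c' = \<zero>\<^bsub>B'\<^esub>" if "c' \<notin> g ` ?S" for c'
  proof -
    have "{c\<in>?S. g c = c'} = {}" using that by auto
    then show ?thesis unfolding P by (simp only: B'.finsum_empty)
  qed
  have c: "push u c' \<in> carrier B'" for c'
    unfolding P using F_component[OF u] by (intro B'.finsum_closed) auto
  have "finite {c'. push u c' \<noteq> \<zero>\<^bsub>B'\<^esub>}"
    by (rule finite_subset[of _ "g ` ?S"]) (use z S in auto)
  moreover have "push u c' = \<zero>\<^bsub>B'\<^esub>" if "c' \<notin> carrier B'" for c'
    using that S g.hom_closed by (intro z) blast
  ultimately show ?thesis using c by (simp add: kaehler_free_def free_module_carrier)
qed

lemma push_add:
  assumes u: "u \<in> carrier B.F" and v: "v \<in> carrier B.F"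
  shows "push (u \<oplus>\<^bsub>B.F\<^esub> v) = push u \<oplus>\<^bsub>B'.F\<^esub> push v"
proof
  fix c'
  let ?S = "{c. u c \<noteq> \<zero>\<^bsub>B\<^esub>} \<union> {c. v c \<noteq> \<zero>\<^bsub>B\<^esub>}"
  have S: "finite ?S" "?S \<subseteq> carrier B" using F_supp[OF u] F_supp[OF v] by auto
  have uv: "u \<oplus>\<^bsub>B.F\<^esub> v = (\<lambda>c. u c \<oplus>\<^bsub>B\<^esub> v c)" by (simp add: kaehler_free_def free_module_ops)
  have "push (u \<oplus>\<^bsub>B.F\<^esub> v) c' = (\<Oplus>\<^bsub>B'\<^esub>c\<in>{c\<in>?S. g c = c'}. g ((u \<oplus>\<^bsub>B.F\<^esub> v) c))"
    by (rule push_superset[OF _ S]) (use u v in \<open>auto simp: uv[symmetric] intro: B.F.a_closed\<close>, auto simp: uv)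
  also have "\<dots> = (\<Oplus>\<^bsub>B'\<^esub>c\<in>{c\<in>?S. g c = c'}. g (u c) \<oplus>\<^bsub>B'\<^esub> g (v c))"
    using F_component[OF u] F_component[OF v] by (intro B'.finsum_cong') (auto simp: uv)
  also have "\<dots> = (\<Oplus>\<^bsub>B'\<^esub>c\<in>{c\<in>?S. g c = c'}. g (u c)) \<oplus>\<^bsub>B'\<^esub> (\<Oplus>\<^bsub>B'\<^esub>c\<in>{c\<in>?S. g c = c'}. g (v c))"
    using F_component[OF u] F_component[OF v] by (intro B'.finsum_addf) auto
  also have "(\<Oplus>\<^bsub>B'\<^esub>c\<in>{c\<in>?S. g c = c'}. g (u c)) = push u c'" by (rule push_superset[OF u S, symmetric]) auto
  also have "(\<Oplus>\<^bsub>B'\<^esub>c\<in>{c\<in>?S. g c = c'}. g (v c)) = push v c'" by (rule push_superset[OF v S, symmetric]) auto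
  finally show "push (u \<oplus>\<^bsub>B.F\<^esub> v) c' = (push u \<oplus>\<^bsub>B'.F\<^esub> push v) c'"
    by (simp add: kaehler_free_def free_module_ops)
qed

lemma push_smult:
  assumes u: "u \<in> carrier B.F" and b: "b \<in> carrier B"
  shows "push (b \<odot>\<^bsub>B.F\<^esub> u) = g b \<odot>\<^bsub>B'.F\<^esub> push u"
proof
  fix c'
  let ?S = "{c. u c \<noteq> \<zero>\<^bsub>B\<^esub>}"
  have S: "finite ?S" "?S \<subseteq> carrier B" using F_supp[OF u] by auto
  have bu: "b \<odot>\<^bsub>B.F\<^esub> u = (\<lambda>c. b \<otimes>\<^bsub>B\<^esub> u c)" by (simp add: kaehler_free_def free_module_ops)
  have bc: "b \<odot>\<^bsub>B.F\<^esub> u \<in> carrier B.F" using u b by (rule B.F.smult_closed[rotated])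
  have "push (b \<odot>\<^bsub>B.F\<^esub> u) c' = (\<Oplus>\<^bsub>B'\<^esub>c\<in>{c\<in>?S. g c = c'}. g ((b \<odot>\<^bsub>B.F\<^esub> u) c))"
    by (rule push_superset[OF bc S]) (use b in \<open>auto simp: bu\<close>)
  also have "\<dots> = (\<Oplus>\<^bsub>B'\<^esub>c\<in>{c\<in>?S. g c = c'}. g b \<otimes>\<^bsub>B'\<^esub> g (u c))"
    using F_component[OF u] b by (intro B'.finsum_cong') (auto simp: bu)
  also have "\<dots> = g b \<otimes>\<^bsub>B'\<^esub> (\<Oplus>\<^bsub>B'\<^esub>c\<in>{c\<in>?S. g c = c'}. g (u c))"
    using F_component[OF u] b S by (intro B'.finsum_rdistr[symmetric]) auto
  also have "(\<Oplus>\<^bsub>B'\<^esub>c\<in>{c\<in>?S. g c = c'}. g (u c)) = push u c'" by (rule push_superset[OF u S, symmetric]) auto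
  finally show "push (b \<odot>\<^bsub>B.F\<^esub> u) c' = (g b \<odot>\<^bsub>B'.F\<^esub> push u) c'"
    by (simp add: kaehler_free_def free_module_ops)
qed

lemma push_gen:
  assumes c: "c \<in> carrier B"
  shows "push (free_gen B c) = free_gen B' (g c)"
proof
  fix c'
  have "push (free_gen B c) c' = (\<Oplus>\<^bsub>B'\<^esub>x\<in>{x\<in>{c}. g x = c'}. g (free_gen B c x))"
    by (rule push_superset[OF B.gen_closed[OF c]]) (use c in \<open>auto simp: free_gen_def\<close>)
  also have "\<dots> = free_gen B' (g c) c'"
  proof (cases "g c = c'")
    case True
    then have e: "{x\<in>{c}. g x = c'} = {c}" by auto
    show ?thesis unfolding e using True by (simp add: free_gen_def)
  next
    case False
    then have e: "{x\<in>{c}. g x = c'} = {}" by auto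
    show ?thesis unfolding e using False by (simp add: free_gen_def)
  qed
  finally show "push (free_gen B c) c' = free_gen B' (g c) c'" .
qed

lemma push_a_inv:
  assumes u: "u \<in> carrier B.F"
  shows "push (\<ominus>\<^bsub>B.F\<^esub> u) = \<ominus>\<^bsub>B'.F\<^esub> push u"
proof -
  have "push (\<ominus>\<^bsub>B.F\<^esub> u) = push ((\<ominus>\<^bsub>B\<^esub> \<one>\<^bsub>B\<^esub>) \<odot>\<^bsub>B.F\<^esub> u)" using u by (simp add: B.F.smult_l_minus)
  also have "\<dots> = (\<ominus>\<^bsub>B'\<^esub> \<one>\<^bsub>B'\<^esub>) \<odot>\<^bsub>B'.F\<^esub> push u" using u by (subst push_smult) auto
  also have "\<dots> = \<ominus>\<^bsub>B'.F\<^esub> push u" using push_closed[OF u] by (simp add: B'.F.smult_l_minus)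
  finally show ?thesis .
qed

lemma push_minus:
  "u \<in> carrier B.F \<Longrightarrow> v \<in> carrier B.F \<Longrightarrow> push (u \<ominus>\<^bsub>B.F\<^esub> v) = push u \<ominus>\<^bsub>B'.F\<^esub> push v"
  by (simp add: a_minus_def push_add push_a_inv)

text \<open>The elements that \<open>push\<close> sends into the relations form a submodule because
  \<open>push\<close> is semilinear over \<open>g\<close>, so only the three kinds of generators
  have to be checked.\<close>

lemma push_relations: "u \<in> B.N \<Longrightarrow> push u \<in> B'.N"
proof -
  let ?K = "{u \<in> carrier B.F. push u \<in> B'.N}"
  note N' = B'.F.submoduleE[OF B'.relations_submodule]
  have z: "push \<zero>\<^bsub>B.F\<^esub> \<in> B'.N"
  proof -
    have "push (\<zero>\<^bsub>B\<^esub> \<odot>\<^bsub>B.F\<^esub> \<zero>\<^bsub>B.F\<^esub>) = \<zero>\<^bsub>B'\<^esub> \<odot>\<^bsub>B'.F\<^esub> push \<zero>\<^bsub>B.F\<^esub>" by (subst push_smult) auto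
    then have "push \<zero>\<^bsub>B.F\<^esub> = \<zero>\<^bsub>B'.F\<^esub>" using push_closed[of "\<zero>\<^bsub>B.F\<^esub>"] by simp
    then show ?thesis by simp
  qed
  have K: "submodule ?K B B.F"
    by (rule B.F.submoduleI) (auto simp: push_add push_smult push_a_inv z intro: N' )
  have "B.N \<subseteq> ?K" unfolding kaehler_relations_def[of A]
  proof (rule B.F.submodule_span_least[OF K], intro subsetI, elim UnE)
    fix u assume "u \<in> {free_gen B (b \<oplus>\<^bsub>B\<^esub> c) \<ominus>\<^bsub>B.F\<^esub> (free_gen B b \<oplus>\<^bsub>B.F\<^esub> free_gen B c) |b c. b \<in> carrier B \<and> c \<in> carrier B}"
    then obtain b c where bc: "b \<in> carrier B" "c \<in> carrier B"
      "u = free_gen B (b \<oplus>\<^bsub>B\<^esub> c) \<ominus>\<^bsub>B.F\<^esub> (free_gen B b \<oplus>\<^bsub>B.F\<^esub> free_gen B c)" by blast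
    then show "u \<in> ?K" using B'.relation_add[of "g b" "g c"]
      by (simp add: push_minus push_add push_gen B.gen_closed)
  next
    fix u assume "u \<in> {free_gen B (b \<otimes>\<^bsub>B\<^esub> c) \<ominus>\<^bsub>B.F\<^esub> (b \<odot>\<^bsub>B.F\<^esub> free_gen B c \<oplus>\<^bsub>B.F\<^esub> c \<odot>\<^bsub>B.F\<^esub> free_gen B b) |b c. b \<in> carrier B \<and> c \<in> carrier B}"
    then obtain b c where bc: "b \<in> carrier B" "c \<in> carrier B"
      "u = free_gen B (b \<otimes>\<^bsub>B\<^esub> c) \<ominus>\<^bsub>B.F\<^esub> (b \<odot>\<^bsub>B.F\<^esub> free_gen B c \<oplus>\<^bsub>B.F\<^esub> c \<odot>\<^bsub>B.F\<^esub> free_gen B b)" by blast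
    then show "u \<in> ?K" using B'.relation_mult[of "g b" "g c"]
      by (simp add: push_minus push_add push_smult push_gen B.gen_closed)
  next
    fix u assume "u \<in> {free_gen B (h a) |a. a \<in> carrier A}"
    then obtain a where a: "a \<in> carrier A" "u = free_gen B (h a)" by blast
    moreover obtain a' where "a' \<in> carrier A'" "g (h a) = h' a'" using g_base a by blast
    ultimately show "u \<in> ?K" using B'.relation_base[of a'] B.base_closed
      by (simp add: push_gen B.gen_closed)
  qed
  then show "u \<in> B.N \<Longrightarrow> push u \<in> B'.N" by blast
qed

lemma kaehler_map_coset:
  assumes u: "u \<in> carrier B.F"
  shows "kaehler_map B A' h' B' g (B.N +>\<^bsub>B.F\<^esub> u) = B'.N +>\<^bsub>B'.F\<^esub> push u"
proof -
  have "B'.N +>\<^bsub>B'.F\<^esub> push u' = B'.N +>\<^bsub>B'.F\<^esub> push u" if u': "u' \<in> B.N +>\<^bsub>B.F\<^esub> u" for u'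
  proof -
    obtain n where n: "n \<in> B.N" "u' = n \<oplus>\<^bsub>B.F\<^esub> u" using u' by (rule B.cosetE)
    then have "push u' = push n \<oplus>\<^bsub>B'.F\<^esub> push u" using u B.N.a_subset by (auto simp: push_add)
    then show ?thesis using B'.coset_add_left[OF push_closed[OF u] push_relations[OF n(1)]] by simp
  qed
  moreover have "u \<in> B.N +>\<^bsub>B.F\<^esub> u" using u by (rule B.N.a_rcos_self)
  ultimately show ?thesis unfolding kaehler_map_def by blast
qed

lemma kaehler_map_smult_d:
  assumes "b \<in> carrier B" "c \<in> carrier B"
  shows "kaehler_map B A' h' B' g (b \<odot>\<^bsub>kaehler A h B\<^esub> B.d c) = g b \<odot>\<^bsub>kaehler A' h' B'\<^esub> B'.d (g c)"
proof -
  have "b \<odot>\<^bsub>kaehler A h B\<^esub> B.d c = B.N +>\<^bsub>B.F\<^esub> (b \<odot>\<^bsub>B.F\<^esub> free_gen B c)"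
    unfolding kaehler_def kaehler_d_def using assms by (intro B.quot_smult B.gen_closed)
  moreover have "g b \<odot>\<^bsub>kaehler A' h' B'\<^esub> B'.d (g c) = B'.N +>\<^bsub>B'.F\<^esub> (g b \<odot>\<^bsub>B'.F\<^esub> free_gen B' (g c))"
    unfolding kaehler_def kaehler_d_def using assms by (intro B'.quot_smult B'.gen_closed) auto
  ultimately show ?thesis using assms
    by (simp add: kaehler_map_coset push_smult push_gen B.gen_closed)
qed

end

subsection \<open>The coordinate ring of the punctured curve\<close>

lemma cring_UP: "cring R \<Longrightarrow> cring (UP R)"
  by (intro UP_cring.UP_cring UP_cring.intro)

lemma UP_const_hom: "cring R \<Longrightarrow> (\<lambda>r. up_ring.monom (UP R) r 0) \<in> ring_hom R (UP R)"
  by (intro UP_ring.const_ring_hom UP_ring.intro cring.axioms(1))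

lemma UP_generated:
  assumes R: "cring R" and f: "f \<in> carrier (UP R)"
    and add: "\<And>f g. f \<in> carrier (UP R) \<Longrightarrow> g \<in> carrier (UP R) \<Longrightarrow> Q f \<Longrightarrow> Q g \<Longrightarrow> Q (f \<oplus>\<^bsub>UP R\<^esub> g)"
    and mult: "\<And>f g. f \<in> carrier (UP R) \<Longrightarrow> g \<in> carrier (UP R) \<Longrightarrow> Q f \<Longrightarrow> Q g \<Longrightarrow> Q (f \<otimes>\<^bsub>UP R\<^esub> g)"
    and const: "\<And>r. r \<in> carrier R \<Longrightarrow> Q (up_ring.monom (UP R) r 0)"
    and var: "Q (up_ring.monom (UP R) \<one>\<^bsub>R\<^esub> 1)"
  shows "Q f"
proof -
  interpret R: cring R by fact
  interpret UP_cring R "UP R" by (intro UP_cring.intro R) auto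
  have m: "Q (up_ring.monom (UP R) r n)" if r: "r \<in> carrier R" for r n
  proof (induction n)
    case (Suc n)
    have "up_ring.monom (UP R) r (Suc n) = up_ring.monom (UP R) r n \<otimes>\<^bsub>UP R\<^esub> up_ring.monom (UP R) \<one>\<^bsub>R\<^esub> 1"
      using monom_mult[of r "\<one>\<^bsub>R\<^esub>" n 1] r by simp
    then show ?case using mult[OF _ _ Suc var] r by simp
  qed (rule const[OF r])
  have "Q (\<Oplus>\<^bsub>UP R\<^esub>i\<in>{..n}. up_ring.monom (UP R) (up_ring.coeff (UP R) f i) i)" for n
  proof (induction n)
    case 0
    then show ?case using f m by simp
  next
    case (Suc n)
    then show ?case using f m by (subst P.finsum_Suc) (auto intro!: add)
  qed
  then show ?thesis using up_repr[OF f] by metis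
qed

lemma UP_universal:
  assumes R: "cring R" and C: "cring C" and h: "h \<in> ring_hom R C" and X: "X \<in> carrier C"
  shows "\<exists>k\<in>ring_hom (UP R) C. (\<forall>r\<in>carrier R. k (up_ring.monom (UP R) r 0) = h r)
    \<and> k (up_ring.monom (UP R) \<one>\<^bsub>R\<^esub> 1) = X"
proof -
  interpret UP_pre_univ_prop R C h "UP R"
    by (intro UP_pre_univ_prop.intro ring_hom_cringI UP_cring.intro assms) auto
  show ?thesis
    using eval_ring_hom[OF X] eval_const[OF X] eval_monom1[OF X] by blast
qed

lemma quotient_ring_universal:
  assumes P: "cring P" and C: "cring C" and I: "ideal I P" and k: "k \<in> ring_hom P C"
    and ker: "\<And>i. i \<in> I \<Longrightarrow> k i = \<zero>\<^bsub>C\<^esub>"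
  shows "\<exists>k'\<in>ring_hom (P Quot I) C. \<forall>r\<in>carrier P. k' (I +>\<^bsub>P\<^esub> r) = k r"
proof -
  interpret I: ideal I P by fact
  interpret C: cring C by fact
  interpret k: ring_hom_cring P C k by (intro ring_hom_cringI assms)
  let ?k = "\<lambda>X. k (SOME r. r \<in> carrier P \<and> X = I +>\<^bsub>P\<^esub> r)"
  have val: "?k (I +>\<^bsub>P\<^esub> r) = k r" if r: "r \<in> carrier P" for r
  proof -
    let ?r = "SOME r'. r' \<in> carrier P \<and> I +>\<^bsub>P\<^esub> r = I +>\<^bsub>P\<^esub> r'"
    have s: "?r \<in> carrier P \<and> I +>\<^bsub>P\<^esub> r = I +>\<^bsub>P\<^esub> ?r"
      using r by (intro someI[where P = "\<lambda>r'. r' \<in> carrier P \<and> I +>\<^bsub>P\<^esub> r = I +>\<^bsub>P\<^esub> r'" and x = r]) simp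
    then have "r \<in> I +>\<^bsub>P\<^esub> ?r" using I.a_rcos_self[OF r] by simp
    then obtain i where i: "i \<in> I" "r = i \<oplus>\<^bsub>P\<^esub> ?r" by (auto simp: a_r_coset_def')
    have "k r = k (i \<oplus>\<^bsub>P\<^esub> ?r)" using i(2) by (rule arg_cong)
    also have "\<dots> = k ?r" using s i(1) ker[of i] by simp
    finally show ?thesis by simp
  qed
  have "?k \<in> ring_hom (P Quot I) C"
  proof (rule ring_hom_memI)
    note hI = I.rcos_ring_hom
    fix x assume "x \<in> carrier (P Quot I)"
    then obtain r where r: "r \<in> carrier P" "x = I +>\<^bsub>P\<^esub> r" by (auto simp: FactRing_def A_RCOSETS_def')
    then show "?k x \<in> carrier C" using val by simp
    fix y assume "y \<in> carrier (P Quot I)"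
    then obtain q where q: "q \<in> carrier P" "y = I +>\<^bsub>P\<^esub> q" by (auto simp: FactRing_def A_RCOSETS_def')
    have "x \<otimes>\<^bsub>P Quot I\<^esub> y = I +>\<^bsub>P\<^esub> (r \<otimes>\<^bsub>P\<^esub> q)" using r q ring_hom_mult[OF hI] by simp
    then show "?k (x \<otimes>\<^bsub>P Quot I\<^esub> y) = ?k x \<otimes>\<^bsub>C\<^esub> ?k y"
      using val[OF r(1)] val[OF q(1)] val[OF I.m_closed[OF r(1) q(1)]] r q by simp
    have "x \<oplus>\<^bsub>P Quot I\<^esub> y = I +>\<^bsub>P\<^esub> (r \<oplus>\<^bsub>P\<^esub> q)" using r q ring_hom_add[OF hI] by simp
    then show "?k (x \<oplus>\<^bsub>P Quot I\<^esub> y) = ?k x \<oplus>\<^bsub>C\<^esub> ?k y"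
      using val[OF r(1)] val[OF q(1)] val[OF I.a_closed[OF r(1) q(1)]] r q by simp
  next
    have "\<one>\<^bsub>P Quot I\<^esub> = I +>\<^bsub>P\<^esub> \<one>\<^bsub>P\<^esub>" using ring_hom_one[OF I.rcos_ring_hom] by simp
    then show "?k \<one>\<^bsub>P Quot I\<^esub> = \<one>\<^bsub>C\<^esub>" using val[OF I.one_closed] by simp
  qed
  then show ?thesis using val by (intro bexI[of _ ?k] ballI)
qed

section \<open>Generators, relations and points of the punctured curve\<close>

definition ell_y :: "('s, 'm) ring_scheme \<Rightarrow> 's \<Rightarrow> 's \<Rightarrow> 's pol3 set" where
  "ell_y S a b = ell_ideal S a b +>\<^bsub>pol3_ring S\<^esub> pol3_y S"

locale elliptic = cring S for S (structure) +
  fixes a b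
  assumes a: "a \<in> carrier S" and b: "b \<in> carrier S"
begin

abbreviation "P \<equiv> pol3_ring S"
abbreviation "E \<equiv> ell_ring S a b"
abbreviation "cE \<equiv> ell_const S a b"
abbreviation "xE \<equiv> ell_x S a b"
abbreviation "yE \<equiv> ell_y S a b"
abbreviation "tE \<equiv> ell_y_inv S a b"

lemma cring_pol3: "cring P" unfolding pol3_ring_def by (intro cring_UP is_cring)

sublocale P: cring P by (rule cring_pol3)

lemma UP_monom_closed:
  "cring R \<Longrightarrow> r \<in> carrier R \<Longrightarrow> up_ring.monom (UP R) r n \<in> carrier (UP R)"
  by (intro UP_ring.monom_closed UP_ring.intro cring.axioms(1))

lemma one_UP: "cring R \<Longrightarrow> \<one>\<^bsub>R\<^esub> \<in> carrier R"
  by (simp add: cring.cring_simprules)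

lemma pol3_closed:
  "s \<in> carrier S \<Longrightarrow> pol3_const S s \<in> carrier P" "pol3_x S \<in> carrier P" "pol3_y S \<in> carrier P" "pol3_t S \<in> carrier P"
  unfolding pol3_const_def pol3_x_def pol3_y_def pol3_t_def pol3_ring_def
  by (simp_all add: UP_monom_closed cring_UP is_cring one_UP)

lemma pol3_const_hom: "pol3_const S \<in> ring_hom S P"
proof -
  have "(\<lambda>s. up_ring.monom (UP (UP (UP S))) s 0) \<circ> ((\<lambda>s. up_ring.monom (UP (UP S)) s 0) \<circ> (\<lambda>s. up_ring.monom (UP S) s 0))
    \<in> ring_hom S (UP (UP (UP S)))"
    by (rule ring_hom_trans[OF ring_hom_trans[OF UP_const_hom[OF is_cring] UP_const_hom[OF cring_UP[OF is_cring]]]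
          UP_const_hom[OF cring_UP[OF cring_UP[OF is_cring]]]])
  then show ?thesis by (simp add: pol3_const_def[abs_def] pol3_ring_def comp_def)
qed

abbreviation "rel1 \<equiv> pol3_y S [^]\<^bsub>P\<^esub> (2::nat) \<ominus>\<^bsub>P\<^esub>
          (pol3_x S [^]\<^bsub>P\<^esub> (3::nat) \<oplus>\<^bsub>P\<^esub> pol3_const S a \<otimes>\<^bsub>P\<^esub> pol3_x S \<oplus>\<^bsub>P\<^esub> pol3_const S b)"
abbreviation "rel2 \<equiv> pol3_y S \<otimes>\<^bsub>P\<^esub> pol3_t S \<ominus>\<^bsub>P\<^esub> \<one>\<^bsub>P\<^esub>"

lemma rel_closed: "{rel1, rel2} \<subseteq> carrier P"
  by (intro insert_subsetI empty_subsetI P.minus_closed P.nat_pow_closed P.a_closed P.m_closed P.one_closed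
      pol3_closed a b)

lemma ideal_ell: "ideal (ell_ideal S a b) P"
  unfolding ell_ideal_def by (rule P.genideal_ideal[OF rel_closed])

sublocale I: ideal "ell_ideal S a b" P by (rule ideal_ell)

lemma rel_in: "rel1 \<in> ell_ideal S a b" "rel2 \<in> ell_ideal S a b"
  by (rule subsetD[OF P.genideal_self[OF rel_closed, folded ell_ideal_def]], simp only: insert_iff simp_thms)+

lemma cring_ell: "cring E" unfolding ell_ring_def by (rule I.quotient_is_cring[OF cring_pol3])

sublocale E: cring E by (rule cring_ell)

abbreviation "q r \<equiv> ell_ideal S a b +>\<^bsub>P\<^esub> r"

lemma q_hom: "(+>\<^bsub>P\<^esub>) (ell_ideal S a b) \<in> ring_hom P E"
  unfolding ell_ring_def by (rule I.rcos_ring_hom)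

sublocale q: ring_hom_cring P E "(+>\<^bsub>P\<^esub>) (ell_ideal S a b)"
  by (intro ring_hom_cringI cring_pol3 cring_ell q_hom)

lemma ell_carrier: "carrier E = q ` carrier P"
  unfolding ell_ring_def FactRing_def A_RCOSETS_def' partial_object.simps by blast

lemma q_eq:
  assumes "u \<in> carrier P" "v \<in> carrier P" "u \<ominus>\<^bsub>P\<^esub> v \<in> ell_ideal S a b"
  shows "q u = q v"
  using P.quotient_eq_iff_same_a_r_cos[OF ideal_ell assms(1,2)] assms(3) by simp

lemma ell_closed [simp]:
  "s \<in> carrier S \<Longrightarrow> cE s \<in> carrier E" "xE \<in> carrier E" "yE \<in> carrier E" "tE \<in> carrier E"
  unfolding ell_const_def ell_x_def ell_y_def ell_y_inv_def by (simp_all add: pol3_closed)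

lemma ell_const_hom: "cE \<in> ring_hom S E"
proof -
  have "(+>\<^bsub>P\<^esub>) (ell_ideal S a b) \<circ> pol3_const S \<in> ring_hom S E"
    by (rule ring_hom_trans[OF pol3_const_hom q_hom])
  then show ?thesis by (simp add: ell_const_def[abs_def] comp_def)
qed

lemma ell_relations:
  "yE [^]\<^bsub>E\<^esub> (2::nat) = xE [^]\<^bsub>E\<^esub> (3::nat) \<oplus>\<^bsub>E\<^esub> cE a \<otimes>\<^bsub>E\<^esub> xE \<oplus>\<^bsub>E\<^esub> cE b"
  "yE \<otimes>\<^bsub>E\<^esub> tE = \<one>\<^bsub>E\<^esub>"
proof -
  note c = pol3_closed(2-4) pol3_closed(1)[OF a] pol3_closed(1)[OF b]
  have "q (pol3_y S [^]\<^bsub>P\<^esub> (2::nat)) =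
     q (pol3_x S [^]\<^bsub>P\<^esub> (3::nat) \<oplus>\<^bsub>P\<^esub> pol3_const S a \<otimes>\<^bsub>P\<^esub> pol3_x S \<oplus>\<^bsub>P\<^esub> pol3_const S b)"
    by (rule q_eq) (use c rel_in in auto)
  then show "yE [^]\<^bsub>E\<^esub> (2::nat) = xE [^]\<^bsub>E\<^esub> (3::nat) \<oplus>\<^bsub>E\<^esub> cE a \<otimes>\<^bsub>E\<^esub> xE \<oplus>\<^bsub>E\<^esub> cE b"
    using c unfolding ell_const_def ell_x_def ell_y_def by simp
  have "q (pol3_y S \<otimes>\<^bsub>P\<^esub> pol3_t S) = q \<one>\<^bsub>P\<^esub>"
    by (rule q_eq) (use c rel_in in auto)
  then show "yE \<otimes>\<^bsub>E\<^esub> tE = \<one>\<^bsub>E\<^esub>"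
    using c unfolding ell_y_inv_def ell_y_def by simp
qed

text \<open>A homomorphism out of the coordinate ring is a point X, Y with Y invertible on the curve
  whose coefficients are moved by \<open>h\<close>. With a Frobenius lift inside \<open>h\<close>
  the point lies on the Frobenius twist, and the lift to the curve amounts to such a point.\<close>

lemma ell_universal:
  assumes C: "cring C" and h: "h \<in> ring_hom S C"
    and XYT: "X \<in> carrier C" "Y \<in> carrier C" "T \<in> carrier C"
    and r1: "Y [^]\<^bsub>C\<^esub> (2::nat) = X [^]\<^bsub>C\<^esub> (3::nat) \<oplus>\<^bsub>C\<^esub> h a \<otimes>\<^bsub>C\<^esub> X \<oplus>\<^bsub>C\<^esub> h b"
    and r2: "Y \<otimes>\<^bsub>C\<^esub> T = \<one>\<^bsub>C\<^esub>"
  shows "\<exists>k\<in>ring_hom E C. (\<forall>s\<in>carrier S. k (cE s) = h s) \<and> k xE = X \<and> k yE = Y \<and> k tE = T"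
proof -
  interpret C: cring C by fact
  note cU = cring_UP[OF is_cring] cring_UP[OF cring_UP[OF is_cring]]
  obtain k1 where k1: "k1 \<in> ring_hom (UP S) C" "\<forall>r\<in>carrier S. k1 (up_ring.monom (UP S) r 0) = h r"
    "k1 (up_ring.monom (UP S) \<one> 1) = X" using UP_universal[OF is_cring C h XYT(1)] by blast
  obtain k2 where k2: "k2 \<in> ring_hom (UP (UP S)) C" "\<forall>r\<in>carrier (UP S). k2 (up_ring.monom (UP (UP S)) r 0) = k1 r"
    "k2 (up_ring.monom (UP (UP S)) \<one>\<^bsub>UP S\<^esub> 1) = Y" using UP_universal[OF cU(1) C k1(1) XYT(2)] by blast
  obtain k3 where k3: "k3 \<in> ring_hom P C" "\<forall>r\<in>carrier (UP (UP S)). k3 (up_ring.monom P r 0) = k2 r"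
    "k3 (up_ring.monom P \<one>\<^bsub>UP (UP S)\<^esub> 1) = T"
    using UP_universal[OF cU(2) C k2(1) XYT(3)] unfolding pol3_ring_def by blast
  have mc: "up_ring.monom (UP S) s n \<in> carrier (UP S)" if "s \<in> carrier S" for s n
    using UP_monom_closed[OF is_cring that] .
  have mc2: "up_ring.monom (UP (UP S)) s n \<in> carrier (UP (UP S))" if "s \<in> carrier (UP S)" for s n
    using UP_monom_closed[OF cU(1) that] .
  have v: "k3 (pol3_const S s) = h s" if "s \<in> carrier S" for s
    unfolding pol3_const_def using that k1 k2 k3 mc mc2 by simp
  have vx: "k3 (pol3_x S) = X" unfolding pol3_x_def using k1 k2 k3 mc mc2 by simp
  have vy: "k3 (pol3_y S) = Y" unfolding pol3_y_def using k2 k3 mc2[OF one_UP[OF cU(1)]] by simp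
  have vt: "k3 (pol3_t S) = T" unfolding pol3_t_def using k3 by simp
  interpret k3: ring_hom_cring P C k3 by (intro ring_hom_cringI cring_pol3 C k3)
  note c = pol3_closed(2-4) pol3_closed(1)[OF a] pol3_closed(1)[OF b]
  have hc: "h a \<in> carrier C" "h b \<in> carrier C" using ring_hom_closed[OF h] a b by auto
  have "k3 rel1 = \<zero>\<^bsub>C\<^esub>" using c XYT hc
    by (simp add: a_minus_def v vx vy a b r1 C.r_neg)
  moreover have "k3 rel2 = \<zero>\<^bsub>C\<^esub>" using c XYT
    by (simp add: a_minus_def vt vy r2 C.r_neg)
  ultimately have "{rel1, rel2} \<subseteq> a_kernel P C k3"
    using rel_closed unfolding a_kernel_def' by blast
  then have "ell_ideal S a b \<subseteq> a_kernel P C k3" unfolding ell_ideal_def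
    by (intro P.genideal_minimal ring_hom_ring.kernel_is_ideal ring_hom_ringI2 P.ring_axioms C.ring_axioms k3(1))
  then have "\<And>i. i \<in> ell_ideal S a b \<Longrightarrow> k3 i = \<zero>\<^bsub>C\<^esub>" unfolding a_kernel_def' by blast
  from quotient_ring_universal[OF cring_pol3 C ideal_ell k3(1) this]
  obtain k where "k \<in> ring_hom E C" "\<forall>r\<in>carrier P. k (q r) = k3 r"
    unfolding ell_ring_def by blast
  then show ?thesis
    using v vx vy vt c pol3_closed(1) unfolding ell_const_def ell_x_def ell_y_def ell_y_inv_def
    by (intro bexI[of _ k] conjI ballI) simp_all
qed

text \<open>Induction over generators. It reduces the Frobenius congruence, whose two sides are
  additive and multiplicative modulo p, to constants and to x, y, 1/y.\<close>

lemma ell_generated: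
  assumes z: "z \<in> carrier E"
    and add: "\<And>f g. f \<in> carrier E \<Longrightarrow> g \<in> carrier E \<Longrightarrow> Q f \<Longrightarrow> Q g \<Longrightarrow> Q (f \<oplus>\<^bsub>E\<^esub> g)"
    and mult: "\<And>f g. f \<in> carrier E \<Longrightarrow> g \<in> carrier E \<Longrightarrow> Q f \<Longrightarrow> Q g \<Longrightarrow> Q (f \<otimes>\<^bsub>E\<^esub> g)"
    and const: "\<And>s. s \<in> carrier S \<Longrightarrow> Q (cE s)" and var: "Q xE" "Q yE" "Q tE"
  shows "Q z"
proof -
  note cU = cring_UP[OF is_cring] cring_UP[OF cring_UP[OF is_cring]]
  have c3: "(\<lambda>r. up_ring.monom P r 0) \<in> ring_hom (UP (UP S)) P" unfolding pol3_ring_def by (rule UP_const_hom[OF cU(2)])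
  have c2: "(\<lambda>r. up_ring.monom (UP (UP S)) r 0) \<in> ring_hom (UP S) (UP (UP S))" by (rule UP_const_hom[OF cU(1)])
  have h3: "(\<lambda>r. q (up_ring.monom P r 0)) \<in> ring_hom (UP (UP S)) E"
    using ring_hom_trans[OF c3 q_hom] by (simp add: comp_def)
  have h2: "(\<lambda>r. q (up_ring.monom P (up_ring.monom (UP (UP S)) r 0) 0)) \<in> ring_hom (UP S) E"
    using ring_hom_trans[OF c2 h3] by (simp add: comp_def)
  have 1: "Q (q (up_ring.monom P (up_ring.monom (UP (UP S)) f 0) 0))" if "f \<in> carrier (UP S)" for f
    using is_cring that
  proof (rule UP_generated)
    show "Q (q (up_ring.monom P (up_ring.monom (UP (UP S)) (up_ring.monom (UP S) r 0) 0) 0))" if "r \<in> carrier S" for r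
      using const[OF that] by (simp add: ell_const_def pol3_const_def)
    show "Q (q (up_ring.monom P (up_ring.monom (UP (UP S)) (up_ring.monom (UP S) \<one> 1) 0) 0))"
      using var(1) by (simp add: ell_x_def pol3_x_def)
  qed (use ring_hom_add[OF h2] ring_hom_mult[OF h2] ring_hom_closed[OF h2] add mult in simp_all)
  have 2: "Q (q (up_ring.monom P f 0))" if "f \<in> carrier (UP (UP S))" for f
    using cU(1) that
  proof (rule UP_generated)
    show "Q (q (up_ring.monom P (up_ring.monom (UP (UP S)) r 0) 0))" if "r \<in> carrier (UP S)" for r
      using 1[OF that] .
    show "Q (q (up_ring.monom P (up_ring.monom (UP (UP S)) \<one>\<^bsub>UP S\<^esub> 1) 0))"
      using var(2) by (simp add: ell_y_def pol3_y_def)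
  qed (use ring_hom_add[OF h3] ring_hom_mult[OF h3] ring_hom_closed[OF h3] add mult in simp_all)
  have 3: "Q (q f)" if "f \<in> carrier (UP (UP (UP S)))" for f
    using cU(2) that
  proof (rule UP_generated)
    show "Q (q (up_ring.monom (UP (UP (UP S))) r 0))" if "r \<in> carrier (UP (UP S))" for r
      using 2[OF that] by (simp add: pol3_ring_def)
    show "Q (q (up_ring.monom (UP (UP (UP S))) \<one>\<^bsub>UP (UP S)\<^esub> 1))"
      using var(3) by (simp add: ell_y_inv_def pol3_t_def pol3_ring_def)
  qed (use ring_hom_add[OF q_hom] ring_hom_mult[OF q_hom] ring_hom_closed[OF q_hom] add mult in \<open>simp_all flip: pol3_ring_def\<close>)
  show ?thesis using z 3 by (auto simp: ell_carrier pol3_ring_def)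
qed

end

subsection \<open>Graded families and the recurrence\<close>

hide_const (open) up_ring.coeff up_ring.monom Poly_Mapping.degree

text \<open>The remainder is written out so that its weight can be read off term by term. Working
  over semirings makes the identity available for polynomials over the natural numbers too.\<close>

lemma prime_power_add:
  fixes x y :: "'a::comm_semiring_1"
  assumes "prime p"
  shows "(x + y) ^ p = x ^ p + y ^ p +
    of_nat p * (\<Sum>k\<in>{1..<p}. of_nat ((p choose k) div p) * x ^ k * y ^ (p - k))"
proof -
  have p: "p > 0" using assms by (simp add: prime_gt_0_nat)
  have "(x + y) ^ p = (\<Sum>k\<le>p. of_nat (p choose k) * x ^ k * y ^ (p - k))" by (rule binomial_ring)
  also have "{..p} = insert 0 (insert p {1..<p})" using p by auto
  also have "(\<Sum>k\<in>insert 0 (insert p {1..<p}). of_nat (p choose k) * x ^ k * y ^ (p - k)) =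
      y ^ p + (x ^ p + (\<Sum>k\<in>{1..<p}. of_nat (p choose k) * x ^ k * y ^ (p - k)))"
    using p by simp
  also have "(\<Sum>k\<in>{1..<p}. of_nat (p choose k) * x ^ k * y ^ (p - k)) =
      (\<Sum>k\<in>{1..<p}. of_nat p * (of_nat ((p choose k) div p) * x ^ k * y ^ (p - k)))"
  proof (intro sum.cong refl)
    fix k assume "k \<in> {1..<p}"
    then have "p dvd (p choose k)" using assms by (intro dvd_choose_prime) auto
    then have "(of_nat (p choose k) :: 'a) = of_nat p * of_nat ((p choose k) div p)"
      by (metis dvd_mult_div_cancel of_nat_mult)
    then show "of_nat (p choose k) * x ^ k * y ^ (p - k) =
      of_nat p * (of_nat ((p choose k) div p) * x ^ k * y ^ (p - k))" by (simp add: mult.assoc)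
  qed
  also have "\<dots> = of_nat p * (\<Sum>k\<in>{1..<p}. of_nat ((p choose k) div p) * x ^ k * y ^ (p - k))"
    by (simp add: sum_distrib_left)
  finally show ?thesis by (simp add: algebra_simps)
qed

text \<open>A family \<open>gr w\<close> of homogeneous pieces; the constant family of a subring is the ungraded case.
  In polynomials the variable has weight 2.\<close>

locale graded_family =
  fixes gr :: "int \<Rightarrow> 'a::field_char_0 set"
  assumes gr_zero: "0 \<in> gr w"
    and gr_one: "1 \<in> gr 0"
    and gr_add: "x \<in> gr w \<Longrightarrow> y \<in> gr w \<Longrightarrow> x + y \<in> gr w"
    and gr_uminus: "x \<in> gr w \<Longrightarrow> - x \<in> gr w"
    and gr_mult: "x \<in> gr v \<Longrightarrow> y \<in> gr w \<Longrightarrow> x * y \<in> gr (v + w)"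

definition weighted_polys :: "(int \<Rightarrow> 'a::zero set) \<Rightarrow> int \<Rightarrow> 'a poly set" where
  "weighted_polys gr w = {P. \<forall>i. coeff P i \<in> gr (w - 2 * int i)}"

context graded_family
begin

lemma gr_diff: "x \<in> gr w \<Longrightarrow> y \<in> gr w \<Longrightarrow> x - y \<in> gr w"
  using gr_add[of x w "- y"] gr_uminus by simp

lemma gr_sum: "(\<And>i. i \<in> I \<Longrightarrow> f i \<in> gr w) \<Longrightarrow> sum f I \<in> gr w"
  by (induction I rule: infinite_finite_induct) (auto simp: gr_zero gr_add)

lemma gr_mult': "x \<in> gr v \<Longrightarrow> y \<in> gr w \<Longrightarrow> u = v + w \<Longrightarrow> x * y \<in> gr u"
  using gr_mult by simp

lemma gr_power: "x \<in> gr w \<Longrightarrow> x ^ n \<in> gr (int n * w)"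
  by (induction n) (auto simp: gr_one algebra_simps intro!: gr_mult')

lemma gr_of_nat: "of_nat n \<in> gr 0"
  by (induction n) (auto simp: gr_zero gr_one gr_add)

lemma gr_scale: "x \<in> gr w \<Longrightarrow> of_nat n * x \<in> gr w"
  using gr_mult[OF gr_of_nat] by simp

lemma gr_of_int: "of_int n \<in> gr 0"
  by (cases n rule: int_cases2) (auto simp: gr_of_nat gr_uminus)

lemma gr_numeral: "numeral n \<in> gr 0"
  using gr_of_nat[of "numeral n"] by simp

lemma gr_scale0: "c \<in> gr 0 \<Longrightarrow> x \<in> gr w \<Longrightarrow> c * x \<in> gr w"
  using gr_mult[of c 0 x w] by simp

abbreviation "H \<equiv> weighted_polys gr"

lemma HD: "P \<in> H w \<Longrightarrow> coeff P i \<in> gr (w - 2 * int i)"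
  by (simp add: weighted_polys_def)

lemma H_add: "P \<in> H w \<Longrightarrow> Q \<in> H w \<Longrightarrow> P + Q \<in> H w"
  by (simp add: weighted_polys_def gr_add)

lemma H_uminus: "P \<in> H w \<Longrightarrow> - P \<in> H w"
  by (simp add: weighted_polys_def gr_uminus)

lemma H_diff: "P \<in> H w \<Longrightarrow> Q \<in> H w \<Longrightarrow> P - Q \<in> H w"
  by (simp add: weighted_polys_def gr_diff)

lemma H_zero: "0 \<in> H w"
  by (simp add: weighted_polys_def gr_zero)

lemma H_mult:
  assumes "P \<in> H v" "Q \<in> H w"
  shows "P * Q \<in> H (v + w)"
  unfolding weighted_polys_def
proof (intro CollectI allI)
  fix n
  show "coeff (P * Q) n \<in> gr (v + w - 2 * int n)"
    unfolding Polynomial.coeff_mult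
    using HD[OF assms(1)] HD[OF assms(2)] by (intro gr_sum gr_mult'[of _ _ _ _ "v + w - 2 * int n"]) auto
qed

lemma H_mult': "P \<in> H v \<Longrightarrow> Q \<in> H w \<Longrightarrow> u = v + w \<Longrightarrow> P * Q \<in> H u"
  using H_mult by simp

lemma H_monom: "c \<in> gr (w - 2 * int n) \<Longrightarrow> Polynomial.monom c n \<in> H w"
  by (simp add: weighted_polys_def gr_zero)

lemma H_const: "c \<in> gr w \<Longrightarrow> [:c:] \<in> H w"
  using H_monom[of c w 0] by (simp add: monom_0)

lemma H_one: "1 \<in> H 0"
  using H_const[OF gr_one] by (simp add: one_pCons)

lemma H_power: "P \<in> H w \<Longrightarrow> P ^ n \<in> H (int n * w)"
  by (induction n) (auto simp: H_one algebra_simps intro!: H_mult')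

lemma H_of_nat: "of_nat n \<in> H 0"
  using H_const[OF gr_of_nat] by (simp add: of_nat_poly)

lemma H_numeral: "numeral n \<in> H 0"
  using H_of_nat[of "numeral n"] by simp

lemma H_scale: "P \<in> H w \<Longrightarrow> of_nat n * P \<in> H w"
  using H_mult[OF H_of_nat] by simp

lemma H_scale0: "Q \<in> H 0 \<Longrightarrow> P \<in> H w \<Longrightarrow> Q * P \<in> H w"
  using H_mult[of Q 0 P w] by simp

lemma H_sum: "(\<And>i. i \<in> I \<Longrightarrow> f i \<in> H w) \<Longrightarrow> sum f I \<in> H w"
  by (induction I rule: infinite_finite_induct) (auto simp: H_zero H_add)

lemma H_pderiv: "P \<in> H w \<Longrightarrow> pderiv P \<in> H (w - 2)"
  unfolding weighted_polys_def
proof (intro CollectI allI)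
  fix n assume "P \<in> {P. \<forall>i. coeff P i \<in> gr (w - 2 * int i)}"
  then have "coeff P (Suc n) \<in> gr (w - 2 - 2 * int n)"
    by (metis (no_types, lifting) CollectD add_diff_eq diff_diff_add mult.commute of_nat_Suc ring_class.ring_distribs(1) mult_1 add.commute)
  then show "coeff (pderiv P) n \<in> gr (w - 2 - 2 * int n)"
    by (simp only: coeff_pderiv gr_scale)
qed

lemma H_power_add:
  assumes "prime p" "P \<in> H w" "Q \<in> H w"
  shows "\<exists>T\<in>H (int p * w). (P + Q) ^ p = P ^ p + Q ^ p + of_nat p * T"
proof
  show "(\<Sum>k\<in>{1..<p}. of_nat ((p choose k) div p) * P ^ k * Q ^ (p - k)) \<in> H (int p * w)"
  proof (rule H_sum)
    fix k assume k: "k \<in> {1..<p}"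
    have "P ^ k * Q ^ (p - k) \<in> H (int p * w)"
      by (rule H_mult'[OF H_power[OF assms(2)] H_power[OF assms(3)]]) (use k in \<open>simp add: algebra_simps of_nat_diff\<close>)
    then show "of_nat ((p choose k) div p) * P ^ k * Q ^ (p - k) \<in> H (int p * w)"
      using H_scale by (simp add: mult.assoc)
  qed
qed (rule prime_power_add[OF assms(1)])

lemma gr_power_add:
  assumes "prime p" "x \<in> gr w" "y \<in> gr w"
  shows "\<exists>z\<in>gr (int p * w). (x + y) ^ p = x ^ p + y ^ p + of_nat p * z"
proof
  show "(\<Sum>k\<in>{1..<p}. of_nat ((p choose k) div p) * x ^ k * y ^ (p - k)) \<in> gr (int p * w)"
  proof (rule gr_sum)
    fix k assume k: "k \<in> {1..<p}"
    have "x ^ k * y ^ (p - k) \<in> gr (int p * w)"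
      by (rule gr_mult'[OF gr_power[OF assms(2)] gr_power[OF assms(3)]]) (use k in \<open>simp add: algebra_simps of_nat_diff\<close>)
    then show "of_nat ((p choose k) div p) * x ^ k * y ^ (p - k) \<in> gr (int p * w)"
      using gr_scale by (simp add: mult.assoc)
  qed
qed (rule prime_power_add[OF assms(1)])

end

text \<open>The solution \<open>c = \<Sum> c\<^sub>n X\<^sup>n\<close> with \<open>c\<^sub>0 = s\<close> of \<open>c' F - c F' / 2 = \<Sum> r\<^sub>j X\<^sup>j\<close> for
  \<open>F = X\<^sup>3 + A X + B\<close>, coefficient by coefficient.\<close>

fun ode_sol :: "'a::field_char_0 \<Rightarrow> 'a \<Rightarrow> 'a \<Rightarrow> (nat \<Rightarrow> 'a) \<Rightarrow> nat \<Rightarrow> 'a" where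
  "ode_sol A B s r n = (if n = 0 then s else
     (r (n - 1) - of_int (2 * int n - 3) / 2 * A * ode_sol A B s r (n - 1)
       - (if n \<ge> 3 then of_int (2 * int n - 9) / 2 * ode_sol A B s r (n - 3) else 0)) / (of_nat n * B))"

declare ode_sol.simps [simp del]

lemma ode_sol_0 [simp]: "ode_sol A B s r 0 = s"
  by (simp add: ode_sol.simps)

lemma ode_sol_Suc:
  "ode_sol A B s r (Suc n) = (r n - of_int (2 * int n - 1) / 2 * A * ode_sol A B s r n
       - (if n \<ge> 2 then of_int (2 * int n - 7) / 2 * ode_sol A B s r (n - 2) else 0)) / (of_nat (Suc n) * B)"
  by (subst ode_sol.simps) (auto simp: algebra_simps numeral_3_eq_3 numeral_2_eq_2)

lemma ode_sol_linear:
  "ode_sol A B (x * s + y * t) (\<lambda>j. x * r j + y * q j) n = x * ode_sol A B s r n + y * ode_sol A B t q n"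
proof (induction n rule: less_induct)
  case (less n)
  show ?case
  proof (cases n)
    case (Suc k)
    have "ode_sol A B (x * s + y * t) (\<lambda>j. x * r j + y * q j) k = x * ode_sol A B s r k + y * ode_sol A B t q k"
      "ode_sol A B (x * s + y * t) (\<lambda>j. x * r j + y * q j) (k - 2) = x * ode_sol A B s r (k - 2) + y * ode_sol A B t q (k - 2)"
      using less Suc by simp_all
    then show ?thesis unfolding Suc ode_sol_Suc
      by (simp add: add_divide_distrib diff_divide_distrib algebra_simps)
  qed simp
qed

lemma ode_sol_sum:
  "ode_sol A B 0 (\<lambda>j. \<Sum>k<(N::nat). x k * r k j) n = (\<Sum>k<N. x k * ode_sol A B 0 (r k) n)"
proof (induction N)
  case 0
  have "ode_sol A B (0 * 0 + 0 * 0) (\<lambda>j. 0 * 0 + 0 * 0) n = 0 * ode_sol A B 0 (\<lambda>j. 0) n + 0 * ode_sol A B 0 (\<lambda>j. 0) n"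
    by (rule ode_sol_linear)
  then show ?case by simp
next
  case (Suc N)
  have "ode_sol A B (1 * 0 + x N * 0) (\<lambda>j. 1 * (\<Sum>k<N. x k * r k j) + x N * r N j) n =
     1 * ode_sol A B 0 (\<lambda>j. \<Sum>k<N. x k * r k j) n + x N * ode_sol A B 0 (r N) n"
    by (rule ode_sol_linear)
  then show ?case using Suc by simp
qed

text \<open>The homogeneous equation c' F = c F' / 2 has the solution (F / B)^(1/2) with c_0 = 1,
  whose coefficients are the \<alpha>_n. Index 0 is excluded: there \<open>alpha\<close> has the
  default value 0 instead of 1.\<close>

lemma alpha_eq_ode_sol:
  assumes "B \<noteq> 0" "n \<ge> 1"
  shows "alpha A B n = ode_sol A B 1 (\<lambda>_. 0) n"
  using assms(2)
proof (induction n rule: less_induct)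
  case (less n)
  let ?s = "ode_sol A B 1 (\<lambda>_. 0)"
  have e: "Suc 1 = 2" "Suc 2 = 3" "Suc 3 = 4" by simp_all
  have s1: "?s 1 = A / (2 * B)" using ode_sol_Suc[of A B 1 "\<lambda>_. 0" 0] assms(1) by (simp add: field_simps)
  have "?s (Suc 1) = - (A ^ 2 / (8 * B ^ 2))"
    unfolding ode_sol_Suc s1 using assms(1) by (simp add: field_simps power2_eq_square)
  then have s2: "?s 2 = - (A ^ 2 / (8 * B ^ 2))" by (simp only: e)
  have "?s (Suc 2) = A ^ 3 / (16 * B ^ 3) + 1 / (2 * B)"
    unfolding ode_sol_Suc s2 using assms(1) by (simp add: field_simps power2_eq_square power3_eq_cube)
  then have s3: "?s 3 = A ^ 3 / (16 * B ^ 3) + 1 / (2 * B)" by (simp only: e)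
  have "?s (Suc 3) = - (5 * A ^ 4 / (128 * B ^ 4)) - A / (4 * B ^ 2)"
    unfolding ode_sol_Suc s3 using assms(1) s1 by (simp add: field_simps power2_eq_square power3_eq_cube power4_eq_xxxx)
  then have s4: "?s 4 = - (5 * A ^ 4 / (128 * B ^ 4)) - A / (4 * B ^ 2)" by (simp only: e)
  consider "n = 1" | "n = 2" | "n = 3" | "n = 4" | "n \<ge> 5" using less.prems by linarith
  then show ?case
  proof cases
    case 5
    have "alpha A B (n - 1) = ?s (n - 1)" "alpha A B (n - 3) = ?s (n - 3)" using less 5 by auto
    moreover have "(of_nat (2 * n - 3) :: 'a) = of_int (2 * int n - 3)" "(of_nat (2 * n - 9) :: 'a) = of_int (2 * int n - 9)"
      using 5 by (simp_all add: of_nat_diff)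
    moreover have "of_nat n \<noteq> (0::'a)" using 5 by simp
    ultimately show ?thesis using 5 assms(1)
      by (subst alpha.simps, subst ode_sol.simps) (simp add: field_simps)
  qed (simp_all only: s1 s2 s3 s4, simp_all add: alpha.simps)
qed

text \<open>With right-hand side F and c_0 = 0 the solution is F^(1/2) times the integral of
  F^(-1/2). Its coefficient at X is 1 whereas \<beta>_1 = 0, so the agreement starts at n = 2; the
  recurrence from n = 5 on never reaches back to index 1.\<close>

lemma beta_eq_ode_sol:
  assumes "B \<noteq> 0" "n \<ge> 2"
  shows "beta A B n = ode_sol A B 0 (coeff [:B, A, 0, 1:]) n"
  using assms(2)
proof (induction n rule: less_induct)
  case (less n)
  let ?s = "ode_sol A B 0 (coeff [:B, A, 0, 1:])"
  have s1: "?s 1 = 1" using ode_sol_Suc[of A B 0 "coeff [:B, A, 0, 1:]" 0] assms(1) by (simp add: field_simps)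
  have e: "Suc 1 = 2" "Suc 2 = 3" "Suc 3 = 4" by simp_all
  have "?s (Suc 1) = A / (4 * B)"
    unfolding ode_sol_Suc s1 using assms(1) by (simp add: field_simps)
  then have s2: "?s 2 = A / (4 * B)" by (simp only: e)
  have "?s (Suc 2) = - (A ^ 2 / (8 * B ^ 2))"
    unfolding ode_sol_Suc s2 using assms(1) by (simp add: field_simps power2_eq_square numeral_2_eq_2)
  then have s3: "?s 3 = - (A ^ 2 / (8 * B ^ 2))" by (simp only: e)
  have "?s (Suc 3) = 5 * A ^ 3 / (64 * B ^ 3) + 3 / (8 * B)"
    unfolding ode_sol_Suc s3 using assms(1) s1
    by (simp add: field_simps power2_eq_square power3_eq_cube numeral_3_eq_3)
  then have s4: "?s 4 = 5 * A ^ 3 / (64 * B ^ 3) + 3 / (8 * B)" by (simp only: e)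
  consider "n = 2" | "n = 3" | "n = 4" | "n \<ge> 5" using less.prems by linarith
  then show ?case
  proof cases
    case 4
    have "beta A B (n - 1) = ?s (n - 1)" "beta A B (n - 3) = ?s (n - 3)" using less 4 by auto
    moreover have "(of_nat (2 * n - 3) :: 'a) = of_int (2 * int n - 3)" "(of_nat (2 * n - 9) :: 'a) = of_int (2 * int n - 9)"
      using 4 by (simp_all add: of_nat_diff)
    moreover have "of_nat n \<noteq> (0::'a)" using 4 by simp
    \<comment> \<open>The inhomogeneity F has degree 3, so from n = 5 on both sequences obey the
      same homogeneous recurrence.\<close>
    moreover have "coeff [:B, A, 0, 1:] (n - 1) = 0" using 4 by (intro coeff_eq_0) simp
    ultimately show ?thesis using 4 assms(1)
      by (subst beta.simps, subst ode_sol.simps) (simp add: field_simps)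
  qed (simp_all only: s1 s2 s3 s4, simp_all add: beta.simps)
qed

subsection \<open>The equations modulo \<open>p\<^sup>2\<close>\<close>

text \<open>The part of the antiderivative that needs no division by p: the terms x^(kp-1) are left
  out, and they are exactly those seen by the Cartier operator.\<close>

definition prime_integral :: "nat \<Rightarrow> 'a::field_char_0 poly \<Rightarrow> 'a poly" where
  "prime_integral p P = (\<Sum>i\<le>Polynomial.degree P.
     Polynomial.monom (if p dvd Suc i then 0 else coeff P i / of_nat (Suc i)) (Suc i))"

lemma coeff_prime_integral:
  "coeff (prime_integral p P) n = (if n = 0 \<or> p dvd n then 0 else coeff P (n - 1) / of_nat n)"
proof (cases n)
  case 0
  then show ?thesis by (simp add: prime_integral_def Polynomial.coeff_sum)
next
  case (Suc k)
  have "coeff (prime_integral p P) n =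
    (\<Sum>i\<le>Polynomial.degree P. if i = k then (if p dvd Suc i then 0 else coeff P i / of_nat (Suc i)) else 0)"
    unfolding prime_integral_def Polynomial.coeff_sum by (intro sum.cong) (auto simp: Suc)
  also have "\<dots> = (if p dvd Suc k then 0 else coeff P k / of_nat (Suc k))"
    by (subst sum.delta) (auto simp: coeff_eq_0)
  finally show ?thesis by (simp add: Suc)
qed

lemma coeff_pderiv_prime_integral:
  "coeff (pderiv (prime_integral p P)) n = (if p dvd Suc n then 0 else coeff P n)"
  by (simp add: coeff_pderiv coeff_prime_integral del: of_nat_Suc)

lemma degree_prime_integral: "Polynomial.degree (prime_integral p P) \<le> Suc (Polynomial.degree P)"
  by (rule degree_le) (auto simp: coeff_prime_integral coeff_eq_0)

text \<open>The linear Cartier operator: \<open>x\<^sup>k\<^sup>p\<^sup>+\<^sup>p\<^sup>-\<^sup>1 \<mapsto> X\<^sup>k\<close>.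
  A polynomial is a derivative modulo \<open>p\<close> iff it is sent into the multiples of \<open>p\<close>.\<close>

definition cartier :: "nat \<Rightarrow> 'a::field_char_0 poly \<Rightarrow> 'a poly" where
  "cartier p P = (\<Sum>k\<le>Polynomial.degree P. Polynomial.monom (coeff P (k * p + p - 1)) k)"

lemma coeff_cartier:
  assumes "p > 0"
  shows "coeff (cartier p P) k = coeff P (k * p + p - 1)"
proof -
  have "coeff (cartier p P) k = (\<Sum>i\<le>Polynomial.degree P. if i = k then coeff P (i * p + p - 1) else 0)"
    unfolding cartier_def Polynomial.coeff_sum by (intro sum.cong) auto
  also have "\<dots> = (if k \<le> Polynomial.degree P then coeff P (k * p + p - 1) else 0)"
    by (subst sum.delta) auto
  also have "\<dots> = coeff P (k * p + p - 1)"
  proof (cases "k \<le> Polynomial.degree P")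
    case False
    have "k \<le> k * p + p - 1" using assms by (cases p) auto
    then show ?thesis using False by (simp add: coeff_eq_0)
  qed simp
  finally show ?thesis .
qed

lemma cartier_add: "p > 0 \<Longrightarrow> cartier p (P + Q) = cartier p P + cartier p Q"
  by (rule poly_eqI) (simp add: coeff_cartier)

lemma cartier_diff: "p > 0 \<Longrightarrow> cartier p (P - Q) = cartier p P - cartier p Q"
  by (rule poly_eqI) (simp add: coeff_cartier)

lemma cartier_const_mult: "p > 0 \<Longrightarrow> cartier p ([:c:] * P) = [:c:] * cartier p P"
  by (rule poly_eqI) (simp add: coeff_cartier)

lemma cartier_of_nat_mult: "p > 0 \<Longrightarrow> cartier p (of_nat n * P) = of_nat n * cartier p P"
  using cartier_const_mult[of p "of_nat n" P] by (simp add: of_nat_poly)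

text \<open>Linearity over polynomials in x^p. It lets the unknown c(x^p), its derivative and the
  twisted cubic F(x^p) pass through the operator unchanged and turns the obstruction into an
  equation in X = x^p.\<close>

lemma cartier_pcompose:
  assumes p: "p > 0"
  shows "cartier p (P * pcompose g (Polynomial.monom 1 p)) = g * cartier p P"
proof (induction g)
  case (pCons c g)
  have shift: "cartier p (Polynomial.monom 1 p * Q) = pCons 0 (cartier p Q)" for Q :: "'a poly"
  proof (rule poly_eqI)
    fix k show "coeff (cartier p (Polynomial.monom 1 p * Q)) k = coeff (pCons 0 (cartier p Q)) k"
      using p by (cases k) (auto simp: coeff_cartier coeff_monom_mult)
  qed
  have "P * pcompose (pCons c g) (Polynomial.monom 1 p) =
      [:c:] * P + Polynomial.monom 1 p * (P * pcompose g (Polynomial.monom 1 p))"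
    by (simp add: pcompose_pCons algebra_simps)
  then show ?case using p
    by (simp only: cartier_add cartier_const_mult shift pCons.IH) simp
qed (simp add: cartier_def)

text \<open>With n = j + 1 the factors become n, 2 n - 3 and 2 n - 9, those of the
  recurrence.\<close>

lemma coeff_ode:
  fixes c :: "'a::field_char_0 poly"
  shows "coeff (pderiv c * [:B, A, 0, 1:] - [:1/2:] * (c * [:A, 0, 3:])) j =
    of_nat (Suc j) * B * coeff c (Suc j) + of_int (2 * int j - 1) / 2 * A * coeff c j
      + (if j \<ge> 2 then of_int (2 * int j - 7) / 2 * coeff c (j - 2) else 0)"
proof -
  have 1: "pderiv c * [:B, A, 0, 1:] = Polynomial.smult B (pderiv c) + pCons 0 (Polynomial.smult A (pderiv c) + pCons 0 (pCons 0 (pderiv c)))"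
    by simp
  have 2: "c * [:A, 0, 3:] = Polynomial.smult A c + pCons 0 (pCons 0 (Polynomial.smult 3 c))" by simp
  consider "j = 0" | "j = 1" | "j = 2" | i where "j = Suc (Suc (Suc i))"
    by (metis One_nat_def Suc_1 old.nat.exhaust)
  then show ?thesis
    by cases (simp_all add: 1 2 coeff_pderiv numeral_2_eq_2 del: mult_pCons_right, simp_all add: field_simps)
qed

lemma const_mult_coeff: "coeff ([:c:] * P) k = c * coeff P k"
  by simp

lemma of_nat_mult_coeff: "coeff (of_nat n * P) k = of_nat n * coeff P k"
  by (simp add: of_nat_poly)

text \<open>Read \<open>q\<close> as p and \<open>Q\<close> as the error in F(x^p) = f^p + p Q. The
  bracket multiplied by \<open>q\<close> on the right is the polynomial \<open>G\<close> of the main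
  construction.\<close>

lemma twist_identity:
  fixes X u :: "'a::comm_ring_1"
  shows "(X + q * u) ^ 3 + (A + q * A1) * (X + q * u) + (B + q * B1) =
    X ^ 3 + A * X + B - q * Q +
    q * (Q + u * (3 * X ^ 2 + A) + A1 * X + B1 + q * (3 * X * u ^ 2 + q * u ^ 3 + A1 * u))"
  by (simp add: algebra_simps power2_eq_square power3_eq_cube)

lemma integrand_identity:
  fixes L :: "'a::comm_ring_1"
  shows "2 * L * f * (P - q * Q) + h * f * (G + W + q * T) - 2 * x * c * (P - q * Q) =
    2 * L * (f * P) + h * (f * G) + h * (f * W) - 2 * (x * (c * P)) +
    q * (h * f * T - 2 * L * f * Q + 2 * x * c * Q)"
  by (simp add: algebra_simps)

text \<open>\<open>K\<close> is twice the derivative wanted for V modulo p. Everything of order q^2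
  goes into the last bracket, which becomes the error term \<open>Z\<close>.\<close>

lemma integrand_identity2:
  fixes L :: "'a::comm_ring_1"
  assumes "K = 2 * L * f * P + h * f * G - 2 * x * c * P" and "K = 2 * K'"
  shows "2 * (h * f + q * (x * c)) * P + 2 * q * (K' - q * Z) =
    (h + q * L) * f * (2 * P + q * G) + q ^ 2 * (- (2 * Z) - L * f * G)"
proof -
  have "2 * q * (K' - q * Z) = q * K - 2 * q ^ 2 * Z"
    unfolding assms(2) by (simp add: algebra_simps power2_eq_square)
  then show ?thesis unfolding assms(1) by (simp add: algebra_simps power2_eq_square)
qed

section \<open>Frobenius congruences that respect weights\<close>

locale frob_family = graded_family gr for gr :: "int \<Rightarrow> 'a::field_char_0 set" +
  fixes p :: nat
  assumes p_prime: "prime p" and p_ge: "p \<ge> 3"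
    and scalar: "\<not> p dvd n \<Longrightarrow> 1 / of_nat n \<in> gr 0"
begin

lemma p_gt: "p > 0" "p > 1" using p_ge by auto

lemma not_dvd: "0 < n \<Longrightarrow> n < p \<Longrightarrow> \<not> p dvd n"
  by (simp add: nat_dvd_not_less)

lemma half: "1 / 2 \<in> gr 0"
  using scalar[of 2] not_dvd[of 2] p_ge by simp

text \<open>A relation instead of a map, so that two parallel computations can be compared: one with
  given elements, one with p-th powers or images under a lift. The error keeps the weight p
  w.\<close>

definition frob :: "int \<Rightarrow> 'a \<Rightarrow> 'a \<Rightarrow> bool" where
  "frob w x y \<longleftrightarrow> x \<in> gr w \<and> (\<exists>z\<in>gr (int p * w). y = x ^ p + of_nat p * z)"

lemma frobE:
  assumes "frob w x y"
  obtains z where "x \<in> gr w" "z \<in> gr (int p * w)" "y = x ^ p + of_nat p * z"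
  using assms by (auto simp: frob_def)

lemma frob_gr: "frob w x y \<Longrightarrow> x \<in> gr w" "frob w x y \<Longrightarrow> y \<in> gr (int p * w)"
  by (auto simp: frob_def intro!: gr_add gr_power gr_scale)

lemma frob_power: "x \<in> gr w \<Longrightarrow> frob w x (x ^ p)"
  unfolding frob_def using gr_zero by (intro conjI bexI[of _ 0]) auto

lemma frob_add:
  assumes "frob w x y" "frob w x' y'"
  shows "frob w (x + x') (y + y')"
proof -
  obtain z where z: "x \<in> gr w" "z \<in> gr (int p * w)" "y = x ^ p + of_nat p * z" using assms(1) by (rule frobE)
  obtain z' where z': "x' \<in> gr w" "z' \<in> gr (int p * w)" "y' = x' ^ p + of_nat p * z'" using assms(2) by (rule frobE)
  obtain t where t: "t \<in> gr (int p * w)" "(x + x') ^ p = x ^ p + x' ^ p + of_nat p * t"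
    using gr_power_add[OF p_prime z(1) z'(1)] by blast
  have "y + y' = (x + x') ^ p + of_nat p * (z + z' - t)" using z z' t by (simp add: algebra_simps)
  then show ?thesis unfolding frob_def using z z' t by (auto intro: gr_add gr_diff)
qed

lemma frob_mult:
  assumes "frob v x y" "frob w x' y'"
  shows "frob (v + w) (x * x') (y * y')"
proof -
  obtain z where z: "x \<in> gr v" "z \<in> gr (int p * v)" "y = x ^ p + of_nat p * z" using assms(1) by (rule frobE)
  obtain z' where z': "x' \<in> gr w" "z' \<in> gr (int p * w)" "y' = x' ^ p + of_nat p * z'" using assms(2) by (rule frobE)
  have y': "y' \<in> gr (int p * w)" using frob_gr[OF assms(2)] by simp
  have "y * y' = (x * x') ^ p + of_nat p * (z * y' + x ^ p * z')"
    using z z' by (simp add: algebra_simps power_mult_distrib)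
  moreover have "z * y' + x ^ p * z' \<in> gr (int p * (v + w))"
    using z z' y' by (intro gr_add gr_mult'[OF _ _ distrib_left] gr_power)
  ultimately show ?thesis unfolding frob_def using z z' by (auto intro: gr_mult)
qed

lemma frob_0: "frob w 0 0"
  unfolding frob_def using p_gt gr_zero by (intro conjI bexI[of _ 0]) auto

lemma frob_1: "frob 0 1 1"
  using frob_power[OF gr_one] by simp

text \<open>Fermat's little theorem, obtained by adding up ones.\<close>

lemma frob_of_nat: "frob 0 (of_nat n) (of_nat n)"
  by (induction n) (auto simp: frob_0 frob_1 intro: frob_add)

lemma frob_minus_one: "frob 0 (- 1) (- 1)"
  using frob_power[OF gr_uminus[OF gr_one]] prime_odd_nat[OF p_prime] p_ge by simp

lemma frob_uminus: "frob w x y \<Longrightarrow> frob w (- x) (- y)"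
  using frob_mult[OF frob_minus_one, of w x y] by simp

lemma frob_diff: "frob w x y \<Longrightarrow> frob w x' y' \<Longrightarrow> frob w (x - x') (y - y')"
  using frob_add[of w x y "- x'" "- y'"] frob_uminus by simp

lemma frob_of_int: "frob 0 (of_int n) (of_int n)"
  by (cases n rule: int_cases2) (auto simp: frob_of_nat frob_uminus)

text \<open>Multiplying n = n^p + p z by 1/n and by (1/n)^p compares 1/n with its p-th power. So
  p-integral rational constants are fixed.\<close>

lemma frob_inverse_of_nat:
  assumes "\<not> p dvd n"
  shows "frob 0 (1 / of_nat n) (1 / of_nat n)"
proof -
  obtain z where z: "z \<in> gr 0" "of_nat n = (of_nat n ^ p :: 'a) + of_nat p * z"
    using frob_of_nat[of n] by (auto elim: frobE)
  have n: "of_nat n \<noteq> (0::'a)" using assms by (metis dvd_0_right of_nat_eq_0_iff)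
  let ?i = "1 / of_nat n :: 'a"
  have i: "of_nat n * ?i = 1" using n by simp
  have "?i ^ p = ?i ^ p * (of_nat n * ?i)" using i by simp
  also have "\<dots> = ?i ^ p * (of_nat n ^ p + of_nat p * z) * ?i" using z(2) by (simp add: mult.assoc)
  also have "\<dots> = (of_nat n * ?i) ^ p * ?i + of_nat p * (?i ^ p * z * ?i)"
    unfolding power_mult_distrib by (simp only: algebra_simps)
  finally have "?i ^ p = ?i + of_nat p * (?i ^ p * z * ?i)" unfolding i by (simp only: power_one mult_1)
  then have "?i = ?i ^ p + of_nat p * (- (?i ^ p * z * ?i))"
    by (simp only: mult_minus_right) (metis add_diff_cancel_right' diff_conv_add_uminus)
  moreover have "- (?i ^ p * z * ?i) \<in> gr (int p * 0)"
    using gr_uminus[OF gr_mult[OF gr_mult[OF gr_power[OF scalar[OF assms], of p] z(1)] scalar[OF assms]]] by simp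
  ultimately show ?thesis unfolding frob_def using scalar[OF assms] by blast
qed

text \<open>\<open>q\<close> is 1 when the recurrence runs on z4, z6 and p when it runs on their
  p-th powers. Below index p all divisors n are invertible scalars.\<close>

lemma ode_sol_gr:
  assumes A: "A \<in> gr (4 * q)" and B: "1 / B \<in> gr (- 6 * q)" and s: "s \<in> gr w"
    and r: "\<And>j. r j \<in> gr (w - 2 * q * int (Suc j) + 6 * q)" and n: "n < p"
  shows "ode_sol A B s r n \<in> gr (w - 2 * q * int n)"
  using n
proof (induction n rule: less_induct)
  case (less n)
  show ?case
  proof (cases n)
    case (Suc k)
    let ?t = "r k - (of_int (2 * int k - 1) * (1 / 2)) * (A * ode_sol A B s r k)
       - (if k \<ge> 2 then (of_int (2 * int k - 7) * (1 / 2)) * ode_sol A B s r (k - 2) else 0)"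
    have eq: "ode_sol A B s r n = (1 / of_nat n) * (?t * (1 / B))"
      unfolding Suc ode_sol_Suc by (simp add: field_simps)
    have c: "of_int i * (1 / 2) \<in> gr 0" for i using gr_scale0[OF gr_of_int half] .
    have i1: "ode_sol A B s r k \<in> gr (w - 2 * q * int k)" using less Suc by simp
    have i2: "ode_sol A B s r (k - 2) \<in> gr (w - 2 * q * int n + 6 * q)" if "k \<ge> 2"
      using less.IH[of "k - 2"] less.prems Suc that by (simp add: of_nat_diff algebra_simps)
    have "?t \<in> gr (w - 2 * q * int n + 6 * q)"
    proof (intro gr_diff)
      show "r k \<in> gr (w - 2 * q * int n + 6 * q)" using r[of k] Suc by simp
      show "(of_int (2 * int k - 1) * (1 / 2)) * (A * ode_sol A B s r k) \<in> gr (w - 2 * q * int n + 6 * q)"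
        by (rule gr_scale0[OF c], rule gr_mult'[OF A i1]) (simp add: Suc algebra_simps)
      show "(if k \<ge> 2 then (of_int (2 * int k - 7) * (1 / 2)) * ode_sol A B s r (k - 2) else 0) \<in> gr (w - 2 * q * int n + 6 * q)"
        using gr_scale0[OF c i2] gr_zero by presburger
    qed
    then have "?t * (1 / B) \<in> gr (w - 2 * q * int n)" by (rule gr_mult'[OF _ B]) simp
    moreover have "1 / of_nat n \<in> gr 0" using less.prems Suc by (intro scalar not_dvd) auto
    ultimately show ?thesis unfolding eq by (rule gr_scale0[rotated])
  qed (use s in simp)
qed

end

text \<open>Two rings occur. \<open>gr\<close> holds homogeneous elements without derivatives, where
  the coefficients of \<Lambda> must lie; \<open>R\<close> also contains \<open>a1\<close> and
  \<open>b1\<close>, the first derivatives, and is the coefficient ring of the unknown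
  polynomials.\<close>

locale frobenius_core = G: frob_family gr p + R: graded_family "\<lambda>_. R"
  for gr :: "int \<Rightarrow> 'a::field_char_0 set" and p :: nat and R :: "'a set" +
  fixes a b a1 b1 :: 'a
  assumes p_ge_11: "p \<ge> 11"
    and gr_R: "x \<in> gr w \<Longrightarrow> x \<in> R"
    and a: "a \<in> gr 4" and b: "b \<in> gr 6" "b \<noteq> 0" "1 / b \<in> gr (- 6)"
    and ab1: "a1 \<in> R" "b1 \<in> R"
begin

abbreviation "RX \<equiv> weighted_polys (\<lambda>_. R) 0"

lemma RX_eq: "weighted_polys (\<lambda>_. R) w = RX"
  by (simp add: weighted_polys_def)

lemma H_RX: "P \<in> G.H w \<Longrightarrow> P \<in> RX"
  by (auto simp: weighted_polys_def intro: gr_R)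

lemma RX_mult: "P \<in> RX \<Longrightarrow> Q \<in> RX \<Longrightarrow> P * Q \<in> RX"
  using R.H_mult[of P 0 Q 0] by simp

lemma RX_power: "P \<in> RX \<Longrightarrow> P ^ n \<in> RX"
  using R.H_power[of P 0 n] by simp

lemma RX_const: "c \<in> R \<Longrightarrow> [:c:] \<in> RX"
  by (rule R.H_const)

lemma RX_pderiv: "P \<in> RX \<Longrightarrow> pderiv P \<in> RX"
  using R.H_pderiv[of P 0] unfolding RX_eq[of "0 - 2"] .

lemma RX_monom: "c \<in> R \<Longrightarrow> Polynomial.monom c n \<in> RX"
  by (rule R.H_monom)

lemmas RX_intros = R.H_add R.H_diff R.H_uminus RX_mult RX_power RX_const RX_pderiv RX_monom R.H_numeral R.H_of_nat R.H_zero R.H_one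

lemma RX_pcompose: "g \<in> RX \<Longrightarrow> P \<in> RX \<Longrightarrow> pcompose g P \<in> RX"
proof (induction g)
  case (pCons c g)
  have co: "coeff (pCons c g) i \<in> R" for i
    using pCons.prems(1) unfolding weighted_polys_def by blast
  have "c \<in> R" "g \<in> RX" using co[of 0] co[of "Suc i" for i] by (simp_all add: weighted_polys_def)
  then show ?case using pCons by (simp add: pcompose_pCons RX_intros)
qed simp

lemma R_mult: "x \<in> R \<Longrightarrow> y \<in> R \<Longrightarrow> x * y \<in> R"
  using R.gr_mult by simp

lemmas p = G.p_prime p_ge_11
lemmas p_gt = G.p_gt and half = G.half and scalar = G.scalar and not_dvd = G.not_dvd

text \<open>The recurrence uses only ring operations, division by b and p-integral constants, so the
  Frobenius relation is inherited from its data. This is why the determinant at (a^p, b^p) is the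
  p-th power of the one at (a, b) modulo p.\<close>

lemma ode_sol_frob:
  assumes s: "G.frob w s s'" and r: "\<And>j. G.frob (w - 2 * int (Suc j) + 6) (r j) (r' j)" and n: "n < p"
  shows "G.frob (w - 2 * int n) (ode_sol a b s r n) (ode_sol (a ^ p) (b ^ p) s' r' n)"
  using n
proof (induction n rule: less_induct)
  case (less n)
  show ?case
  proof (cases n)
    case (Suc k)
    let ?t = "\<lambda>A B s r. r k - (of_int (2 * int k - 1) * (1 / of_nat 2)) * (A * ode_sol A B s r k)
       - (if k \<ge> 2 then (of_int (2 * int k - 7) * (1 / of_nat 2)) * ode_sol A B s r (k - 2) else 0)"
    have eq: "ode_sol A B s r n = (1 / of_nat n) * (?t A B s r * (1 / B))" for A B s :: 'a and r
      unfolding Suc ode_sol_Suc by (simp add: field_simps)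
    have c: "G.frob 0 (of_int i * (1 / of_nat 2)) (of_int i * (1 / of_nat 2))" for i
      using G.frob_mult[OF G.frob_of_int G.frob_inverse_of_nat[of 2]] not_dvd[of 2] p by simp
    have sc: "G.frob v (x * y) (x' * y')" if "G.frob 0 x x'" "G.frob v y y'" for x y x' y' v
      using G.frob_mult[OF that] by simp
    have i1: "G.frob (w - 2 * int k) (ode_sol a b s r k) (ode_sol (a ^ p) (b ^ p) s' r' k)" using less Suc by simp
    have i2: "G.frob (w - 2 * int n + 6) (ode_sol a b s r (k - 2)) (ode_sol (a ^ p) (b ^ p) s' r' (k - 2))" if "k \<ge> 2"
      using less.IH[of "k - 2"] less.prems Suc that by (simp add: of_nat_diff algebra_simps)
    have "G.frob (w - 2 * int n + 6) (?t a b s r) (?t (a ^ p) (b ^ p) s' r')"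
    proof (intro G.frob_diff)
      show "G.frob (w - 2 * int n + 6) (r k) (r' k)" using r[of k] Suc by simp
      have "G.frob (w - 2 * int n + 6) (a * ode_sol a b s r k) (a ^ p * ode_sol (a ^ p) (b ^ p) s' r' k)"
        using G.frob_mult[OF G.frob_power[OF a] i1] Suc by (simp add: algebra_simps)
      then show "G.frob (w - 2 * int n + 6) ((of_int (2 * int k - 1) * (1 / of_nat 2)) * (a * ode_sol a b s r k))
         ((of_int (2 * int k - 1) * (1 / of_nat 2)) * (a ^ p * ode_sol (a ^ p) (b ^ p) s' r' k))"
        by (rule sc[OF c])
      show "G.frob (w - 2 * int n + 6) (if k \<ge> 2 then (of_int (2 * int k - 7) * (1 / of_nat 2)) * ode_sol a b s r (k - 2) else 0)
         (if k \<ge> 2 then (of_int (2 * int k - 7) * (1 / of_nat 2)) * ode_sol (a ^ p) (b ^ p) s' r' (k - 2) else 0)"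
        using sc[OF c i2] G.frob_0 by presburger
    qed
    moreover have "G.frob (- 6) (1 / b) (1 / b ^ p)" using G.frob_power[OF b(3)] by (simp add: power_divide)
    ultimately have "G.frob (w - 2 * int n) (?t a b s r * (1 / b)) (?t (a ^ p) (b ^ p) s' r' * (1 / b ^ p))"
      using G.frob_mult[of "w - 2 * int n + 6" _ _ "- 6"] by fastforce
    moreover have "G.frob 0 (1 / of_nat n) (1 / of_nat n)" using less.prems Suc by (intro G.frob_inverse_of_nat not_dvd) auto
    ultimately show ?thesis unfolding eq by (rule sc[rotated])
  qed (use s in simp)
qed


section \<open>The polynomial equations and their solution\<close>

abbreviation (input) "f \<equiv> [:b, a, 0, 1:]"
abbreviation (input) "F \<equiv> [:b ^ p, a ^ p, 0, 1:]"
abbreviation (input) "X \<equiv> Polynomial.monom (1::'a) p"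
abbreviation (input) "m \<equiv> (p - 1) div 2"
abbreviation (input) "N \<equiv> (p + 5) div 2"

lemma p_odd: "odd p" using prime_odd_nat[OF p(1)] p by simp

lemma m_eq: "2 * m = p - 1" "2 * N = p + 5" using p_odd p by presburger+

lemma m_int: "2 * int m = int p - 1" "2 * int N = int p + 5"
  using m_eq p by linarith+

lemma f_H: "f \<in> G.H 6"
  using a b G.gr_zero G.gr_one
  by (auto simp: weighted_polys_def coeff_pCons split: nat.splits)

lemma degree_f_power: "Polynomial.degree (f ^ n) \<le> 3 * n"
  using degree_power_le[of f n] by simp

text \<open>As 3 m < 2 p - 1, the only monomial x^(kp-1) that can occur in f^m is x^(p-1), with
  coefficient h. After division by h it is precisely the monomial that is subtracted, and the rest
  integrates without dividing by p.\<close>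

lemma hasse_antiderivative:
  assumes h: "h = coeff (f ^ m) (p - 1)" "h \<noteq> 0" "1 / h \<in> gr (1 - int p)"
  shows "prime_integral p ([:1 / h:] * f ^ m) \<in> G.H (2 * int p)"
    and "pderiv (prime_integral p ([:1 / h:] * f ^ m)) = [:1 / h:] * f ^ m - Polynomial.monom 1 (p - 1)"
    and "Polynomial.degree (prime_integral p ([:1 / h:] * f ^ m)) \<le> 3 * m + 1"
proof -
  let ?P = "[:1 / h:] * f ^ m"
  have P: "?P \<in> G.H (2 * int p - 2)"
    by (rule G.H_mult'[OF G.H_const[OF h(3)] G.H_power[OF f_H]]) (use m_int in linarith)
  show "prime_integral p ?P \<in> G.H (2 * int p)"
    unfolding weighted_polys_def
  proof (intro CollectI allI)
    fix n show "coeff (prime_integral p ?P) n \<in> gr (2 * int p - 2 * int n)"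
    proof (cases "n = 0 \<or> p dvd n")
      case True
      then show ?thesis by (simp add: coeff_prime_integral G.gr_zero)
    next
      case False
      have "coeff ?P (n - 1) \<in> gr (2 * int p - 2 * int n)"
        using G.HD[OF P, of "n - 1"] False by (simp add: of_nat_diff algebra_simps)
      then have "(1 / of_nat n) * coeff ?P (n - 1) \<in> gr (2 * int p - 2 * int n)"
        using False by (intro G.gr_scale0 scalar) auto
      then show ?thesis using False by (simp add: coeff_prime_integral mult.commute)
    qed
  qed
  have deg: "Polynomial.degree ?P \<le> 3 * m"
    using degree_mult_le[of "[:1 / h:]" "f ^ m"] degree_f_power[of m] by simp
  show "Polynomial.degree (prime_integral p ?P) \<le> 3 * m + 1"
    using degree_prime_integral[of p ?P] deg by linarith
  show "pderiv (prime_integral p ?P) = ?P - Polynomial.monom 1 (p - 1)"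
  proof (rule poly_eqI)
    fix n
    show "coeff (pderiv (prime_integral p ?P)) n = coeff (?P - Polynomial.monom 1 (p - 1)) n"
    proof (cases "p dvd Suc n")
      case False
      then have "n \<noteq> p - 1" using p_gt by auto
      then show ?thesis using False by (simp add: coeff_pderiv_prime_integral)
    next
      case True
      show ?thesis
      proof (cases "n = p - 1")
        case True
        then have "coeff ?P n = 1" using h by simp
        then show ?thesis using True p_gt by (simp add: coeff_pderiv_prime_integral)
      next
        case False
        obtain k where k: "Suc n = p * k" using \<open>p dvd Suc n\<close> by (rule dvdE)
        have "k \<noteq> 0" using k by (metis mult_0_right nat.distinct(1))
        moreover have "k \<noteq> 1" using k False by (metis diff_Suc_1 mult.right_neutral)
        ultimately have "p * 2 \<le> p * k" by (intro mult_le_mono) auto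
        then have "n > 3 * m" using k m_eq(1) p_gt by linarith
        then have "coeff ?P n = 0" using deg by (intro coeff_eq_0) simp
        then show ?thesis using True False by (simp add: coeff_pderiv_prime_integral)
      qed
    qed
  qed
qed

lemma frobenius_twist:
  "\<exists>Q\<in>G.H (6 * int p). pcompose F X = f ^ p + of_nat p * Q \<and> Polynomial.degree Q \<le> 3 * p"
proof -
  have e: "f = (Polynomial.monom 1 3 + Polynomial.monom a 1) + Polynomial.monom b 0"
    by (simp add: monom_altdef numeral_3_eq_3)
  have h1: "Polynomial.monom 1 3 \<in> G.H 6" "Polynomial.monom a 1 \<in> G.H 6" "Polynomial.monom b 0 \<in> G.H 6"
    using a b G.gr_one by (auto intro!: G.H_monom)
  obtain T1 where T1: "T1 \<in> G.H (int p * 6)"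
    "(Polynomial.monom 1 3 + Polynomial.monom a 1) ^ p = Polynomial.monom 1 3 ^ p + Polynomial.monom a 1 ^ p + of_nat p * T1"
    using G.H_power_add[OF p(1) h1(1,2)] by blast
  obtain T2 where T2: "T2 \<in> G.H (int p * 6)"
    "f ^ p = (Polynomial.monom 1 3 + Polynomial.monom a 1) ^ p + Polynomial.monom b 0 ^ p + of_nat p * T2"
    using G.H_power_add[OF p(1) G.H_add[OF h1(1,2)] h1(3)] unfolding e by blast
  let ?Q = "- (T1 + T2)"
  have "pcompose F X = Polynomial.monom 1 3 ^ p + Polynomial.monom a 1 ^ p + Polynomial.monom b 0 ^ p"
    by (simp add: pcompose_pCons monom_power mult_monom algebra_simps monom_0 numeral_3_eq_3 smult_monom poly_const_pow)
  then have eq: "pcompose F X = f ^ p + of_nat p * ?Q" unfolding T2(2) T1(2) by (simp add: algebra_simps)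
  have d1: "Polynomial.degree (pcompose F X) \<le> 3 * p"
    using degree_pcompose_le[of F X] degree_monom_le[of "1::'a" p] by (simp add: degree_monom_eq)
  \<comment> \<open>The degree of the quotient is read off from p Q = F(x^p) - f^p, where both terms
    have degree at most 3 p.\<close>
  have "of_nat p * ?Q = pcompose F X - f ^ p" using eq by simp
  then have "Polynomial.smult (of_nat p) ?Q = pcompose F X - f ^ p" by (simp add: of_nat_poly)
  then have "Polynomial.degree (Polynomial.smult (of_nat p) ?Q) \<le> 3 * p"
    using degree_diff_le[OF d1 degree_f_power[of p]] by simp
  then have "Polynomial.degree ?Q \<le> 3 * p" using p_gt by simp
  moreover have "?Q \<in> G.H (6 * int p)" using T1(1) T2(1) by (intro G.H_uminus G.H_add) (simp_all add: mult.commute)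
  ultimately show ?thesis using eq by blast
qed

text \<open>The recursion expresses \<open>c\<^sub>n\<close> by \<open>c\<^sub>0\<close>, \<open>\<lambda>\<close> and \<open>\<rho>\<close>. The factor \<open>2 n - 9\<close> of \<open>c\<^sub>n\<^sub>-\<^sub>3\<close> equals
  \<open>p\<close> at \<open>n = N + 2\<close>, so the solution may be truncated at \<open>N\<close> modulo \<open>p\<close> as soon as
  \<open>c\<^sub>N = c\<^sub>N\<^sub>+\<^sub>1 = 0\<close>, a linear system for \<open>c\<^sub>0\<close> and \<open>\<lambda>\<close> with determinant \<open>\<psi>\<^sub>N\<close>.\<close>

lemma ode_solvable:
  assumes psi: "psi a b N \<noteq> 0" "1 / psi a b N \<in> gr (4 * int N)"
  shows "\<exists>\<mu>. (\<forall>k<4. \<mu> k \<in> gr (2 * int p * int k - 6 * int p)) \<and>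
    (\<forall>\<rho>. (\<forall>k<4. \<rho> k \<in> R) \<longrightarrow> (\<exists>c\<in>RX. \<forall>j. \<exists>z\<in>R.
       coeff (pderiv c * F - [:1/2:] * (c * [:a ^ p, 0, 3:])) j =
         (\<Sum>k<4. \<rho> k * \<mu> k) * coeff F j + (if j < 4 then \<rho> j else 0) + of_nat p * z))"
proof -
  define al where "al = ode_sol (a ^ p) (b ^ p) 1 (\<lambda>_. 0)"
  define be where "be = ode_sol (a ^ p) (b ^ p) 0 (coeff F)"
  define e where "e k = ode_sol (a ^ p) (b ^ p) 0 (\<lambda>j. if j = k then 1 else 0)" for k :: nat
  have N: "N \<ge> 8" "N + 1 < p" using m_eq p by linarith+
  have B0: "b ^ p \<noteq> 0" using b by simp
  have A: "a ^ p \<in> gr (4 * int p)" using G.gr_power[OF a, of p] by (simp add: mult.commute)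
  have B: "1 / b ^ p \<in> gr (- 6 * int p)" using G.gr_power[OF b(3), of p] by (simp add: mult.commute power_divide)
  have F_gr: "coeff F j \<in> gr (6 * int p - 2 * int p * int j)" for j
    using G.gr_power[OF a, of p] G.gr_power[OF b(1), of p] G.gr_one G.gr_zero
    by (auto simp: coeff_pCons algebra_simps split: nat.splits)
  have al: "al n \<in> gr (- 2 * int p * int n)" if "n < p" for n
    using G.ode_sol_gr[OF A B, of 1 0 "\<lambda>_. 0" n] G.gr_one G.gr_zero that by (simp add: al_def)
  have be: "be n \<in> gr (2 * int p - 2 * int p * int n)" if "n < p" for n
    using G.ode_sol_gr[OF A B, of 0 "2 * int p" "coeff F" n] F_gr G.gr_zero that
    by (simp add: be_def algebra_simps)
  have e: "e k n \<in> gr (2 * int p * int k - 4 * int p - 2 * int p * int n)" if "n < p" for k n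
  proof -
    have "(if j = k then 1 else 0) \<in> gr (2 * int p * int k - 4 * int p - 2 * int p * int (Suc j) + 6 * int p)" for j
      using G.gr_one G.gr_zero by (simp add: algebra_simps)
    then show ?thesis unfolding e_def by (intro G.ode_sol_gr[OF A B] G.gr_zero that)
  qed
  \<comment> \<open>\<open>PS\<close> is the determinant at (a^p, b^p). It is congruent to the p-th
    power of \<open>psi a b N\<close>, so the p-th power \<delta> of the inverse satisfies \<delta>
    \<open>PS\<close> = 1 + p \<open>z0\<close>.\<close>
  define PS where "PS = al N * be (N + 1) - al (N + 1) * be N"
  define \<delta> where "\<delta> = (1 / psi a b N) ^ p"
  have "G.frob (- 4 * int N) (psi a b N) PS"
  proof -
    let ?al = "ode_sol a b 1 (\<lambda>_. 0)" and ?be = "ode_sol a b 0 (coeff f)"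
    have fa: "G.frob (- 2 * int n) (?al n) (al n)" if "n < p" for n
      using ode_sol_frob[of 0 1 1 "\<lambda>_. 0" "\<lambda>_. 0" n] G.frob_1 G.frob_0 that by (simp add: al_def)
    have "G.frob (6 - 2 * int j) (coeff f j) (coeff F j)" for j
      using G.frob_power[OF a] G.frob_power[OF b(1)] G.frob_0 G.frob_1
      by (auto simp: coeff_pCons split: nat.splits)
    then have fb: "G.frob (2 - 2 * int n) (?be n) (be n)" if "n < p" for n
      using ode_sol_frob[of 2 0 0 "coeff f" "coeff F" n] G.frob_0 that by (simp add: be_def)
    have ps: "psi a b N = ?al N * ?be (N + 1) - ?al (N + 1) * ?be N"
      unfolding psi_def using N b(2) by (simp add: alpha_eq_ode_sol beta_eq_ode_sol)
    have "G.frob (- 4 * int N) (?al N * ?be (N + 1)) (al N * be (N + 1))"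
      using G.frob_mult[OF fa fb, of N "N + 1"] N by (simp add: algebra_simps)
    moreover have "G.frob (- 4 * int N) (?al (N + 1) * ?be N) (al (N + 1) * be N)"
      using G.frob_mult[OF fa fb, of "N + 1" N] N by (simp add: algebra_simps)
    ultimately show ?thesis unfolding ps PS_def by (rule G.frob_diff)
  qed
  then obtain z where z: "z \<in> gr (int p * (- 4 * int N))" "PS = psi a b N ^ p + of_nat p * z" by (rule G.frobE)
  have \<delta>: "\<delta> \<in> gr (4 * int p * int N)"
    using G.gr_power[OF psi(2), of p] by (simp add: \<delta>_def algebra_simps)
  define z0 where "z0 = \<delta> * z"
  have z0: "z0 \<in> gr 0" unfolding z0_def by (rule G.gr_mult'[OF \<delta> z(1)]) simp
  have \<delta>PS: "\<delta> * PS = 1 + of_nat p * z0"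
    unfolding z(2) \<delta>_def z0_def using psi(1) by (simp add: algebra_simps power_divide)
  \<comment> \<open>Cramer's rule for c_0 \<alpha>_n + \<lambda> \<beta>_n + e_n = 0 at n = N and N
    + 1, with \<delta> in place of the inverse determinant. The number \<open>\<mu> k\<close> is the
    \<lambda> that belongs to the right-hand side X^k; it does not involve the derivatives.\<close>
  define \<mu> where "\<mu> k = \<delta> * (al (N + 1) * e k N - al N * e k (N + 1))" for k
  have "\<mu> k \<in> gr (2 * int p * int k - 6 * int p)" for k
  proof -
    have n: "N < p" "N + 1 < p" using N by auto
    have "al (N + 1) * e k N \<in> gr (2 * int p * int k - 6 * int p - 4 * int p * int N)"
      by (rule G.gr_mult'[OF al[OF n(2)] e[OF n(1)]]) (simp add: algebra_simps)
    moreover have "al N * e k (N + 1) \<in> gr (2 * int p * int k - 6 * int p - 4 * int p * int N)"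
      by (rule G.gr_mult'[OF al[OF n(1)] e[OF n(2)]]) (simp add: algebra_simps)
    ultimately have "al (N + 1) * e k N - al N * e k (N + 1) \<in> gr (2 * int p * int k - 6 * int p - 4 * int p * int N)"
      by (rule G.gr_diff)
    then show ?thesis unfolding \<mu>_def by (rule G.gr_mult'[OF \<delta>]) simp
  qed
  moreover have "\<exists>c\<in>RX. \<forall>j. \<exists>z\<in>R.
       coeff (pderiv c * F - [:1/2:] * (c * [:a ^ p, 0, 3:])) j =
         (\<Sum>k<4. \<rho> k * \<mu> k) * coeff F j + (if j < 4 then \<rho> j else 0) + of_nat p * z"
    if \<rho>: "\<forall>k<4. \<rho> k \<in> R" for \<rho> :: "nat \<Rightarrow> 'a"
  proof -
    define \<gamma> where "\<gamma> n = (\<Sum>k<4. \<rho> k * e k n)" for n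
    define lam where "lam = (\<Sum>k<4. \<rho> k * \<mu> k)"
    define c0 where "c0 = \<delta> * (be N * \<gamma> (N + 1) - be (N + 1) * \<gamma> N)"
    define rr where "rr j = lam * coeff F j + (\<Sum>k<4. \<rho> k * (if j = k then 1 else 0))" for j
    define ch where "ch = ode_sol (a ^ p) (b ^ p) c0 rr"
    have rr: "rr j = lam * coeff F j + (if j < 4 then \<rho> j else 0)" for j
    proof -
      have "(\<Sum>k<4. \<rho> k * (if j = k then 1 else 0)) = (\<Sum>k<4. if j = k then \<rho> k else 0)"
        by (intro sum.cong) auto
      also have "\<dots> = (if j < 4 then \<rho> j else 0)" by (subst sum.delta') auto
      finally show ?thesis by (simp add: rr_def)
    qed
    have lam: "lam = \<delta> * (al (N + 1) * \<gamma> N - al N * \<gamma> (N + 1))"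
      unfolding lam_def \<mu>_def \<gamma>_def by (simp add: sum_distrib_left sum_subtractf algebra_simps)
    have ch: "ch n = c0 * al n + (lam * be n + \<gamma> n)" for n
    proof -
      have "ode_sol (a ^ p) (b ^ p) (c0 * 1 + 1 * 0) (\<lambda>j. c0 * 0 + 1 * rr j) n =
          c0 * al n + 1 * ode_sol (a ^ p) (b ^ p) 0 rr n" unfolding al_def by (rule ode_sol_linear)
      moreover have "ode_sol (a ^ p) (b ^ p) (lam * 0 + 1 * 0)
          (\<lambda>j. lam * coeff F j + 1 * (\<Sum>k<4. \<rho> k * (if j = k then 1 else 0))) n =
          lam * be n + 1 * ode_sol (a ^ p) (b ^ p) 0 (\<lambda>j. \<Sum>k<4. \<rho> k * (if j = k then 1 else 0)) n"
        unfolding be_def by (rule ode_sol_linear)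
      moreover have "ode_sol (a ^ p) (b ^ p) 0 (\<lambda>j. \<Sum>k<4. \<rho> k * (if j = k then 1 else 0)) n = \<gamma> n"
        unfolding \<gamma>_def e_def by (rule ode_sol_sum)
      ultimately show ?thesis by (simp add: ch_def rr_def[abs_def])
    qed
    have \<gamma>R: "\<gamma> n \<in> R" if "n < p" for n
      unfolding \<gamma>_def using \<rho> gr_R[OF e[OF that]] by (intro R.gr_sum R_mult) auto
    have R1: "al n \<in> R" "be n \<in> R" if "n < p" for n using gr_R[OF al[OF that]] gr_R[OF be[OF that]] .
    have \<delta>R: "\<delta> \<in> R" using gr_R[OF \<delta>] .
    have lamR: "lam \<in> R" unfolding lam using N by (intro R_mult R.gr_diff \<delta>R R1 \<gamma>R) auto
    have c0R: "c0 \<in> R" unfolding c0_def using N by (intro R_mult R.gr_diff \<delta>R R1 \<gamma>R) auto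
    have chR: "ch n \<in> R" if "n < p" for n
      unfolding ch using that by (intro R.gr_add R_mult c0R lamR R1 \<gamma>R)
    \<comment> \<open>Because \<delta> inverts the determinant only up to 1 + p \<open>z0\<close>,
      the two coefficients come out as multiples of p rather than 0.\<close>
    have chN: "ch N = - of_nat p * z0 * \<gamma> N"
    proof -
      have "ch N = \<gamma> N - (\<delta> * PS) * \<gamma> N" unfolding ch c0_def lam PS_def by (simp add: algebra_simps)
      then show ?thesis unfolding \<delta>PS by (simp add: algebra_simps)
    qed
    have chN1: "ch (N + 1) = - of_nat p * z0 * \<gamma> (N + 1)"
    proof -
      have "ch (N + 1) = \<gamma> (N + 1) - (\<delta> * PS) * \<gamma> (N + 1)" unfolding ch c0_def lam PS_def by (simp add: algebra_simps)
      then show ?thesis unfolding \<delta>PS by (simp add: algebra_simps)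
    qed
    have rec: "of_nat (Suc j) * b ^ p * ch (Suc j) + of_int (2 * int j - 1) / 2 * a ^ p * ch j
      + (if j \<ge> 2 then of_int (2 * int j - 7) / 2 * ch (j - 2) else 0) = rr j" for j
    proof -
      have "of_nat (Suc j) * b ^ p \<noteq> (0::'a)" using B0 by (simp del: of_nat_Suc)
      then show ?thesis unfolding ch_def ode_sol_Suc[of _ _ _ _ j] by (simp del: of_nat_Suc)
    qed
    define c where "c = (\<Sum>n<N. Polynomial.monom (ch n) n)"
    have cc: "coeff c n = (if n < N then ch n else 0)" for n
      unfolding c_def Polynomial.coeff_sum coeff_monom by (subst sum.delta) auto
    have cR: "c \<in> RX" unfolding weighted_polys_def using cc chR N R.gr_zero by auto
    have hR: "of_int i / 2 \<in> R" for i using R_mult[OF gr_R[OF G.gr_of_int] gr_R[OF half]] by simp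
    have AR: "a ^ p \<in> R" "b ^ p \<in> R" using gr_R[OF A] gr_R[OF G.gr_power[OF b(1), of p]] .
    have nR: "of_nat i \<in> R" for i using gr_R[OF G.gr_of_nat] .
    have z0R: "z0 \<in> R" using gr_R[OF z0] .
    have "\<exists>z\<in>R. coeff (pderiv c * F - [:1/2:] * (c * [:a ^ p, 0, 3:])) j = rr j + of_nat p * z" for j
    proof -
      \<comment> \<open>Coefficient j involves c_(j+1), c_j and c_(j-2). Truncation at N drops c_N
        for j = N - 1, and c_(N+1) and c_N for j = N, all multiples of p. For j = N + 1 only c_(N-1)
        survives, with factor (2 j - 7) / 2 = p / 2; beyond that nothing is left.\<close>
      consider "Suc j < N" | "Suc j = N" | "j = N" | "j = N + 1" | "j \<ge> N + 2" by linarith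
      then show ?thesis
      proof cases
        case 1
        then have "coeff (pderiv c * F - [:1/2:] * (c * [:a ^ p, 0, 3:])) j = rr j + of_nat p * 0"
          unfolding coeff_ode rec[symmetric] by (auto simp: cc)
        then show ?thesis using R.gr_zero by blast
      next
        case 2
        let ?z = "of_nat (Suc j) * b ^ p * (z0 * \<gamma> N)"
        have "coeff (pderiv c * F - [:1/2:] * (c * [:a ^ p, 0, 3:])) j = rr j - of_nat (Suc j) * b ^ p * ch N"
          unfolding coeff_ode rec[symmetric] using 2 by (auto simp: cc)
        also have "\<dots> = rr j + of_nat p * ?z" unfolding chN by (simp add: algebra_simps)
        finally have *: "coeff (pderiv c * F - [:1/2:] * (c * [:a ^ p, 0, 3:])) j = rr j + of_nat p * ?z" .
        have "?z \<in> R" using N by (intro R_mult nR AR z0R \<gamma>R) auto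
        then show ?thesis using * by blast
      next
        case 3
        let ?z = "of_nat (Suc j) * b ^ p * (z0 * \<gamma> (N + 1)) + of_int (2 * int j - 1) / 2 * a ^ p * (z0 * \<gamma> N)"
        have "coeff (pderiv c * F - [:1/2:] * (c * [:a ^ p, 0, 3:])) j =
            rr j - of_nat (Suc j) * b ^ p * ch (N + 1) - of_int (2 * int j - 1) / 2 * a ^ p * ch N"
          unfolding coeff_ode rec[symmetric] using 3 N by (auto simp: cc)
        also have "\<dots> = rr j + of_nat p * ?z" unfolding chN chN1 by (simp add: algebra_simps add_divide_distrib diff_divide_distrib)
        finally have *: "coeff (pderiv c * F - [:1/2:] * (c * [:a ^ p, 0, 3:])) j = rr j + of_nat p * ?z" .
        have "?z \<in> R" using N by (intro R.gr_add R_mult nR AR z0R \<gamma>R hR) auto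
        then show ?thesis using * by blast
      next
        case 4
        have "2 * int j - 7 = int p" using 4 m_int by linarith
        then have "(of_int (2 * int j - 7) :: 'a) = of_nat p" by simp
        then have "coeff (pderiv c * F - [:1/2:] * (c * [:a ^ p, 0, 3:])) j = of_nat p * (1 / 2 * ch (N - 1))"
          unfolding coeff_ode using 4 N by (simp add: cc del: of_int_diff of_int_mult)
        moreover have "rr j = 0" using 4 N unfolding rr by (simp add: coeff_eq_0)
        ultimately have *: "coeff (pderiv c * F - [:1/2:] * (c * [:a ^ p, 0, 3:])) j = rr j + of_nat p * (1 / 2 * ch (N - 1))"
          by (simp only: add_0_left)
        have "1 / 2 * ch (N - 1) \<in> R" using N by (intro R_mult gr_R[OF half] chR) auto
        then show ?thesis using * by blast
      next
        case 5
        then have "coeff (pderiv c * F - [:1/2:] * (c * [:a ^ p, 0, 3:])) j = 0"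
          unfolding coeff_ode by (auto simp: cc)
        moreover have "rr j = 0" using 5 N unfolding rr by (simp add: coeff_eq_0)
        ultimately have "coeff (pderiv c * F - [:1/2:] * (c * [:a ^ p, 0, 3:])) j = rr j + of_nat p * 0"
          by (simp only: add_0_left mult_zero_right)
        then show ?thesis using R.gr_zero by blast
      qed
    qed
    then show ?thesis using cR unfolding rr lam_def by blast
  qed
  ultimately show ?thesis by blast
qed

text \<open>The second equation is Lie invariance modulo p^2 with denominators cleared. Put U =
  x^(p-1) + u'. Then d Phi(x) / p is U + p V' / f^p and Phi(y) is y^p (1 + p G / (2 f^p)), both
  modulo p^2. Equating d Phi(x) / (p Phi(y)) with \<Lambda> dx / y and multiplying by 2 f^p, with
  y^(p-1) = f^m, gives the stated form.\<close>

lemma frobenius_core: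
  assumes h: "h = coeff (f ^ m) (p - 1)" "h \<noteq> 0" "1 / h \<in> gr (1 - int p)"
    and psi: "psi a b N \<noteq> 0" "1 / psi a b N \<in> gr (4 * int N)"
  shows "\<exists>l0\<in>gr (1 - int p). \<exists>l1\<in>gr (1 - 5 * int p). \<exists>l2\<in>gr (1 - 7 * int p).
    \<exists>u\<in>RX. \<exists>V\<in>RX. \<exists>G\<in>RX. \<exists>Z\<in>RX.
      (X + of_nat p * u) ^ 3 + [:a ^ p + of_nat p * a1:] * (X + of_nat p * u) + [:b ^ p + of_nat p * b1:]
        = f ^ p + of_nat p * G \<and>
      2 * (Polynomial.monom 1 (p - 1) + pderiv u) * f ^ p + 2 * of_nat p * pderiv V
        = [:1 / h + of_nat p * (l0 + l1 * a1 + l2 * b1):] * f ^ m * (2 * f ^ p + of_nat p * G) + of_nat p ^ 2 * Z"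
proof -
  define u0 where "u0 = prime_integral p ([:1 / h:] * f ^ m)"
  note u0 = hasse_antiderivative[OF h, folded u0_def]
  obtain Q where Q: "Q \<in> G.H (6 * int p)" "pcompose F X = f ^ p + of_nat p * Q" "Polynomial.degree Q \<le> 3 * p"
    using frobenius_twist by blast
  define F' where "F' = [:a ^ p, 0, 3:]"
  have F'X: "pcompose F' X = 3 * X ^ 2 + [:a ^ p:]"
    by (simp add: F'_def pcompose_pCons power2_eq_square algebra_simps numeral_poly)
  \<comment> \<open>The part of G modulo p that involves neither c nor the derivatives
    \<open>a1\<close>, \<open>b1\<close>. It is homogeneous, unlike G itself.\<close>
  define G0 where "G0 = Q + u0 * pcompose F' X"
  have X_H: "X \<in> G.H (2 * int p)" using G.gr_one by (intro G.H_monom) simp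
  have ap: "a ^ p \<in> gr (4 * int p)" using G.gr_power[OF a, of p] by (simp add: mult.commute)
  have "X ^ 2 \<in> G.H (4 * int p)" using G.H_power[OF X_H, of 2] by simp
  then have F'H: "pcompose F' X \<in> G.H (4 * int p)"
    unfolding F'X by (intro G.H_add G.H_scale0[OF G.H_numeral] G.H_const[OF ap])
  have G0: "G0 \<in> G.H (6 * int p)" unfolding G0_def
    by (intro G.H_add Q(1) G.H_mult'[OF u0(1) F'H]) simp
  define D where "D = cartier p (f ^ m * G0)"
  have D: "coeff D k \<in> gr (7 * int p - 1 - 2 * int p * int k)" for k
  proof -
    have "f ^ m * G0 \<in> G.H (9 * int p - 3)"
      by (rule G.H_mult'[OF G.H_power[OF f_H] G0]) (use m_int in linarith)
    from G.HD[OF this, of "k * p + p - 1"] show ?thesis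
      unfolding D_def coeff_cartier[OF p_gt(1)] using p_gt by (simp add: of_nat_diff algebra_simps)
  qed
  \<comment> \<open>The degree of f^m \<open>G0\<close> is at most 3 m + (3 m + 1 + 2 p) = 5 p - 2,
    just below the exponent 5 p - 1 read by coefficient 4. Four numbers \<rho>_k therefore describe
    the right-hand side.\<close>
  have D0: "coeff D k = 0" if "k \<ge> 4" for k
  proof -
    have d1: "Polynomial.degree (pcompose F' X) \<le> 2 * p"
      using degree_pcompose_le[of F' X] degree_monom_le[of "1::'a" p] by (simp add: F'_def degree_monom_eq)
    have d2: "Polynomial.degree G0 \<le> max (3 * p) (3 * m + 1 + 2 * p)"
      unfolding G0_def using Q(3) degree_mult_le[of u0 "pcompose F' X"] u0(3) d1
      by (intro degree_add_le) (auto intro: max.coboundedI1 max.coboundedI2)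
    have "Polynomial.degree (f ^ m * G0) \<le> 3 * m + max (3 * p) (3 * m + 1 + 2 * p)"
      using degree_mult_le[of "f ^ m" G0] degree_f_power[of m] d2 by linarith
    also have "\<dots> < 4 * p + p - 1" using m_eq(1) p by linarith
    also have "\<dots> \<le> k * p + p - 1" using that by (intro diff_le_mono add_le_mono mult_le_mono) auto
    finally show ?thesis unfolding D_def coeff_cartier[OF p_gt(1)] by (rule coeff_eq_0)
  qed
  define dd where "dd k = (1 / 2) * (1 / h * coeff D k)" for k
  have dd: "dd k \<in> gr (6 * int p - 2 * int p * int k)" for k
    unfolding dd_def by (rule G.gr_scale0[OF half], rule G.gr_mult'[OF h(3) D]) simp
  \<comment> \<open>Half of the Cartier image of the terms known in advance: \<open>D / h\<close>
    from \<open>G0\<close>, and b1 + a1 X from the twist of the coefficients of the curve.\<close>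
  define \<rho> where "\<rho> k = dd k + (1 / 2) * coeff [:b1, a1:] k" for k
  have \<rho>R: "\<rho> k \<in> R" for k
    unfolding \<rho>_def using ab1 R.gr_zero
    by (intro R.gr_add R_mult gr_R[OF dd] gr_R[OF half]) (auto simp: coeff_pCons split: nat.splits)
  obtain \<mu> where \<mu>: "\<And>k. k < 4 \<Longrightarrow> \<mu> k \<in> gr (2 * int p * int k - 6 * int p)"
    and sol: "\<And>\<rho>. (\<forall>k<4. \<rho> k \<in> R) \<longrightarrow> (\<exists>c\<in>RX. \<forall>j. \<exists>z\<in>R.
       coeff (pderiv c * F - [:1/2:] * (c * F')) j =
         (\<Sum>k<4. \<rho> k * \<mu> k) * coeff F j + (if j < 4 then \<rho> j else 0) + of_nat p * z)"
    using ode_solvable[OF psi] unfolding F'_def by blast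
  define lam where "lam = (\<Sum>k<4. \<rho> k * \<mu> k)"
  obtain c where c: "c \<in> RX" and c_eq: "\<And>j. \<exists>z\<in>R.
       coeff (pderiv c * F - [:1/2:] * (c * F')) j = lam * coeff F j + (if j < 4 then \<rho> j else 0) + of_nat p * z"
    using sol[of \<rho>] \<rho>R unfolding lam_def by blast
  \<comment> \<open>\<lambda> / h split along \<rho>: the constant part comes from
    \<open>dd\<close>, while \<open>a1\<close> and \<open>b1\<close> enter through the entries 1 and
    0 of \<rho>.\<close>
  define l0 where "l0 = 1 / h * (\<Sum>k<4. dd k * \<mu> k)"
  define l1 where "l1 = 1 / h * ((1 / 2) * \<mu> 1)"
  define l2 where "l2 = 1 / h * ((1 / 2) * \<mu> 0)"
  have l0: "l0 \<in> gr (1 - int p)"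
  proof -
    have "(\<Sum>k<4. dd k * \<mu> k) \<in> gr 0" using \<mu> by (intro G.gr_sum G.gr_mult'[OF dd]) auto
    then show ?thesis unfolding l0_def by (rule G.gr_mult'[OF h(3)]) simp
  qed
  have l1: "l1 \<in> gr (1 - 5 * int p)" unfolding l1_def
    by (rule G.gr_mult'[OF h(3) G.gr_scale0[OF half \<mu>]]) auto
  have l2: "l2 \<in> gr (1 - 7 * int p)" unfolding l2_def
    by (rule G.gr_mult'[OF h(3) G.gr_scale0[OF half \<mu>]]) auto
  define L1 where "L1 = l0 + l1 * a1 + l2 * b1"
  have L1: "L1 = 1 / h * lam"
    unfolding L1_def l0_def l1_def l2_def lam_def \<rho>_def
    by (simp add: numeral_eq_Suc lessThan_Suc algebra_simps)
  have L1R: "L1 \<in> R" unfolding L1_def by (intro R.gr_add R_mult gr_R[OF l0] gr_R[OF l1] gr_R[OF l2] ab1)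
  define u where "u = u0 + pcompose c X"
  have aR: "a ^ p \<in> R" "a \<in> R" "b \<in> R" using gr_R[OF ap] gr_R[OF a] gr_R[OF b(1)] .
  have oneR: "1 \<in> R" using gr_R[OF G.gr_one] .
  have XR: "X \<in> RX" using oneR by (rule RX_monom)
  have fR: "f \<in> RX" using H_RX[OF f_H] .
  have cXR: "pcompose c X \<in> RX" using c XR by (rule RX_pcompose)
  have u0R: "u0 \<in> RX" using H_RX[OF u0(1)] .
  have uR: "u \<in> RX" unfolding u_def using u0R cXR by (rule R.H_add)
  define T where "T = 3 * X * u ^ 2 + of_nat p * u ^ 3 + [:a1:] * u"
  have TR: "T \<in> RX" unfolding T_def by (intro RX_intros XR uR ab1)
  define G where "G = Q + u * pcompose F' X + [:a1:] * X + [:b1:] + of_nat p * T"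
  have GR: "G \<in> RX" unfolding G_def by (intro RX_intros H_RX[OF Q(1)] uR H_RX[OF F'H] XR TR ab1)
  have FX: "pcompose F X = X ^ 3 + [:a ^ p:] * X + [:b ^ p:]"
    by (simp add: pcompose_pCons power3_eq_cube algebra_simps)
  have fp: "f ^ p = X ^ 3 + [:a ^ p:] * X + [:b ^ p:] - of_nat p * Q" using Q(2) unfolding FX by simp
  have e1: "(X + of_nat p * u) ^ 3 + [:a ^ p + of_nat p * a1:] * (X + of_nat p * u) + [:b ^ p + of_nat p * b1:]
        = f ^ p + of_nat p * G"
  proof -
    have s: "[:a ^ p + of_nat p * a1:] = [:a ^ p:] + of_nat p * [:a1:]"
      "[:b ^ p + of_nat p * b1:] = [:b ^ p:] + of_nat p * [:b1:]" by (simp_all add: of_nat_poly)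
    show ?thesis unfolding s fp G_def T_def F'X by (rule twist_identity)
  qed
  define cd where "cd = pcompose (pderiv c) X"
  define xp where "xp = Polynomial.monom (1::'a) (p - 1)"
  have cdR: "cd \<in> RX" unfolding cd_def by (intro RX_pcompose RX_pderiv c XR)
  have xpR: "xp \<in> RX" unfolding xp_def using oneR by (rule RX_monom)
  \<comment> \<open>The derivative of c(x^p) is p x^(p-1) c'(x^p): adding c(x^p) to
    \<open>u0\<close> keeps the equation modulo p and changes it only at the next order.\<close>
  have du: "xp + pderiv u = [:1 / h:] * f ^ m + of_nat p * (xp * cd)"
  proof -
    have "pderiv (pcompose c X) = of_nat p * (xp * cd)"
    proof -
      have "Polynomial.monom (of_nat p * 1) (p - 1) = of_nat p * xp" by (simp add: xp_def of_nat_poly smult_monom)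
      then show ?thesis unfolding pderiv_pcompose pderiv_monom cd_def[symmetric] by (simp only: mult_ac)
    qed
    then show ?thesis unfolding u_def pderiv_add u0(2) xp_def by simp
  qed
  \<comment> \<open>Inserting \<open>du\<close> into the target, cancelling the terms without p and
    dividing by p leaves 2 V' = \<open>K\<close> modulo p.\<close>
  define K where "K = 2 * [:L1:] * f ^ m * f ^ p + [:1 / h:] * f ^ m * G - 2 * xp * cd * f ^ p"
  have KR: "K \<in> RX" unfolding K_def
    by (intro RX_intros fR GR xpR cdR L1R gr_R[OF h(3)])
  have K_cart: "\<exists>z\<in>R. coeff (cartier p K) k = of_nat p * z" for k
  proof -
    define T2 where "T2 = [:1 / h:] * f ^ m * T - 2 * [:L1:] * f ^ m * Q + 2 * xp * cd * Q"
    have T2R: "T2 \<in> RX" unfolding T2_def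
      by (intro RX_intros fR TR xpR cdR L1R gr_R[OF h(3)] H_RX[OF Q(1)])
    have fp': "f ^ p = pcompose F X - of_nat p * Q" using Q(2) by simp
    have bX: "pcompose [:b1, a1:] X = [:b1:] + [:a1:] * X" by (simp add: pcompose_pCons algebra_simps)
    have G': "G = G0 + pcompose (c * F' + [:b1, a1:]) X + of_nat p * T"
      unfolding G_def u_def G0_def pcompose_add pcompose_mult bX by (simp add: algebra_simps)
    have "K = [:2 * L1:] * (f ^ m * pcompose F X) + [:1 / h:] * (f ^ m * G0)
        + [:1 / h:] * (f ^ m * pcompose (c * F' + [:b1, a1:]) X) - [:2:] * (xp * pcompose (pderiv c * F) X) + of_nat p * T2"
    proof -
      have s: "[:2 * L1:] = 2 * [:L1:]" "[:2:] = (2 :: 'a poly)" by (simp_all add: numeral_poly)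
      show ?thesis unfolding K_def fp' G' T2_def s pcompose_mult[of "pderiv c"] cd_def by (rule integrand_identity)
    qed
    then have "cartier p K = [:2 * L1:] * (F * cartier p (f ^ m)) + [:1 / h:] * D
        + [:1 / h:] * ((c * F' + [:b1, a1:]) * cartier p (f ^ m)) - [:2:] * (pderiv c * F * cartier p xp) + of_nat p * cartier p T2"
      by (simp only: cartier_add[OF p_gt(1)] cartier_diff[OF p_gt(1)] cartier_const_mult[OF p_gt(1)]
          cartier_of_nat_mult[OF p_gt(1)] cartier_pcompose[OF p_gt(1)] D_def)
    \<comment> \<open>Only k = 0 contributes, since the degree of f^m is below 2 p - 1.\<close>
    moreover have "cartier p (f ^ m) = [:h:]"
    proof (rule poly_eqI)
      fix k show "coeff (cartier p (f ^ m)) k = coeff [:h:] k"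
      proof (cases k)
        case 0
        then show ?thesis using p_gt by (simp add: coeff_cartier h(1))
      next
        case (Suc i)
        have "Polynomial.degree (f ^ m) < 1 * p + p - 1" using degree_f_power[of m] m_eq(1) p by linarith
        also have "\<dots> \<le> k * p + p - 1" using Suc by (intro diff_le_mono add_le_mono mult_le_mono) auto
        finally have "coeff (f ^ m) (k * p + p - 1) = 0" by (rule coeff_eq_0)
        then show ?thesis using p_gt Suc by (simp add: coeff_cartier)
      qed
    qed
    moreover have "cartier p xp = 1"
    proof (rule poly_eqI)
      fix k show "coeff (cartier p xp) k = coeff 1 k"
        using p_gt by (cases k) (auto simp: coeff_cartier xp_def)
    qed
    ultimately have "cartier p K = [:2 * L1:] * (F * [:h:]) + [:1 / h:] * D
        + [:1 / h:] * ((c * F' + [:b1, a1:]) * [:h:]) - [:2:] * (pderiv c * F * 1) + of_nat p * cartier p T2"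
      by simp
    also have "\<dots> = [:2 * lam:] * F + ([:1 / h:] * D + [:b1, a1:]) - [:2:] * (pderiv c * F - [:1/2:] * (c * F')) + of_nat p * cartier p T2"
    proof -
      have s: "[:2 * lam:] = [:2 * L1:] * [:h:]" "[:1 / h:] * [:h:] = 1" "[:2:] * [:1/2:] = (1 :: 'a poly)"
        using h(2) by (simp_all add: L1 one_pCons)
      have "[:1 / h:] * ((c * F' + [:b1, a1:]) * [:h:]) = ([:1 / h:] * [:h:]) * (c * F' + [:b1, a1:])"
        by (simp only: mult_ac)
      also have "\<dots> = c * F' + [:b1, a1:]" unfolding s by simp
      finally have t: "[:1 / h:] * ((c * F' + [:b1, a1:]) * [:h:]) = c * F' + [:b1, a1:]" .
      have t2: "[:2:] * (pderiv c * F - [:1/2:] * (c * F')) = [:2:] * (pderiv c * F) - c * F'"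
        unfolding right_diff_distrib mult.assoc[symmetric] s by simp
      show ?thesis unfolding s(1) t t2 by (simp only: algebra_simps mult_1_right mult_1_left)
    qed
    finally have kk: "coeff (cartier p K) k = 2 * lam * coeff F k + (1 / h * coeff D k + coeff [:b1, a1:] k)
        - 2 * coeff (pderiv c * F - [:1/2:] * (c * F')) k + of_nat p * coeff (cartier p T2) k"
      by (simp only: const_mult_coeff of_nat_mult_coeff Polynomial.coeff_add Polynomial.coeff_diff)
    obtain z where z: "z \<in> R" "coeff (pderiv c * F - [:1/2:] * (c * F')) k = lam * coeff F k + (if k < 4 then \<rho> k else 0) + of_nat p * z"
      using c_eq by blast
    have "1 / h * coeff D k + coeff [:b1, a1:] k = 2 * (if k < 4 then \<rho> k else 0)"
      using D0[of k] by (auto simp: \<rho>_def dd_def coeff_eq_0)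
    then have "coeff (cartier p K) k = of_nat p * (coeff (cartier p T2) k - 2 * z)"
      unfolding kk z(2) by (simp add: algebra_simps)
    moreover have "coeff (cartier p T2) k \<in> R" using T2R p_gt by (simp add: coeff_cartier weighted_polys_def)
    ultimately show ?thesis using z(1) gr_R[OF G.gr_numeral]
      by (intro bexI[of _ "coeff (cartier p T2) k - 2 * z"] R.gr_diff R_mult) auto
  qed
  define K2 where "K2 = [:1/2:] * K"
  define V where "V = prime_integral p K2"
  have K2R: "K2 \<in> RX" unfolding K2_def by (intro RX_intros KR gr_R[OF half])
  have VR: "V \<in> RX" unfolding weighted_polys_def
  proof (intro CollectI allI)
    fix n
    have "(1 / of_nat n) * coeff K2 (n - 1) \<in> R" if "\<not> p dvd n"
      using K2R by (intro R_mult gr_R[OF scalar[OF that]]) (simp add: weighted_polys_def)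
    then show "coeff V n \<in> R" using R.gr_zero by (simp add: V_def coeff_prime_integral)
  qed
  \<comment> \<open>\<open>K2\<close> and the derivative of V differ only at the monomials x^(kp-1).
    Their coefficients are those of the Cartier image, which was made divisible by p, so the
    quotient stays in R.\<close>
  define Z' where "Z' = [:1 / of_nat p:] * (K2 - pderiv V)"
  have Z'R: "Z' \<in> RX" unfolding weighted_polys_def
  proof (intro CollectI allI)
    fix n
    show "coeff Z' n \<in> R"
    proof (cases "p dvd Suc n")
      case False
      then show ?thesis using R.gr_zero by (simp add: Z'_def V_def coeff_pderiv_prime_integral)
    next
      case True
      then obtain k where k: "Suc n = p * k" by (rule dvdE)
      then have "k \<noteq> 0" by (metis mult_0_right nat.distinct(1))
      then obtain i where i: "k = Suc i" by (cases k) auto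
      have "Suc n = i * p + p" using k i by (simp add: algebra_simps)
      then have n: "n = i * p + p - 1" by linarith
      obtain z where z: "z \<in> R" "coeff (cartier p K) i = of_nat p * z" using K_cart by blast
      have "coeff K n = of_nat p * z" using z(2) unfolding coeff_cartier[OF p_gt(1)] n .
      then have "coeff Z' n = (1 / 2) * z" using True p_gt
        by (simp add: Z'_def V_def coeff_pderiv_prime_integral K2_def)
      then show ?thesis using R_mult[OF gr_R[OF half] z(1)] by (simp only:)
    qed
  qed
  have pZ: "pderiv V = K2 - of_nat p * Z'" unfolding Z'_def using p_gt by (simp add: of_nat_poly)
  have KK: "K = 2 * K2" unfolding K2_def by (simp add: numeral_poly)
  define Z where "Z = - (2 * Z') - [:L1:] * f ^ m * G"
  have ZR: "Z \<in> RX" unfolding Z_def by (intro RX_intros Z'R fR GR L1R)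
  have "2 * (xp + pderiv u) * f ^ p + 2 * of_nat p * pderiv V
        = [:1 / h + of_nat p * L1:] * f ^ m * (2 * f ^ p + of_nat p * G) + of_nat p ^ 2 * Z"
  proof -
    have s: "[:1 / h + of_nat p * L1:] = [:1 / h:] + of_nat p * [:L1:]" by (simp add: of_nat_poly)
    have e: "K = 2 * [:L1:] * f ^ m * f ^ p + [:1 / h:] * f ^ m * G - 2 * xp * cd * f ^ p" by (rule K_def)
    show ?thesis unfolding du s pZ Z_def by (rule integrand_identity2[OF e KK])
  qed
  then show ?thesis
    using l0 l1 l2 uR VR GR ZR e1 unfolding L1_def xp_def by blast
qed

end

section \<open>The fraction field of the jet polynomials\<close>

lemma to_fract_of_nat: "to_fract (of_nat n) = of_nat n"
  by (induction n) simp_all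

lemma to_fract_power: "to_fract (x ^ n) = to_fract x ^ n"
  by (induction n) simp_all

instance fract :: ("{idom, ring_char_0}") field_char_0
proof
  show "inj (of_nat :: nat \<Rightarrow> 'a fract)"
    by (rule injI) (metis of_nat_eq_iff to_fract_eq_iff to_fract_of_nat)
qed

lemma poly_mapping_sum_singles:
  "P = (\<Sum>m\<in>Poly_Mapping.keys P. Poly_Mapping.single m (Poly_Mapping.lookup P m))"
proof (rule poly_mapping_eqI)
  fix k
  have "Poly_Mapping.lookup (\<Sum>m\<in>Poly_Mapping.keys P. Poly_Mapping.single m (Poly_Mapping.lookup P m)) k =
    (\<Sum>m\<in>Poly_Mapping.keys P. if m = k then Poly_Mapping.lookup P m else 0)"
    unfolding lookup_sum by (intro sum.cong) (auto simp: lookup_single when_def)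
  also have "\<dots> = Poly_Mapping.lookup P k"
    by (subst sum.delta) (auto simp: in_keys_iff)
  finally show "Poly_Mapping.lookup P k =
    Poly_Mapping.lookup (\<Sum>m\<in>Poly_Mapping.keys P. Poly_Mapping.single m (Poly_Mapping.lookup P m)) k" ..
qed

lemma poly_mapping_mult_singles:
  fixes P Q :: jet_poly
  shows "P * Q = (\<Sum>m\<in>Poly_Mapping.keys P. \<Sum>n\<in>Poly_Mapping.keys Q.
    Poly_Mapping.single (m + n) (Poly_Mapping.lookup P m * Poly_Mapping.lookup Q n))"
  by (subst poly_mapping_sum_singles[of P], subst poly_mapping_sum_singles[of Q], subst sum_product)
    (simp add: mult_single)

subsection \<open>The local ring at \<open>p\<close>\<close>

text \<open>The reduced denominator divides every other one, so any representation with a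
  denominator prime to p will do.\<close>

lemma Z_loc_iff:
  assumes "prime p"
  shows "q \<in> Z_loc p \<longleftrightarrow> (\<exists>a b. \<not> int p dvd b \<and> q = of_int a / of_int b)"
proof
  assume "q \<in> Z_loc p"
  moreover obtain a b where ab: "quotient_of q = (a, b)" by (cases "quotient_of q")
  ultimately show "\<exists>a b. \<not> int p dvd b \<and> q = of_int a / of_int b"
    using quotient_of_div[OF ab] by (auto simp: Z_loc_def)
next
  assume "\<exists>a b. \<not> int p dvd b \<and> q = of_int a / of_int b"
  then obtain a b where ab: "\<not> int p dvd b" "q = of_int a / of_int b" by blast
  obtain c d where cd: "quotient_of q = (c, d)" by (cases "quotient_of q")
  have d: "d > 0" "coprime c d" "q = of_int c / of_int d"
    using quotient_of_denom_pos[OF cd] quotient_of_coprime[OF cd] quotient_of_div[OF cd] .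
  have b: "b \<noteq> 0" using ab by auto
  have "(of_int c * of_int b :: rat) = of_int a * of_int d" using ab d b by (simp add: field_simps)
  then have "c * b = a * d" by (metis of_int_eq_iff of_int_mult)
  then have "d dvd c * b" by simp
  then have "d dvd b" using d(2) by (simp add: coprime_commute coprime_dvd_mult_right_iff)
  then have "\<not> int p dvd d" using ab(1) dvd_trans by blast
  then show "q \<in> Z_loc p" using cd by (simp add: Z_loc_def)
qed

lemma Z_loc_closed:
  assumes p: "prime p" and x: "x \<in> Z_loc p" and y: "y \<in> Z_loc p"
  shows "x + y \<in> Z_loc p" "x * y \<in> Z_loc p"
proof -
  obtain a b where ab: "\<not> int p dvd b" "x = of_int a / of_int b" using x Z_loc_iff[OF p] by blast
  obtain c d where cd: "\<not> int p dvd d" "y = of_int c / of_int d" using y Z_loc_iff[OF p] by blast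
  have bd: "\<not> int p dvd b * d" using p ab cd by (simp add: prime_dvd_mult_iff)
  have nz: "b \<noteq> 0" "d \<noteq> 0" using ab cd by auto
  have "x + y = of_int (a * d + c * b) / of_int (b * d)" using ab cd nz by (simp add: field_simps)
  then show "x + y \<in> Z_loc p" using bd Z_loc_iff[OF p] by blast
  have "x * y = of_int (a * c) / of_int (b * d)" using ab cd by simp
  then show "x * y \<in> Z_loc p" using bd Z_loc_iff[OF p] by blast
qed

lemma Z_loc_of_int: "prime p \<Longrightarrow> of_int n \<in> Z_loc p"
  using Z_loc_iff[of p "of_int n"] by (metis div_by_1 not_prime_unit of_int_1 prime_nat_int_transfer)

lemma Z_loc_inverse: "prime p \<Longrightarrow> \<not> p dvd n \<Longrightarrow> 1 / of_nat n \<in> Z_loc p"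
  using Z_loc_iff[of p "1 / of_nat n"] by (metis int_dvd_int_iff of_int_1 of_int_of_nat_eq)

subsection \<open>Subrings of a field\<close>

definition field_subring :: "'a::field set \<Rightarrow> 'a ring" where
  "field_subring A = \<lparr>carrier = A, mult = (*), one = 1, zero = 0, add = (+)\<rparr>"

locale closed_subset =
  fixes A :: "'a::field set"
  assumes one: "1 \<in> A" and add: "x \<in> A \<Longrightarrow> y \<in> A \<Longrightarrow> x + y \<in> A"
    and uminus: "x \<in> A \<Longrightarrow> - x \<in> A" and mult: "x \<in> A \<Longrightarrow> y \<in> A \<Longrightarrow> x * y \<in> A"
begin

lemma zero: "0 \<in> A" using add[OF one uminus[OF one]] by simp

lemma power: "x \<in> A \<Longrightarrow> x ^ n \<in> A"
  by (induction n) (auto simp: one mult)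

lemma of_nat: "of_nat n \<in> A"
  by (induction n) (auto simp: zero one add)

lemma cring_field_subring: "cring (field_subring A)"
proof (intro cringI abelian_groupI comm_monoidI)
  fix x assume "x \<in> carrier (field_subring A)"
  then show "\<exists>y\<in>carrier (field_subring A). y \<oplus>\<^bsub>field_subring A\<^esub> x = \<zero>\<^bsub>field_subring A\<^esub>"
    using uminus by (intro bexI[of _ "- x"]) (auto simp: field_subring_def)
qed (auto simp: field_subring_def one add mult zero algebra_simps)

lemma field_subring_simps [simp]:
  "carrier (field_subring A) = A" "x \<otimes>\<^bsub>field_subring A\<^esub> y = x * y" "x \<oplus>\<^bsub>field_subring A\<^esub> y = x + y"
  "\<one>\<^bsub>field_subring A\<^esub> = 1" "\<zero>\<^bsub>field_subring A\<^esub> = 0"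
  by (simp_all add: field_subring_def)

lemma field_subring_pow: "x [^]\<^bsub>field_subring A\<^esub> (n::nat) = x ^ n"
proof -
  interpret cring "field_subring A" by (rule cring_field_subring)
  show ?thesis by (induction n) (simp_all add: mult.commute)
qed

lemma field_subring_add_pow: "[(n::nat)] \<cdot>\<^bsub>field_subring A\<^esub> x = of_nat n * x"
proof -
  interpret cring "field_subring A" by (rule cring_field_subring)
  show ?thesis by (induction n) (simp_all add: algebra_simps)
qed

end

lemma localization_universal:
  assumes A: "closed_subset A" and D: "D \<in> A" "D \<noteq> 0" and C: "cring C"
    and h: "h \<in> ring_hom (field_subring A) C" and u: "u \<in> carrier C" "h D \<otimes>\<^bsub>C\<^esub> u = \<one>\<^bsub>C\<^esub>"
  shows "\<exists>h'\<in>ring_hom (field_subring {x / D ^ k | x k. x \<in> A}) C. \<forall>x\<in>A. h' x = h x"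
proof -
  interpret A: closed_subset A by fact
  interpret C: cring C by fact
  let ?M = "{x / D ^ k | x k. x \<in> A}"
  interpret h: ring_hom_cring "field_subring A" C h by (intro ring_hom_cringI A.cring_field_subring C h)
  have hc: "h x \<in> carrier C" if "x \<in> A" for x using h.hom_closed that by simp
  have hm: "h (x * y) = h x \<otimes>\<^bsub>C\<^esub> h y" if "x \<in> A" "y \<in> A" for x y using h.hom_mult[of x y] that by simp
  have ha: "h (x + y) = h x \<oplus>\<^bsub>C\<^esub> h y" if "x \<in> A" "y \<in> A" for x y using h.hom_add[of x y] that by simp
  have hp: "h (x ^ k) = h x [^]\<^bsub>C\<^esub> k" if "x \<in> A" for x and k :: nat
    using h.hom_pow[of x k] that by (simp add: A.field_subring_pow)
  have Du: "h (D ^ k) \<otimes>\<^bsub>C\<^esub> u [^]\<^bsub>C\<^esub> k = \<one>\<^bsub>C\<^esub>" for k :: nat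
    using D u hc C.nat_pow_distrib[of "h D" u k] by (simp add: hp)
  \<comment> \<open>Independence of the chosen fraction: from x D^l = y D^k, multiply by the powers
    of \<open>u\<close> that invert both images of powers of D.\<close>
  have key: "h x \<otimes>\<^bsub>C\<^esub> u [^]\<^bsub>C\<^esub> k = h y \<otimes>\<^bsub>C\<^esub> u [^]\<^bsub>C\<^esub> l"
    if "x \<in> A" "y \<in> A" "x / D ^ k = y / D ^ l" for x y k l
  proof -
    have e: "x * D ^ l = y * D ^ k" using that(3) D(2) by (simp add: field_simps)
    have c: "h x \<in> carrier C" "h y \<in> carrier C" "u [^]\<^bsub>C\<^esub> k \<in> carrier C" "u [^]\<^bsub>C\<^esub> l \<in> carrier C"
      "h (D ^ k) \<in> carrier C" "h (D ^ l) \<in> carrier C"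
      using that u hc D A.power by auto
    have "h x \<otimes>\<^bsub>C\<^esub> u [^]\<^bsub>C\<^esub> k = h x \<otimes>\<^bsub>C\<^esub> u [^]\<^bsub>C\<^esub> k \<otimes>\<^bsub>C\<^esub> (h (D ^ l) \<otimes>\<^bsub>C\<^esub> u [^]\<^bsub>C\<^esub> l)"
      using c by (simp only: Du) simp
    also have "\<dots> = h (x * D ^ l) \<otimes>\<^bsub>C\<^esub> (u [^]\<^bsub>C\<^esub> k \<otimes>\<^bsub>C\<^esub> u [^]\<^bsub>C\<^esub> l)"
      using c that A.power[OF D(1)] by (simp add: hm C.m_ac)
    also have "\<dots> = h y \<otimes>\<^bsub>C\<^esub> u [^]\<^bsub>C\<^esub> l \<otimes>\<^bsub>C\<^esub> (h (D ^ k) \<otimes>\<^bsub>C\<^esub> u [^]\<^bsub>C\<^esub> k)"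
      unfolding e using c that A.power[OF D(1)] by (simp add: hm C.m_ac)
    also have "\<dots> = h y \<otimes>\<^bsub>C\<^esub> u [^]\<^bsub>C\<^esub> l" using c by (simp only: Du) simp
    finally show ?thesis .
  qed
  define h' where "h' r = (SOME z. \<exists>x\<in>A. \<exists>k. r = x / D ^ k \<and> z = h x \<otimes>\<^bsub>C\<^esub> u [^]\<^bsub>C\<^esub> k)" for r
  have h': "h' (x / D ^ k) = h x \<otimes>\<^bsub>C\<^esub> u [^]\<^bsub>C\<^esub> k" if x: "x \<in> A" for x and k :: nat
    unfolding h'_def
  proof (rule some_equality)
    show "\<exists>x'\<in>A. \<exists>k'. x / D ^ k = x' / D ^ k' \<and> h x \<otimes>\<^bsub>C\<^esub> u [^]\<^bsub>C\<^esub> k = h x' \<otimes>\<^bsub>C\<^esub> u [^]\<^bsub>C\<^esub> k'"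
      using x by blast
  next
    fix z assume "\<exists>x'\<in>A. \<exists>k'. x / D ^ k = x' / D ^ k' \<and> z = h x' \<otimes>\<^bsub>C\<^esub> u [^]\<^bsub>C\<^esub> k'"
    then obtain x' k' where "x' \<in> A" "x / D ^ k = x' / D ^ k'" "z = h x' \<otimes>\<^bsub>C\<^esub> u [^]\<^bsub>C\<^esub> k'" by blast
    then show "z = h x \<otimes>\<^bsub>C\<^esub> u [^]\<^bsub>C\<^esub> k" using key[OF x, of x' k k'] by simp
  qed
  have h'A: "h' x = h x" if "x \<in> A" for x using h'[OF that, of 0] hc[OF that] by simp
  have "h' \<in> ring_hom (field_subring ?M) C"
  proof (rule ring_hom_memI)
    fix r assume "r \<in> carrier (field_subring ?M)"
    then obtain x k where x: "x \<in> A" "r = x / D ^ k" by (auto simp: field_subring_def)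
    show "h' r \<in> carrier C" using x h' hc u by simp
    fix s assume "s \<in> carrier (field_subring ?M)"
    then obtain y l where y: "y \<in> A" "s = y / D ^ l" by (auto simp: field_subring_def)
    have c: "h x \<in> carrier C" "h y \<in> carrier C" "u [^]\<^bsub>C\<^esub> k \<in> carrier C" "u [^]\<^bsub>C\<^esub> l \<in> carrier C"
      "h (D ^ k) \<in> carrier C" "h (D ^ l) \<in> carrier C"
      using x y u hc D A.power by auto
    have "r * s = (x * y) / D ^ (k + l)" using x y by (simp add: power_add)
    then have "h' (r * s) = h (x * y) \<otimes>\<^bsub>C\<^esub> u [^]\<^bsub>C\<^esub> (k + l)"
      using x y by (simp only:) (intro h' A.mult)
    also have "\<dots> = h' r \<otimes>\<^bsub>C\<^esub> h' s" using x y c u by (simp add: h' hm C.nat_pow_mult[symmetric] C.m_ac)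
    finally show "h' (r \<otimes>\<^bsub>field_subring ?M\<^esub> s) = h' r \<otimes>\<^bsub>C\<^esub> h' s" by (simp add: field_subring_def)
    have "r + s = (x * D ^ l + y * D ^ k) / D ^ (k + l)"
      unfolding x(2) y(2) using D(2) by (simp add: field_simps power_add)
    then have "h' (r + s) = h (x * D ^ l + y * D ^ k) \<otimes>\<^bsub>C\<^esub> u [^]\<^bsub>C\<^esub> (k + l)"
      using x y by (simp only:) (intro h' A.add A.mult A.power D)
    also have "\<dots> = h x \<otimes>\<^bsub>C\<^esub> u [^]\<^bsub>C\<^esub> k \<otimes>\<^bsub>C\<^esub> (h (D ^ l) \<otimes>\<^bsub>C\<^esub> u [^]\<^bsub>C\<^esub> l)
        \<oplus>\<^bsub>C\<^esub> h y \<otimes>\<^bsub>C\<^esub> u [^]\<^bsub>C\<^esub> l \<otimes>\<^bsub>C\<^esub> (h (D ^ k) \<otimes>\<^bsub>C\<^esub> u [^]\<^bsub>C\<^esub> k)"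
      using x y c u A.power[OF D(1)] A.mult
      by (simp add: ha hm C.nat_pow_mult[symmetric] C.l_distr C.r_distr C.m_ac)
    also have "\<dots> = h' r \<oplus>\<^bsub>C\<^esub> h' s" using x y c by (simp only: Du h') simp
    finally show "h' (r \<oplus>\<^bsub>field_subring ?M\<^esub> s) = h' r \<oplus>\<^bsub>C\<^esub> h' s" by (simp add: field_subring_def)
  next
    show "h' \<one>\<^bsub>field_subring ?M\<^esub> = \<one>\<^bsub>C\<^esub>" using h'A[OF A.one] h.hom_one by (simp add: field_subring_def)
  qed
  then show ?thesis using h'A by blast
qed

section \<open>Constants and substitution in jet polynomials\<close>

definition jet_const :: "rat \<Rightarrow> jet_frac" where
  "jet_const c = to_fract (Poly_Mapping.single 0 c)"

lemma jet_const_add: "jet_const (c + d) = jet_const c + jet_const d"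
  by (simp add: jet_const_def single_add)

lemma jet_const_mult: "jet_const (c * d) = jet_const c * jet_const d"
  by (simp add: jet_const_def mult_single flip: to_fract_mult)

lemma jet_const_0: "jet_const 0 = 0" and jet_const_1: "jet_const 1 = 1"
  by (simp_all add: jet_const_def)

lemma jet_const_of_int: "jet_const (of_int n) = of_int n"
proof -
  have "jet_const (of_nat n) = of_nat n" for n
    by (induction n) (simp_all add: jet_const_0 jet_const_1 jet_const_add)
  moreover have "jet_const (- c) = - jet_const c" for c
    using jet_const_add[of c "- c"] by (simp add: jet_const_0 eq_neg_iff_add_eq_0 add.commute)
  ultimately show ?thesis by (cases n rule: int_cases2) simp_all
qed

lemma jet_const_divide:
  assumes "b \<noteq> 0"
  shows "jet_const (of_int a / of_int b) = of_int a / of_int b"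
proof -
  have "jet_const (of_int a / of_int b) * of_int b = of_int a"
    using assms by (simp flip: jet_const_of_int jet_const_mult)
  then show ?thesis using assms by (simp add: field_simps)
qed

text \<open>The sign is moved to the numerator, leaving 1 / n with n a natural number, the form in
  which scalars are assumed invertible elsewhere.\<close>

lemma Z_loc_jet_const:
  assumes "prime p" "c \<in> Z_loc p"
  obtains a b where "\<not> p dvd b" "jet_const c = of_int a * (1 / of_nat b)"
proof -
  obtain a b where ab: "\<not> int p dvd b" "c = of_int a / of_int b" using assms Z_loc_iff by blast
  have b: "b \<noteq> 0" using ab by auto
  have eq: "jet_const c = of_int a / of_int b" using ab b by (simp add: jet_const_divide)
  show ?thesis
  proof (cases "b > 0")
    case True
    then obtain n where n: "b = int n" by (metis nonneg_int_cases order_less_imp_le)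
    show ?thesis by (rule that[of n a]) (use ab eq n in simp_all)
  next
    case False
    then obtain n where n: "b = - int n" by (metis nonpos_int_cases not_le_imp_less less_imp_le linorder_not_less)
    show ?thesis by (rule that[of n "- a"]) (use ab eq n in simp_all)
  qed
qed

definition jet_monom :: "(nat \<Rightarrow> jet_frac) \<Rightarrow> (nat \<Rightarrow>\<^sub>0 nat) \<Rightarrow> jet_frac" where
  "jet_monom g m = (\<Prod>v\<in>Poly_Mapping.keys m. g v ^ Poly_Mapping.lookup m v)"

lemma jet_monom_superset:
  assumes "finite S" "Poly_Mapping.keys m \<subseteq> S"
  shows "jet_monom g m = (\<Prod>v\<in>S. g v ^ Poly_Mapping.lookup m v)"
  unfolding jet_monom_def by (rule prod.mono_neutral_left) (use assms in \<open>auto simp: in_keys_iff\<close>)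

lemma jet_monom_add: "jet_monom g (m + n) = jet_monom g m * jet_monom g n"
proof -
  let ?S = "Poly_Mapping.keys m \<union> Poly_Mapping.keys n"
  have "jet_monom g (m + n) = (\<Prod>v\<in>?S. g v ^ Poly_Mapping.lookup (m + n) v)"
    by (rule jet_monom_superset) (use keys_add[of m n] in auto)
  also have "\<dots> = (\<Prod>v\<in>?S. g v ^ Poly_Mapping.lookup m v) * (\<Prod>v\<in>?S. g v ^ Poly_Mapping.lookup n v)"
    by (simp add: lookup_add power_add prod.distrib)
  finally show ?thesis by (simp flip: jet_monom_superset)
qed

definition jet_eval :: "(nat \<Rightarrow> jet_frac) \<Rightarrow> jet_poly \<Rightarrow> jet_frac" where
  "jet_eval g P = (\<Sum>m\<in>Poly_Mapping.keys P. jet_const (Poly_Mapping.lookup P m) * jet_monom g m)"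

lemma jet_eval_add: "jet_eval g (P + Q) = jet_eval g P + jet_eval g Q"
  unfolding jet_eval_def
  by (rule setsum_keys_plus_distrib[where f = "\<lambda>m c. jet_const c * jet_monom g m"])
    (simp_all add: jet_const_0 jet_const_add algebra_simps)

lemma jet_eval_single: "jet_eval g (Poly_Mapping.single m c) = jet_const c * jet_monom g m"
  by (simp add: jet_eval_def jet_const_0)

lemma jet_eval_0: "jet_eval g 0 = 0"
  by (simp add: jet_eval_def)

lemma jet_eval_sum: "jet_eval g (sum f A) = (\<Sum>i\<in>A. jet_eval g (f i))"
  by (induction A rule: infinite_finite_induct) (simp_all add: jet_eval_0 jet_eval_add)

lemma jet_eval_mult: "jet_eval g (P * Q) = jet_eval g P * jet_eval g Q"
proof -
  have "jet_eval g (P * Q) = (\<Sum>m\<in>Poly_Mapping.keys P. \<Sum>n\<in>Poly_Mapping.keys Q.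
      (jet_const (Poly_Mapping.lookup P m) * jet_monom g m) * (jet_const (Poly_Mapping.lookup Q n) * jet_monom g n))"
    by (subst poly_mapping_mult_singles)
      (simp add: jet_eval_sum jet_eval_single jet_monom_add jet_const_mult mult_ac)
  then show ?thesis by (simp add: jet_eval_def sum_product)
qed

lemma jet_eval_1: "jet_eval g 1 = 1"
  using jet_eval_single[of g 0 1] by (simp add: jet_const_1 jet_monom_def)

lemma jet_eval_var: "jet_eval g (Poly_Mapping.single (Poly_Mapping.single v 1) 1) = g v"
  by (simp add: jet_eval_single jet_const_1 jet_monom_def)

text \<open>The embedding is itself a substitution, so one argument by variables and constants
  serves both the embedding and the lift of Frobenius.\<close>

lemma to_fract_eq_jet_eval: "to_fract P = jet_eval jet_var P"
proof -
  have mon: "to_fract (Poly_Mapping.single m 1) = jet_monom jet_var m" for m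
  proof -
    have pw: "Poly_Mapping.single (Poly_Mapping.single v k) (1::rat) = Poly_Mapping.single (Poly_Mapping.single v 1) 1 ^ k" for v k :: nat
    proof (induction k)
      case (Suc k)
      have "Poly_Mapping.single v (Suc k) = Poly_Mapping.single v 1 + Poly_Mapping.single v k"
        by (simp flip: single_add)
      then have "Poly_Mapping.single (Poly_Mapping.single v (Suc k)) (1::rat) =
          Poly_Mapping.single (Poly_Mapping.single v 1) 1 * Poly_Mapping.single (Poly_Mapping.single v k) 1"
        by (simp only: mult_single mult_1_left)
      then show ?case using Suc by (simp only: power_Suc)
    qed simp
    have "to_fract (Poly_Mapping.single (\<Sum>v\<in>A. Poly_Mapping.single v (k v)) 1) = (\<Prod>v\<in>A. jet_var v ^ k v)"
      if "finite A" for A :: "nat set" and k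
      using that
    proof (induction A rule: finite_induct)
      case (insert v A)
      have "Poly_Mapping.single (\<Sum>v\<in>insert v A. Poly_Mapping.single v (k v)) (1::rat) =
        Poly_Mapping.single (Poly_Mapping.single v (k v)) 1 * Poly_Mapping.single (\<Sum>v\<in>A. Poly_Mapping.single v (k v)) 1"
        using insert by (simp add: mult_single)
      then show ?case using insert by (simp only: to_fract_mult pw[of v "k v"] to_fract_power jet_var_def) simp
    qed simp
    from this[OF finite_keys[of m], of "Poly_Mapping.lookup m"] show ?thesis
      unfolding poly_mapping_sum_singles[of m, symmetric] jet_monom_def .
  qed
  have s: "to_fract (Poly_Mapping.single m c) = jet_const c * jet_monom jet_var m" for m c
    using mult_single[of 0 c m 1] by (simp add: jet_const_def flip: mon to_fract_mult)
  have "to_fract P = (\<Sum>m\<in>Poly_Mapping.keys P. to_fract (Poly_Mapping.single m (Poly_Mapping.lookup P m)))"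
    by (subst poly_mapping_sum_singles[of P]) (simp add: to_fract_sum)
  then show ?thesis by (simp add: s jet_eval_def)
qed

subsection \<open>Polynomials with \<open>p\<close>-integral coefficients\<close>

lemma jet_polys_iff:
  assumes "prime p"
  shows "P \<in> jet_polys p r \<longleftrightarrow> (\<forall>m\<in>Poly_Mapping.keys P.
    Poly_Mapping.lookup P m \<in> Z_loc p \<and> (\<forall>v\<in>Poly_Mapping.keys m. v div 2 \<le> r))"
  unfolding jet_polys_def using Z_loc_of_int[OF assms, of 0] by (auto simp: in_keys_iff)

lemma jet_polys_mono: "r \<le> s \<Longrightarrow> jet_polys p r \<subseteq> jet_polys p s"
  by (fastforce simp: jet_polys_def)

lemma jet_polys_single:
  assumes "prime p" "c \<in> Z_loc p" "\<forall>v\<in>Poly_Mapping.keys m. v div 2 \<le> r"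
  shows "Poly_Mapping.single m c \<in> jet_polys p r"
  using assms by (auto simp: jet_polys_iff split: if_splits)

lemma jet_polys_add:
  assumes "prime p" "P \<in> jet_polys p r" "Q \<in> jet_polys p r"
  shows "P + Q \<in> jet_polys p r"
  using assms keys_add[of P Q] Z_loc_closed(1)[OF assms(1)] unfolding jet_polys_def
  by (auto simp: lookup_add)

lemma jet_polys_sum:
  assumes "prime p" "\<And>i. i \<in> A \<Longrightarrow> f i \<in> jet_polys p r"
  shows "sum f A \<in> jet_polys p r"
proof -
  have "0 \<in> jet_polys p r" using assms(1) by (simp add: jet_polys_iff)
  then show ?thesis using assms(2)
    by (induction A rule: infinite_finite_induct) (auto intro: jet_polys_add[OF assms(1)])
qed

lemma jet_polys_mult:
  assumes "prime p" "P \<in> jet_polys p r" "Q \<in> jet_polys p r"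
  shows "P * Q \<in> jet_polys p r"
  unfolding poly_mapping_mult_singles
proof (intro jet_polys_sum jet_polys_single assms(1))
  fix m n assume mn: "m \<in> Poly_Mapping.keys P" "n \<in> Poly_Mapping.keys Q"
  show "Poly_Mapping.lookup P m * Poly_Mapping.lookup Q n \<in> Z_loc p"
    using assms mn by (intro Z_loc_closed(2)) (auto simp: jet_polys_def)
  show "\<forall>v\<in>Poly_Mapping.keys (m + n). v div 2 \<le> r"
  proof
    fix v assume "v \<in> Poly_Mapping.keys (m + n)"
    then have "v \<in> Poly_Mapping.keys m \<union> Poly_Mapping.keys n" using keys_add[of m n] by blast
    then show "v div 2 \<le> r" using assms mn unfolding jet_polys_def by blast
  qed
qed

abbreviation jet_poly_ring :: "nat \<Rightarrow> nat \<Rightarrow> jet_frac set" where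
  "jet_poly_ring p r \<equiv> to_fract ` jet_polys p r"

lemma jet_const_in: "prime p \<Longrightarrow> c \<in> Z_loc p \<Longrightarrow> jet_const c \<in> jet_poly_ring p r"
  unfolding jet_const_def by (intro imageI jet_polys_single) auto

lemma closed_jet_polys:
  assumes p: "prime p"
  shows "closed_subset (jet_poly_ring p r)"
proof
  show "1 \<in> jet_poly_ring p r" using jet_const_in[OF p Z_loc_of_int[OF p, of 1]] jet_const_1 by simp
  have m1: "- 1 \<in> jet_poly_ring p r"
    using jet_const_in[OF p Z_loc_of_int[OF p, of "- 1"]] jet_const_of_int[of "- 1"] by simp
  show m: "x * y \<in> jet_poly_ring p r" if "x \<in> jet_poly_ring p r" "y \<in> jet_poly_ring p r" for x y
    using that jet_polys_mult[OF p] by (auto simp flip: to_fract_mult)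
  show "x + y \<in> jet_poly_ring p r" if "x \<in> jet_poly_ring p r" "y \<in> jet_poly_ring p r" for x y
    using that jet_polys_add[OF p] by (auto simp flip: to_fract_add)
  show "- x \<in> jet_poly_ring p r" if "x \<in> jet_poly_ring p r" for x
    using m[OF m1 that] by simp
qed

lemma jet_var_in: "prime p \<Longrightarrow> v div 2 \<le> r \<Longrightarrow> jet_var v \<in> jet_poly_ring p r"
  unfolding jet_var_def using Z_loc_of_int[of p 1] by (intro imageI jet_polys_single) auto

lemma jet_scalar_in: "prime p \<Longrightarrow> \<not> p dvd n \<Longrightarrow> 1 / of_nat n \<in> jet_poly_ring p r"
proof -
  assume p: "prime p" "\<not> p dvd n"
  then have n: "int n \<noteq> 0" by (cases n) auto
  have "jet_const (1 / of_nat n) = 1 / of_nat n" using jet_const_divide[OF n, of 1] by simp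
  then show ?thesis using jet_const_in[OF p(1) Z_loc_inverse[OF p]] by metis
qed

text \<open>For \<open>g = jet_var\<close> it says that the variables and the scalars 1/n with n
  prime to p generate the jet polynomials, which is how two Frobenius lifts are compared.\<close>

lemma jet_eval_closed:
  assumes p: "prime p" and A: "closed_subset A" and P: "P \<in> jet_polys p r"
    and sc: "\<And>n. \<not> p dvd n \<Longrightarrow> 1 / of_nat n \<in> A" and g: "\<And>v. v div 2 \<le> r \<Longrightarrow> g v \<in> A"
  shows "jet_eval g P \<in> A"
proof -
  interpret A: closed_subset A by fact
  have s: "sum f I \<in> A" if "\<And>i. i \<in> I \<Longrightarrow> f i \<in> A" for f and I :: "(nat \<Rightarrow>\<^sub>0 nat) set"
    using that by (induction I rule: infinite_finite_induct) (auto intro: A.zero A.add)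
  have pr: "prod f I \<in> A" if "\<And>i. i \<in> I \<Longrightarrow> f i \<in> A" for f and I :: "nat set"
    using that by (induction I rule: infinite_finite_induct) (auto intro: A.one A.mult)
  have oi: "of_int n \<in> A" for n
    by (cases n rule: int_cases2) (auto intro: A.of_nat A.uminus)
  show ?thesis unfolding jet_eval_def
  proof (intro s A.mult)
    fix m assume m: "m \<in> Poly_Mapping.keys P"
    show "jet_monom g m \<in> A" unfolding jet_monom_def
      using m P g by (intro pr A.power) (auto simp: jet_polys_def)
    have "Poly_Mapping.lookup P m \<in> Z_loc p" using P by (simp add: jet_polys_def)
    then obtain a b where "\<not> p dvd b" "jet_const (Poly_Mapping.lookup P m) = of_int a * (1 / of_nat b)"
      using Z_loc_jet_const[OF p] by blast
    then show "jet_const (Poly_Mapping.lookup P m) \<in> A" using A.mult[OF oi sc] by simp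
  qed
qed

subsection \<open>Weights\<close>

lemma isobaric_mult:
  assumes "isobaric p a P" "isobaric p b Q"
  shows "isobaric p (a + b) (P * Q)"
  unfolding isobaric_def
proof
  fix k assume "k \<in> Poly_Mapping.keys (P * Q)"
  then obtain m n where k: "k = m + n" "m \<in> Poly_Mapping.keys P" "n \<in> Poly_Mapping.keys Q"
    using keys_mult[of P Q] by auto
  show "(\<Sum>v\<in>Poly_Mapping.keys k. Poly_Mapping.lookup k v * weak_var_weight p v) = a + b"
    using assms k setsum_keys_plus_distrib[of "\<lambda>v c. c * weak_var_weight p v" m n]
    by (simp add: isobaric_def algebra_simps)
qed

lemma isobaric_add: "isobaric p a P \<Longrightarrow> isobaric p a Q \<Longrightarrow> isobaric p a (P + Q)"
  using keys_add[of P Q] by (auto simp: isobaric_def)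

lemma isobaric_const: "isobaric p 0 (Poly_Mapping.single 0 c)"
  by (auto simp: isobaric_def)

lemma weak_weight_add:
  assumes "weak_weight p w x" "weak_weight p w y"
  shows "weak_weight p w (x + y)"
proof -
  obtain P Q a b where x: "Q \<noteq> 0" "isobaric p a P" "isobaric p b Q" "x = to_fract P / to_fract Q" "w = int a - int b"
    using assms(1) by (auto simp: weak_weight_def)
  obtain P' Q' a' b' where y: "Q' \<noteq> 0" "isobaric p a' P'" "isobaric p b' Q'" "y = to_fract P' / to_fract Q'" "w = int a' - int b'"
    using assms(2) by (auto simp: weak_weight_def)
  have "a + b' = a' + b" using x(5) y(5) by linarith
  then have "isobaric p (a + b') (P * Q' + P' * Q)"
    using isobaric_mult[OF x(2) y(3)] isobaric_mult[OF y(2) x(3)] by (intro isobaric_add) simp_all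
  moreover have "x + y = to_fract (P * Q' + P' * Q) / to_fract (Q * Q')" using x y by (simp add: field_simps)
  moreover have "isobaric p (b + b') (Q * Q')" using x y by (intro isobaric_mult)
  moreover have "w = int (a + b') - int (b + b')" using x by simp
  ultimately show ?thesis unfolding weak_weight_def using x(1) y(1) by (metis mult_eq_0_iff)
qed

lemma weak_weight_mult:
  assumes "weak_weight p v x" "weak_weight p w y"
  shows "weak_weight p (v + w) (x * y)"
proof -
  obtain P Q a b where x: "Q \<noteq> 0" "isobaric p a P" "isobaric p b Q" "x = to_fract P / to_fract Q" "v = int a - int b"
    using assms(1) by (auto simp: weak_weight_def)
  obtain P' Q' a' b' where y: "Q' \<noteq> 0" "isobaric p a' P'" "isobaric p b' Q'" "y = to_fract P' / to_fract Q'" "w = int a' - int b'"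
    using assms(2) by (auto simp: weak_weight_def)
  have "x * y = to_fract (P * P') / to_fract (Q * Q')" using x y by simp
  moreover have "v + w = int (a + a') - int (b + b')" using x y by simp
  ultimately show ?thesis unfolding weak_weight_def using x(1-3) y(1-3) isobaric_mult by (metis mult_eq_0_iff)
qed

lemma weak_weight_inverse:
  assumes "weak_weight p w x" "x \<noteq> 0"
  shows "weak_weight p (- w) (1 / x)"
proof -
  obtain P Q a b where x: "Q \<noteq> 0" "isobaric p a P" "isobaric p b Q" "x = to_fract P / to_fract Q" "w = int a - int b"
    using assms(1) by (auto simp: weak_weight_def)
  have "P \<noteq> 0" using assms(2) x(4) by auto
  moreover have "1 / x = to_fract Q / to_fract P" "- w = int b - int a" using x by simp_all
  ultimately show ?thesis unfolding weak_weight_def using x(2,3) by blast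
qed

lemma weak_weight_jet_const: "weak_weight p 0 (jet_const c)"
  unfolding weak_weight_def
  by (intro exI[of _ "Poly_Mapping.single 0 c"] exI[of _ 1] exI[of _ 0])
    (simp add: isobaric_const jet_const_def, simp add: isobaric_def)

lemma weak_weight_var: "weak_weight p (int (weak_var_weight p v)) (jet_var v)"
  unfolding weak_weight_def
  by (intro exI[of _ "Poly_Mapping.single (Poly_Mapping.single v 1) 1"] exI[of _ 1] exI[of _ "weak_var_weight p v"] exI[of _ 0])
    (simp add: jet_var_def, simp add: isobaric_def)

lemma weak_weight_0: "weak_weight p w 0"
proof -
  have "weak_weight p (int (nat w)) 0"
    unfolding weak_weight_def
    by (intro exI[of _ 0] exI[of _ 1] exI[of _ "nat w"] exI[of _ 0]) (simp add: isobaric_def)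
  moreover have "weak_weight p w 0" if "w < 0"
  proof -
    \<comment> \<open>A negative weight requires a denominator of positive weight. Take z4^k, of
      weight 4 k, under the numerator 0, which is isobaric of every weight, here 3 k.\<close>
    define k where "k = nat (- w)"
    let ?Q = "Poly_Mapping.single (Poly_Mapping.single 0 k) (1::rat)"
    have "isobaric p (k * 4) ?Q" by (simp add: isobaric_def weak_var_weight_def)
    moreover have "w = int (3 * k) - int (k * 4)" using that by (simp add: k_def)
    moreover have "?Q \<noteq> 0" by (metis lookup_single_eq lookup_zero one_neq_zero)
    moreover have "isobaric p (3 * k) 0" by (simp add: isobaric_def)
    ultimately show ?thesis unfolding weak_weight_def
      by (intro exI[of _ 0] exI[of _ ?Q] exI[of _ "3 * k"] exI[of _ "k * 4"] conjI) simp_all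
  qed
  ultimately show ?thesis by (cases "w < 0") auto
qed

lemma frob_family_weak_weight:
  assumes "prime p" "p \<ge> 3"
  shows "frob_family (\<lambda>w. Collect (weak_weight p w)) p"
proof
  have m1: "weak_weight p 0 (- 1)" using weak_weight_jet_const[of p "- 1"] jet_const_of_int[of "- 1"] by simp
  show "1 / of_nat n \<in> Collect (weak_weight p 0)" if "\<not> p dvd n" for n
  proof -
    have "int n \<noteq> 0" using that by (cases n) auto
    then show ?thesis using weak_weight_jet_const[of p "of_int 1 / of_int (int n)"] jet_const_divide[of "int n" 1] by simp
  qed
  show "- x \<in> Collect (weak_weight p w)" if "x \<in> Collect (weak_weight p w)" for x w
    using weak_weight_mult[OF m1, of w x] that by simp
  show "1 \<in> Collect (weak_weight p 0)" using weak_weight_jet_const[of p 1] jet_const_1 by simp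
qed (use assms in \<open>auto simp: weak_weight_0 weak_weight_add weak_weight_mult\<close>)

subsection \<open>Non-vanishing of \<open>\<Delta>\<close> and \<open>H\<close>\<close>

text \<open>Sums of non-negative polynomials do not cancel, so the coefficient defining \<open>H\<close> cannot vanish.\<close>

definition nonneg_jets :: "jet_frac set" where
  "nonneg_jets = to_fract ` {P. \<forall>m. Poly_Mapping.lookup P m \<ge> 0}"

lemma nonneg_jets_add: "x \<in> nonneg_jets \<Longrightarrow> y \<in> nonneg_jets \<Longrightarrow> x + y \<in> nonneg_jets"
  unfolding nonneg_jets_def by (force simp: lookup_add simp flip: to_fract_add)

lemma nonneg_jets_mult:
  assumes "x \<in> nonneg_jets" "y \<in> nonneg_jets"
  shows "x * y \<in> nonneg_jets"
proof -
  obtain P Q where PQ: "x = to_fract P" "y = to_fract Q" "\<forall>m. Poly_Mapping.lookup P m \<ge> 0" "\<forall>m. Poly_Mapping.lookup Q m \<ge> 0"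
    using assms by (auto simp: nonneg_jets_def)
  have "Poly_Mapping.lookup (P * Q) k \<ge> 0" for k
    unfolding poly_mapping_mult_singles lookup_sum lookup_single
    using PQ by (intro sum_nonneg) (auto simp: when_def)
  then show ?thesis using PQ by (auto simp: nonneg_jets_def simp flip: to_fract_mult)
qed

lemma nonneg_jets_add_eq_0:
  assumes "x \<in> nonneg_jets" "y \<in> nonneg_jets" "x + y = 0"
  shows "x = 0"
proof -
  obtain P Q where PQ: "x = to_fract P" "y = to_fract Q" "\<forall>m. Poly_Mapping.lookup P m \<ge> 0" "\<forall>m. Poly_Mapping.lookup Q m \<ge> 0"
    using assms by (auto simp: nonneg_jets_def)
  have "P + Q = 0" using assms(3) PQ by (simp flip: to_fract_add)
  then have "Poly_Mapping.lookup P m + Poly_Mapping.lookup Q m = 0" for m by (metis lookup_add lookup_zero)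
  then have "Poly_Mapping.lookup P m = 0" for m using PQ by (metis add_nonneg_eq_0_iff)
  then have "P = 0" by (intro poly_mapping_eqI) simp
  then show ?thesis using PQ by simp
qed

lemma nonneg_jets_basic:
  "0 \<in> nonneg_jets" "1 \<in> nonneg_jets" "jet_var v \<in> nonneg_jets" "of_nat n \<in> nonneg_jets"
proof -
  show 0: "0 \<in> nonneg_jets" unfolding nonneg_jets_def by (intro image_eqI[of _ _ 0]) auto
  show 1: "1 \<in> nonneg_jets" unfolding nonneg_jets_def by (intro image_eqI[of _ _ 1]) (auto simp: lookup_one when_def)
  show "jet_var v \<in> nonneg_jets" unfolding nonneg_jets_def jet_var_def by (auto simp: lookup_single when_def)
  show "of_nat n \<in> nonneg_jets" by (induction n) (auto intro: 0 1 nonneg_jets_add)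
qed

lemma nonneg_jets_sum: "(\<And>i. i \<in> A \<Longrightarrow> f i \<in> nonneg_jets) \<Longrightarrow> sum f A \<in> nonneg_jets"
  by (induction A rule: infinite_finite_induct) (auto intro: nonneg_jets_add nonneg_jets_basic)

lemma jet_var_nonzero: "jet_var v \<noteq> 0"
proof
  assume "jet_var v = 0"
  then have "Poly_Mapping.single (Poly_Mapping.single v (1::nat)) (1::rat) = 0"
    unfolding jet_var_def to_fract_eq_0_iff .
  then show False by (metis lookup_single_eq lookup_zero one_neq_zero)
qed

lemma Delta_nonzero: "Delta \<noteq> 0"
proof
  assume D: "Delta = 0"
  have pw: "x ^ n \<in> nonneg_jets" if "x \<in> nonneg_jets" for x and n :: nat
    using that by (induction n) (auto intro: nonneg_jets_mult nonneg_jets_basic)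
  have "4 * z4 0 ^ 3 \<in> nonneg_jets" "27 * z6 0 ^ 2 \<in> nonneg_jets"
    using nonneg_jets_basic(4)[of 4] nonneg_jets_basic(4)[of 27]
    by (auto simp: z4_def z6_def intro!: nonneg_jets_mult pw nonneg_jets_basic)
  then have "4 * z4 0 ^ 3 = 0" using D nonneg_jets_add_eq_0 unfolding Delta_def by blast
  then show False using jet_var_nonzero by (simp add: z4_def)
qed

lemma nonneg_poly_coeff_mult:
  assumes "\<And>i. coeff P i \<in> nonneg_jets" "\<And>i. coeff Q i \<in> nonneg_jets" "coeff P i \<noteq> 0" "coeff Q j \<noteq> 0"
  shows "coeff (P * Q) (i + j) \<noteq> 0"
proof
  assume z: "coeff (P * Q) (i + j) = 0"
  have 1: "coeff (P * Q) (i + j) = coeff P i * coeff Q (i + j - i) + (\<Sum>k\<in>{..i + j} - {i}. coeff P k * coeff Q (i + j - k))"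
    unfolding Polynomial.coeff_mult by (subst sum.remove[of _ i]) auto
  have 2: "(\<Sum>k\<in>{..i + j} - {i}. coeff P k * coeff Q (i + j - k)) \<in> nonneg_jets"
    by (intro nonneg_jets_sum nonneg_jets_mult assms(1,2))
  have 3: "coeff P i * coeff Q (i + j - i) \<in> nonneg_jets" by (intro nonneg_jets_mult assms(1,2))
  have "coeff P i * coeff Q (i + j - i) = 0" by (rule nonneg_jets_add_eq_0[OF 3 2]) (use 1 z in simp)
  then show False using assms(3,4) by simp
qed

lemma nonneg_poly_mult:
  "(\<And>i. coeff P i \<in> nonneg_jets) \<Longrightarrow> (\<And>i. coeff Q i \<in> nonneg_jets) \<Longrightarrow> coeff (P * Q) k \<in> nonneg_jets"
  unfolding Polynomial.coeff_mult by (intro nonneg_jets_sum nonneg_jets_mult)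

lemma Hasse_nonzero:
  assumes "p \<ge> 11" "odd p"
  shows "Hasse p \<noteq> 0"
proof -
  let ?f = "[:z6 0, z4 0, 0, 1:]"
  have f: "coeff ?f i \<in> nonneg_jets" for i
    by (auto simp: coeff_pCons z4_def z6_def nonneg_jets_basic split: nat.splits)
  have fn: "coeff (?f ^ n) i \<in> nonneg_jets" for n i
    by (induction n arbitrary: i) (auto simp: nonneg_jets_basic coeff_pCons intro!: nonneg_poly_mult f split: nat.splits simp del: mult_pCons_left)
  have pos: "coeff (?f ^ n) (d * n) \<noteq> 0" if "coeff ?f d \<noteq> 0" for d n
  proof (induction n)
    case (Suc n)
    then show ?case using nonneg_poly_coeff_mult[OF f fn that Suc] by (simp del: mult_pCons_left)
  qed simp
  \<comment> \<open>The exponent 2 m = p - 1 is reached by taking x^3 from i factors, z4 x from j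
    and z6 from k: i is the quotient of 2 m by 3 and j the remainder. For m >= 5 the remaining count
    k is not negative.\<close>
  define m where "m = (p - 1) div 2"
  define i where "i = 2 * m div 3"
  define j where "j = 2 * m - 3 * i"
  define k where "k = m - i - j"
  have m: "m \<ge> 5" "2 * m = p - 1" using assms by (auto simp: m_def)
  have "3 * i \<le> 2 * m" "2 * m \<le> 3 * i + 2" unfolding i_def by presburger+
  then have ijk: "m = i + (j + k)" "p - 1 = 3 * i + (1 * j + 0 * k)" using m by (auto simp: j_def k_def)
  have nz: "coeff ?f 3 \<noteq> 0" "coeff ?f 1 \<noteq> 0" "coeff ?f 0 \<noteq> 0"
    using jet_var_nonzero by (simp_all add: z4_def z6_def numeral_3_eq_3)
  have "coeff (?f ^ i * (?f ^ j * ?f ^ k)) (3 * i + (1 * j + 0 * k)) \<noteq> 0"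
    using pos[OF nz(1)] pos[OF nz(2)] pos[OF nz(3)] fn
    by (intro nonneg_poly_coeff_mult nonneg_poly_mult)
  moreover have "Hasse p = coeff (?f ^ (i + (j + k))) (p - 1)"
    unfolding Hasse_def m_def[symmetric] ijk(1)[symmetric] ..
  ultimately show ?thesis unfolding ijk(2) power_add by simp
qed

text \<open>The Casoratian of a recursion \<open>x\<^sub>n = a\<^sub>n x\<^sub>n\<^sub>-\<^sub>1 + c\<^sub>n x\<^sub>n\<^sub>-\<^sub>3\<close> satisfies
  \<open>\<psi>\<^sub>n = - c\<^sub>n\<^sub>+\<^sub>1 a\<^sub>n \<psi>\<^sub>n\<^sub>-\<^sub>2 + c\<^sub>n\<^sub>+\<^sub>1 c\<^sub>n \<psi>\<^sub>n\<^sub>-\<^sub>3\<close>, which keeps the order of its pole in \<open>B\<close> down to \<open>n + 1\<close>.\<close>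

lemma psi_recurrence:
  fixes A B :: "'a::field_char_0"
  assumes B: "B \<noteq> 0" and n: "n \<ge> 5"
  shows "B ^ 2 * psi A B n =
    - (of_nat (2 * n - 7) * (1 / of_nat (2 * (n + 1)))) * (of_nat (2 * n - 3) * (1 / of_nat (2 * n))) * A * psi A B (n - 2)
    + (of_nat (2 * n - 7) * (1 / of_nat (2 * (n + 1)))) * (of_nat (2 * n - 9) * (1 / of_nat (2 * n))) * psi A B (n - 3)"
proof -
  define t0 :: 'a where "t0 = of_nat (2 * (n + 1) - 3) * (1 / of_nat (2 * (n + 1)))"
  define t1 :: 'a where "t1 = of_nat (2 * n - 7) * (1 / of_nat (2 * (n + 1)))"
  define t2 :: 'a where "t2 = of_nat (2 * n - 3) * (1 / of_nat (2 * n))"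
  define t3 :: 'a where "t3 = of_nat (2 * n - 9) * (1 / of_nat (2 * n))"
  have i: "2 * (n + 1) - 9 = 2 * n - 7" "n + 1 - 3 = n - 2" "n - 2 + 1 = n - 1" "n - 3 + 1 = n - 2" using n by auto
  have a1: "alpha A B (n + 1) = - (t0 * (A / B) * alpha A B n) - t1 * (1 / B) * alpha A B (n - 2)"
    using n by (subst alpha.simps) (simp add: t0_def t1_def i)
  have a0: "alpha A B n = - (t2 * (A / B) * alpha A B (n - 1)) - t3 * (1 / B) * alpha A B (n - 3)"
    using n by (subst alpha.simps) (simp add: t2_def t3_def)
  have b1: "beta A B (n + 1) = - (t0 * (A / B) * beta A B n) - t1 * (1 / B) * beta A B (n - 2)"
    using n by (subst beta.simps) (simp add: t0_def t1_def i)
  have b0: "beta A B n = - (t2 * (A / B) * beta A B (n - 1)) - t3 * (1 / B) * beta A B (n - 3)"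
    using n by (subst beta.simps) (simp add: t2_def t3_def)
  \<comment> \<open>The A-terms of \<alpha>_(n+1) and \<beta>_(n+1) cancel in the determinant.
    Expanding \<alpha>_n and \<beta>_n afterwards leaves two determinants of consecutive
    indices.\<close>
  have "B * psi A B n = - t1 * (alpha A B n * beta A B (n - 2) - alpha A B (n - 2) * beta A B n)"
    unfolding psi_def a1 b1 using B by (simp add: field_simps)
  then have "B ^ 2 * psi A B n = - t1 * (B * (alpha A B n * beta A B (n - 2) - alpha A B (n - 2) * beta A B n))"
    by (simp only: power2_eq_square mult.assoc mult.left_commute[of B])
  also have "B * (alpha A B n * beta A B (n - 2) - alpha A B (n - 2) * beta A B n) =
      t2 * A * psi A B (n - 2) - t3 * psi A B (n - 3)"
    unfolding psi_def i a0 b0 using B by (simp add: field_simps)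
  finally show ?thesis unfolding t1_def t2_def t3_def by (simp add: algebra_simps)
qed

text \<open>Makes \<Psi>_N a p-integral polynomial, so that \<Sigma> lies in the polynomial ring and
  the localisation inverts \<Psi>_N. Bounding the poles of \<alpha>_n and \<beta>_n separately would
  give a worse power of b; the recurrence for the determinant sees the cancellation.\<close>

lemma psi_polynomial:
  fixes a b :: "'a::field_char_0"
  assumes S: "closed_subset S" and ab: "a \<in> S" "b \<in> S" "b \<noteq> 0" and p: "prime p" "p \<ge> 11"
    and sc: "\<And>n. \<not> p dvd n \<Longrightarrow> 1 / of_nat n \<in> S" and n: "2 \<le> n" "n + 1 < p"
  shows "b ^ (2 * ((n + 1) div 2)) * psi a b n \<in> S"
  using n
proof (induction n rule: less_induct)
  case (less n)
  interpret S: closed_subset S by fact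
  have sc': "1 / of_nat k \<in> S" if "0 < k" "k < p" for k using sc that by (simp add: nat_dvd_not_less)
  have h: "1 / 2 \<in> S" "1 / 5 \<in> S" using sc'[of 2] sc'[of 5] p by auto
  have e: "(2::nat) + 1 = 3" "(3::nat) + 1 = 4" "(4::nat) + 1 = 5" "(3::nat) div 2 = 1" "(4::nat) div 2 = 2" "(5::nat) div 2 = 2"
    "(2::nat) * 1 = 2" "(2::nat) * 2 = 4"
    by simp_all
  have al: "alpha a b 2 = - (a ^ 2 / (8 * b ^ 2))" "alpha a b 3 = a ^ 3 / (16 * b ^ 3) + 1 / (2 * b)"
    "alpha a b 4 = - (5 * a ^ 4 / (128 * b ^ 4)) - a / (4 * b ^ 2)"
    "alpha a b 5 = - (7 / 10 * (a / b) * alpha a b 4) - 1 / 10 * (1 / b) * alpha a b 2"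
    by (subst alpha.simps, simp)+
  have be: "beta a b 2 = a / (4 * b)" "beta a b 3 = - (a ^ 2 / (8 * b ^ 2))"
    "beta a b 4 = 5 * a ^ 3 / (64 * b ^ 3) + 3 / (8 * b)"
    "beta a b 5 = - (7 / 10 * (a / b) * beta a b 4) - 1 / 10 * (1 / b) * beta a b 2"
    by (subst beta.simps, simp)+
  note pw = power2_eq_square power3_eq_cube power4_eq_xxxx
  consider "n = 2" | "n = 3" | "n = 4" | "n \<ge> 5" using less.prems by linarith
  then show ?case
  proof cases
    case 1
    have "b ^ (2 * ((n + 1) div 2)) * psi a b n = - ((1 / 2) ^ 3 * a)"
      unfolding 1 psi_def e al be using ab(3) by (simp add: field_simps pw)
    then show ?thesis using h ab by (simp only:) (intro S.uminus S.mult S.power)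
  next
    case 2
    have "b ^ (2 * ((n + 1) div 2)) * psi a b n = (1 / 2) ^ 5 * a ^ 3 + of_nat 3 * (1 / 2) ^ 4 * b ^ 2"
      unfolding 2 psi_def e al be using ab(3) by (simp add: field_simps pw)
    then show ?thesis using h ab by (simp only:) (intro S.add S.mult S.power S.of_nat)
  next
    case 3
    \<comment> \<open>The multiples of \<alpha>_4 and \<beta>_4 inside \<alpha>_5 and \<beta>_5
      cancel in the determinant.\<close>
    have "psi a b 4 = - (1 / 10 * (1 / b)) * (alpha a b 4 * beta a b 2 - alpha a b 2 * beta a b 4)"
      unfolding psi_def e al(4) be(4) by (simp add: algebra_simps)
    then have "b ^ (2 * ((n + 1) div 2)) * psi a b n = (1 / 2) ^ 7 * (1 / 5) * a ^ 2"
      unfolding 3 e al(1-3) be(1-3) using ab(3) by (simp add: field_simps pw)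
    then show ?thesis using h ab by (simp only:) (intro S.mult S.power)
  next
    case 4
    define t1 :: 'a where "t1 = of_nat (2 * n - 7) * (1 / of_nat (2 * (n + 1)))"
    define t2 :: 'a where "t2 = of_nat (2 * n - 3) * (1 / of_nat (2 * n))"
    define t3 :: 'a where "t3 = of_nat (2 * n - 9) * (1 / of_nat (2 * n))"
    have nd: "\<not> p dvd 2 * k" if "0 < k" "k < p" for k
      using that p by (auto simp: prime_dvd_mult_iff nat_dvd_not_less)
    have t: "t1 \<in> S" "t2 \<in> S" "t3 \<in> S" unfolding t1_def t2_def t3_def
      using less.prems 4 sc[OF nd, of "n + 1"] sc[OF nd, of n] by (simp_all only: S.mult S.of_nat)
    \<comment> \<open>The exponents allowed at n - 2 and n - 3. The one at n is \<open>e\<close> +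
      2, and the factor b^2 in the recurrence absorbs exactly the extra 2.\<close>
    define e where "e = 2 * ((n - 1) div 2)"
    define e3 where "e3 = 2 * ((n - 2) div 2)"
    have e: "2 * ((n + 1) div 2) = e + 2" "n - 2 + 1 = n - 1" "n - 3 + 1 = n - 2" "e = (e - e3) + e3"
      using 4 unfolding e_def e3_def by presburger+
    have "b ^ (2 * ((n - 2 + 1) div 2)) * psi a b (n - 2) \<in> S" "b ^ (2 * ((n - 3 + 1) div 2)) * psi a b (n - 3) \<in> S"
      using less.prems 4 by (intro less.IH; simp)+
    then have i2: "b ^ e * psi a b (n - 2) \<in> S" and i3: "b ^ e3 * psi a b (n - 3) \<in> S"
      unfolding e(2,3) e_def e3_def .
    have "b ^ (2 * ((n + 1) div 2)) * psi a b n = b ^ e * (b ^ 2 * psi a b n)"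
      unfolding e(1) by (simp only: power_add mult.assoc)
    also have "\<dots> = b ^ e * (- t1 * t2 * a * psi a b (n - 2) + t1 * t3 * psi a b (n - 3))"
      unfolding psi_recurrence[OF ab(3) 4] t1_def t2_def t3_def ..
    also have "\<dots> = - (t1 * t2 * a * (b ^ e * psi a b (n - 2))) + t1 * t3 * (b ^ e * psi a b (n - 3))"
      by (simp add: algebra_simps)
    also have "b ^ e * psi a b (n - 3) = b ^ (e - e3) * (b ^ e3 * psi a b (n - 3))"
      by (subst e(4)) (simp only: power_add mult.assoc)
    finally show ?thesis
      using S.add[OF S.uminus[OF S.mult[OF S.mult[OF S.mult[OF t(1,2)] ab(1)] i2]]
        S.mult[OF S.mult[OF t(1,3)] S.mult[OF S.power[OF ab(2)] i3]]] by (simp only:)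
  qed
qed

section \<open>The localised jet rings, their units and weights\<close>

lemma closed_localization:
  assumes A: "closed_subset A" and D: "D \<in> A" "D \<noteq> 0"
  shows "closed_subset {x / D ^ k | x k. x \<in> A}"
proof
  interpret A: closed_subset A by fact
  show "1 \<in> {x / D ^ k | x k. x \<in> A}" using A.one by (intro CollectI exI[of _ 1] exI[of _ 0]) simp
  fix x assume "x \<in> {x / D ^ k | x k. x \<in> A}"
  then obtain u k where x: "x = u / D ^ k" "u \<in> A" by blast
  then have "- x = (- u) / D ^ k" "- u \<in> A" using A.uminus by auto
  then show "- x \<in> {x / D ^ k | x k. x \<in> A}" by blast
  fix y assume "y \<in> {x / D ^ k | x k. x \<in> A}"
  then obtain v l where y: "y = v / D ^ l" "v \<in> A" by blast
  have "x + y = (u * D ^ l + v * D ^ k) / D ^ (k + l)" unfolding x y using D by (simp add: field_simps power_add)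
  moreover have "u * D ^ l + v * D ^ k \<in> A" using x y D by (intro A.add A.mult A.power)
  ultimately show "x + y \<in> {x / D ^ k | x k. x \<in> A}" by blast
  have "x * y = (u * v) / D ^ (k + l)" unfolding x y by (simp add: power_add)
  then show "x * y \<in> {x / D ^ k | x k. x \<in> A}" using A.mult x y by blast
qed

locale jets =
  fixes p :: nat and Sig :: jet_frac
  assumes p: "prime p" "p \<ge> 11" and Psi_nz: "Psi ((p + 5) div 2) \<noteq> 0"
    and Sig: "Sig = z6 0 * Psi ((p + 5) div 2) * Hasse p"
begin

abbreviation "N \<equiv> (p + 5) div 2"
abbreviation "D \<equiv> Delta * Sig"
abbreviation "J \<equiv> jet_poly_ring p"

definition "Jinf = (\<Union>r. J r)"
definition "M = {x / D ^ k | x k. x \<in> Jinf}"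

lemma p_odd: "odd p" using prime_odd_nat[OF p(1)] p by simp

lemma N_eq: "2 * N = p + 5" using p_odd p by presburger

lemma closed_J: "closed_subset (J r)" using p(1) by (rule closed_jet_polys)

lemma J_mono: "r \<le> s \<Longrightarrow> J r \<subseteq> J s" using jet_polys_mono by blast

lemma closed_Jinf: "closed_subset Jinf"
proof
  show "1 \<in> Jinf" unfolding Jinf_def using closed_subset.one[OF closed_J] by blast
  fix x assume "x \<in> Jinf"
  then obtain r where r: "x \<in> J r" unfolding Jinf_def by blast
  then show "- x \<in> Jinf" unfolding Jinf_def using closed_subset.uminus[OF closed_J] by blast
  fix y assume "y \<in> Jinf"
  then obtain s where s: "y \<in> J s" unfolding Jinf_def by blast
  have "x \<in> J (max r s)" "y \<in> J (max r s)" using r s J_mono[of r "max r s"] J_mono[of s "max r s"] by auto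
  then have "x + y \<in> J (max r s)" "x * y \<in> J (max r s)"
    by (rule closed_subset.add[OF closed_J] closed_subset.mult[OF closed_J])+
  then show "x + y \<in> Jinf" "x * y \<in> Jinf" unfolding Jinf_def by blast+
qed

lemma z_in_J: "z4 0 \<in> J r" "z6 0 \<in> J r" "z4 1 \<in> J 1" "z6 1 \<in> J 1"
  unfolding z4_def z6_def by (rule jet_var_in[OF p(1)], simp)+

lemma z_nz: "z4 i \<noteq> 0" "z6 i \<noteq> 0" by (simp_all add: z4_def z6_def jet_var_nonzero)

lemma Psi_in: "Psi N \<in> J 0"
  unfolding Psi_def
  by (rule psi_polynomial[OF closed_J z_in_J(1,2) z_nz(2) p])
    (use p N_eq jet_scalar_in[OF p(1)] in auto)

lemma psi_nz: "psi (z4 0) (z6 0) N \<noteq> 0"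
  using Psi_nz unfolding Psi_def by auto

lemma Hasse_in: "Hasse p \<in> J 0"
proof -
  interpret J: closed_subset "J 0" by (rule closed_J)
  interpret G: graded_family "\<lambda>_. J 0"
    by unfold_locales (auto intro: J.zero J.one J.add J.uminus J.mult simp del: image_iff)
  have "[:z6 0, z4 0, 0, 1:] \<in> weighted_polys (\<lambda>_. J 0) 0"
    unfolding weighted_polys_def using z_in_J(1,2)[of 0] J.zero J.one
    by (auto simp: coeff_pCons split: nat.splits simp del: image_iff)
  from G.HD[OF G.H_power[OF this]] show ?thesis unfolding Hasse_def by blast
qed

lemma Hasse_nz: "Hasse p \<noteq> 0" using Hasse_nonzero p p_odd by blast

lemma Delta_in: "Delta \<in> J 0"
proof -
  interpret J: closed_subset "J 0" by (rule closed_J)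
  have "of_nat 4 * z4 0 ^ 3 + of_nat 27 * z6 0 ^ 2 \<in> J 0"
    by (intro J.add J.mult J.power J.of_nat z_in_J)
  then show ?thesis by (simp add: Delta_def)
qed

lemma D_in: "D \<in> J 0" and D_nz: "D \<noteq> 0"
proof -
  interpret J: closed_subset "J 0" by (rule closed_J)
  show "D \<in> J 0" unfolding Sig by (intro J.mult Delta_in Psi_in Hasse_in z_in_J)
  show "D \<noteq> 0" unfolding Sig using Delta_nonzero z_nz Psi_nz Hasse_nz by simp
qed

lemma D_in_J: "D \<in> J r" using D_in J_mono[of 0 r] by blast

lemma jet_M_eq: "jet_M p Sig r = {x / D ^ k | x k. x \<in> J r}"
  unfolding jet_M_def by blast

lemma closed_jet_M: "closed_subset (jet_M p Sig r)"
  unfolding jet_M_eq by (rule closed_localization[OF closed_J D_in_J D_nz])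

lemma J_jet_M: "x \<in> J r \<Longrightarrow> x \<in> jet_M p Sig r"
  unfolding jet_M_eq by (intro CollectI exI[of _ x] exI[of _ 0]) simp

lemma jet_M_divide: "x \<in> J r \<Longrightarrow> x / D ^ k \<in> jet_M p Sig r"
  unfolding jet_M_eq by blast

lemma Jinf_D: "D \<in> Jinf" unfolding Jinf_def using D_in by blast

lemma M_eq: "M = (\<Union>r. jet_M p Sig r)"
  unfolding M_def jet_M_eq Jinf_def by blast

lemma closed_M: "closed_subset M"
  unfolding M_def by (rule closed_localization[OF closed_Jinf Jinf_D D_nz])

lemma jet_M_inf_eq: "jet_M_inf p Sig = field_subring M"
  by (simp add: jet_M_inf_def field_subring_def M_eq)

text \<open>Each factor of \<Sigma> accounts for one division: z6 for the recurrence, H for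
  \<Lambda> modulo p, \<Psi> for the linear system.\<close>

lemma inverses: "1 / z6 0 \<in> jet_M p Sig 0" "1 / Hasse p \<in> jet_M p Sig 0" "1 / Psi N \<in> jet_M p Sig 0" "1 / D \<in> jet_M p Sig 0"
proof -
  interpret J: closed_subset "J 0" by (rule closed_J)
  have "1 / z6 0 = (Delta * Psi N * Hasse p) / D ^ 1" "1 / Hasse p = (Delta * (z6 0 * Psi N)) / D ^ 1"
    "1 / Psi N = (Delta * z6 0 * Hasse p) / D ^ 1" "1 / D = 1 / D ^ 1"
    using Delta_nonzero z_nz Psi_nz Hasse_nz by (simp_all add: Sig)
  then show "1 / z6 0 \<in> jet_M p Sig 0" "1 / Hasse p \<in> jet_M p Sig 0" "1 / Psi N \<in> jet_M p Sig 0" "1 / D \<in> jet_M p Sig 0"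
    using Delta_in Psi_in Hasse_in z_in_J by (metis jet_M_divide J.mult J.one)+
qed

text \<open>The intersection forces a coefficient to be p-integral, free of derivatives and
  homogeneous at the same time.\<close>

definition "gr w = {x \<in> jet_M p Sig 0. weak_weight p w x}"

lemma weights:
  "weak_weight p 4 (z4 0)" "weak_weight p 6 (z6 0)" "weak_weight p (4 * int p) (z4 1)" "weak_weight p (6 * int p) (z6 1)"
  using weak_weight_var[of p 0] weak_weight_var[of p 1] weak_weight_var[of p 2] weak_weight_var[of p 3]
  by (simp_all add: z4_def z6_def weak_var_weight_def numeral_3_eq_3)

text \<open>The same grading on the whole field: weights of H and \<psi>_N can be computed there
  separately from integrality.\<close>

sublocale W: frob_family "\<lambda>w. Collect (weak_weight p w)" p
  by (rule frob_family_weak_weight) (use p in auto)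

lemma weight_Hasse: "weak_weight p (int p - 1) (Hasse p)"
proof -
  have "[:z6 0, z4 0, 0, 1:] \<in> weighted_polys (\<lambda>w. Collect (weak_weight p w)) 6"
    unfolding weighted_polys_def using weights(1,2) W.gr_zero W.gr_one
    by (auto simp: coeff_pCons split: nat.splits)
  from W.HD[OF W.H_power[OF this, of "(p - 1) div 2"], of "p - 1"]
  have "weak_weight p (int ((p - 1) div 2) * 6 - 2 * int (p - 1)) (Hasse p)" by (simp add: Hasse_def)
  moreover have e: "int ((p - 1) div 2) * 6 - 2 * int (p - 1) = int p - 1" using p_odd p by (auto elim!: oddE)
  ultimately show ?thesis unfolding e by blast
qed

text \<open>\<alpha>_n has weight - 2 n and \<beta>_n has weight 2 - 2 n, so both products of the
  determinant have weight - 2 N + 2 - 2 (N + 1) = - 4 N.\<close>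

lemma weight_psi: "weak_weight p (- 4 * int N) (psi (z4 0) (z6 0) N)"
proof -
  have B: "1 / z6 0 \<in> Collect (weak_weight p (- 6 * 1))" using weak_weight_inverse[OF weights(2) z_nz(2)] by simp
  have A: "z4 0 \<in> Collect (weak_weight p (4 * 1))" using weights(1) by simp
  have n: "N \<ge> 8" "N + 1 < p" using N_eq p by linarith+
  have al: "alpha (z4 0) (z6 0) k \<in> Collect (weak_weight p (- 2 * int k))" if "1 \<le> k" "k < p" for k
    using W.ode_sol_gr[OF A B, of 1 0 "\<lambda>_. 0" k] W.gr_one W.gr_zero that
    by (simp add: alpha_eq_ode_sol[OF z_nz(2)])
  have F: "coeff [:z6 0, z4 0, 0, 1:] j \<in> Collect (weak_weight p (6 - 2 * int j))" for j
    using weights W.gr_zero W.gr_one by (auto simp: coeff_pCons split: nat.splits)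
  have be: "beta (z4 0) (z6 0) k \<in> Collect (weak_weight p (2 - 2 * int k))" if "2 \<le> k" "k < p" for k
    using W.ode_sol_gr[OF A B, of 0 2 "coeff [:z6 0, z4 0, 0, 1:]" k] W.gr_zero F that
    by (simp add: beta_eq_ode_sol[OF z_nz(2)])
  have "alpha (z4 0) (z6 0) N * beta (z4 0) (z6 0) (N + 1) \<in> Collect (weak_weight p (- 4 * int N))"
    by (rule W.gr_mult'[OF al be]) (use n in auto)
  moreover have "alpha (z4 0) (z6 0) (N + 1) * beta (z4 0) (z6 0) N \<in> Collect (weak_weight p (- 4 * int N))"
    by (rule W.gr_mult'[OF al be]) (use n in auto)
  ultimately show ?thesis using W.gr_diff unfolding psi_def by blast
qed

lemma inverse_psi: "1 / psi (z4 0) (z6 0) N \<in> gr (4 * int N)"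
proof -
  interpret M0: closed_subset "jet_M p Sig 0" by (rule closed_jet_M)
  have "1 / psi (z4 0) (z6 0) N = z6 0 ^ (2 * ((N + 1) div 2)) * (1 / Psi N)"
    unfolding Psi_def using z_nz psi_nz by simp
  moreover have "z6 0 ^ (2 * ((N + 1) div 2)) * (1 / Psi N) \<in> jet_M p Sig 0"
    by (intro M0.mult M0.power inverses J_jet_M z_in_J)
  ultimately show ?thesis using weak_weight_inverse[OF weight_psi psi_nz] by (simp add: gr_def)
qed

sublocale core: frobenius_core gr p M "z4 0" "z6 0" "z4 1" "z6 1"
proof -
  interpret M0: closed_subset "jet_M p Sig 0" by (rule closed_jet_M)
  interpret M: closed_subset M by (rule closed_M)
  have sc: "1 / of_nat n \<in> jet_M p Sig 0" if "\<not> p dvd n" for n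
    using jet_scalar_in[OF p(1) that, of 0] J_jet_M by blast
  have gM: "x \<in> M" if "x \<in> jet_M p Sig r" for x r using that unfolding M_eq by blast
  show "frobenius_core gr p M (z4 0) (z6 0) (z4 1) (z6 1)"
  proof
    show "0 \<in> gr w" for w unfolding gr_def using M0.zero weak_weight_0 by simp
    show "1 \<in> gr 0" unfolding gr_def using M0.one W.gr_one by simp
    show "x + y \<in> gr w" if "x \<in> gr w" "y \<in> gr w" for x y w
      using that M0.add weak_weight_add unfolding gr_def by blast
    show "- x \<in> gr w" if "x \<in> gr w" for x w
      using that M0.uminus[of x] W.gr_uminus[of x w] unfolding gr_def by blast
    show "x * y \<in> gr (v + w)" if "x \<in> gr v" "y \<in> gr w" for x y v w
      using that M0.mult weak_weight_mult unfolding gr_def by blast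
    show "1 / of_nat n \<in> gr 0" if "\<not> p dvd n" for n
      using sc[OF that] W.scalar[OF that] by (simp add: gr_def)
    show "z4 0 \<in> gr 4" "z6 0 \<in> gr 6"
      using weights J_jet_M z_in_J(1,2) by (simp_all add: gr_def del: image_iff)
    show "1 / z6 0 \<in> gr (- 6)" using inverses weak_weight_inverse[OF weights(2) z_nz(2)] by (simp add: gr_def)
    show "z4 1 \<in> M" "z6 1 \<in> M" using z_in_J(3,4) J_jet_M gM by blast+
    show "x \<in> M" if "x \<in> gr w" for x w using that gM by (auto simp: gr_def)
  qed (use p M.zero M.one M.add M.uminus M.mult z_nz in auto)
qed

lemma core_result:
  "\<exists>l0\<in>gr (1 - int p). \<exists>l1\<in>gr (1 - 5 * int p). \<exists>l2\<in>gr (1 - 7 * int p).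
    \<exists>u\<in>core.RX. \<exists>V\<in>core.RX. \<exists>G\<in>core.RX. \<exists>Z\<in>core.RX.
      (Polynomial.monom 1 p + of_nat p * u) ^ 3 + [:z4 0 ^ p + of_nat p * z4 1:] * (Polynomial.monom 1 p + of_nat p * u)
          + [:z6 0 ^ p + of_nat p * z6 1:]
        = [:z6 0, z4 0, 0, 1:] ^ p + of_nat p * G \<and>
      2 * (Polynomial.monom 1 (p - 1) + pderiv u) * [:z6 0, z4 0, 0, 1:] ^ p + 2 * of_nat p * pderiv V
        = [:1 / Hasse p + of_nat p * (l0 + l1 * z4 1 + l2 * z6 1):] * [:z6 0, z4 0, 0, 1:] ^ ((p - 1) div 2)
            * (2 * [:z6 0, z4 0, 0, 1:] ^ p + of_nat p * G) + of_nat p ^ 2 * Z"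
  by (rule core.frobenius_core)
    (use Hasse_nz psi_nz inverse_psi inverses weak_weight_inverse[OF weight_Hasse Hasse_nz] in
      \<open>auto simp: Hasse_def gr_def\<close>)

text \<open>The weights 1 - 5 p and 1 - 7 p of \<open>l1\<close>, \<open>l2\<close> are chosen so
  that multiplication by z4' and z6', of weights 4 p and 6 p, gives 1 - p. The factor p is counted
  with the coefficients for quasi linearity and with the derivatives for tangency.\<close>

lemma eigenvalue_properties:
  assumes l: "l0 \<in> gr (1 - int p)" "l1 \<in> gr (1 - 5 * int p)" "l2 \<in> gr (1 - 7 * int p)"
    and \<Lambda>: "\<Lambda> = 1 / Hasse p + of_nat p * (l0 + l1 * z4 1 + l2 * z6 1)"
  shows "\<Lambda> \<in> jet_M p Sig 1" "quasi_linear p Sig \<Lambda>" "tangential p Sig \<Lambda>" "weak_weight p (1 - int p) \<Lambda>"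
    "\<Lambda> - inverse (Hasse p) \<in> {of_nat p * f | f. f \<in> jet_M p Sig 1}"
proof -
  interpret M0: closed_subset "jet_M p Sig 0" by (rule closed_jet_M)
  interpret M1: closed_subset "jet_M p Sig 1" by (rule closed_jet_M)
  have lM: "l0 \<in> jet_M p Sig 0" "l1 \<in> jet_M p Sig 0" "l2 \<in> jet_M p Sig 0" using l by (auto simp: gr_def)
  have M01: "x \<in> jet_M p Sig 1" if "x \<in> jet_M p Sig 0" for x
    using that J_mono[of 0 1] unfolding jet_M_eq by blast
  have fM: "l0 + l1 * z4 1 + l2 * z6 1 \<in> jet_M p Sig 1"
    by (intro M1.add M1.mult M01 lM J_jet_M z_in_J)
  then show "\<Lambda> - inverse (Hasse p) \<in> {of_nat p * f | f. f \<in> jet_M p Sig 1}"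
    unfolding \<Lambda> by (auto simp: inverse_eq_divide)
  show "\<Lambda> \<in> jet_M p Sig 1" unfolding \<Lambda> by (intro M1.add M1.mult M1.of_nat M01[OF inverses(2)] fM)
  have a: "1 / Hasse p + of_nat p * l0 \<in> jet_M p Sig 0" by (intro M0.add M0.mult M0.of_nat inverses(2) lM)
  have "\<Lambda> = (1 / Hasse p + of_nat p * l0) + (of_nat p * l1) * z4 1 + (of_nat p * l2) * z6 1"
    unfolding \<Lambda> by (simp add: algebra_simps)
  then show "quasi_linear p Sig \<Lambda>" unfolding quasi_linear_def using a M0.mult[OF M0.of_nat] lM by blast
  have "\<Lambda> = (1 / Hasse p + of_nat p * l0) + l1 * (of_nat p * z4 1) + l2 * (of_nat p * z6 1)"
    unfolding \<Lambda> by (simp add: algebra_simps)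
  then show "tangential p Sig \<Lambda>" unfolding tangential_def using a lM by blast
  have 1: "1 / Hasse p \<in> Collect (weak_weight p (1 - int p))"
    using weak_weight_inverse[OF weight_Hasse Hasse_nz] by simp
  have 2: "l1 * z4 1 \<in> Collect (weak_weight p (1 - int p))" "l2 * z6 1 \<in> Collect (weak_weight p (1 - int p))"
    using l weights(3,4)
    by (auto simp: gr_def intro!: W.gr_mult'[of l1 _ "z4 1", simplified] W.gr_mult'[of l2 _ "z6 1", simplified])
  have "\<Lambda> \<in> Collect (weak_weight p (1 - int p))" unfolding \<Lambda>
    using l(1) by (intro W.gr_add W.gr_scale 1 2) (simp add: gr_def)
  then show "weak_weight p (1 - int p) \<Lambda>" by simp
qed

end

subsection \<open>The universal Frobenius lift\<close>

context frob_family
begin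

lemma frob_pow: "frob 0 x y \<Longrightarrow> frob 0 (x ^ n) (y ^ n)"
proof (induction n)
  case (Suc n)
  then show ?case using frob_mult[of 0 x y 0 "x ^ n" "y ^ n"] by simp
qed (simp add: frob_1)

lemma frob_prod: "(\<And>i. i \<in> A \<Longrightarrow> frob 0 (f i) (g i)) \<Longrightarrow> frob 0 (prod f A) (prod g A)"
proof (induction A rule: infinite_finite_induct)
  case (insert i A)
  then show ?case using frob_mult[of 0 "f i" "g i" 0 "prod f A" "prod g A"] by simp
qed (simp_all add: frob_1)

lemma frob_sum: "(\<And>i. i \<in> A \<Longrightarrow> frob w (f i) (g i)) \<Longrightarrow> frob w (sum f A) (sum g A)"
  by (induction A rule: infinite_finite_induct) (auto simp: frob_0 intro: frob_add)

end

context jets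
begin

sublocale JF: frob_family "\<lambda>_. Jinf" p
proof -
  interpret J: closed_subset Jinf by (rule closed_Jinf)
  have "1 / of_nat n \<in> Jinf" if "\<not> p dvd n" for n
    unfolding Jinf_def using jet_scalar_in[OF p(1) that] by blast
  then show "frob_family (\<lambda>_. Jinf) p"
    using p J.zero J.one J.add J.uminus J.mult by unfold_locales auto
qed

text \<open>Jet coordinates of z4 and z6 alternate, so \<open>v + 2\<close> is the next derivative
  of the same variable.\<close>

definition lift_var :: "nat \<Rightarrow> jet_frac" where
  "lift_var v = jet_var v ^ p + of_nat p * jet_var (v + 2)"

definition lift :: "jet_frac \<Rightarrow> jet_frac" where
  "lift x = jet_eval lift_var (inv_into UNIV to_fract x)"

lemma lift_to_fract: "lift (to_fract P) = jet_eval lift_var P"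
  by (simp add: lift_def inv_f_f inj_def)

lemma Jinf_iff: "x \<in> Jinf \<longleftrightarrow> (\<exists>r. \<exists>P\<in>jet_polys p r. x = to_fract P)"
  by (auto simp: Jinf_def)

lemma var_Jinf: "jet_var v \<in> Jinf"
  unfolding Jinf_def using jet_var_in[OF p(1), of v "v div 2"] by blast

text \<open>Constants are left unchanged by \<open>lift\<close> and satisfy the congruence by
  Fermat's theorem; the variables satisfy it by construction, and \<open>frob\<close> is compatible
  with sums and products.\<close>

lemma frob_lift:
  assumes "x \<in> Jinf"
  shows "JF.frob 0 x (lift x)"
proof -
  obtain r P where P: "P \<in> jet_polys p r" "x = to_fract P" using assms by (auto simp: Jinf_iff)
  have v: "JF.frob 0 (jet_var v) (lift_var v)" for v
    unfolding JF.frob_def lift_var_def using var_Jinf by blast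
  have c: "JF.frob 0 (jet_const c) (jet_const c)" if "c \<in> Z_loc p" for c
  proof -
    obtain a b where "\<not> p dvd b" "jet_const c = of_int a * (1 / of_nat b)"
      using Z_loc_jet_const[OF p(1) \<open>c \<in> Z_loc p\<close>] .
    then show ?thesis using JF.frob_mult[OF JF.frob_of_int[of a] JF.frob_inverse_of_nat[of b]] by simp
  qed
  have "JF.frob 0 (jet_const (Poly_Mapping.lookup P m) * jet_monom jet_var m)
      (jet_const (Poly_Mapping.lookup P m) * jet_monom lift_var m)" for m
  proof -
    have "Poly_Mapping.lookup P m \<in> Z_loc p" using P(1) by (simp add: jet_polys_def)
    moreover have "JF.frob 0 (jet_monom jet_var m) (jet_monom lift_var m)"
      unfolding jet_monom_def by (intro JF.frob_prod JF.frob_pow v)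
    ultimately show ?thesis using JF.frob_mult[OF c] by fastforce
  qed
  then have "JF.frob 0 (jet_eval jet_var P) (jet_eval lift_var P)"
    unfolding jet_eval_def by (intro JF.frob_sum)
  then show ?thesis unfolding P(2) lift_to_fract by (simp add: to_fract_eq_jet_eval)
qed

lemma Jinf_M: "x \<in> Jinf \<Longrightarrow> x \<in> M"
  unfolding M_def by (intro CollectI exI[of _ x] exI[of _ 0]) simp

lemma lift_hom: "lift \<in> ring_hom (field_subring Jinf) (field_subring M)"
proof (rule ring_hom_memI)
  interpret J: closed_subset Jinf by (rule closed_Jinf)
  interpret M: closed_subset M by (rule closed_M)
  fix x assume x: "x \<in> carrier (field_subring Jinf)"
  have "lift x \<in> Jinf" using JF.frob_gr(2)[OF frob_lift] x by simp
  then show "lift x \<in> carrier (field_subring M)"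
    using Jinf_M by simp
  fix y assume y: "y \<in> carrier (field_subring Jinf)"
  obtain P Q where "x = to_fract P" "y = to_fract Q" using x y by (auto simp: Jinf_iff)
  then show "lift (x \<otimes>\<^bsub>field_subring Jinf\<^esub> y) = lift x \<otimes>\<^bsub>field_subring M\<^esub> lift y"
    "lift (x \<oplus>\<^bsub>field_subring Jinf\<^esub> y) = lift x \<oplus>\<^bsub>field_subring M\<^esub> lift y"
    by (simp_all flip: to_fract_mult to_fract_add add: lift_to_fract jet_eval_mult jet_eval_add)
next
  interpret J: closed_subset Jinf by (rule closed_Jinf)
  interpret M: closed_subset M by (rule closed_M)
  show "lift \<one>\<^bsub>field_subring Jinf\<^esub> = \<one>\<^bsub>field_subring M\<^esub>"
    using lift_to_fract[of 1] by (simp add: jet_eval_1)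
qed

section \<open>The completion of the jet ring and its Frobenius lift\<close>

abbreviation "MR \<equiv> field_subring M"
abbreviation "S \<equiv> padic_completion p MR"
abbreviation "emb \<equiv> padic_embed p MR"

lemma jet_S_eq: "jet_S p Sig = S" and jet_embed_eq: "jet_embed p Sig = emb"
  by (simp_all add: jet_S_def jet_embed_def jet_M_inf_eq)

sublocale MM: closed_subset M by (rule closed_M)
sublocale MR: cring MR by (rule MM.cring_field_subring)
sublocale S: cring S by (rule MR.cring_padic_completion)
sublocale emb: ring_hom_cring MR S emb
  by (intro ring_hom_cringI MM.cring_field_subring MR.cring_padic_completion MR.padic_embed_hom)

lemma emb_mult: "x \<in> M \<Longrightarrow> y \<in> M \<Longrightarrow> emb (x * y) = emb x \<otimes>\<^bsub>S\<^esub> emb y" using emb.hom_mult[of x y] by simp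
lemma emb_add: "x \<in> M \<Longrightarrow> y \<in> M \<Longrightarrow> emb (x + y) = emb x \<oplus>\<^bsub>S\<^esub> emb y" using emb.hom_add[of x y] by simp
lemma emb_one: "emb 1 = \<one>\<^bsub>S\<^esub>" using emb.hom_one by simp
lemma emb_scale: "x \<in> M \<Longrightarrow> emb (of_nat n * x) = [n] \<cdot>\<^bsub>S\<^esub> emb x"
  using ring_hom_add_pow[OF MR.padic_embed_hom MM.cring_field_subring MR.cring_padic_completion, of x p n]
  by (simp add: MM.field_subring_add_pow)
lemma emb_pow: "x \<in> M \<Longrightarrow> emb (x ^ n) = emb x [^]\<^bsub>S\<^esub> n"
  using emb.hom_pow[of x n] by (simp add: MM.field_subring_pow)

lemma inverse_D_M: "1 / D \<in> M" using inverses(4) unfolding M_eq by blast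

lemma emb_D_power: "emb (D ^ k) \<otimes>\<^bsub>S\<^esub> emb ((1 / D) ^ k) = \<one>\<^bsub>S\<^esub>"
proof -
  have "D ^ k * (1 / D) ^ k = 1" using D_nz by (simp flip: power_mult_distrib)
  then show ?thesis
    using emb_mult[of "D ^ k" "(1 / D) ^ k"] emb_one MM.power[OF Jinf_M[OF Jinf_D]] MM.power[OF inverse_D_M] by simp
qed

text \<open>The lift on polynomials must be extended to fractions with denominator D^k. The target
  is already the completion, because the image of D is invertible there.\<close>

lemma frobenius_on_M:
  "\<exists>h\<in>ring_hom MR S. (\<forall>x\<in>Jinf. h x = emb (lift x)) \<and>
    (\<forall>r\<in>M. h r 1 = padic_proj p MR 1 r [^]\<^bsub>padic_quot p MR 1\<^esub> p)"
proof -
  have h0: "emb \<circ> lift \<in> ring_hom (field_subring Jinf) S"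
    by (rule ring_hom_trans[OF lift_hom MR.padic_embed_hom])
  obtain z where z: "z \<in> Jinf" "lift D = D ^ p + of_nat p * z"
    using frob_lift[OF Jinf_D] by (auto elim: JF.frobE)
  have DM: "D ^ p \<in> M" "(1 / D) ^ p \<in> M" "z \<in> M" "z * (1 / D) ^ p \<in> M"
    using Jinf_M[OF Jinf_D] inverse_D_M Jinf_M[OF z(1)] MM.power MM.mult by auto
  define w where "w = emb (z * (1 / D) ^ p)"
  have w: "w \<in> carrier S" unfolding w_def using DM by simp
  obtain v where v: "v \<in> carrier S" "(\<one>\<^bsub>S\<^esub> \<oplus>\<^bsub>S\<^esub> [p] \<cdot>\<^bsub>S\<^esub> w) \<otimes>\<^bsub>S\<^esub> v = \<one>\<^bsub>S\<^esub>"
    using MR.padic_one_plus_unit[OF w] by blast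
  \<comment> \<open>The image of D is D^p times 1 + p z / D^p; the first factor is a unit of M and
    the second one of the completion.\<close>
  have "lift D = D ^ p * (1 + of_nat p * (z * (1 / D) ^ p))"
    unfolding z(2) using D_nz by (simp add: algebra_simps flip: power_mult_distrib)
  then have "emb (lift D) = emb (D ^ p) \<otimes>\<^bsub>S\<^esub> (\<one>\<^bsub>S\<^esub> \<oplus>\<^bsub>S\<^esub> [p] \<cdot>\<^bsub>S\<^esub> w)"
    using emb_mult[OF DM(1) MM.add[OF MM.one MM.mult[OF MM.of_nat[of p] DM(4)]]]
      emb_add[OF MM.one MM.mult[OF MM.of_nat[of p] DM(4)]] emb_scale[OF DM(4), of p]
    by (simp only: emb_one w_def)
  then have "emb (lift D) \<otimes>\<^bsub>S\<^esub> (emb ((1 / D) ^ p) \<otimes>\<^bsub>S\<^esub> v) =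
      (emb (D ^ p) \<otimes>\<^bsub>S\<^esub> emb ((1 / D) ^ p)) \<otimes>\<^bsub>S\<^esub> ((\<one>\<^bsub>S\<^esub> \<oplus>\<^bsub>S\<^esub> [p] \<cdot>\<^bsub>S\<^esub> w) \<otimes>\<^bsub>S\<^esub> v)"
    using DM v(1) w by (simp add: S.m_ac)
  then have unit: "(emb \<circ> lift) D \<otimes>\<^bsub>S\<^esub> (emb ((1 / D) ^ p) \<otimes>\<^bsub>S\<^esub> v) = \<one>\<^bsub>S\<^esub>"
    by (simp add: emb_D_power v(2))
  have uc: "emb ((1 / D) ^ p) \<otimes>\<^bsub>S\<^esub> v \<in> carrier S" using DM v by simp
  obtain h where h: "h \<in> ring_hom MR S" "\<forall>x\<in>Jinf. h x = (emb \<circ> lift) x"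
    using localization_universal[OF closed_Jinf Jinf_D D_nz MR.cring_padic_completion h0 uc unit]
    unfolding M_def by blast
  interpret Q: cring "padic_quot p MR 1" by (rule MR.cring_padic_quot)
  interpret pr: ring_hom_cring MR "padic_quot p MR 1" "padic_proj p MR 1"
    by (intro ring_hom_cringI MM.cring_field_subring MR.cring_padic_quot MR.padic_proj_hom)
  let ?\<pi> = "padic_proj p MR 1"
  let ?Q = "padic_quot p MR 1"
  have \<pi>m: "?\<pi> (x * y) = ?\<pi> x \<otimes>\<^bsub>?Q\<^esub> ?\<pi> y" if "x \<in> M" "y \<in> M" for x y using pr.hom_mult[of x y] that by simp
  have \<pi>c: "?\<pi> x \<in> carrier ?Q" if "x \<in> M" for x using pr.hom_closed[of x] that by simp
  have \<pi>p: "?\<pi> (x ^ n) = ?\<pi> x [^]\<^bsub>?Q\<^esub> n" if "x \<in> M" for x and n :: nat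
    using pr.hom_pow[of x n] that by (simp add: MM.field_subring_pow)
  have hm: "h (x * y) = h x \<otimes>\<^bsub>S\<^esub> h y" if "x \<in> M" "y \<in> M" for x y using ring_hom_mult[OF h(1), of x y] that by simp
  have hc: "h x \<in> carrier S" if "x \<in> M" for x using ring_hom_closed[OF h(1), of x] that by simp
  have hJ: "h x 1 = ?\<pi> x [^]\<^bsub>?Q\<^esub> p" if x: "x \<in> Jinf" for x
  proof -
    obtain y where y: "y \<in> Jinf" "lift x = x ^ p + of_nat p * y"
      using frob_lift[OF x] by (auto elim: JF.frobE)
    have M: "x ^ p \<in> M" "of_nat p * y \<in> M" "y \<in> M" "x \<in> M"
      using Jinf_M[OF x] Jinf_M[OF y(1)] MM.power MM.of_nat MM.mult by auto
    have "h x 1 = ?\<pi> (x ^ p + of_nat p * y)" using h(2) x y(2) by (simp add: padic_embed_def)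
    also have "\<dots> = ?\<pi> (x ^ p)"
      using M MM.add MR.padic_proj_eq_iff[of "x ^ p + of_nat p * y" "x ^ p" p 1]
      by (auto simp: MM.field_subring_add_pow simp del: One_nat_def)
    finally show ?thesis using \<pi>p M by simp
  qed
  have "h r 1 = ?\<pi> r [^]\<^bsub>?Q\<^esub> p" if r: "r \<in> M" for r
  proof -
    obtain x k where x: "x \<in> Jinf" "r = x / D ^ k" using r unfolding M_def by blast
    define d where "d = D ^ k"
    define i where "i = (1 / D) ^ k"
    interpret J: closed_subset Jinf by (rule closed_Jinf)
    have d: "d \<in> Jinf" "d \<in> M" "i \<in> M" "r * d = x" "d * i = 1" "x \<in> M"
      unfolding d_def i_def using J.power[OF Jinf_D] Jinf_M MM.power[OF inverse_D_M] x D_nz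
      by (auto simp flip: power_mult_distrib)
    \<comment> \<open>The congruence passes from r D^k, a polynomial, to r by cancelling the image
      of D^k modulo p, which is a unit.\<close>
    have "h r 1 \<otimes>\<^bsub>?Q\<^esub> ?\<pi> d [^]\<^bsub>?Q\<^esub> p = (h r \<otimes>\<^bsub>S\<^esub> h d) 1"
      using hJ[OF d(1)] by (simp add: MR.padic_completion_ops)
    also have "\<dots> = ?\<pi> x [^]\<^bsub>?Q\<^esub> p" using hm[OF r d(2)] hJ[OF x(1)] d(4) by simp
    also have "?\<pi> x = ?\<pi> r \<otimes>\<^bsub>?Q\<^esub> ?\<pi> d" using \<pi>m[OF r d(2)] d(4) by simp
    also have "(?\<pi> r \<otimes>\<^bsub>?Q\<^esub> ?\<pi> d) [^]\<^bsub>?Q\<^esub> p = ?\<pi> r [^]\<^bsub>?Q\<^esub> p \<otimes>\<^bsub>?Q\<^esub> ?\<pi> d [^]\<^bsub>?Q\<^esub> p"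
      using \<pi>c r d by (intro Q.nat_pow_distrib)
    finally have e: "h r 1 \<otimes>\<^bsub>?Q\<^esub> ?\<pi> d [^]\<^bsub>?Q\<^esub> p = ?\<pi> r [^]\<^bsub>?Q\<^esub> p \<otimes>\<^bsub>?Q\<^esub> ?\<pi> d [^]\<^bsub>?Q\<^esub> p" .
    have inv: "?\<pi> d [^]\<^bsub>?Q\<^esub> p \<otimes>\<^bsub>?Q\<^esub> ?\<pi> i [^]\<^bsub>?Q\<^esub> p = \<one>\<^bsub>?Q\<^esub>"
      using \<pi>m[OF d(2,3)] d(5) \<pi>c[OF d(2)] \<pi>c[OF d(3)] pr.hom_one Q.nat_pow_distrib[of "?\<pi> d" "?\<pi> i" p] by (simp del: One_nat_def)
    have c: "h r 1 \<in> carrier ?Q" "?\<pi> d [^]\<^bsub>?Q\<^esub> p \<in> carrier ?Q" "?\<pi> i [^]\<^bsub>?Q\<^esub> p \<in> carrier ?Q" "?\<pi> r [^]\<^bsub>?Q\<^esub> p \<in> carrier ?Q"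
      using hc[OF r] \<pi>c d r by (auto simp: MR.padic_completion_carrier simp del: One_nat_def)
    have "h r 1 = h r 1 \<otimes>\<^bsub>?Q\<^esub> ?\<pi> d [^]\<^bsub>?Q\<^esub> p \<otimes>\<^bsub>?Q\<^esub> ?\<pi> i [^]\<^bsub>?Q\<^esub> p"
      using c by (simp add: Q.m_assoc inv del: One_nat_def)
    also have "\<dots> = ?\<pi> r [^]\<^bsub>?Q\<^esub> p" unfolding e using c by (simp add: Q.m_assoc inv del: One_nat_def)
    finally show ?thesis .
  qed
  then show ?thesis using h by (intro bexI[of _ h]) auto
qed

definition frob_spec :: "((nat \<Rightarrow> jet_frac set) \<Rightarrow> nat \<Rightarrow> jet_frac set) \<Rightarrow> bool" where
  "frob_spec \<phi> \<longleftrightarrow> \<phi> \<in> extensional (carrier S) \<and> frobenius_lift p S \<phi> \<and>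
     (\<forall>z\<in>{z4, z6}. \<forall>i. \<phi> (emb (z i)) = emb (z i) [^]\<^bsub>S\<^esub> p \<oplus>\<^bsub>S\<^esub> [p] \<cdot>\<^bsub>S\<^esub> emb (z (Suc i)))"

lemma z_Jinf: "z4 i \<in> Jinf" "z6 i \<in> Jinf"
  by (simp_all add: z4_def z6_def var_Jinf)

lemma frob_spec_exists: "\<exists>\<phi>. frob_spec \<phi>"
proof -
  obtain h where h: "h \<in> ring_hom MR S" "\<And>x. x \<in> Jinf \<Longrightarrow> h x = emb (lift x)"
    "\<And>r. r \<in> M \<Longrightarrow> h r 1 = padic_proj p MR 1 r [^]\<^bsub>padic_quot p MR 1\<^esub> p" using frobenius_on_M by blast
  define \<phi>0 where "\<phi>0 = MR.padic_extend p h"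
  define \<phi> where "\<phi> = restrict \<phi>0 (carrier S)"
  have \<phi>0: "\<phi>0 \<in> ring_hom S S" unfolding \<phi>0_def by (rule MR.padic_extend_hom[OF MM.cring_field_subring h(1)])
  then have \<phi>: "\<phi> \<in> ring_hom S S" unfolding \<phi>_def using S.ring_hom_restrict[of \<phi>0 S] by simp
  have \<phi>e: "\<phi> (emb r) = h r" if "r \<in> M" for r
    unfolding \<phi>_def \<phi>0_def using that MR.padic_extend_embed[OF MM.cring_field_subring h(1), of r] by simp
  have "frobenius_lift p S \<phi>"
    by (rule MR.frobenius_lift_completionI[OF \<phi>]) (use h(3) \<phi>e in simp)
  moreover have "\<phi> (emb (z i)) = emb (z i) [^]\<^bsub>S\<^esub> p \<oplus>\<^bsub>S\<^esub> [p] \<cdot>\<^bsub>S\<^esub> emb (z (Suc i))" if "z \<in> {z4, z6}" for z i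
  proof -
    have zJ: "z j \<in> Jinf" for j using that z_Jinf by auto
    have "lift (z i) = z i ^ p + of_nat p * z (Suc i)"
    proof -
      have "lift (jet_var v) = lift_var v" for v
        unfolding jet_var_def lift_to_fract jet_eval_var ..
      then show ?thesis using that by (auto simp: z4_def z6_def lift_var_def)
    qed
    then show ?thesis using \<phi>e[OF Jinf_M[OF zJ]] h(2)[OF zJ] Jinf_M[OF zJ] MM.power MM.mult MM.of_nat
      by (simp add: emb_add emb_scale emb_pow)
  qed
  ultimately show ?thesis unfolding frob_spec_def \<phi>_def by blast
qed

text \<open>The elements of M on which two lifts agree are closed under ring operations and under
  inverses in M. They contain all variables, hence all of M, and continuity extends the agreement to
  S.\<close>

lemma frob_spec_unique:
  assumes "frob_spec \<phi>" "frob_spec \<psi>"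
  shows "\<phi> = \<psi>"
proof -
  have \<phi>: "\<phi> \<in> ring_hom S S" "\<psi> \<in> ring_hom S S" using assms by (auto simp: frob_spec_def frobenius_lift_def)
  interpret f: ring_hom_cring S S \<phi> by (intro ring_hom_cringI \<phi> MR.cring_padic_completion)
  interpret g: ring_hom_cring S S \<psi> by (intro ring_hom_cringI \<phi> MR.cring_padic_completion)
  define E where "E = {r \<in> M. \<phi> (emb r) = \<psi> (emb r)}"
  have one: "1 \<in> E" unfolding E_def using MM.one by (simp add: emb_one)
  have inv: "r' \<in> E" if r: "r \<in> E" and r': "r' \<in> M" "r * r' = 1" for r r'
  proof -
    have rM: "r \<in> M" using r by (simp add: E_def)
    have m: "emb r \<otimes>\<^bsub>S\<^esub> emb r' = \<one>\<^bsub>S\<^esub>" using emb_mult[OF rM r'(1)] r'(2) emb_one by simp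
    have 1: "\<phi> (emb r) \<otimes>\<^bsub>S\<^esub> \<phi> (emb r') = \<one>\<^bsub>S\<^esub>" using f.hom_mult[of "emb r" "emb r'"] m rM r' by simp
    have 2: "\<phi> (emb r) \<otimes>\<^bsub>S\<^esub> \<psi> (emb r') = \<one>\<^bsub>S\<^esub>"
      using g.hom_mult[of "emb r" "emb r'"] m rM r' r by (simp add: E_def)
    have c: "\<phi> (emb r) \<in> carrier S" "\<phi> (emb r') \<in> carrier S" "\<psi> (emb r') \<in> carrier S" using rM r' by auto
    have "\<phi> (emb r') = \<phi> (emb r') \<otimes>\<^bsub>S\<^esub> (\<phi> (emb r) \<otimes>\<^bsub>S\<^esub> \<psi> (emb r'))" using c 2 by simp
    also have "\<dots> = (\<phi> (emb r) \<otimes>\<^bsub>S\<^esub> \<phi> (emb r')) \<otimes>\<^bsub>S\<^esub> \<psi> (emb r')" using c by (simp add: S.m_ac)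
    finally show ?thesis using r'(1) c 1 by (simp add: E_def)
  qed
  have add: "x + y \<in> E" if "x \<in> E" "y \<in> E" for x y
    using that MM.add by (simp add: E_def emb_add)
  have mult: "x * y \<in> E" if "x \<in> E" "y \<in> E" for x y
    using that MM.mult by (simp add: E_def emb_mult)
  have m1: "- 1 \<in> E"
  proof -
    have M: "- 1 \<in> M" using MM.uminus[OF MM.one] .
    have z: "emb (- 1) = \<ominus>\<^bsub>S\<^esub> \<one>\<^bsub>S\<^esub>"
    proof (rule S.sum_zero_eq_neg)
      show "emb (- 1) \<oplus>\<^bsub>S\<^esub> \<one>\<^bsub>S\<^esub> = \<zero>\<^bsub>S\<^esub>"
        using emb_add[OF M MM.one] emb.hom_zero by (simp add: emb_one)
    qed (use M in auto)
    then show ?thesis using M by (simp add: E_def)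
  qed
  have E: "closed_subset E"
  proof
    show "- x \<in> E" if "x \<in> E" for x using mult[OF m1 that] by simp
  qed (fact one add mult)+
  interpret E: closed_subset E by fact
  have sc: "1 / of_nat n \<in> E" if "\<not> p dvd n" for n
  proof (rule inv)
    show "of_nat n \<in> E" by (rule E.of_nat)
    show "1 / of_nat n \<in> M" using JF.scalar[OF that] by (rule Jinf_M)
    show "of_nat n * (1 / of_nat n) = (1::jet_frac)" using that by (cases n) (auto simp del: of_nat_Suc)
  qed
  have var: "jet_var v \<in> E" for v
  proof -
    have "z i \<in> E" if "z \<in> {z4, z6}" for z i
      using assms that Jinf_M z_Jinf unfolding frob_spec_def E_def by auto
    moreover have "\<exists>z\<in>{z4, z6}. \<exists>i. jet_var v = z i"
      by (cases "even v") (auto simp: z4_def z6_def elim!: evenE oddE)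
    ultimately show ?thesis by auto
  qed
  have JE: "x \<in> E" if xJ: "x \<in> Jinf" for x
  proof -
    obtain r P where P: "P \<in> jet_polys p r" "x = to_fract P" using xJ unfolding Jinf_iff by blast
    show ?thesis unfolding P(2) to_fract_eq_jet_eval
      by (rule jet_eval_closed[OF p(1) E P(1) sc var])
  qed
  have DE: "1 / D \<in> E" by (rule inv[OF JE[OF Jinf_D] inverse_D_M]) (use D_nz in simp)
  have ME: "r \<in> E" if rM: "r \<in> M" for r
  proof -
    obtain x k where x: "x \<in> Jinf" "r = x / D ^ k" using rM unfolding M_def by blast
    have "r = x * (1 / D) ^ k" using x by (simp add: power_divide)
    then show ?thesis using E.mult[OF JE[OF x(1)] E.power[OF DE]] by simp
  qed
  have "\<phi> s = \<psi> s" if "s \<in> carrier S" for s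
    by (rule MR.padic_hom_unique[OF MM.cring_field_subring \<phi> _ that]) (use ME in \<open>simp add: E_def\<close>)
  then show ?thesis using assms unfolding frob_spec_def by (intro extensionalityI[of _ "carrier S"]) auto
qed

lemma universal_frobenius_spec: "frob_spec (universal_frobenius p Sig)"
proof -
  have "universal_frobenius p Sig = (THE \<phi>. frob_spec \<phi>)"
    unfolding universal_frobenius_def frob_spec_def jet_S_eq jet_embed_eq ..
  moreover have "\<exists>!\<phi>. frob_spec \<phi>" using frob_spec_exists frob_spec_unique by blast
  ultimately show ?thesis using theI'[of frob_spec] by simp
qed

end

subsection \<open>Evaluation of polynomials and their differentials\<close>

text \<open>The bridge from identities between polynomials over a type to rings given by records.
  The coefficient map need only respect the operations on the subset \<open>A\<close>, so it can be
  the embedding of M into a completion or a quotient.\<close>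

locale poly_eval = cring C for C (structure) +
  fixes A :: "'k::comm_semiring_1 set" and \<iota> :: "'k \<Rightarrow> 'a" and x :: 'a
  assumes A_zero: "0 \<in> A" and A_one: "1 \<in> A"
    and A_add: "c \<in> A \<Longrightarrow> d \<in> A \<Longrightarrow> c + d \<in> A" and A_mult: "c \<in> A \<Longrightarrow> d \<in> A \<Longrightarrow> c * d \<in> A"
    and \<iota>_closed: "c \<in> A \<Longrightarrow> \<iota> c \<in> carrier C" and \<iota>_zero: "\<iota> 0 = \<zero>" and \<iota>_one: "\<iota> 1 = \<one>"
    and \<iota>_add: "c \<in> A \<Longrightarrow> d \<in> A \<Longrightarrow> \<iota> (c + d) = \<iota> c \<oplus> \<iota> d"
    and \<iota>_mult: "c \<in> A \<Longrightarrow> d \<in> A \<Longrightarrow> \<iota> (c * d) = \<iota> c \<otimes> \<iota> d"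
    and x_closed: "x \<in> carrier C"
begin

definition "AX = {P. \<forall>i. coeff P i \<in> A}"

definition ev :: "'k poly \<Rightarrow> 'a" where
  "ev P = fold_coeffs (\<lambda>c y. \<iota> c \<oplus> x \<otimes> y) P \<zero>"

lemma AX_pCons: "pCons c P \<in> AX \<longleftrightarrow> c \<in> A \<and> P \<in> AX"
  by (auto simp: AX_def coeff_pCons split: nat.splits)

lemma AX_zero: "0 \<in> AX" by (simp add: AX_def A_zero)

lemma AX_add: "P \<in> AX \<Longrightarrow> Q \<in> AX \<Longrightarrow> P + Q \<in> AX" by (simp add: AX_def A_add)

lemma AX_smult: "c \<in> A \<Longrightarrow> Q \<in> AX \<Longrightarrow> Polynomial.smult c Q \<in> AX" by (simp add: AX_def A_mult)

lemma AX_mult: "P \<in> AX \<Longrightarrow> Q \<in> AX \<Longrightarrow> P * Q \<in> AX"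
  by (induction P) (auto simp: AX_pCons AX_zero A_zero intro!: AX_add AX_smult)

lemma ev_0: "ev 0 = \<zero>" by (simp add: ev_def)

lemma ev_pCons: "ev (pCons c P) = \<iota> c \<oplus> x \<otimes> ev P"
  using x_closed by (cases "c = 0 \<and> P = 0") (auto simp: ev_def \<iota>_zero)

lemma ev_closed: "P \<in> AX \<Longrightarrow> ev P \<in> carrier C"
  by (induction P) (auto simp: AX_pCons ev_0 ev_pCons \<iota>_closed x_closed)

lemma ev_add: "P \<in> AX \<Longrightarrow> Q \<in> AX \<Longrightarrow> ev (P + Q) = ev P \<oplus> ev Q"
proof (induction P arbitrary: Q)
  case (pCons c P)
  obtain d Q' where Q: "Q = pCons d Q'" by (cases Q)
  have m: "c \<in> A" "P \<in> AX" "d \<in> A" "Q' \<in> AX" using pCons Q by (auto simp: AX_pCons)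
  show ?case unfolding Q using m pCons.IH[OF m(2,4)] x_closed
    by (simp add: ev_pCons \<iota>_add \<iota>_closed ev_closed r_distr a_ac)
qed (simp add: ev_0 ev_closed)

lemma ev_smult: "c \<in> A \<Longrightarrow> Q \<in> AX \<Longrightarrow> ev (Polynomial.smult c Q) = \<iota> c \<otimes> ev Q"
proof (induction Q)
  case (pCons d Q)
  have m: "d \<in> A" "Q \<in> AX" using pCons by (auto simp: AX_pCons)
  show ?case using m pCons.IH[OF pCons.prems(1) m(2)] pCons.prems x_closed
    by (simp add: ev_pCons \<iota>_mult \<iota>_closed ev_closed r_distr m_ac)
qed (simp add: ev_0 \<iota>_closed)

lemma ev_mult: "P \<in> AX \<Longrightarrow> Q \<in> AX \<Longrightarrow> ev (P * Q) = ev P \<otimes> ev Q"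
proof (induction P)
  case (pCons c P)
  have m: "c \<in> A" "P \<in> AX" using pCons by (auto simp: AX_pCons)
  have "ev (pCons c P * Q) = ev (Polynomial.smult c Q) \<oplus> ev (pCons 0 (P * Q))"
    using m pCons.prems by (simp add: ev_add AX_smult AX_mult AX_pCons A_zero)
  also have "\<dots> = \<iota> c \<otimes> ev Q \<oplus> x \<otimes> (ev P \<otimes> ev Q)"
    using m pCons.prems pCons.IH[OF m(2) pCons.prems(2)] x_closed
    by (simp add: ev_smult ev_pCons \<iota>_zero ev_closed)
  finally show ?case using m pCons.prems x_closed by (simp add: ev_pCons l_distr m_assoc \<iota>_closed ev_closed)
qed (simp add: ev_0 ev_closed)

lemma ev_const: "c \<in> A \<Longrightarrow> ev [:c:] = \<iota> c"
  using x_closed by (simp add: ev_pCons ev_0 \<iota>_closed)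

lemma AX_const: "c \<in> A \<Longrightarrow> [:c:] \<in> AX" by (simp add: AX_pCons AX_zero)

lemma ev_1: "ev 1 = \<one>" and AX_1: "1 \<in> AX"
  using ev_const[OF A_one] AX_const[OF A_one] by (simp_all add: \<iota>_one flip: one_pCons)

lemma ev_x: "ev [:0, 1:] = x" and AX_x: "[:0, 1:] \<in> AX"
  using x_closed by (simp_all add: ev_pCons ev_0 \<iota>_zero \<iota>_one AX_pCons AX_zero A_zero A_one)

lemma AX_power: "P \<in> AX \<Longrightarrow> P ^ n \<in> AX"
  by (induction n) (auto simp: AX_1 AX_mult)

lemma ev_power: "P \<in> AX \<Longrightarrow> ev (P ^ n) = ev P [^] n"
  by (induction n) (auto simp: ev_1 ev_mult AX_power ev_closed m_comm)

lemma AX_of_nat: "of_nat n \<in> AX"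
  by (induction n) (auto simp: AX_zero AX_1 AX_add)

lemma ev_of_nat: "ev (of_nat n) = [n] \<cdot> \<one>"
  by (induction n) (auto simp: ev_0 ev_1 ev_add AX_1 AX_of_nat a_comm)

lemma ev_of_nat_mult: "y \<in> carrier C \<Longrightarrow> ev (of_nat n) \<otimes> y = [n] \<cdot> y"
  by (simp add: ev_of_nat add_pow_ldistr)

end

text \<open>The binomial identity is taken in two variables over the natural numbers and evaluated
  at x and y; its remainder then vanishes because p does.\<close>

lemma (in cring) char_p_power_add:
  fixes p :: nat
  assumes p: "prime p" and char: "\<And>z. z \<in> carrier R \<Longrightarrow> [p] \<cdot> z = \<zero>"
    and xy: "x \<in> carrier R" "y \<in> carrier R"
  shows "(x \<oplus> y) [^] p = x [^] p \<oplus> y [^] p"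
proof -
  interpret n: poly_eval R UNIV "\<lambda>n::nat. [n] \<cdot> \<one>" x
    by unfold_locales (auto simp: xy add.nat_pow_mult add_pow_ldistr add.nat_pow_pow mult.commute)
  have n: "n.AX = UNIV" by (simp add: n.AX_def)
  interpret e: poly_eval R UNIV n.ev y
    by unfold_locales (auto simp: xy n n.ev_closed n.ev_add n.ev_mult n.ev_0 n.ev_1)
  have e: "e.AX = UNIV" by (simp add: e.AX_def)
  define u :: "nat poly poly" where "u = [:[:0, 1:]:]"
  define v :: "nat poly poly" where "v = [:0, 1:]"
  have uv: "e.ev u = x" "e.ev v = y" unfolding u_def v_def by (simp_all add: e.ev_const n.ev_x e.ev_x del: One_nat_def)
  obtain T where T: "(u + v) ^ p = u ^ p + v ^ p + of_nat p * T" using prime_power_add[OF p] by blast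
  have "(x \<oplus> y) [^] p = e.ev ((u + v) ^ p)" by (simp add: e e.ev_power e.ev_add uv)
  also have "\<dots> = x [^] p \<oplus> y [^] p \<oplus> [p] \<cdot> e.ev T"
    unfolding T by (simp add: e e.ev_power e.ev_add e.ev_mult uv e.ev_of_nat_mult e.ev_closed)
  finally show ?thesis using char[of "e.ev T"] xy by (simp add: e e.ev_closed)
qed

context kaehler_differentials
begin

lemma d_poly:
  assumes "poly_eval B M \<iota> \<xi>" and base: "\<And>c. c \<in> M \<Longrightarrow> \<exists>a\<in>carrier A. \<iota> c = h a"
    and P: "P \<in> poly_eval.AX M"
  shows "d (poly_eval.ev B \<iota> \<xi> P) = poly_eval.ev B \<iota> \<xi> (pderiv P) \<odot>\<^bsub>kaehler A h B\<^esub> d \<xi>"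
    and "pderiv P \<in> poly_eval.AX M"
proof -
  interpret pe: poly_eval B M \<iota> \<xi> by fact
  have "d (pe.ev P) = pe.ev (pderiv P) \<odot>\<^bsub>kaehler A h B\<^esub> d \<xi> \<and> pderiv P \<in> pe.AX"
    using P
  proof (induction P)
    case 0
    have "d \<zero> = \<zero>\<^bsub>kaehler A h B\<^esub>" using base[OF pe.A_zero] d_base pe.\<iota>_zero by metis
    then show ?case using d_closed[OF pe.x_closed] by (simp add: pe.ev_0 pe.AX_zero)
  next
    case (pCons c P)
    have m: "c \<in> M" "P \<in> pe.AX" using pCons by (auto simp: pe.AX_pCons)
    have IH: "d (pe.ev P) = pe.ev (pderiv P) \<odot>\<^bsub>kaehler A h B\<^esub> d \<xi>" "pderiv P \<in> pe.AX"
      using pCons.IH m by auto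
    note c = pe.\<iota>_closed[OF m(1)] pe.ev_closed[OF m(2)] pe.ev_closed[OF IH(2)] pe.x_closed d_closed[OF pe.x_closed]
    have dc: "d (\<iota> c) = \<zero>\<^bsub>kaehler A h B\<^esub>" using base[OF m(1)] d_base by metis
    have x: "pCons 0 (pderiv P) \<in> pe.AX" using IH(2) by (simp add: pe.AX_pCons pe.A_zero)
    have "d (pe.ev (pCons c P)) = \<xi> \<odot>\<^bsub>kaehler A h B\<^esub> (pe.ev (pderiv P) \<odot>\<^bsub>kaehler A h B\<^esub> d \<xi>) \<oplus>\<^bsub>kaehler A h B\<^esub> pe.ev P \<odot>\<^bsub>kaehler A h B\<^esub> d \<xi>"
      using c by (simp add: pe.ev_pCons d_add d_mult dc IH(1))
    also have "\<dots> = (pe.ev P \<oplus> \<xi> \<otimes> pe.ev (pderiv P)) \<odot>\<^bsub>kaehler A h B\<^esub> d \<xi>"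
      using c by (simp add: \<Omega>.smult_l_distr \<Omega>.smult_assoc1 \<Omega>.M.a_comm)
    also have "pe.ev P \<oplus> \<xi> \<otimes> pe.ev (pderiv P) = pe.ev (pderiv (pCons c P))"
      using c x m(2) by (simp add: pderiv_pCons pe.ev_add pe.ev_pCons pe.\<iota>_zero)
    finally show ?case using x m(2) by (simp add: pderiv_pCons pe.AX_add)
  qed
  then show "d (pe.ev P) = pe.ev (pderiv P) \<odot>\<^bsub>kaehler A h B\<^esub> d \<xi>" "pderiv P \<in> pe.AX" by auto
qed

lemma d_inverse:
  assumes q: "q \<in> carrier B" "r \<in> carrier B" "q \<otimes> r = \<one>" and one: "d \<one> = \<zero>\<^bsub>kaehler A h B\<^esub>"
    and g: "g \<in> carrier B" "\<xi> \<in> carrier (kaehler A h B)" "d r = g \<odot>\<^bsub>kaehler A h B\<^esub> \<xi>"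
  shows "d q = (\<ominus> (q \<otimes> q \<otimes> g)) \<odot>\<^bsub>kaehler A h B\<^esub> \<xi>"
proof -
  let ?O = "kaehler A h B"
  note c = d_closed[OF q(1)] d_closed[OF q(2)]
  have e: "q \<odot>\<^bsub>?O\<^esub> d r \<oplus>\<^bsub>?O\<^esub> r \<odot>\<^bsub>?O\<^esub> d q = \<zero>\<^bsub>?O\<^esub>" using d_mult[OF q(1,2)] q(3) one by simp
  have "d q = (q \<otimes> r) \<odot>\<^bsub>?O\<^esub> d q" using q(3) c by simp
  also have "\<dots> = q \<odot>\<^bsub>?O\<^esub> (r \<odot>\<^bsub>?O\<^esub> d q)" by (rule \<Omega>.smult_assoc1[OF q(1,2) c(1)])
  also have "r \<odot>\<^bsub>?O\<^esub> d q = \<ominus>\<^bsub>?O\<^esub> (q \<odot>\<^bsub>?O\<^esub> d r)"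
    using e q c by (intro \<Omega>.M.minus_equality[symmetric]) (auto simp: \<Omega>.M.a_comm)
  also have "q \<odot>\<^bsub>?O\<^esub> (\<ominus>\<^bsub>?O\<^esub> (q \<odot>\<^bsub>?O\<^esub> d r)) = \<ominus>\<^bsub>?O\<^esub> (q \<odot>\<^bsub>?O\<^esub> (q \<odot>\<^bsub>?O\<^esub> (g \<odot>\<^bsub>?O\<^esub> \<xi>)))"
    using q c g by (simp add: \<Omega>.smult_r_minus)
  also have "\<dots> = (\<ominus> (q \<otimes> q \<otimes> g)) \<odot>\<^bsub>?O\<^esub> \<xi>" using q g by (simp add: \<Omega>.smult_l_minus \<Omega>.smult_assoc1)
  finally show ?thesis .
qed

end

text \<open>Unfolded from the definition of the iterated sum, and thus applicable to the record of
  completed differentials directly.\<close>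

lemma add_pow_simps:
  "[(0::nat)] \<cdot>\<^bsub>R\<^esub> a = \<zero>\<^bsub>R\<^esub>" "[Suc k] \<cdot>\<^bsub>R\<^esub> a = [k] \<cdot>\<^bsub>R\<^esub> a \<oplus>\<^bsub>R\<^esub> a"
  by (simp_all add: add_pow_def nat_pow_def)

section \<open>Completed differentials that are multiples of dx\<close>

locale completed_differentials = A: cring A + B: cring B for A :: "('a, 'k) ring_scheme" and B :: "('b, 'm) ring_scheme" +
  fixes p :: nat and h :: "'a \<Rightarrow> 'b" and x :: 'b
  assumes h: "h \<in> ring_hom A B" and x: "x \<in> carrier B"
begin

abbreviation "\<Omega> n \<equiv> padic_kaehler p A h B n"
abbreviation "Q n \<equiv> padic_quot p B n"
abbreviation "hq n \<equiv> padic_quot_map p B n h"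
abbreviation "dn n \<equiv> kaehler_d (padic_quot p A n) (hq n) (Q n)"
abbreviation "CK \<equiv> completed_kaehler p A h B"
abbreviation "C \<equiv> padic_completion p B"

lemma hq_hom: "hq n \<in> ring_hom (padic_quot p A n) (Q n)"
  by (rule B.padic_quot_map_hom[OF A.is_cring h])

lemma kd: "kaehler_differentials (Q n) (padic_quot p A n) (hq n)"
  by (intro kaehler_differentials.intro kaehler_differentials_axioms.intro B.cring_padic_quot ring_hom_closed[OF hq_hom])

lemma kd_module: "module (Q n) (\<Omega> n)"
proof -
  interpret kaehler_differentials "Q n" "padic_quot p A n" "hq n" by (rule kd)
  show ?thesis unfolding padic_kaehler_def by (rule \<Omega>.module_axioms)
qed

definition dx :: "nat \<Rightarrow> ('b set \<Rightarrow> 'b set) set" where "dx n = dn n (padic_proj p B n x)"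

text \<open>The invariant form, its pullback and the error term are all multiples of dx. Computing
  with forms becomes computing with their coefficients in the completion.\<close>

definition form :: "(nat \<Rightarrow> 'b set) \<Rightarrow> nat \<Rightarrow> ('b set \<Rightarrow> 'b set) set" where
  "form \<alpha> = (\<lambda>n. \<alpha> n \<odot>\<^bsub>\<Omega> n\<^esub> dx n)"

lemma dx_closed: "dx n \<in> carrier (\<Omega> n)"
  unfolding dx_def padic_kaehler_def
  by (rule kaehler_differentials.d_closed[OF kd B.padic_proj_closed[OF x]])

lemma C_component: "\<alpha> \<in> carrier C \<Longrightarrow> \<alpha> n \<in> carrier (Q n)"
  by (simp add: B.padic_completion_carrier)

lemma form_closed:
  assumes "\<alpha> \<in> carrier C"
  shows "form \<alpha> \<in> carrier CK"
proof -
  have "kaehler_map (Q (Suc n)) (padic_quot p A n) (hq n) (Q n) (padic_quot_map p B n id) (form \<alpha> (Suc n)) = form \<alpha> n" for n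
  proof -
    have "kaehler_pushforward (Q (Suc n)) (padic_quot p A (Suc n)) (hq (Suc n)) (Q n) (padic_quot p A n) (hq n) (padic_quot_map p B n id)"
    proof (intro kaehler_pushforward.intro kaehler_pushforward_axioms.intro kd B.padic_transition_hom)
      fix s assume "s \<in> carrier (padic_quot p A (Suc n))"
      then obtain r where r: "r \<in> carrier A" "s = padic_proj p A (Suc n) r" by (auto simp: A.padic_quot_carrier)
      have hr: "h r \<in> carrier B" using ring_hom_closed[OF h r(1)] .
      have "padic_quot_map p B n id (hq (Suc n) s) = hq n (padic_proj p A n r)"
        using r hr by (simp add: B.padic_quot_map_proj[OF A.is_cring h] B.padic_transition_proj)
      then show "\<exists>s'\<in>carrier (padic_quot p A n). padic_quot_map p B n id (hq (Suc n) s) = hq n s'"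
        using A.padic_proj_closed[OF r(1)] by blast
    qed
    from kaehler_pushforward.kaehler_map_smult_d[OF this C_component[OF assms] B.padic_proj_closed[OF x]]
    show ?thesis using assms x
      by (simp add: form_def dx_def padic_kaehler_def B.padic_transition_proj B.padic_completion_carrier)
  qed
  moreover have "form \<alpha> n \<in> carrier (\<Omega> n)" for n
    unfolding form_def by (rule module.smult_closed[OF kd_module C_component[OF assms] dx_closed])
  ultimately show ?thesis by (simp add: completed_kaehler_def)
qed

lemma form_add:
  assumes "\<alpha> \<in> carrier C" "\<beta> \<in> carrier C"
  shows "form (\<alpha> \<oplus>\<^bsub>C\<^esub> \<beta>) = form \<alpha> \<oplus>\<^bsub>CK\<^esub> form \<beta>"
  by (simp add: form_def completed_kaehler_def B.padic_completion_ops
      module.smult_l_distr[OF kd_module C_component[OF assms(1)] C_component[OF assms(2)] dx_closed])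

lemma form_smult:
  assumes "\<alpha> \<in> carrier C" "\<beta> \<in> carrier C"
  shows "\<alpha> \<odot>\<^bsub>CK\<^esub> form \<beta> = form (\<alpha> \<otimes>\<^bsub>C\<^esub> \<beta>)"
  by (simp add: form_def completed_kaehler_def B.padic_completion_ops
      module.smult_assoc1[OF kd_module C_component[OF assms(1)] C_component[OF assms(2)] dx_closed])

lemma form_add_pow:
  assumes "\<alpha> \<in> carrier C"
  shows "[(k::nat)] \<cdot>\<^bsub>CK\<^esub> form \<alpha> = form ([k] \<cdot>\<^bsub>C\<^esub> \<alpha>)"
proof -
  interpret C: cring C by (rule B.cring_padic_completion)
  have z: "form \<zero>\<^bsub>C\<^esub> = \<zero>\<^bsub>CK\<^esub>"
    by (simp add: form_def completed_kaehler_def B.padic_completion_ops module.smult_l_null[OF kd_module dx_closed])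
  show ?thesis
  proof (induction k)
    case (Suc k)
    then show ?case using form_add[of "[k] \<cdot>\<^bsub>C\<^esub> \<alpha>" \<alpha>] assms by (simp add: add_pow_simps del: C.add.nat_pow_Suc)
  qed (simp add: add_pow_simps z)
qed

text \<open>At each level the pullback of t dx is Phi(t) d Phi(x). Once d Phi(x) is known to be g dx
  at every level, the coefficients multiply in the completion.\<close>

lemma pullback_form:
  assumes \<Phi>: "\<Phi> \<in> ring_hom C C" and base: "\<And>r. r \<in> carrier A \<Longrightarrow> \<exists>r'\<in>carrier A. \<Phi> (padic_embed p B (h r)) = padic_embed p B (h r')"
    and t: "t \<in> carrier B" and gx: "g \<in> carrier C" and dX: "\<And>n. dn n (\<Phi> (padic_embed p B x) n) = g n \<odot>\<^bsub>\<Omega> n\<^esub> dx n"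
  shows "completed_pullback p A h B \<Phi> (form (padic_embed p B t)) = form (\<Phi> (padic_embed p B t) \<otimes>\<^bsub>C\<^esub> g)"
proof
  fix n
  have "kaehler_pushforward (Q n) (padic_quot p A n) (hq n) (Q n) (padic_quot p A n) (hq n) (padic_reduce p B \<Phi> n)"
  proof (intro kaehler_pushforward.intro kaehler_pushforward_axioms.intro kd B.padic_reduce_hom \<Phi>)
    fix s assume "s \<in> carrier (padic_quot p A n)"
    then obtain r where r: "r \<in> carrier A" "s = padic_proj p A n r" by (auto simp: A.padic_quot_carrier)
    obtain r' where r': "r' \<in> carrier A" "\<Phi> (padic_embed p B (h r)) = padic_embed p B (h r')" using base[OF r(1)] by blast
    have hr: "h r \<in> carrier B" using ring_hom_closed[OF h r(1)] .
    have "padic_reduce p B \<Phi> n (hq n s) = hq n (padic_proj p A n r')"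
      using r r' hr by (simp add: B.padic_quot_map_proj[OF A.is_cring h] B.padic_reduce_proj[OF \<Phi>]) (simp add: padic_embed_def)
    then show "\<exists>s'\<in>carrier (padic_quot p A n). padic_reduce p B \<Phi> n (hq n s) = hq n s'"
      using A.padic_proj_closed[OF r'(1)] by blast
  qed
  from kaehler_pushforward.kaehler_map_smult_d[OF this B.padic_proj_closed[OF t, of p n] B.padic_proj_closed[OF x, of p n]]
  have "completed_pullback p A h B \<Phi> (form (padic_embed p B t)) n =
      \<Phi> (padic_embed p B t) n \<odot>\<^bsub>\<Omega> n\<^esub> dn n (\<Phi> (padic_embed p B x) n)"
    by (simp add: completed_pullback_def form_def dx_def padic_kaehler_def padic_embed_def
        B.padic_reduce_proj[OF \<Phi> t, unfolded padic_embed_def] B.padic_reduce_proj[OF \<Phi> x, unfolded padic_embed_def])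
  also have "\<dots> = (\<Phi> (padic_embed p B t) n \<otimes>\<^bsub>Q n\<^esub> g n) \<odot>\<^bsub>\<Omega> n\<^esub> dx n"
    unfolding dX
    by (rule module.smult_assoc1[OF kd_module C_component[OF ring_hom_closed[OF \<Phi> B.padic_embed_closed[OF t]]] C_component[OF gx] dx_closed, symmetric])
  finally show "completed_pullback p A h B \<Phi> (form (padic_embed p B t)) n = form (\<Phi> (padic_embed p B t) \<otimes>\<^bsub>C\<^esub> g) n"
    by (simp add: form_def B.padic_completion_ops)
qed

end

subsection \<open>Lifting Frobenius to the curve\<close>

lemma (in poly_eval) compose:
  assumes B: "cring B" and g: "g \<in> ring_hom C B"
  shows "poly_eval B A (\<lambda>c. g (\<iota> c)) (g x)"
    and "P \<in> AX \<Longrightarrow> poly_eval.ev B (\<lambda>c. g (\<iota> c)) (g x) P = g (ev P)"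
proof -
  interpret g: ring_hom_cring C B g by (intro ring_hom_cringI is_cring B g)
  show *: "poly_eval B A (\<lambda>c. g (\<iota> c)) (g x)"
    by unfold_locales (simp_all add: A_zero A_one A_add A_mult \<iota>_closed \<iota>_zero \<iota>_one \<iota>_add \<iota>_mult x_closed)
  interpret b: poly_eval B A "\<lambda>c. g (\<iota> c)" "g x" by fact
  show "b.ev P = g (ev P)" if "P \<in> AX"
    using that by (induction P) (simp_all add: b.ev_0 ev_0 b.ev_pCons ev_pCons AX_pCons \<iota>_closed ev_closed x_closed)
qed

section \<open>Calculations in the completed coordinate ring\<close>

context cring
begin

text \<open>The correction \<pi>^2 V T changes the cubic by itself times the difference quotient
  \<open>K\<close>. It therefore enters only \<open>E1\<close>, and the term G of order \<pi> stays
  as it was.\<close>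

lemma twisted_cubic:
  assumes c: "\<pi> \<in> carrier R" "X0 \<in> carrier R" "V \<in> carrier R" "T \<in> carrier R" "G \<in> carrier R" "F \<in> carrier R" "A \<in> carrier R" "B \<in> carrier R"
    and e: "X0 \<otimes> X0 \<otimes> X0 \<oplus> A \<otimes> X0 \<oplus> B = F \<oplus> \<pi> \<otimes> G" and FT: "F \<otimes> T = \<one>"
    and X: "X = X0 \<oplus> \<pi> \<otimes> \<pi> \<otimes> (V \<otimes> T)"
  shows "\<exists>E1\<in>carrier R. X \<otimes> X \<otimes> X \<oplus> A \<otimes> X \<oplus> B = F \<otimes> (\<one> \<oplus> \<pi> \<otimes> (T \<otimes> G \<oplus> \<pi> \<otimes> E1))"
proof
  define r where "r = \<pi> \<otimes> \<pi> \<otimes> (V \<otimes> T)"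
  define K where "K = X \<otimes> X \<oplus> X \<otimes> X0 \<oplus> X0 \<otimes> X0 \<oplus> A"
  have r: "r \<in> carrier R" and Xc: "X \<in> carrier R" unfolding X r_def using c by simp_all
  have K: "K \<in> carrier R" unfolding K_def using c Xc by simp
  have Xr: "r = X \<ominus> X0" unfolding X r_def[symmetric] using c(2) r by algebra
  show E1: "T \<otimes> (V \<otimes> T \<otimes> K) \<in> carrier R" using c K by simp
  have "X \<otimes> X \<otimes> X \<oplus> A \<otimes> X \<oplus> B = (X0 \<otimes> X0 \<otimes> X0 \<oplus> A \<otimes> X0 \<oplus> B) \<oplus> r \<otimes> K"
    unfolding Xr K_def using c(2,7,8) Xc by algebra
  also have "\<dots> = F \<oplus> \<pi> \<otimes> (F \<otimes> T \<otimes> G) \<oplus> \<pi> \<otimes> \<pi> \<otimes> (F \<otimes> T \<otimes> (V \<otimes> T \<otimes> K))"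
    unfolding e FT r_def using c K by (simp add: m_assoc)
  also have "\<dots> = F \<otimes> (\<one> \<oplus> \<pi> \<otimes> (T \<otimes> G \<oplus> \<pi> \<otimes> (T \<otimes> (V \<otimes> T \<otimes> K))))"
    using c(1,3-6) K by (simp add: r_distr m_ac a_ac)
  finally show "X \<otimes> X \<otimes> X \<oplus> A \<otimes> X \<oplus> B = F \<otimes> (\<one> \<oplus> \<pi> \<otimes> (T \<otimes> G \<oplus> \<pi> \<otimes> (T \<otimes> (V \<otimes> T \<otimes> K))))" .
qed

text \<open>The first equation determines twice the root 1 + \<pi> w up to order \<pi>^2, the
  precision at which the forms are compared.\<close>

lemma twisted_root:
  assumes c: "\<pi> \<in> carrier R" "E \<in> carrier R" "i \<in> carrier R" "w \<in> carrier R"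
    and i: "i \<oplus> i = \<one>" and w: "w = i \<otimes> (E \<ominus> \<pi> \<otimes> (w \<otimes> w))"
  shows "w \<oplus> w = E \<ominus> \<pi> \<otimes> (w \<otimes> w)"
    and "(\<one> \<oplus> \<pi> \<otimes> w) \<otimes> (\<one> \<oplus> \<pi> \<otimes> w) = \<one> \<oplus> \<pi> \<otimes> E"
proof -
  define q where "q = E \<ominus> \<pi> \<otimes> (w \<otimes> w)"
  have q: "q \<in> carrier R" unfolding q_def using c by simp
  have "w \<oplus> w = i \<otimes> q \<oplus> i \<otimes> q" using w unfolding q_def[symmetric] by simp
  also have "\<dots> = (i \<oplus> i) \<otimes> q" using c q by algebra
  finally show ww: "w \<oplus> w = E \<ominus> \<pi> \<otimes> (w \<otimes> w)" using q by (simp add: i q_def)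
  have "(\<one> \<oplus> \<pi> \<otimes> w) \<otimes> (\<one> \<oplus> \<pi> \<otimes> w) = \<one> \<oplus> \<pi> \<otimes> (w \<oplus> w) \<oplus> \<pi> \<otimes> \<pi> \<otimes> (w \<otimes> w)" using c by algebra
  also have "\<dots> = \<one> \<oplus> \<pi> \<otimes> E" unfolding ww using c by algebra
  finally show "(\<one> \<oplus> \<pi> \<otimes> w) \<otimes> (\<one> \<oplus> \<pi> \<otimes> w) = \<one> \<oplus> \<pi> \<otimes> E" .
qed

text \<open>Multiplying the cleared identity by T shows that 2 g is L \<open>fm\<close> times twice
  the root, up to \<pi>^2. Halving by \<open>i\<close>, dividing by the root through
  \<open>v\<close> and by y^p through \<open>tp\<close> gives L / y.\<close>

lemma twisted_form:
  assumes c: "\<pi> \<in> carrier R" "U \<in> carrier R" "V' \<in> carrier R" "T \<in> carrier R" "G \<in> carrier R" "F \<in> carrier R" "L \<in> carrier R"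
      "fm \<in> carrier R" "Z \<in> carrier R" "V2 \<in> carrier R" "E1 \<in> carrier R" "w \<in> carrier R" "v \<in> carrier R" "tp \<in> carrier R" "i \<in> carrier R"
    and hz: "(U \<otimes> F \<oplus> U \<otimes> F) \<oplus> (\<pi> \<otimes> V' \<oplus> \<pi> \<otimes> V') = L \<otimes> fm \<otimes> (F \<oplus> F \<oplus> \<pi> \<otimes> G) \<oplus> \<pi> \<otimes> \<pi> \<otimes> Z"
    and FT: "F \<otimes> T = \<one>" and i: "i \<oplus> i = \<one>"
    and ww: "w \<oplus> w = (T \<otimes> G \<oplus> \<pi> \<otimes> E1) \<ominus> \<pi> \<otimes> (w \<otimes> w)"
    and sv: "(\<one> \<oplus> \<pi> \<otimes> w) \<otimes> v = \<one>" and t: "fm \<otimes> tp = t"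
    and g: "g = U \<oplus> \<pi> \<otimes> (T \<otimes> V') \<ominus> \<pi> \<otimes> \<pi> \<otimes> V2"
  shows "\<exists>W\<in>carrier R. tp \<otimes> v \<otimes> g = L \<otimes> t \<oplus> \<pi> \<otimes> \<pi> \<otimes> W"
proof
  define q where "q = T \<otimes> Z \<ominus> (V2 \<oplus> V2) \<ominus> L \<otimes> fm \<otimes> (E1 \<ominus> w \<otimes> w)"
  define s where "s = \<one> \<oplus> \<pi> \<otimes> w"
  have gc: "g \<in> carrier R" and qc: "q \<in> carrier R" and sc: "s \<in> carrier R" unfolding g q_def s_def using c by simp_all
  show "i \<otimes> q \<otimes> (tp \<otimes> v) \<in> carrier R" using c qc by simp
  have ss: "s \<oplus> s = \<one> \<oplus> \<one> \<oplus> \<pi> \<otimes> (T \<otimes> G) \<oplus> \<pi> \<otimes> \<pi> \<otimes> (E1 \<ominus> w \<otimes> w)"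
  proof -
    have "s \<oplus> s = \<one> \<oplus> \<one> \<oplus> \<pi> \<otimes> (w \<oplus> w)" unfolding s_def using c by algebra
    also have "\<dots> = \<one> \<oplus> \<one> \<oplus> \<pi> \<otimes> (T \<otimes> G) \<oplus> \<pi> \<otimes> \<pi> \<otimes> (E1 \<ominus> w \<otimes> w)" unfolding ww using c by algebra
    finally show ?thesis .
  qed
  have "g \<oplus> g = (\<one> \<otimes> U \<oplus> \<one> \<otimes> U) \<oplus> (\<pi> \<otimes> (T \<otimes> V') \<oplus> \<pi> \<otimes> (T \<otimes> V')) \<ominus> \<pi> \<otimes> \<pi> \<otimes> (V2 \<oplus> V2)"
    unfolding g using c by algebra
  also have "\<dots> = T \<otimes> ((U \<otimes> F \<oplus> U \<otimes> F) \<oplus> (\<pi> \<otimes> V' \<oplus> \<pi> \<otimes> V')) \<ominus> \<pi> \<otimes> \<pi> \<otimes> (V2 \<oplus> V2)"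
    unfolding FT[symmetric] using c by algebra
  also have "\<dots> = L \<otimes> fm \<otimes> ((F \<otimes> T) \<oplus> (F \<otimes> T) \<oplus> \<pi> \<otimes> (T \<otimes> G)) \<oplus> \<pi> \<otimes> \<pi> \<otimes> (T \<otimes> Z \<ominus> (V2 \<oplus> V2))"
    unfolding hz using c by algebra
  also have "\<dots> = L \<otimes> fm \<otimes> (\<one> \<oplus> \<one> \<oplus> \<pi> \<otimes> (T \<otimes> G) \<oplus> \<pi> \<otimes> \<pi> \<otimes> (E1 \<ominus> w \<otimes> w)) \<oplus> \<pi> \<otimes> \<pi> \<otimes> q"
    unfolding FT q_def using c by algebra
  finally have gg: "g \<oplus> g = L \<otimes> fm \<otimes> (s \<oplus> s) \<oplus> \<pi> \<otimes> \<pi> \<otimes> q" unfolding ss .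
  have "g = (i \<oplus> i) \<otimes> g" using gc by (simp add: i)
  also have "\<dots> = i \<otimes> (g \<oplus> g)" using c gc by algebra
  also have "\<dots> = L \<otimes> fm \<otimes> ((i \<oplus> i) \<otimes> s) \<oplus> \<pi> \<otimes> \<pi> \<otimes> (i \<otimes> q)" unfolding gg using c sc qc by algebra
  also have "\<dots> = L \<otimes> fm \<otimes> s \<oplus> \<pi> \<otimes> \<pi> \<otimes> (i \<otimes> q)" using c sc by (simp add: i)
  finally have g': "g = L \<otimes> fm \<otimes> s \<oplus> \<pi> \<otimes> \<pi> \<otimes> (i \<otimes> q)" .
  have "tp \<otimes> v \<otimes> g = L \<otimes> (fm \<otimes> tp) \<otimes> (s \<otimes> v) \<oplus> \<pi> \<otimes> \<pi> \<otimes> (i \<otimes> q \<otimes> (tp \<otimes> v))"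
    unfolding g' using c sc qc by algebra
  also have "s \<otimes> v = \<one>" unfolding s_def by (rule sv)
  also have "L \<otimes> (fm \<otimes> tp) \<otimes> \<one> = L \<otimes> t" using c(7) m_closed[OF c(8,14)] unfolding t by simp
  finally show "tp \<otimes> v \<otimes> g = L \<otimes> t \<oplus> \<pi> \<otimes> \<pi> \<otimes> (i \<otimes> q \<otimes> (tp \<otimes> v))" .
qed

end

lemma (in cring) pow_inverse_cancel:
  assumes "y \<in> carrier R" "t \<in> carrier R" "y \<otimes> t = \<one>"
  shows "y [^] (n::nat) \<otimes> t [^] n = \<one>"
  using assms by (simp flip: nat_pow_distrib)

lemma (in kaehler_differentials) d_twisted:
  assumes c: "X \<in> carrier B" "r \<in> carrier B" "U \<in> carrier B" "V \<in> carrier B" "V' \<in> carrier B" "K \<in> carrier B" "\<tau> \<in> carrier B"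
    and \<xi>: "\<xi> \<in> carrier (kaehler A h B)"
    and d: "d X = (r \<otimes> U) \<odot>\<^bsub>kaehler A h B\<^esub> \<xi>" "d \<tau> = (\<ominus> (\<tau> \<otimes> \<tau> \<otimes> (r \<otimes> K))) \<odot>\<^bsub>kaehler A h B\<^esub> \<xi>"
      "d (r \<otimes> r \<otimes> V) = (r \<otimes> r \<otimes> V') \<odot>\<^bsub>kaehler A h B\<^esub> \<xi>"
  shows "d (X \<oplus> (r \<otimes> r \<otimes> V) \<otimes> \<tau>) =
    (r \<otimes> (U \<oplus> r \<otimes> (\<tau> \<otimes> V') \<ominus> r \<otimes> r \<otimes> (V \<otimes> \<tau> \<otimes> \<tau> \<otimes> K))) \<odot>\<^bsub>kaehler A h B\<^esub> \<xi>"
proof -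
  define m where "m = \<ominus> (\<tau> \<otimes> \<tau> \<otimes> (r \<otimes> K))"
  have m: "m \<in> carrier B" unfolding m_def using c by simp
  have r: "r \<otimes> r \<otimes> V \<in> carrier B" "r \<otimes> r \<otimes> V' \<in> carrier B" "r \<otimes> U \<in> carrier B" using c by simp_all
  have "d (X \<oplus> (r \<otimes> r \<otimes> V) \<otimes> \<tau>) = d X \<oplus>\<^bsub>kaehler A h B\<^esub> d ((r \<otimes> r \<otimes> V) \<otimes> \<tau>)"
    by (intro d_add c r m_closed)
  also have "d ((r \<otimes> r \<otimes> V) \<otimes> \<tau>) =
      (r \<otimes> r \<otimes> V) \<odot>\<^bsub>kaehler A h B\<^esub> d \<tau> \<oplus>\<^bsub>kaehler A h B\<^esub> \<tau> \<odot>\<^bsub>kaehler A h B\<^esub> d (r \<otimes> r \<otimes> V)"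
    by (intro d_mult c r m_closed)
  also have "\<dots> = ((r \<otimes> r \<otimes> V) \<otimes> m \<oplus> \<tau> \<otimes> (r \<otimes> r \<otimes> V')) \<odot>\<^bsub>kaehler A h B\<^esub> \<xi>"
    unfolding d(2,3) m_def[symmetric]
    using \<Omega>.smult_l_distr[OF m_closed[OF r(1) m] m_closed[OF c(7) r(2)] \<xi>]
      \<Omega>.smult_assoc1[OF r(1) m \<xi>] \<Omega>.smult_assoc1[OF c(7) r(2) \<xi>] by simp
  also have "d X \<oplus>\<^bsub>kaehler A h B\<^esub> \<dots> =
      (r \<otimes> U \<oplus> ((r \<otimes> r \<otimes> V) \<otimes> m \<oplus> \<tau> \<otimes> (r \<otimes> r \<otimes> V'))) \<odot>\<^bsub>kaehler A h B\<^esub> \<xi>"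
    unfolding d(1) by (intro \<Omega>.smult_l_distr[symmetric] r a_closed m_closed c m \<xi>)
  also have "r \<otimes> U \<oplus> ((r \<otimes> r \<otimes> V) \<otimes> m \<oplus> \<tau> \<otimes> (r \<otimes> r \<otimes> V')) =
      r \<otimes> (U \<oplus> r \<otimes> (\<tau> \<otimes> V') \<ominus> r \<otimes> r \<otimes> (V \<otimes> \<tau> \<otimes> \<tau> \<otimes> K))"
    unfolding m_def using c by algebra
  finally show ?thesis .
qed

text \<open>The meeting point of the two halves of the proof: polynomial identities over a domain on
  one side, a curve over an abstract ring S with Frobenius lift on the other. \<alpha> and \<beta>
  are preimages in M of the twisted coefficients of the curve.\<close>

locale twisted_frobenius = elliptic S a b + PS: poly_eval S M \<iota> a
  for S (structure) and a b and M :: "'k::idom set" and \<iota> +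
  fixes p :: nat and \<phi> and u V G Z :: "'k poly" and A B \<alpha> \<beta> \<Lambda> half :: 'k
  assumes p: "prime p" "odd p" and \<phi>: "frobenius_lift p S \<phi>"
    and AB: "A \<in> M" "B \<in> M" "\<iota> A = a" "\<iota> B = b"
    and \<alpha>\<beta>: "\<alpha> \<in> M" "\<beta> \<in> M" "\<iota> \<alpha> = \<phi> a" "\<iota> \<beta> = \<phi> b"
    and half: "half \<in> M" "half + half = 1" and \<Lambda>: "\<Lambda> \<in> M"
    and polys: "u \<in> PS.AX" "V \<in> PS.AX" "G \<in> PS.AX" "Z \<in> PS.AX"
    and cubic: "(Polynomial.monom 1 p + of_nat p * u) ^ 3 + [:\<alpha>:] * (Polynomial.monom 1 p + of_nat p * u) + [:\<beta>:]
        = [:B, A, 0, 1:] ^ p + of_nat p * G"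
    and diff_form: "2 * (Polynomial.monom 1 (p - 1) + pderiv u) * [:B, A, 0, 1:] ^ p + 2 * of_nat p * pderiv V
        = [:\<Lambda>:] * [:B, A, 0, 1:] ^ ((p - 1) div 2) * (2 * [:B, A, 0, 1:] ^ p + of_nat p * G) + of_nat p ^ 2 * Z"
begin

abbreviation "C \<equiv> padic_completion p E"
abbreviation "em \<equiv> padic_embed p E"
definition "f = [:B, A, 0, 1:]"
definition "X0 = Polynomial.monom 1 p + of_nat p * u"
definition "U = Polynomial.monom 1 (p - 1) + pderiv u"

sublocale PB: poly_eval E M "\<lambda>c. cE (\<iota> c)" xE
proof -
  interpret c: ring_hom_cring S E cE by (intro ring_hom_cringI is_cring cring_ell ell_const_hom)
  show "poly_eval E M (\<lambda>c. cE (\<iota> c)) xE"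
    by unfold_locales
      (simp_all add: PS.A_zero PS.A_one PS.A_add PS.A_mult PS.\<iota>_closed PS.\<iota>_zero PS.\<iota>_one PS.\<iota>_add PS.\<iota>_mult)
qed

sublocale C: cring C by (rule E.cring_padic_completion)

sublocale em: ring_hom_cring E C em
  by (intro ring_hom_cringI cring_ell E.cring_padic_completion E.padic_embed_hom)

sublocale PC: poly_eval C M "\<lambda>c. em (cE (\<iota> c))" "em xE"
  by (rule PB.compose(1)[OF E.cring_padic_completion E.padic_embed_hom])

lemma PC_ev: "F \<in> PS.AX \<Longrightarrow> PC.ev F = em (PB.ev F)"
  by (rule PB.compose(2)[OF E.cring_padic_completion E.padic_embed_hom])

lemma AX_pderiv: "F \<in> PS.AX \<Longrightarrow> pderiv F \<in> PS.AX"
proof -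
  have "of_nat n \<in> M" for n by (induction n) (auto simp: PS.A_zero PS.A_one PS.A_add)
  then show "F \<in> PS.AX \<Longrightarrow> pderiv F \<in> PS.AX"
    by (auto simp: PS.AX_def coeff_pderiv intro!: PS.A_mult simp del: of_nat_Suc)
qed

lemma AX_monom: "c \<in> M \<Longrightarrow> Polynomial.monom c n \<in> PS.AX"
  by (simp add: PS.AX_def PS.A_zero)

lemma f_AX: "f \<in> PS.AX"
  by (simp add: f_def PS.AX_pCons PS.AX_zero PS.A_zero PS.A_one AB)

lemma X0_AX: "X0 \<in> PS.AX" and U_AX: "U \<in> PS.AX"
  unfolding X0_def U_def by (intro PS.AX_add PS.AX_mult PS.AX_of_nat AX_monom PS.A_one AX_pderiv polys)+

lemmas AX_intros = PS.AX_add PS.AX_mult PS.AX_of_nat PS.AX_power PS.AX_const AX_pderiv f_AX X0_AX U_AX polys \<alpha>\<beta>(1,2) \<Lambda>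

lemma ev_f: "PB.ev f = yE [^]\<^bsub>E\<^esub> (2::nat)"
proof -
  have "PB.ev f = cE b \<oplus>\<^bsub>E\<^esub> xE \<otimes>\<^bsub>E\<^esub> (cE a \<oplus>\<^bsub>E\<^esub> xE \<otimes>\<^bsub>E\<^esub> xE)"
    unfolding f_def by (simp add: PB.ev_pCons PB.ev_0 PB.\<iota>_zero PB.\<iota>_one AB)
  also have "\<dots> = xE [^]\<^bsub>E\<^esub> (3::nat) \<oplus>\<^bsub>E\<^esub> cE a \<otimes>\<^bsub>E\<^esub> xE \<oplus>\<^bsub>E\<^esub> cE b"
    using a b by (simp add: numeral_3_eq_3 E.r_distr E.m_ac E.a_ac)
  finally show ?thesis by (simp add: ell_relations)
qed

lemma f_power_inverse: "PB.ev (f ^ p) \<otimes>\<^bsub>E\<^esub> tE [^]\<^bsub>E\<^esub> (2 * p) = \<one>\<^bsub>E\<^esub>"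
  using E.pow_inverse_cancel[OF ell_closed(3,4) ell_relations(2), of "2 * p"]
  by (simp add: PB.ev_power f_AX ev_f E.nat_pow_pow)

lemma f_half_power: "PB.ev (f ^ ((p - 1) div 2)) \<otimes>\<^bsub>E\<^esub> tE [^]\<^bsub>E\<^esub> p = tE"
proof -
  obtain m where m: "p = Suc (2 * m)" using p(2) by (elim oddE) simp
  have "PB.ev (f ^ ((p - 1) div 2)) = yE [^]\<^bsub>E\<^esub> (2 * m)"
    by (simp add: m PB.ev_power f_AX ev_f E.nat_pow_pow)
  moreover have "tE [^]\<^bsub>E\<^esub> p = tE [^]\<^bsub>E\<^esub> (2 * m) \<otimes>\<^bsub>E\<^esub> tE" by (simp add: m)
  ultimately show ?thesis
    using E.pow_inverse_cancel[OF ell_closed(3,4) ell_relations(2), of "2 * m"] by (simp flip: E.m_assoc)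
qed

abbreviation "\<pi> \<equiv> PB.ev (of_nat p)"
abbreviation "T \<equiv> tE [^]\<^bsub>E\<^esub> (2 * p)"
text \<open>Comes from differentiating f^-p, which gives - p f^(p-1) f' / f^(2p).\<close>

definition "V2 = PB.ev V \<otimes>\<^bsub>E\<^esub> T \<otimes>\<^bsub>E\<^esub> T \<otimes>\<^bsub>E\<^esub> PB.ev (f ^ (p - 1) * pderiv f)"
definition "X1 = PB.ev X0 \<oplus>\<^bsub>E\<^esub> \<pi> \<otimes>\<^bsub>E\<^esub> \<pi> \<otimes>\<^bsub>E\<^esub> (PB.ev V \<otimes>\<^bsub>E\<^esub> T)"
definition "g1 = PB.ev U \<oplus>\<^bsub>E\<^esub> \<pi> \<otimes>\<^bsub>E\<^esub> (T \<otimes>\<^bsub>E\<^esub> PB.ev (pderiv V)) \<ominus>\<^bsub>E\<^esub> \<pi> \<otimes>\<^bsub>E\<^esub> \<pi> \<otimes>\<^bsub>E\<^esub> V2"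

lemma \<pi>_closed: "\<pi> \<in> carrier E" by (intro PB.ev_closed AX_intros)
lemma T_closed: "T \<in> carrier E" by simp
lemma V2_closed: "V2 \<in> carrier E" unfolding V2_def by (intro E.m_closed PB.ev_closed T_closed AX_intros)
lemma X1_closed: "X1 \<in> carrier E" unfolding X1_def by (intro E.m_closed E.a_closed PB.ev_closed T_closed AX_intros)
lemma g1_closed: "g1 \<in> carrier E"
  unfolding g1_def by (intro E.m_closed E.a_closed E.minus_closed PB.ev_closed T_closed V2_closed AX_intros)

sublocale CD: completed_differentials S E p cE xE
  by unfold_locales (simp_all add: ell_const_hom)

text \<open>The derivative of \<open>X1\<close> is p times the explicit element \<open>g1\<close> of
  the coordinate ring, so the division by p takes place in the coefficient. \<open>X1\<close> needs
  only the powers of 1/y, and the completion enters first with the square root.\<close>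

lemma d_X1: "CD.dn n (padic_proj p E n X1) = padic_proj p E n (\<pi> \<otimes>\<^bsub>E\<^esub> g1) \<odot>\<^bsub>CD.\<Omega> n\<^esub> CD.dx n"
proof -
  let ?Q = "padic_quot p E n" and ?q = "padic_proj p E n" and ?O = "CD.\<Omega> n"
  interpret K: kaehler_differentials ?Q "padic_quot p S n" "CD.hq n" by (rule CD.kd)
  interpret h: ring_hom_cring E ?Q ?q
    by (intro ring_hom_cringI cring_ell E.cring_padic_quot E.padic_proj_hom)
  have pe: "poly_eval ?Q M (\<lambda>c. ?q (cE (\<iota> c))) (?q xE)"
    by (rule PB.compose(1)[OF E.cring_padic_quot E.padic_proj_hom])
  interpret PQ: poly_eval ?Q M "\<lambda>c. ?q (cE (\<iota> c))" "?q xE" by (rule pe)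
  have ev: "PQ.ev F = ?q (PB.ev F)" if "F \<in> PS.AX" for F
    by (rule PB.compose(2)[OF E.cring_padic_quot E.padic_proj_hom that])
  have base: "\<exists>r\<in>carrier (padic_quot p S n). ?q (cE (\<iota> c)) = CD.hq n r" if "c \<in> M" for c
    using E.padic_quot_map_proj[OF is_cring ell_const_hom PS.\<iota>_closed[OF that], of p n]
      padic_proj_closed[OF PS.\<iota>_closed[OF that], of p n] by metis
  have dP: "CD.dn n (?q (PB.ev F)) = ?q (PB.ev (pderiv F)) \<odot>\<^bsub>?O\<^esub> CD.dx n" if "F \<in> PS.AX" for F
    using K.d_poly(1)[OF pe base that] ev[OF that] ev[OF AX_pderiv[OF that]]
    by (simp add: CD.dx_def padic_kaehler_def)
  have one: "CD.dn n \<one>\<^bsub>?Q\<^esub> = \<zero>\<^bsub>?O\<^esub>"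
    using base[OF PS.A_one] K.d_base PQ.\<iota>_one unfolding padic_kaehler_def by metis
  have d_f: "pderiv (f ^ p) = of_nat p * (f ^ (p - 1) * pderiv f)"
    using p prime_gt_0_nat[OF p(1)] by (simp add: pderiv_power of_nat_poly mult.assoc)
  have d_X0: "pderiv X0 = of_nat p * U"
    by (simp add: X0_def U_def pderiv_add pderiv_mult pderiv_monom distrib_left of_nat_monom mult_monom)
  have d_V: "pderiv (of_nat p * of_nat p * V) = of_nat p * of_nat p * pderiv V"
    by (simp add: pderiv_mult)
  define ev' where "ev' F = ?q (PB.ev F)" for F
  define \<tau> where "\<tau> = ?q T"
  define K where "K = f ^ (p - 1) * pderiv f"
  have KA: "K \<in> PS.AX" unfolding K_def by (intro AX_intros)
  have ev'm: "ev' (F * F') = ev' F \<otimes>\<^bsub>?Q\<^esub> ev' F'" if "F \<in> PS.AX" "F' \<in> PS.AX" for F F'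
    unfolding ev'_def using that by (simp add: PB.ev_mult PB.ev_closed)
  have c: "ev' (of_nat p) \<in> carrier ?Q" "ev' V \<in> carrier ?Q" "ev' (pderiv V) \<in> carrier ?Q" "ev' U \<in> carrier ?Q"
    "ev' K \<in> carrier ?Q" "\<tau> \<in> carrier ?Q" "ev' (f ^ p) \<in> carrier ?Q"
    unfolding ev'_def \<tau>_def by (intro h.hom_closed PB.ev_closed AX_intros KA T_closed)+
  have dxc: "CD.dx n \<in> carrier (kaehler (padic_quot p S n) (CD.hq n) ?Q)"
    using CD.dx_closed unfolding padic_kaehler_def .
  let ?k = "kaehler (padic_quot p S n) (CD.hq n) ?Q"
  have inv: "\<tau> \<otimes>\<^bsub>?Q\<^esub> ev' (f ^ p) = \<one>\<^bsub>?Q\<^esub>"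
    using f_power_inverse h.hom_mult[of T "PB.ev (f ^ p)"] T_closed
    unfolding \<tau>_def ev'_def by (simp add: E.m_comm PB.ev_closed PS.AX_power f_AX)
  have dF: "CD.dn n (ev' (f ^ p)) = (ev' (of_nat p) \<otimes>\<^bsub>?Q\<^esub> ev' K) \<odot>\<^bsub>?k\<^esub> CD.dx n"
    using dP[OF PS.AX_power[OF f_AX], of p] ev'm[OF PS.AX_of_nat KA, of p]
    by (simp add: d_f ev'_def K_def padic_kaehler_def)
  have dT: "CD.dn n \<tau> = (\<ominus>\<^bsub>?Q\<^esub> (\<tau> \<otimes>\<^bsub>?Q\<^esub> \<tau> \<otimes>\<^bsub>?Q\<^esub> (ev' (of_nat p) \<otimes>\<^bsub>?Q\<^esub> ev' K))) \<odot>\<^bsub>?k\<^esub> CD.dx n"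
    by (rule K.d_inverse[OF c(6,7) inv one[unfolded padic_kaehler_def] _ dxc dF]) (intro K.m_closed c)
  have pp: "of_nat p * of_nat p * V \<in> PS.AX" "of_nat p * of_nat p * pderiv V \<in> PS.AX" by (intro AX_intros)+
  have dX0: "CD.dn n (ev' X0) = (ev' (of_nat p) \<otimes>\<^bsub>?Q\<^esub> ev' U) \<odot>\<^bsub>?k\<^esub> CD.dx n"
    using dP[OF X0_AX] ev'm[OF PS.AX_of_nat U_AX, of p] by (simp add: d_X0 ev'_def padic_kaehler_def)
  have ppe: "ev' (of_nat p * of_nat p * V) = ev' (of_nat p) \<otimes>\<^bsub>?Q\<^esub> ev' (of_nat p) \<otimes>\<^bsub>?Q\<^esub> ev' V"
    "ev' (of_nat p * of_nat p * pderiv V) = ev' (of_nat p) \<otimes>\<^bsub>?Q\<^esub> ev' (of_nat p) \<otimes>\<^bsub>?Q\<^esub> ev' (pderiv V)"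
    by (simp_all add: ev'm PS.AX_mult PS.AX_of_nat polys AX_pderiv)
  have dV: "CD.dn n (ev' (of_nat p) \<otimes>\<^bsub>?Q\<^esub> ev' (of_nat p) \<otimes>\<^bsub>?Q\<^esub> ev' V) =
      (ev' (of_nat p) \<otimes>\<^bsub>?Q\<^esub> ev' (of_nat p) \<otimes>\<^bsub>?Q\<^esub> ev' (pderiv V)) \<odot>\<^bsub>?k\<^esub> CD.dx n"
    using dP[OF pp(1)] unfolding d_V ev'_def[symmetric] ppe padic_kaehler_def .
  have qX1: "?q X1 = ev' X0 \<oplus>\<^bsub>?Q\<^esub> (ev' (of_nat p) \<otimes>\<^bsub>?Q\<^esub> ev' (of_nat p) \<otimes>\<^bsub>?Q\<^esub> ev' V) \<otimes>\<^bsub>?Q\<^esub> \<tau>"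
    unfolding X1_def ev'_def \<tau>_def using T_closed
    by (simp add: PB.ev_closed X0_AX polys PS.AX_of_nat K.m_assoc)
  let ?r = "ev' (of_nat p)"
  have qg1: "?q (\<pi> \<otimes>\<^bsub>E\<^esub> g1) = ?r \<otimes>\<^bsub>?Q\<^esub> (ev' U \<oplus>\<^bsub>?Q\<^esub> ?r \<otimes>\<^bsub>?Q\<^esub> (\<tau> \<otimes>\<^bsub>?Q\<^esub> ev' (pderiv V))
      \<ominus>\<^bsub>?Q\<^esub> ?r \<otimes>\<^bsub>?Q\<^esub> ?r \<otimes>\<^bsub>?Q\<^esub> (ev' V \<otimes>\<^bsub>?Q\<^esub> \<tau> \<otimes>\<^bsub>?Q\<^esub> \<tau> \<otimes>\<^bsub>?Q\<^esub> ev' K))"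
    unfolding g1_def V2_def ev'_def \<tau>_def K_def[symmetric] a_minus_def using T_closed
    by (simp add: PB.ev_closed U_AX polys PS.AX_of_nat AX_pderiv KA)
  have x0: "ev' X0 \<in> carrier ?Q" unfolding ev'_def by (intro h.hom_closed PB.ev_closed X0_AX)
  show ?thesis
    unfolding qX1 qg1 padic_kaehler_def
    by (rule K.d_twisted[OF x0 c(1) c(4) c(2) c(3) c(5) c(6) dxc dX0 dT dV])
qed

end

context twisted_frobenius
begin

lemma ev_cubic:
  "PC.ev X0 \<otimes>\<^bsub>C\<^esub> PC.ev X0 \<otimes>\<^bsub>C\<^esub> PC.ev X0 \<oplus>\<^bsub>C\<^esub> em (cE (\<phi> a)) \<otimes>\<^bsub>C\<^esub> PC.ev X0 \<oplus>\<^bsub>C\<^esub> em (cE (\<phi> b))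
    = PC.ev (f ^ p) \<oplus>\<^bsub>C\<^esub> PC.ev (of_nat p) \<otimes>\<^bsub>C\<^esub> PC.ev G"
proof -
  have "PC.ev (X0 * X0 * X0 + [:\<alpha>:] * X0 + [:\<beta>:]) = PC.ev (f ^ p + of_nat p * G)"
    using cubic unfolding X0_def[symmetric] f_def[symmetric] by (simp only: power3_eq_cube)
  moreover have "PC.ev (X0 * X0 * X0 + [:\<alpha>:] * X0 + [:\<beta>:]) = PC.ev X0 \<otimes>\<^bsub>C\<^esub> PC.ev X0 \<otimes>\<^bsub>C\<^esub> PC.ev X0
      \<oplus>\<^bsub>C\<^esub> PC.ev [:\<alpha>:] \<otimes>\<^bsub>C\<^esub> PC.ev X0 \<oplus>\<^bsub>C\<^esub> PC.ev [:\<beta>:]"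
    by (simp only: PC.ev_add PC.ev_mult AX_intros)
  moreover have "PC.ev (f ^ p + of_nat p * G) = PC.ev (f ^ p) \<oplus>\<^bsub>C\<^esub> PC.ev (of_nat p) \<otimes>\<^bsub>C\<^esub> PC.ev G"
    by (simp only: PC.ev_add PC.ev_mult AX_intros)
  ultimately show ?thesis by (simp only: PC.ev_const \<alpha>\<beta>)
qed

lemma ev_diff_form:
  "(PC.ev U \<otimes>\<^bsub>C\<^esub> PC.ev (f ^ p) \<oplus>\<^bsub>C\<^esub> PC.ev U \<otimes>\<^bsub>C\<^esub> PC.ev (f ^ p)) \<oplus>\<^bsub>C\<^esub>
    (PC.ev (of_nat p) \<otimes>\<^bsub>C\<^esub> PC.ev (pderiv V) \<oplus>\<^bsub>C\<^esub> PC.ev (of_nat p) \<otimes>\<^bsub>C\<^esub> PC.ev (pderiv V))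
    = em (cE (\<iota> \<Lambda>)) \<otimes>\<^bsub>C\<^esub> PC.ev (f ^ ((p - 1) div 2)) \<otimes>\<^bsub>C\<^esub>
      (PC.ev (f ^ p) \<oplus>\<^bsub>C\<^esub> PC.ev (f ^ p) \<oplus>\<^bsub>C\<^esub> PC.ev (of_nat p) \<otimes>\<^bsub>C\<^esub> PC.ev G)
      \<oplus>\<^bsub>C\<^esub> PC.ev (of_nat p) \<otimes>\<^bsub>C\<^esub> PC.ev (of_nat p) \<otimes>\<^bsub>C\<^esub> PC.ev Z"
proof -
  have "PC.ev ((U * f ^ p + U * f ^ p) + (of_nat p * pderiv V + of_nat p * pderiv V)) =
      PC.ev ([:\<Lambda>:] * f ^ ((p - 1) div 2) * (f ^ p + f ^ p + of_nat p * G) + of_nat p * of_nat p * Z)"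
    using diff_form unfolding U_def[symmetric] f_def[symmetric]
    by (simp only: power2_eq_square mult_2 distrib_right)
  moreover have "PC.ev ((U * f ^ p + U * f ^ p) + (of_nat p * pderiv V + of_nat p * pderiv V)) =
      (PC.ev U \<otimes>\<^bsub>C\<^esub> PC.ev (f ^ p) \<oplus>\<^bsub>C\<^esub> PC.ev U \<otimes>\<^bsub>C\<^esub> PC.ev (f ^ p)) \<oplus>\<^bsub>C\<^esub>
      (PC.ev (of_nat p) \<otimes>\<^bsub>C\<^esub> PC.ev (pderiv V) \<oplus>\<^bsub>C\<^esub> PC.ev (of_nat p) \<otimes>\<^bsub>C\<^esub> PC.ev (pderiv V))"
    by (simp only: PC.ev_add PC.ev_mult AX_intros)
  moreover have "PC.ev ([:\<Lambda>:] * f ^ ((p - 1) div 2) * (f ^ p + f ^ p + of_nat p * G) + of_nat p * of_nat p * Z) =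
      PC.ev [:\<Lambda>:] \<otimes>\<^bsub>C\<^esub> PC.ev (f ^ ((p - 1) div 2)) \<otimes>\<^bsub>C\<^esub>
      (PC.ev (f ^ p) \<oplus>\<^bsub>C\<^esub> PC.ev (f ^ p) \<oplus>\<^bsub>C\<^esub> PC.ev (of_nat p) \<otimes>\<^bsub>C\<^esub> PC.ev G)
      \<oplus>\<^bsub>C\<^esub> PC.ev (of_nat p) \<otimes>\<^bsub>C\<^esub> PC.ev (of_nat p) \<otimes>\<^bsub>C\<^esub> PC.ev Z"
    by (simp only: PC.ev_add PC.ev_mult AX_intros)
  ultimately show ?thesis by (simp only: PC.ev_const \<Lambda>)
qed

text \<open>Take Y = y^p s with s^2 = 1 + p E', where f^p (1 + p E') is the value of the twisted
  cubic at \<open>X1\<close>; its inverse is t^p times 1/s. As s is congruent to 1 modulo p, both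
  reduce to p-th powers.\<close>

lemma twisted_point:
  "\<exists>Y\<in>carrier C. \<exists>T'\<in>carrier C. \<exists>W\<in>carrier C. Y \<otimes>\<^bsub>C\<^esub> T' = \<one>\<^bsub>C\<^esub> \<and>
    Y [^]\<^bsub>C\<^esub> (2::nat) = em X1 [^]\<^bsub>C\<^esub> (3::nat) \<oplus>\<^bsub>C\<^esub> em (cE (\<phi> a)) \<otimes>\<^bsub>C\<^esub> em X1 \<oplus>\<^bsub>C\<^esub> em (cE (\<phi> b)) \<and>
    Y 1 = em (yE [^]\<^bsub>E\<^esub> p) 1 \<and> T' 1 = em (tE [^]\<^bsub>E\<^esub> p) 1 \<and>
    T' \<otimes>\<^bsub>C\<^esub> em g1 = em (cE (\<iota> \<Lambda>)) \<otimes>\<^bsub>C\<^esub> em tE \<oplus>\<^bsub>C\<^esub> [(p ^ 2)] \<cdot>\<^bsub>C\<^esub> W"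
proof -
  let ?r = "PC.ev (of_nat p)" and ?F = "PC.ev (f ^ p)" and ?a = "em (cE (\<phi> a))" and ?b = "em (cE (\<phi> b))"
  let ?T = "em T" and ?y = "em (yE [^]\<^bsub>E\<^esub> p)" and ?t = "em (tE [^]\<^bsub>E\<^esub> p)" and ?L = "em (cE (\<iota> \<Lambda>))"
  have ab: "?a \<in> carrier C" "?b \<in> carrier C"
    using PC.\<iota>_closed[OF \<alpha>\<beta>(1)] PC.\<iota>_closed[OF \<alpha>\<beta>(2)] by (simp_all add: \<alpha>\<beta>)
  have evc: "?r \<in> carrier C" "PC.ev X0 \<in> carrier C" "PC.ev V \<in> carrier C" "PC.ev G \<in> carrier C" "?F \<in> carrier C"
    "PC.ev U \<in> carrier C" "PC.ev (pderiv V) \<in> carrier C" "PC.ev Z \<in> carrier C" "PC.ev (f ^ ((p - 1) div 2)) \<in> carrier C"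
    by (intro PC.ev_closed AX_intros)+
  have tc: "?T \<in> carrier C" "?y \<in> carrier C" "?t \<in> carrier C" "?L \<in> carrier C" "em V2 \<in> carrier C"
    using V2_closed by (simp_all add: PC.\<iota>_closed \<Lambda>)
  have rp: "?r \<otimes>\<^bsub>C\<^esub> z = [p] \<cdot>\<^bsub>C\<^esub> z" if "z \<in> carrier C" for z by (rule PC.ev_of_nat_mult[OF that])
  have FT: "?F \<otimes>\<^bsub>C\<^esub> ?T = \<one>\<^bsub>C\<^esub>"
    using arg_cong[OF f_power_inverse, of em] T_closed PB.ev_closed[OF PS.AX_power[OF f_AX], of p]
    by (simp add: PC_ev PS.AX_power f_AX)
  have X: "em X1 = PC.ev X0 \<oplus>\<^bsub>C\<^esub> ?r \<otimes>\<^bsub>C\<^esub> ?r \<otimes>\<^bsub>C\<^esub> (PC.ev V \<otimes>\<^bsub>C\<^esub> ?T)"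
    unfolding X1_def using T_closed by (simp add: PC_ev PB.ev_closed X0_AX polys PS.AX_of_nat)
  obtain E1 where E1: "E1 \<in> carrier C"
    "em X1 \<otimes>\<^bsub>C\<^esub> em X1 \<otimes>\<^bsub>C\<^esub> em X1 \<oplus>\<^bsub>C\<^esub> ?a \<otimes>\<^bsub>C\<^esub> em X1 \<oplus>\<^bsub>C\<^esub> ?b
      = ?F \<otimes>\<^bsub>C\<^esub> (\<one>\<^bsub>C\<^esub> \<oplus>\<^bsub>C\<^esub> ?r \<otimes>\<^bsub>C\<^esub> (?T \<otimes>\<^bsub>C\<^esub> PC.ev G \<oplus>\<^bsub>C\<^esub> ?r \<otimes>\<^bsub>C\<^esub> E1))"
    using C.twisted_cubic[OF evc(1-3) tc(1) evc(4,5) ab ev_cubic FT X] by (elim bexE) (rule that)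
  define E' where "E' = ?T \<otimes>\<^bsub>C\<^esub> PC.ev G \<oplus>\<^bsub>C\<^esub> ?r \<otimes>\<^bsub>C\<^esub> E1"
  have E': "E' \<in> carrier C" unfolding E'_def by (intro C.a_closed C.m_closed tc evc E1)
  define i where "i = PC.ev [:half:]"
  have i: "i \<in> carrier C" unfolding i_def by (intro PC.ev_closed AX_intros half)
  have ii: "i \<oplus>\<^bsub>C\<^esub> i = \<one>\<^bsub>C\<^esub>"
    using PC.\<iota>_add[OF half(1) half(1)] PC.\<iota>_one half by (simp add: i_def PC.ev_const)
  obtain w where w: "w \<in> carrier C" "w = i \<otimes>\<^bsub>C\<^esub> (E' \<ominus>\<^bsub>C\<^esub> [p] \<cdot>\<^bsub>C\<^esub> (w \<otimes>\<^bsub>C\<^esub> w))"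
    using E.padic_half_fixed_point[OF i E'] by (elim bexE) (rule that)
  have w': "w = i \<otimes>\<^bsub>C\<^esub> (E' \<ominus>\<^bsub>C\<^esub> ?r \<otimes>\<^bsub>C\<^esub> (w \<otimes>\<^bsub>C\<^esub> w))"
    using w(2) unfolding rp[OF C.m_closed[OF w(1) w(1)]] .
  note root = C.twisted_root[OF evc(1) E' i w(1) ii w']
  define s where "s = \<one>\<^bsub>C\<^esub> \<oplus>\<^bsub>C\<^esub> ?r \<otimes>\<^bsub>C\<^esub> w"
  have s: "s \<in> carrier C" unfolding s_def using evc w by simp
  obtain v where v: "v \<in> carrier C" "s \<otimes>\<^bsub>C\<^esub> v = \<one>\<^bsub>C\<^esub>"
    using E.padic_one_plus_unit[OF w(1), folded rp[OF w(1)], folded s_def] by (elim bexE) (rule that)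
  have yt: "?y \<otimes>\<^bsub>C\<^esub> ?t = \<one>\<^bsub>C\<^esub>"
    using arg_cong[OF E.pow_inverse_cancel[OF ell_closed(3,4) ell_relations(2), of p], of em]
      em.hom_mult[OF E.nat_pow_closed[OF ell_closed(3)] E.nat_pow_closed[OF ell_closed(4)], of p p] em.hom_one
    by simp
  have yy: "?y \<otimes>\<^bsub>C\<^esub> ?y = ?F"
  proof -
    have "yE [^]\<^bsub>E\<^esub> p \<otimes>\<^bsub>E\<^esub> yE [^]\<^bsub>E\<^esub> p = PB.ev (f ^ p)"
      by (simp add: PB.ev_power f_AX ev_f E.nat_pow_pow E.nat_pow_mult mult_2)
    then show ?thesis
      using em.hom_mult[OF E.nat_pow_closed[OF ell_closed(3)] E.nat_pow_closed[OF ell_closed(3)], of p p]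
      by (simp add: PC_ev PS.AX_power f_AX del: em.hom_mult em.hom_pow)
  qed
  have fm: "PC.ev (f ^ ((p - 1) div 2)) \<otimes>\<^bsub>C\<^esub> ?t = em tE"
    using em.hom_mult[OF PB.ev_closed[OF PS.AX_power[OF f_AX]] E.nat_pow_closed[OF ell_closed(4)], of "(p - 1) div 2" p]
    by (simp add: PC_ev PS.AX_power f_AX f_half_power del: em.hom_mult em.hom_pow One_nat_def)
  have g: "em g1 = PC.ev U \<oplus>\<^bsub>C\<^esub> ?r \<otimes>\<^bsub>C\<^esub> (?T \<otimes>\<^bsub>C\<^esub> PC.ev (pderiv V)) \<ominus>\<^bsub>C\<^esub> ?r \<otimes>\<^bsub>C\<^esub> ?r \<otimes>\<^bsub>C\<^esub> em V2"
    unfolding g1_def a_minus_def using T_closed V2_closed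
    by (simp add: PC_ev PB.ev_closed U_AX AX_pderiv polys PS.AX_of_nat)
  obtain W where W: "W \<in> carrier C" "?t \<otimes>\<^bsub>C\<^esub> v \<otimes>\<^bsub>C\<^esub> em g1 = ?L \<otimes>\<^bsub>C\<^esub> em tE \<oplus>\<^bsub>C\<^esub> ?r \<otimes>\<^bsub>C\<^esub> ?r \<otimes>\<^bsub>C\<^esub> W"
    using C.twisted_form[OF evc(1,6,7) tc(1) evc(4,5) tc(4) evc(9,8) tc(5) E1(1) w(1) v(1) tc(3) i ev_diff_form FT ii
        root(1)[unfolded E'_def] v(2)[unfolded s_def] fm g] by (elim bexE) (rule that)
  have rrW: "?r \<otimes>\<^bsub>C\<^esub> ?r \<otimes>\<^bsub>C\<^esub> W = [(p ^ 2)] \<cdot>\<^bsub>C\<^esub> W"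
    unfolding C.m_assoc[OF evc(1) evc(1) W(1)] rp[OF W(1)] rp[OF C.add.nat_pow_closed[OF W(1)]] power2_eq_square
    by (rule C.add.nat_pow_pow[OF W(1)])
  define Y where "Y = ?y \<otimes>\<^bsub>C\<^esub> s"
  define T' where "T' = ?t \<otimes>\<^bsub>C\<^esub> v"
  have c: "Y \<in> carrier C" "T' \<in> carrier C" unfolding Y_def T'_def by (intro C.m_closed tc s v)+
  have "Y \<otimes>\<^bsub>C\<^esub> T' = (?y \<otimes>\<^bsub>C\<^esub> ?t) \<otimes>\<^bsub>C\<^esub> (s \<otimes>\<^bsub>C\<^esub> v)" unfolding Y_def T'_def using tc(2,3) s v(1) by (simp only: C.m_ac C.m_closed)
  then have 1: "Y \<otimes>\<^bsub>C\<^esub> T' = \<one>\<^bsub>C\<^esub>" unfolding yt v(2) by simp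
  have "Y [^]\<^bsub>C\<^esub> (2::nat) = Y \<otimes>\<^bsub>C\<^esub> Y" using c(1) by (simp add: numeral_2_eq_2)
  also have "\<dots> = (?y \<otimes>\<^bsub>C\<^esub> ?y) \<otimes>\<^bsub>C\<^esub> (s \<otimes>\<^bsub>C\<^esub> s)"
    unfolding Y_def using tc(2) s by (simp only: C.m_ac C.m_closed)
  also have "\<dots> = em X1 \<otimes>\<^bsub>C\<^esub> em X1 \<otimes>\<^bsub>C\<^esub> em X1 \<oplus>\<^bsub>C\<^esub> ?a \<otimes>\<^bsub>C\<^esub> em X1 \<oplus>\<^bsub>C\<^esub> ?b"
    unfolding yy E1(2) s_def root(2) E'_def ..
  also have "em X1 \<otimes>\<^bsub>C\<^esub> em X1 \<otimes>\<^bsub>C\<^esub> em X1 = em X1 [^]\<^bsub>C\<^esub> (3::nat)"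
    using em.hom_closed[OF X1_closed] by (simp add: numeral_3_eq_3)
  finally have 2: "Y [^]\<^bsub>C\<^esub> (2::nat) = em X1 [^]\<^bsub>C\<^esub> (3::nat) \<oplus>\<^bsub>C\<^esub> ?a \<otimes>\<^bsub>C\<^esub> em X1 \<oplus>\<^bsub>C\<^esub> ?b" .
  have "Y = ?y \<oplus>\<^bsub>C\<^esub> ?r \<otimes>\<^bsub>C\<^esub> (?y \<otimes>\<^bsub>C\<^esub> w)"
    unfolding Y_def s_def using tc(2) evc(1) w(1) by (simp add: C.r_distr C.m_lcomm del: em.hom_pow)
  then have "Y = ?y \<oplus>\<^bsub>C\<^esub> [(p ^ 1)] \<cdot>\<^bsub>C\<^esub> (?y \<otimes>\<^bsub>C\<^esub> w)"
    unfolding rp[OF C.m_closed[OF tc(2) w(1)]] by (simp only: power_one_right)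
  then have 3: "Y 1 = ?y 1"
    using E.padic_component_eq_iff[OF c(1) tc(2), of 1] C.m_closed[OF tc(2) w(1)] by blast
  have "?t = ?t \<otimes>\<^bsub>C\<^esub> (s \<otimes>\<^bsub>C\<^esub> v)" using tc(3) v(2) by (simp del: em.hom_pow)
  also have "\<dots> = T' \<oplus>\<^bsub>C\<^esub> ?r \<otimes>\<^bsub>C\<^esub> (w \<otimes>\<^bsub>C\<^esub> T')"
    unfolding T'_def s_def using tc(3) evc(1) w(1) v(1) by (simp add: C.r_distr C.l_distr C.m_ac del: em.hom_pow)
  finally have "?t = T' \<oplus>\<^bsub>C\<^esub> [(p ^ 1)] \<cdot>\<^bsub>C\<^esub> (w \<otimes>\<^bsub>C\<^esub> T')"
    unfolding rp[OF C.m_closed[OF w(1) c(2)]] by (simp only: power_one_right)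
  then have 4: "T' 1 = ?t 1"
    using E.padic_component_eq_iff[OF tc(3) c(2), of 1] C.m_closed[OF w(1) c(2)] by metis
  show ?thesis
    by (rule bexI[OF _ c(1)], rule bexI[OF _ c(2)], rule bexI[OF _ W(1)])
      (intro conjI 1 2 3 4 W(2)[unfolded rrW, folded T'_def])
qed

lemma X1_frobenius: "padic_proj p E 1 X1 = padic_proj p E 1 xE [^]\<^bsub>padic_quot p E 1\<^esub> p"
proof -
  interpret h: ring_hom_cring E "padic_quot p E 1" "padic_proj p E 1"
    by (intro ring_hom_cringI cring_ell E.cring_padic_quot E.padic_proj_hom)
  have m: "Polynomial.monom (1::'k) p = [:0, 1:] ^ p" by (simp add: monom_altdef)
  have c: "PB.ev u \<in> carrier E" "PB.ev V \<otimes>\<^bsub>E\<^esub> T \<in> carrier E" by (intro E.m_closed PB.ev_closed polys T_closed)+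
  let ?d = "PB.ev u \<oplus>\<^bsub>E\<^esub> \<pi> \<otimes>\<^bsub>E\<^esub> (PB.ev V \<otimes>\<^bsub>E\<^esub> T)"
  have d: "?d \<in> carrier E" by (intro E.a_closed c(1) E.m_closed[OF \<pi>_closed c(2)])
  have "PB.ev X0 = xE [^]\<^bsub>E\<^esub> p \<oplus>\<^bsub>E\<^esub> \<pi> \<otimes>\<^bsub>E\<^esub> PB.ev u"
    unfolding X0_def m by (simp only: PB.ev_add PB.ev_mult PB.ev_power PB.ev_x PS.AX_x AX_intros)
  then have "X1 = xE [^]\<^bsub>E\<^esub> p \<oplus>\<^bsub>E\<^esub> \<pi> \<otimes>\<^bsub>E\<^esub> ?d"
    unfolding X1_def using c \<pi>_closed by (simp add: E.r_distr E.m_assoc E.a_assoc del: E.nat_pow_pow)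
  also have "\<pi> \<otimes>\<^bsub>E\<^esub> ?d = [(p ^ 1)] \<cdot>\<^bsub>E\<^esub> ?d" using PB.ev_of_nat_mult[OF d] by (simp only: power_one_right)
  finally have "padic_proj p E 1 X1 = padic_proj p E 1 (xE [^]\<^bsub>E\<^esub> p)"
    using E.padic_proj_eq_iff[OF X1_closed E.nat_pow_closed[OF ell_closed(2)], of p 1 p] d by blast
  then show ?thesis by (simp del: One_nat_def)
qed

lemma const_frobenius:
  assumes r: "r \<in> carrier S"
  shows "padic_proj p E 1 (cE (\<phi> r)) = padic_proj p E 1 (cE r) [^]\<^bsub>padic_quot p E 1\<^esub> p"
proof -
  interpret h: ring_hom_cring E "padic_quot p E 1" "padic_proj p E 1"
    by (intro ring_hom_cringI cring_ell E.cring_padic_quot E.padic_proj_hom)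
  interpret c: ring_hom_cring S E cE by (intro ring_hom_cringI is_cring cring_ell ell_const_hom)
  have \<phi>r: "\<phi> r \<in> carrier S" using \<phi> r ring_hom_closed unfolding frobenius_lift_def by metis
  have "\<phi> r \<ominus> r [^] p \<in> padic_ideal p S 1" using \<phi> r unfolding frobenius_lift_def by blast
  then obtain d where d: "d \<in> carrier S" "\<phi> r \<ominus> r [^] p = [(p ^ 1)] \<cdot> d" using padic_ideal_iff by blast
  have "\<phi> r = r [^] p \<oplus> (\<phi> r \<ominus> r [^] p)" using \<phi>r nat_pow_closed[OF r, of p] by algebra
  then have "cE (\<phi> r) = cE (r [^] p \<oplus> [(p ^ 1)] \<cdot> d)" using d(2) by metis
  also have "\<dots> = cE r [^]\<^bsub>E\<^esub> p \<oplus>\<^bsub>E\<^esub> [(p ^ 1)] \<cdot>\<^bsub>E\<^esub> cE d"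
    using r d(1) ring_hom_add_pow[OF ell_const_hom is_cring cring_ell d(1), of "p ^ 1"] by simp
  finally have "padic_proj p E 1 (cE (\<phi> r)) = padic_proj p E 1 (cE r [^]\<^bsub>E\<^esub> p)"
    using E.padic_proj_eq_iff[OF c.hom_closed[OF \<phi>r] E.nat_pow_closed[OF c.hom_closed[OF r]], of p 1 p]
      c.hom_closed[OF d(1)] by blast
  then show ?thesis using r by (simp del: One_nat_def)
qed

lemma ell_omega_form: "ell_omega p S a b = CD.form (em tE)"
  by (simp add: ell_omega_def ell_differentials_def completed_kaehler_def completed_d_def CD.form_def CD.dx_def
      padic_embed_def)

theorem lie_invariant_lift:
  "\<exists>\<Phi>. ell_frobenius_lift p S a b \<phi> \<Phi> \<and> lie_invariant_mod p S a b 2 (\<iota> \<Lambda>) \<Phi>"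
proof -
  obtain Y T' W where c: "Y \<in> carrier C" "T' \<in> carrier C" "W \<in> carrier C" and YT: "Y \<otimes>\<^bsub>C\<^esub> T' = \<one>\<^bsub>C\<^esub>"
    and Y2: "Y [^]\<^bsub>C\<^esub> (2::nat) = em X1 [^]\<^bsub>C\<^esub> (3::nat) \<oplus>\<^bsub>C\<^esub> em (cE (\<phi> a)) \<otimes>\<^bsub>C\<^esub> em X1 \<oplus>\<^bsub>C\<^esub> em (cE (\<phi> b))"
    and Y1: "Y 1 = em (yE [^]\<^bsub>E\<^esub> p) 1" and T1: "T' 1 = em (tE [^]\<^bsub>E\<^esub> p) 1"
    and form: "T' \<otimes>\<^bsub>C\<^esub> em g1 = em (cE (\<iota> \<Lambda>)) \<otimes>\<^bsub>C\<^esub> em tE \<oplus>\<^bsub>C\<^esub> [(p ^ 2)] \<cdot>\<^bsub>C\<^esub> W"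
    using twisted_point by (elim bexE conjE) (rule that)
  have \<phi>h: "\<phi> \<in> ring_hom S S" using \<phi> unfolding frobenius_lift_def by blast
  have h0: "(\<lambda>r. em (cE (\<phi> r))) \<in> ring_hom S C"
    using ring_hom_trans[OF ring_hom_trans[OF \<phi>h ell_const_hom] E.padic_embed_hom] unfolding comp_def .
  obtain k where k: "k \<in> ring_hom E C" and kc: "\<forall>r\<in>carrier S. k (cE r) = em (cE (\<phi> r))"
    and kx: "k xE = em X1" and ky: "k yE = Y" and kt: "k tE = T'"
    using ell_universal[OF E.cring_padic_completion h0 em.hom_closed[OF X1_closed] c(1,2) Y2 YT]
    by (elim bexE conjE) (rule that)
  define \<Phi> where "\<Phi> = E.padic_extend p k"
  have \<Phi>: "\<Phi> \<in> ring_hom C C" unfolding \<Phi>_def by (rule E.padic_extend_hom[OF cring_ell k])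
  have \<Phi>e: "\<Phi> (em r) = k r" if "r \<in> carrier E" for r
    unfolding \<Phi>_def by (rule E.padic_extend_embed[OF cring_ell k that])
  let ?Q = "padic_quot p E 1" and ?q = "padic_proj p E 1"
  interpret Q: cring ?Q by (rule E.cring_padic_quot)
  interpret h: ring_hom_cring E ?Q ?q
    by (intro ring_hom_cringI cring_ell E.cring_padic_quot E.padic_proj_hom)
  interpret k: ring_hom_cring E C k by (intro ring_hom_cringI cring_ell E.cring_padic_completion k)
  have char: "[p] \<cdot>\<^bsub>?Q\<^esub> z = \<zero>\<^bsub>?Q\<^esub>" if "z \<in> carrier ?Q" for z
    using E.padic_quot_p_power_zero[OF that] by (simp only: power_one_right)
  \<comment> \<open>Both sides are multiplicative, and additive because p vanishes in the quotient,
    so the generators suffice.\<close>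
  have k1: "k r 1 = ?q r [^]\<^bsub>?Q\<^esub> p" if "r \<in> carrier E" for r
    using that
  proof (rule ell_generated)
    fix g g' assume g: "g \<in> carrier E" "g' \<in> carrier E" "k g 1 = ?q g [^]\<^bsub>?Q\<^esub> p" "k g' 1 = ?q g' [^]\<^bsub>?Q\<^esub> p"
    have "k (g \<oplus>\<^bsub>E\<^esub> g') 1 = k g 1 \<oplus>\<^bsub>?Q\<^esub> k g' 1" using g(1,2) by (simp add: E.padic_completion_ops)
    then show "k (g \<oplus>\<^bsub>E\<^esub> g') 1 = ?q (g \<oplus>\<^bsub>E\<^esub> g') [^]\<^bsub>?Q\<^esub> p"
      using g Q.char_p_power_add[OF p(1) char h.hom_closed[OF g(1)] h.hom_closed[OF g(2)]]
      by (simp del: One_nat_def)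
    have "k (g \<otimes>\<^bsub>E\<^esub> g') 1 = k g 1 \<otimes>\<^bsub>?Q\<^esub> k g' 1" using g(1,2) by (simp add: E.padic_completion_ops)
    then show "k (g \<otimes>\<^bsub>E\<^esub> g') 1 = ?q (g \<otimes>\<^bsub>E\<^esub> g') [^]\<^bsub>?Q\<^esub> p"
      using g by (simp add: Q.nat_pow_distrib del: One_nat_def)
  next
    fix r assume "r \<in> carrier S"
    then show "k (cE r) 1 = ?q (cE r) [^]\<^bsub>?Q\<^esub> p"
      using const_frobenius[of r] bspec[OF kc, of r] by (simp add: padic_embed_def del: One_nat_def)
  next
    show "k xE 1 = ?q xE [^]\<^bsub>?Q\<^esub> p" using X1_frobenius by (simp add: kx padic_embed_def del: One_nat_def)
    show "k yE 1 = ?q yE [^]\<^bsub>?Q\<^esub> p" unfolding ky Y1 by (simp add: padic_embed_def del: One_nat_def em.hom_pow)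
    show "k tE 1 = ?q tE [^]\<^bsub>?Q\<^esub> p" unfolding kt T1 by (simp add: padic_embed_def del: One_nat_def em.hom_pow)
  qed
  have "frobenius_lift p C \<Phi>"
    by (rule E.frobenius_lift_completionI[OF \<Phi>]) (simp only: \<Phi>e k1)
  then have lift: "ell_frobenius_lift p S a b \<phi> \<Phi>"
    unfolding ell_frobenius_lift_def ell_completion_def ell_base_def using \<Phi>e kc by simp
  let ?L = "em (cE (\<iota> \<Lambda>))"
  have Lc: "?L \<in> carrier C" "em tE \<in> carrier C" "em g1 \<in> carrier C" "em \<pi> \<in> carrier C"
    using g1_closed \<pi>_closed by (simp_all add: PC.\<iota>_closed \<Lambda>)
  define e where "e = ?L \<otimes>\<^bsub>C\<^esub> em tE \<oplus>\<^bsub>C\<^esub> [(p ^ 2)] \<cdot>\<^bsub>C\<^esub> W"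
  have e: "e \<in> carrier C" unfolding e_def using Lc c by simp
  have "completed_pullback p S cE E \<Phi> (CD.form (em tE)) = CD.form (\<Phi> (em tE) \<otimes>\<^bsub>C\<^esub> em (\<pi> \<otimes>\<^bsub>E\<^esub> g1))"
  proof (rule CD.pullback_form[OF \<Phi> _ ell_closed(4)])
    show "\<exists>r'\<in>carrier S. \<Phi> (em (cE r)) = em (cE r')" if "r \<in> carrier S" for r
      using \<Phi>e[of "cE r"] bspec[OF kc that] ring_hom_closed[OF \<phi>h that] that by auto
    show "em (\<pi> \<otimes>\<^bsub>E\<^esub> g1) \<in> carrier C" using \<pi>_closed g1_closed by simp
    show "CD.dn n (\<Phi> (em xE) n) = em (\<pi> \<otimes>\<^bsub>E\<^esub> g1) n \<odot>\<^bsub>CD.\<Omega> n\<^esub> CD.dx n" for n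
      using d_X1[of n] \<Phi>e[OF ell_closed(2)] unfolding kx by (simp add: padic_embed_def)
  qed
  \<comment> \<open>The factor p of d Phi(x) is pulled to the front. What remains is the coefficient
    \<open>e\<close> of the form that serves as the quotient of the pullback by p.\<close>
  also have "\<Phi> (em tE) \<otimes>\<^bsub>C\<^esub> em (\<pi> \<otimes>\<^bsub>E\<^esub> g1) = em \<pi> \<otimes>\<^bsub>C\<^esub> (T' \<otimes>\<^bsub>C\<^esub> em g1)"
    using \<Phi>e[OF ell_closed(4)] \<pi>_closed g1_closed Lc c by (simp add: kt C.m_lcomm)
  also have "\<dots> = [p] \<cdot>\<^bsub>C\<^esub> e"
    unfolding form e_def[symmetric] using PC.ev_of_nat_mult[OF e, of p] by (simp add: PC_ev PS.AX_of_nat)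
  also have "CD.form ([p] \<cdot>\<^bsub>C\<^esub> e) = [p] \<cdot>\<^bsub>CD.CK\<^esub> CD.form e" by (rule CD.form_add_pow[OF e, symmetric])
  finally have 1: "[p] \<cdot>\<^bsub>CD.CK\<^esub> CD.form e = completed_pullback p S cE E \<Phi> (CD.form (em tE))" by simp
  have 2: "CD.form e = ?L \<odot>\<^bsub>CD.CK\<^esub> CD.form (em tE) \<oplus>\<^bsub>CD.CK\<^esub> [(p ^ 2)] \<cdot>\<^bsub>CD.CK\<^esub> CD.form W"
    unfolding e_def CD.form_smult[OF Lc(1,2)] CD.form_add_pow[OF c(3)]
    by (intro CD.form_add C.m_closed Lc C.add.nat_pow_closed c)
  have "lie_invariant_mod p S a b 2 (\<iota> \<Lambda>) \<Phi>"
    unfolding lie_invariant_mod_def ell_omega_form ell_base_def ell_differentials_def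
    using 1 2 CD.form_closed[OF e] CD.form_closed[OF c(3)] by blast
  with lift show ?thesis by blast
qed

end

section \<open>The lift over the universal base\<close>

lemma (in jets) lie_invariant_frobenius:
  "\<exists>\<Lambda>\<in>jet_M p Sig 1.
      quasi_linear p Sig \<Lambda> \<and> tangential p Sig \<Lambda> \<and> weak_weight p (1 - int p) \<Lambda> \<and>
      \<Lambda> - inverse (Hasse p) \<in> {of_nat p * f | f. f \<in> jet_M p Sig 1} \<and>
      (\<exists>\<Phi>. ell_frobenius_lift p S (emb (z4 0)) (emb (z6 0)) (universal_frobenius p Sig) \<Phi> \<and>
           lie_invariant_mod p S (emb (z4 0)) (emb (z6 0)) 2 (emb \<Lambda>) \<Phi>)"
proof -
  obtain l0 l1 l2 u V G Z where l: "l0 \<in> gr (1 - int p)" "l1 \<in> gr (1 - 5 * int p)" "l2 \<in> gr (1 - 7 * int p)"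
    and polys: "u \<in> core.RX" "V \<in> core.RX" "G \<in> core.RX" "Z \<in> core.RX"
    and cubic: "(Polynomial.monom 1 p + of_nat p * u) ^ 3 + [:z4 0 ^ p + of_nat p * z4 1:] * (Polynomial.monom 1 p + of_nat p * u)
          + [:z6 0 ^ p + of_nat p * z6 1:] = [:z6 0, z4 0, 0, 1:] ^ p + of_nat p * G"
    and diff_form: "2 * (Polynomial.monom 1 (p - 1) + pderiv u) * [:z6 0, z4 0, 0, 1:] ^ p + 2 * of_nat p * pderiv V
        = [:1 / Hasse p + of_nat p * (l0 + l1 * z4 1 + l2 * z6 1):] * [:z6 0, z4 0, 0, 1:] ^ ((p - 1) div 2)
            * (2 * [:z6 0, z4 0, 0, 1:] ^ p + of_nat p * G) + of_nat p ^ 2 * Z"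
    using core_result by (elim bexE conjE) (rule that)
  define \<Lambda> where "\<Lambda> = 1 / Hasse p + of_nat p * (l0 + l1 * z4 1 + l2 * z6 1)"
  note ev = eigenvalue_properties[OF l \<Lambda>_def]
  have \<phi>: "frobenius_lift p S (universal_frobenius p Sig)"
    and \<phi>z: "\<forall>z\<in>{z4, z6}. \<forall>i. universal_frobenius p Sig (emb (z i)) = emb (z i) [^]\<^bsub>S\<^esub> p \<oplus>\<^bsub>S\<^esub> [p] \<cdot>\<^bsub>S\<^esub> emb (z (Suc i))"
    using universal_frobenius_spec unfolding frob_spec_def by simp_all
  have zM: "z4 i \<in> M" "z6 i \<in> M" for i by (simp_all add: Jinf_M z_Jinf)
  have \<alpha>M: "z4 0 ^ p + of_nat p * z4 1 \<in> M" "z6 0 ^ p + of_nat p * z6 1 \<in> M"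
    by (intro MM.add MM.power MM.mult MM.of_nat zM)+
  have \<alpha>: "emb (z4 0 ^ p + of_nat p * z4 1) = universal_frobenius p Sig (emb (z4 0))"
    "emb (z6 0 ^ p + of_nat p * z6 1) = universal_frobenius p Sig (emb (z6 0))"
    using \<phi>z by (simp_all add: emb_add[OF MM.power[OF zM(1)] MM.mult[OF MM.of_nat zM(1)]]
        emb_add[OF MM.power[OF zM(2)] MM.mult[OF MM.of_nat zM(2)]] emb_pow[OF zM(1)] emb_pow[OF zM(2)]
        emb_scale[OF zM(1)] emb_scale[OF zM(2)])
  have "\<not> p dvd 2" using p by (auto dest: dvd_imp_le)
  then have half: "1 / 2 \<in> M"
    using jet_scalar_in[OF p(1), of 2 0] J_jet_M unfolding M_eq by auto
  have \<Lambda>M: "\<Lambda> \<in> M" using ev(1) unfolding M_eq by blast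
  have pe: "poly_eval S M emb (emb (z4 0))"
    using MM.zero MM.one MM.add MM.mult emb.hom_zero
    by (intro poly_eval.intro poly_eval_axioms.intro S.is_cring) (simp_all add: emb_add emb_mult emb_one zM)
  interpret tw: twisted_frobenius S "emb (z4 0)" "emb (z6 0)" M emb p "universal_frobenius p Sig" u V G Z
    "z4 0" "z6 0" "z4 0 ^ p + of_nat p * z4 1" "z6 0 ^ p + of_nat p * z6 1" \<Lambda> "1 / 2"
  proof (intro twisted_frobenius.intro twisted_frobenius_axioms.intro elliptic.intro elliptic_axioms.intro S.is_cring pe)
    show "u \<in> poly_eval.AX M" "V \<in> poly_eval.AX M" "G \<in> poly_eval.AX M" "Z \<in> poly_eval.AX M"
      using polys unfolding poly_eval.AX_def[OF pe] weighted_polys_def by simp_all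
  qed (fact p p_odd \<phi> \<alpha>M \<alpha> zM half \<Lambda>M refl cubic diff_form[folded \<Lambda>_def] | simp add: zM)+
  show ?thesis using ev tw.lie_invariant_lift by (intro bexI[of _ \<Lambda>] conjI)
qed

theorem theorem4p4:
  fixes p :: nat and \<Psi> Sig :: jet_frac
  assumes "prime p" and "p \<ge> 11"
    and "\<Psi> = Psi ((p + 5) div 2)"
    and "\<Psi> \<notin> {of_nat p * to_fract P | P. P \<in> jet_polys p 0}"
    and "Sig = z6 0 * \<Psi> * Hasse p"
  shows "\<exists>\<Lambda>\<in>jet_M p Sig 1.
      quasi_linear p Sig \<Lambda> \<and> tangential p Sig \<Lambda> \<and> weak_weight p (1 - int p) \<Lambda> \<and>
      \<Lambda> - inverse (Hasse p) \<in> {of_nat p * f | f. f \<in> jet_M p Sig 1} \<and>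
      (\<exists>\<Phi>. ell_frobenius_lift p (jet_S p Sig) (jet_embed p Sig (z4 0)) (jet_embed p Sig (z6 0))
              (universal_frobenius p Sig) \<Phi> \<and>
           lie_invariant_mod p (jet_S p Sig) (jet_embed p Sig (z4 0)) (jet_embed p Sig (z6 0))
              2 (jet_embed p Sig \<Lambda>) \<Phi>)"
proof -
  have "Psi ((p + 5) div 2) \<noteq> 0"
  proof
    assume "Psi ((p + 5) div 2) = 0"
    then have "\<Psi> = of_nat p * to_fract 0" by (simp add: assms)
    moreover have "0 \<in> jet_polys p 0" using assms(1) by (simp add: jet_polys_def Z_loc_def prime_nat_iff)
    ultimately show False using assms(4) by blast
  qed
  then interpret jets p Sig using assms by unfold_locales simp_all
  show ?thesis unfolding jet_S_eq jet_embed_eq by (rule lie_invariant_frobenius)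
qed

end
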